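(* Let $\mathcal{M}$ be a semi-finite von Neumann algebra on a Hilbert space $H$ with a faithful, normal, semi-finite trace $\tau$. If $0<p\le q<\infty$, then the Lorentz space $L_{q,p}(\mathcal{M})$ has the uniform Kadec-Klee-Huff property with respect to local convergence in measure.
   Context: Measurable operators. $\widetilde{\mathcal{M}}$ denotes the $*$-algebra of $\tau$-measurable operators: closed densely defined linear operators $x$ affiliated with $\mathcal{M}$ such that $\tau(\chi_{(s,\infty)}(|x|))<\infty$ for some $s\ge 0$; sums and products are closures of the algebraic ones. For $x\in\widetilde{\mathcal{M}}$ the generalized singular value function (decreasing rearrangement) is $\mu_t(x)=\inf\{s\ge 0:\tau(\chi_{(s,\infty)}(|x|))\le t\}$, $t\ge 0$. For $\mathcal{M}=L^\infty(\mathbf{R}^+)$, $\mathbf{R}^+=[0,\infty)$, with Lebesgue integration as trace, $\mu(f)$ is the usual right-continuous decreasing rearrangement of $|f|$. Lorentz spaces. For $0<p\le q<\infty$, $L_{q,p}(\mathbf{R}^+)$ consists of all Lebesgue measurable functions $f$ on $\mathbf{R}^+$ with $\|f\|_{q,p}=\left(\int_0^\infty\mu_t^p(f)\,d(t^{p/q})\right)^{1/p}<\infty$. $L_{q,p}(\mathcal{M})=\{x\in\widetilde{\mathcal{M}}:\mu(x)\in L_{q,p}(\mathbf{R}^+)\}$ with $\|x\|_{L_{q,p}(\mathcal{M})}=\|\mu(x)\|_{q,p}$. (This is a complete $\alpha$-normed space with $\alpha=\min\{1,p\}$.) Local convergence in measure. This is the Hausdorff linear topology on $\widetilde{\mathcal{M}}$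 (restricted to $L_{q,p}(\mathcal{M})$) with neighbourhood base at $0$ given by the sets $\{x\in\widetilde{\mathcal{M}}:\mu_\delta(exe)<\epsilon\}$, where $\epsilon,\delta>0$ and $e\in\mathcal{M}$ is a projection with $\tau(e)<\infty$. UKKH property. Let $(X,\|\cdot\|_X)$ be an $\alpha$-normed quasi-Banach space, $0<\alpha\le 1$ (i.e. $\|x+y\|_X^\alpha\le\|x\|_X^\alpha+\|y\|_X^\alpha$), with unit ball $\mathbf{B}_X$, and let $\mathcal{T}$ be a vector space topology on $X$ weaker than the quasi-norm topology. $X$ has the uniform Kadec-Klee-Huff property with respect to $\mathcal{T}$ if for every $\epsilon>0$ there exists $\delta\in(0,1)$ such that whenever $(x_n)$ is a sequence in $\mathbf{B}_X$ with $x_n\to x\in X$ with respect to $\mathcal{T}$ and $\|x\|_X>1-\delta$, there is a positive integer $N$ with $\sup_{n,m\ge N}\|x_n-x_m\|_X\le\epsilon$. *)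

theory Defs
  imports "HOL-Analysis.Analysis"
begin

subsection \<open>Complex Hilbert spaces and bounded operators\<close>

text \<open>The metric structure comes from the underlying real Hilbert space, whose inner product is the
  real part of the sesquilinear one.  The latter is linear in the first argument.\<close>

class complex_hilbert_space = real_inner + complete_space +
  fixes scaleC :: "complex \<Rightarrow> 'a \<Rightarrow> 'a"  (infixr \<open>*\<^sub>C\<close> 75)
    and cinner :: "'a \<Rightarrow> 'a \<Rightarrow> complex"
  assumes scaleC_add_right: "c *\<^sub>C (x + y) = c *\<^sub>C x + c *\<^sub>C y"
    and scaleC_add_left: "(c + d) *\<^sub>C x = c *\<^sub>C x + d *\<^sub>C x"
    and scaleC_scaleC: "c *\<^sub>C (d *\<^sub>C x) = (c * d) *\<^sub>C x"
    and scaleC_of_real: "complex_of_real r *\<^sub>C x = r *\<^sub>R x"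
    and cinner_commute: "cinner x y = cnj (cinner y x)"
    and cinner_add_left: "cinner (x + y) z = cinner x z + cinner y z"
    and cinner_scaleC_left: "cinner (c *\<^sub>C x) y = c * cinner x y"
    and inner_eq_Re_cinner: "inner x y = Re (cinner x y)"

text \<open>The elements of \<^typ>\<open>'h \<Rightarrow>\<^sub>L 'h\<close> are the real-linear bounded operators; those in
  \<open>bounded_ops\<close> are the complex-linear ones.\<close>

definition bounded_ops :: "('h::complex_hilbert_space \<Rightarrow>\<^sub>L 'h) set" where
  "bounded_ops = {A. \<forall>c \<xi>. blinfun_apply A (c *\<^sub>C \<xi>) = c *\<^sub>C blinfun_apply A \<xi>}"

definition badj :: "('h::complex_hilbert_space \<Rightarrow>\<^sub>L 'h) \<Rightarrow> ('h \<Rightarrow>\<^sub>L 'h)" where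
  "badj A = (THE B. \<forall>\<xi> \<eta>. cinner (blinfun_apply A \<xi>) \<eta> = cinner \<xi> (blinfun_apply B \<eta>))"

definition positive_op :: "('h::complex_hilbert_space \<Rightarrow>\<^sub>L 'h) \<Rightarrow> bool" where
  "positive_op A \<longleftrightarrow> A \<in> bounded_ops \<and> (\<forall>\<xi>. cinner (blinfun_apply A \<xi>) \<xi> \<in> \<real>\<^sub>\<ge>\<^sub>0)"

definition op_le :: "('h::complex_hilbert_space \<Rightarrow>\<^sub>L 'h) \<Rightarrow> ('h \<Rightarrow>\<^sub>L 'h) \<Rightarrow> bool" where
  "op_le A B \<longleftrightarrow> positive_op (B - A)"

definition projection_op :: "('h::complex_hilbert_space \<Rightarrow>\<^sub>L 'h) \<Rightarrow> bool" where
  "projection_op P \<longleftrightarrow> P \<in> bounded_ops \<and> P o\<^sub>L P = P \<and> badj P = P"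

definition unitary_op :: "('h::complex_hilbert_space \<Rightarrow>\<^sub>L 'h) \<Rightarrow> bool" where
  "unitary_op U \<longleftrightarrow> U \<in> bounded_ops \<and> badj U o\<^sub>L U = id_blinfun \<and> U o\<^sub>L badj U = id_blinfun"


subsection \<open>Von Neumann algebras and traces\<close>

definition commutant :: "('h::complex_hilbert_space \<Rightarrow>\<^sub>L 'h) set \<Rightarrow> ('h \<Rightarrow>\<^sub>L 'h) set" where
  "commutant S = {A \<in> bounded_ops. \<forall>B\<in>S. A o\<^sub>L B = B o\<^sub>L A}"

definition von_neumann_algebra :: "('h::complex_hilbert_space \<Rightarrow>\<^sub>L 'h) set \<Rightarrow> bool" where
  "von_neumann_algebra M \<longleftrightarrow>
     M \<subseteq> bounded_ops \<and> (\<forall>A\<in>M. badj A \<in> M) \<and> commutant (commutant M) = M"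

definition positive_part :: "('h::complex_hilbert_space \<Rightarrow>\<^sub>L 'h) set \<Rightarrow> ('h \<Rightarrow>\<^sub>L 'h) set" where
  "positive_part M = {A \<in> M. positive_op A}"

text \<open>Only the values of \<open>\<tau>\<close> on the positive part of \<open>M\<close> are constrained or used.\<close>

definition is_trace ::
    "('h::complex_hilbert_space \<Rightarrow>\<^sub>L 'h) set \<Rightarrow> (('h \<Rightarrow>\<^sub>L 'h) \<Rightarrow> ennreal) \<Rightarrow> bool" where
  "is_trace M \<tau> \<longleftrightarrow>
     (\<forall>A\<in>positive_part M. \<forall>B\<in>positive_part M. \<tau> (A + B) = \<tau> A + \<tau> B) \<and>
     (\<forall>A\<in>positive_part M. \<forall>r\<ge>0. \<tau> (r *\<^sub>R A) = ennreal r * \<tau> A) \<and>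
     (\<forall>A\<in>M. \<tau> (badj A o\<^sub>L A) = \<tau> (A o\<^sub>L badj A))"

definition faithful_trace ::
    "('h::complex_hilbert_space \<Rightarrow>\<^sub>L 'h) set \<Rightarrow> (('h \<Rightarrow>\<^sub>L 'h) \<Rightarrow> ennreal) \<Rightarrow> bool" where
  "faithful_trace M \<tau> \<longleftrightarrow> (\<forall>A\<in>positive_part M. \<tau> A = 0 \<longrightarrow> A = 0)"

text \<open>\<open>D\<close> is an increasing net in the positive part, indexed by itself, with least upper bound \<open>S\<close>.\<close>

definition normal_trace ::
    "('h::complex_hilbert_space \<Rightarrow>\<^sub>L 'h) set \<Rightarrow> (('h \<Rightarrow>\<^sub>L 'h) \<Rightarrow> ennreal) \<Rightarrow> bool" where
  "normal_trace M \<tau> \<longleftrightarrow>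
     (\<forall>D S. D \<noteq> {} \<and> D \<subseteq> positive_part M \<and> S \<in> positive_part M \<and>
        (\<forall>A\<in>D. \<forall>B\<in>D. \<exists>C\<in>D. op_le A C \<and> op_le B C) \<and>
        (\<forall>A\<in>D. op_le A S) \<and>
        (\<forall>R\<in>positive_part M. (\<forall>A\<in>D. op_le A R) \<longrightarrow> op_le S R)
        \<longrightarrow> \<tau> S = (SUP A\<in>D. \<tau> A))"

definition semifinite_trace ::
    "('h::complex_hilbert_space \<Rightarrow>\<^sub>L 'h) set \<Rightarrow> (('h \<Rightarrow>\<^sub>L 'h) \<Rightarrow> ennreal) \<Rightarrow> bool" where
  "semifinite_trace M \<tau> \<longleftrightarrow>
     (\<forall>A\<in>positive_part M. A \<noteq> 0 \<longrightarrow>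
        (\<exists>B\<in>positive_part M. B \<noteq> 0 \<and> op_le B A \<and> \<tau> B < \<infinity>))"

text \<open>A von Neumann algebra is semi-finite precisely when it carries a trace as below.\<close>

definition semifinite_von_neumann_algebra ::
    "('h::complex_hilbert_space \<Rightarrow>\<^sub>L 'h) set \<Rightarrow> (('h \<Rightarrow>\<^sub>L 'h) \<Rightarrow> ennreal) \<Rightarrow> bool" where
  "semifinite_von_neumann_algebra M \<tau> \<longleftrightarrow>
     von_neumann_algebra M \<and>
     is_trace M \<tau> \<and> faithful_trace M \<tau> \<and> normal_trace M \<tau> \<and> semifinite_trace M \<tau>"


subsection \<open>Closed operators, given by their graphs\<close>

definition closed_densely_defined :: "('h::complex_hilbert_space \<times> 'h) set \<Rightarrow> bool" where
  "closed_densely_defined x \<longleftrightarrow>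
     (0, 0) \<in> x \<and>
     (\<forall>(\<xi>, \<xi>') \<in> x. \<forall>(\<eta>, \<eta>') \<in> x. (\<xi> + \<eta>, \<xi>' + \<eta>') \<in> x) \<and>
     (\<forall>c. \<forall>(\<xi>, \<xi>') \<in> x. (c *\<^sub>C \<xi>, c *\<^sub>C \<xi>') \<in> x) \<and>
     single_valued x \<and> closed x \<and> closure (Domain x) = UNIV"

definition graph_of :: "('h::complex_hilbert_space \<Rightarrow>\<^sub>L 'h) \<Rightarrow> ('h \<times> 'h) set" where
  "graph_of A = range (\<lambda>\<xi>. (\<xi>, blinfun_apply A \<xi>))"

text \<open>Strong difference and strong product.  As \<open>O\<close> composes relations from left to right,
  \<open>y O x\<close> is the graph of \<open>\<xi> \<mapsto> x (y \<xi>)\<close>.\<close>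

definition op_diff ::
    "('h::complex_hilbert_space \<times> 'h) set \<Rightarrow> ('h \<times> 'h) set \<Rightarrow> ('h \<times> 'h) set" where
  "op_diff x y = closure {(\<xi>, \<eta> - \<zeta>) |\<xi> \<eta> \<zeta>. (\<xi>, \<eta>) \<in> x \<and> (\<xi>, \<zeta>) \<in> y}"

definition op_mult ::
    "('h::complex_hilbert_space \<times> 'h) set \<Rightarrow> ('h \<times> 'h) set \<Rightarrow> ('h \<times> 'h) set" where
  "op_mult x y = closure (y O x)"

definition op_adj :: "('h::complex_hilbert_space \<times> 'h) set \<Rightarrow> ('h \<times> 'h) set" where
  "op_adj x = {(\<eta>, \<zeta>). \<forall>(\<xi>, \<xi>') \<in> x. cinner \<xi>' \<eta> = cinner \<xi> \<zeta>}"

definition positive_selfadjoint :: "('h::complex_hilbert_space \<times> 'h) set \<Rightarrow> bool" where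
  "positive_selfadjoint a \<longleftrightarrow>
     closed_densely_defined a \<and> op_adj a = a \<and> (\<forall>(\<xi>, \<eta>) \<in> a. cinner \<eta> \<xi> \<in> \<real>\<^sub>\<ge>\<^sub>0)"

text \<open>The positive square root of \<open>x\<^sup>* x\<close>.\<close>

definition op_abs :: "('h::complex_hilbert_space \<times> 'h) set \<Rightarrow> ('h \<times> 'h) set" where
  "op_abs x = (THE a. positive_selfadjoint a \<and> a O a = x O op_adj x)"

definition projection_valued_measure :: "(real set \<Rightarrow> ('h::complex_hilbert_space \<Rightarrow>\<^sub>L 'h)) \<Rightarrow> bool" where
  "projection_valued_measure E \<longleftrightarrow>
     (\<forall>B\<in>sets borel. projection_op (E B)) \<and> E UNIV = id_blinfun \<and>
     (\<forall>B :: nat \<Rightarrow> real set. range B \<subseteq> sets borel \<and> disjoint_family B \<longrightarrow>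
        (\<forall>\<xi>. (\<lambda>n. blinfun_apply (E (B n)) \<xi>) sums blinfun_apply (E (\<Union>n. B n)) \<xi>))"

text \<open>The measure \<open>B \<mapsto> \<langle>E(B) \<xi>, \<xi>\<rangle> = \<parallel>E(B) \<xi>\<parallel>\<^sup>2\<close>.\<close>

definition spectral_scalar_measure ::
    "(real set \<Rightarrow> ('h::complex_hilbert_space \<Rightarrow>\<^sub>L 'h)) \<Rightarrow> 'h \<Rightarrow> real measure" where
  "spectral_scalar_measure E \<xi> =
     measure_of UNIV (sets borel) (\<lambda>B. ennreal ((norm (blinfun_apply (E B) \<xi>))\<^sup>2))"

text \<open>\<open>a = \<integral> \<lambda> dE(\<lambda>)\<close>: the domain consists of all \<open>\<xi>\<close> with \<open>\<integral> \<lambda>\<^sup>2 d\<langle>E \<xi>, \<xi>\<rangle> < \<infinity>\<close>, and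
  \<open>\<langle>a \<xi>, \<xi>\<rangle> = \<integral> \<lambda> d\<langle>E \<xi>, \<xi>\<rangle>\<close> there, which determines \<open>a\<close> by polarization.\<close>

definition spectral_measure_of ::
    "(real set \<Rightarrow> ('h::complex_hilbert_space \<Rightarrow>\<^sub>L 'h)) \<Rightarrow> ('h \<times> 'h) set \<Rightarrow> bool" where
  "spectral_measure_of E a \<longleftrightarrow>
     projection_valued_measure E \<and>
     Domain a = {\<xi>. (\<integral>\<^sup>+ r. ennreal (r\<^sup>2) \<partial>spectral_scalar_measure E \<xi>) < \<infinity>} \<and>
     (\<forall>(\<xi>, \<eta>) \<in> a. cinner \<eta> \<xi> = complex_of_real (\<integral> r. r \<partial>spectral_scalar_measure E \<xi>))"

text \<open>\<open>\<chi>\<^sub>B(a)\<close> for self-adjoint \<open>a\<close>.\<close>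

definition spectral_projection ::
    "real set \<Rightarrow> ('h::complex_hilbert_space \<times> 'h) set \<Rightarrow> ('h \<Rightarrow>\<^sub>L 'h)" where
  "spectral_projection B a = (THE P. \<exists>E. spectral_measure_of E a \<and> P = E B)"


subsection \<open>Measurable operators and generalized singular values\<close>

definition affiliated ::
    "('h::complex_hilbert_space \<times> 'h) set \<Rightarrow> ('h \<Rightarrow>\<^sub>L 'h) set \<Rightarrow> bool" where
  "affiliated x M \<longleftrightarrow>
     (\<forall>U\<in>commutant M. unitary_op U \<longrightarrow>
        map_prod (blinfun_apply U) (blinfun_apply U) ` x = x)"

definition measurable_ops ::
    "('h::complex_hilbert_space \<Rightarrow>\<^sub>L 'h) set \<Rightarrow> (('h \<Rightarrow>\<^sub>L 'h) \<Rightarrow> ennreal) \<Rightarrow> ('h \<times> 'h) set set" where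
  "measurable_ops M \<tau> =
     {x. closed_densely_defined x \<and> affiliated x M \<and>
         (\<exists>s\<ge>0. \<tau> (spectral_projection {s<..} (op_abs x)) < \<infinity>)}"

text \<open>The value at \<open>t = 0\<close> is \<open>\<infinity>\<close> if \<open>x\<close> is unbounded (infimum of the empty set).\<close>

definition gen_singular_value ::
    "(('h::complex_hilbert_space \<Rightarrow>\<^sub>L 'h) \<Rightarrow> ennreal) \<Rightarrow> ('h \<times> 'h) set \<Rightarrow> real \<Rightarrow> ennreal" where
  "gen_singular_value \<tau> x t =
     Inf {ennreal s |s. 0 \<le> s \<and> \<tau> (spectral_projection {s<..} (op_abs x)) \<le> ennreal t}"


subsection \<open>Lorentz spaces\<close>

definition decreasing_rearrangement :: "(real \<Rightarrow> complex) \<Rightarrow> real \<Rightarrow> ennreal" where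
  "decreasing_rearrangement f t =
     Inf {ennreal s |s. 0 \<le> s \<and> emeasure (lebesgue_on {0..}) {u \<in> {0..}. s < cmod (f u)} \<le> ennreal t}"

text \<open>Used for positive exponents only.\<close>

definition ennreal_powr :: "ennreal \<Rightarrow> real \<Rightarrow> ennreal" where
  "ennreal_powr a r = (if a = \<infinity> then \<infinity> else ennreal (enn2real a powr r))"

text \<open>The integral against \<open>d(t\<^bsup>p/q\<^esup>)\<close> is the Lebesgue--Stieltjes integral; the \<open>max\<close> extends the
  integrator by \<open>0\<close> to the negative half-line.\<close>

definition lorentz_norm :: "real \<Rightarrow> real \<Rightarrow> (real \<Rightarrow> complex) \<Rightarrow> ennreal" where
  "lorentz_norm q p f =
     ennreal_powr
       (\<integral>\<^sup>+ t \<in> {0..}. ennreal_powr (decreasing_rearrangement f t) p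
          \<partial>interval_measure (\<lambda>t. (max 0 t) powr (p / q)))
       (1 / p)"

definition lorentz_space :: "real \<Rightarrow> real \<Rightarrow> (real \<Rightarrow> complex) set" where
  "lorentz_space q p =
     {f. f \<in> borel_measurable (lebesgue_on {0..}) \<and> lorentz_norm q p f < \<infinity>}"

text \<open>\<open>\<mu>(x)\<close> as a function on the half-line.  For measurable \<open>x\<close> it is finite at every \<open>t > 0\<close>, so
  \<^const>\<open>enn2real\<close> alters it at most on the null set \<open>{0}\<close>.\<close>

definition singular_value_fun ::
    "(('h::complex_hilbert_space \<Rightarrow>\<^sub>L 'h) \<Rightarrow> ennreal) \<Rightarrow> ('h \<times> 'h) set \<Rightarrow> real \<Rightarrow> complex" where
  "singular_value_fun \<tau> x t = complex_of_real (enn2real (gen_singular_value \<tau> x t))"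

definition nc_lorentz_space ::
    "real \<Rightarrow> real \<Rightarrow> ('h::complex_hilbert_space \<Rightarrow>\<^sub>L 'h) set \<Rightarrow> (('h \<Rightarrow>\<^sub>L 'h) \<Rightarrow> ennreal) \<Rightarrow>
      ('h \<times> 'h) set set" where
  "nc_lorentz_space q p M \<tau> = {x \<in> measurable_ops M \<tau>. singular_value_fun \<tau> x \<in> lorentz_space q p}"

definition nc_lorentz_norm ::
    "real \<Rightarrow> real \<Rightarrow> (('h::complex_hilbert_space \<Rightarrow>\<^sub>L 'h) \<Rightarrow> ennreal) \<Rightarrow> ('h \<times> 'h) set \<Rightarrow> real" where
  "nc_lorentz_norm q p \<tau> x = enn2real (lorentz_norm q p (singular_value_fun \<tau> x))"


subsection \<open>Local convergence in measure\<close>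

definition local_measure_nhds ::
    "('h::complex_hilbert_space \<Rightarrow>\<^sub>L 'h) set \<Rightarrow> (('h \<Rightarrow>\<^sub>L 'h) \<Rightarrow> ennreal) \<Rightarrow> ('h \<times> 'h) set set set" where
  "local_measure_nhds M \<tau> =
     {{x \<in> measurable_ops M \<tau>.
         gen_singular_value \<tau> (op_mult (graph_of e) (op_mult x (graph_of e))) \<delta> < ennreal \<epsilon>}
      |e \<epsilon> \<delta>. 0 < \<epsilon> \<and> 0 < \<delta> \<and> e \<in> M \<and> projection_op e \<and> \<tau> e < \<infinity>}"

text \<open>The translation-invariant topology determined by these neighbourhoods of \<open>0\<close>.  They are not
  open in general, so they do not generate it as a subbase.  The family is directed downwards; finite
  intersections are allowed only so that the axioms of a topology hold by inspection.\<close>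

definition local_measure_open ::
    "('h::complex_hilbert_space \<Rightarrow>\<^sub>L 'h) set \<Rightarrow> (('h \<Rightarrow>\<^sub>L 'h) \<Rightarrow> ennreal) \<Rightarrow> ('h \<times> 'h) set set \<Rightarrow> bool" where
  "local_measure_open M \<tau> U \<longleftrightarrow>
     U \<subseteq> measurable_ops M \<tau> \<and>
     (\<forall>x\<in>U. \<exists>F. finite F \<and> F \<subseteq> local_measure_nhds M \<tau> \<and>
        {y \<in> measurable_ops M \<tau>. op_diff y x \<in> \<Inter>F} \<subseteq> U)"

definition local_measure_topology ::
    "('h::complex_hilbert_space \<Rightarrow>\<^sub>L 'h) set \<Rightarrow> (('h \<Rightarrow>\<^sub>L 'h) \<Rightarrow> ennreal) \<Rightarrow> ('h \<times> 'h) set topology" where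
  "local_measure_topology M \<tau> = topology (local_measure_open M \<tau>)"

lemma istopology_local_measure_open: "istopology (local_measure_open M \<tau>)"
  unfolding istopology_def
proof (intro conjI allI impI)
  fix S T assume S: "local_measure_open M \<tau> S" and T: "local_measure_open M \<tau> T"
  have "\<exists>H. finite H \<and> H \<subseteq> local_measure_nhds M \<tau> \<and>
        {y \<in> measurable_ops M \<tau>. op_diff y x \<in> \<Inter>H} \<subseteq> S \<inter> T" if x: "x \<in> S" "x \<in> T" for x
  proof -
    from S x(1) obtain F where F: "finite F" "F \<subseteq> local_measure_nhds M \<tau>"
      "{y \<in> measurable_ops M \<tau>. op_diff y x \<in> \<Inter>F} \<subseteq> S"
      unfolding local_measure_open_def by meson
    from T x(2) obtain G where G: "finite G" "G \<subseteq> local_measure_nhds M \<tau>"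
      "{y \<in> measurable_ops M \<tau>. op_diff y x \<in> \<Inter>G} \<subseteq> T"
      unfolding local_measure_open_def by meson
    have "{y \<in> measurable_ops M \<tau>. op_diff y x \<in> \<Inter>(F \<union> G)} \<subseteq> S \<inter> T"
      using F(3) G(3) by blast
    then show ?thesis using F(1,2) G(1,2) by (meson finite_UnI Un_least)
  qed
  moreover have "S \<inter> T \<subseteq> measurable_ops M \<tau>"
    using S unfolding local_measure_open_def by (meson inf.coboundedI1)
  ultimately show "local_measure_open M \<tau> (S \<inter> T)"
    unfolding local_measure_open_def by (meson IntD1 IntD2)
next
  fix K assume K: "\<forall>S\<in>K. local_measure_open M \<tau> S"
  have "\<exists>F. finite F \<and> F \<subseteq> local_measure_nhds M \<tau> \<and>
        {y \<in> measurable_ops M \<tau>. op_diff y x \<in> \<Inter>F} \<subseteq> \<Union>K" if x: "x \<in> S" "S \<in> K" for x S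
  proof -
    have "local_measure_open M \<tau> S" using K x(2) by (rule bspec)
    with x(1) obtain F where F: "finite F" "F \<subseteq> local_measure_nhds M \<tau>"
      "{y \<in> measurable_ops M \<tau>. op_diff y x \<in> \<Inter>F} \<subseteq> S"
      unfolding local_measure_open_def by meson
    then show ?thesis using x(2) by (meson Sup_upper subset_trans)
  qed
  moreover have "\<Union>K \<subseteq> measurable_ops M \<tau>"
    using K unfolding local_measure_open_def by (meson Sup_least)
  ultimately show "local_measure_open M \<tau> (\<Union>K)"
    unfolding local_measure_open_def by (meson UnionE)
qed

lemma openin_local_measure_topology:
  "openin (local_measure_topology M \<tau>) = local_measure_open M \<tau>"
  unfolding local_measure_topology_def by (rule topology_inverse'[OF istopology_local_measure_open])

lemma topspace_local_measure_topology:
  "topspace (local_measure_topology M \<tau>) = measurable_ops M \<tau>"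
proof
  show "topspace (local_measure_topology M \<tau>) \<subseteq> measurable_ops M \<tau>"
    using openin_topspace[of "local_measure_topology M \<tau>"]
    unfolding openin_local_measure_topology local_measure_open_def by (rule conjunct1)
  have "local_measure_open M \<tau> (measurable_ops M \<tau>)"
    unfolding local_measure_open_def
    by (intro conjI ballI exI[of _ "{}"]) simp_all
  then show "measurable_ops M \<tau> \<subseteq> topspace (local_measure_topology M \<tau>)"
    by (metis openin_local_measure_topology openin_subset)
qed


subsection \<open>The uniform Kadec-Klee-Huff property\<close>

text \<open>\<open>X\<close> is the carrier of a quasi-normed space with quasi-norm \<open>N\<close> and subtraction \<open>diff\<close>, and
  \<open>T\<close> is a topology on \<open>X\<close>.\<close>

definition UKKH ::
    "'a set \<Rightarrow> ('a \<Rightarrow> 'a \<Rightarrow> 'a) \<Rightarrow> ('a \<Rightarrow> real) \<Rightarrow> 'a topology \<Rightarrow> bool" where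
  "UKKH X diff N T \<longleftrightarrow>
     (\<forall>\<epsilon>>0. \<exists>\<delta>. 0 < \<delta> \<and> \<delta> < 1 \<and>
        (\<forall>(u :: nat \<Rightarrow> 'a) x.
           (\<forall>n. u n \<in> X \<and> N (u n) \<le> 1) \<and> x \<in> X \<and> limitin T u x sequentially \<and> N x > 1 - \<delta>
           \<longrightarrow> (\<exists>n\<^sub>0>0. \<forall>n\<ge>n\<^sub>0. \<forall>m\<ge>n\<^sub>0. N (diff (u n) (u m)) \<le> \<epsilon>)))"

end

theory Submission
 imports Defs "HOL-Probability.Helly_Selection" "HOL-Real_Asymp.Real_Asymp"
begin

text \<open>Let \<open>d\<^sub>x(s) = \<tau>(\<chi>\<^bsub>(s,\<infinity>)\<^esub>(|x|))\<close>.  The \<open>p\<close>-th power of the Lorentz norm is \<open>\<Lambda>(d\<^sub>x) = \<integral> p s^(p-1) d\<^sub>x(s)^th ds\<close> with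
 \<open>th = p/q <= 1\<close>.  It is uniformly monotone: if \<open>0 <= a <= h\<close>, \<open>\<Lambda>(d\<^sub>h) <= 1\<close> and \<open>\<Lambda>(d\<^sub>a)\<close> is close to \<open>1\<close>, then
 \<open>\<Lambda>(d\<^bsub>h-a\<^esub>)\<close> is small.  For \<open>p > 1\<close> this follows from the superadditivity of \<open>a \<mapsto> \<tau>((a - s)\<^sub>+)\<close>, and operator
 monotonicity of the square root descends from \<open>2p\<close> to \<open>p\<close>.  Applied to \<open>y\<^sup>*ey <= y\<^sup>*y\<close> it shows that a unit vector \<open>y\<close>
 almost normed by its corner \<open>e y f\<close> is almost equal to it.

 If \<open>u\<^sub>n \<rightarrow> x\<close> locally in measure, choose \<open>e\<close> of finite trace carrying most of \<open>x\<close>.  By lower semicontinuity of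
 distribution functions almost the whole norm of \<open>u\<^sub>n\<close> sits in a corner \<open>e u\<^sub>n f\<close>, \<open>f <= e\<close>, on which \<open>u\<^sub>n\<close> and \<open>u\<^sub>m\<close>
 are uniformly close; hence \<open>u\<^sub>n - u\<^sub>m\<close> is small.

 Hilbert spaces are treated as real ones, with the inner product \<open>Re \<langle>xi, eta\<rangle>\<close>; complex linearity is commutation with \<open>\<i>\<close>.\<close>

text \<open>Local convergence in measure controls corners of finite trace only; the mass outside
  them has to be excluded by the norms. The projection f depends on the pair (n, m), so the modulus
  must be uniform over all projections. No triangle inequality for the Lorentz norm is used: as th
  <= 1, t^th is subadditive, and sums of operators cost factors 2^p. The superadditive argument
  needs p > 1 because the integral of v^(-p) over (1, \<infinity>) enters; passing from y to y*y
  halves the exponent, so small exponents occur even if p > 1.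

  This is insensitive to the closures in sums and products, since graphs need to agree only on
  subspaces of small codimension. The definite descriptions of |x| and of its spectral projections
  are resolved through the bounded operator 1 / (1 + x*x), whose Borel calculus rests on the
  Hausdorff moment problem.\<close>

no_notation vec_nth (infixl "$" 90)
notation blinfun_apply (infixr "$" 75) and blinfun_compose (infixl "oL" 55)

abbreviation seqlim (infix "---->" 60) where "f ----> l \<equiv> f \<longlonglongrightarrow> l"

section \<open>Hilbert space preliminaries\<close>

definition selfadj :: "('a::real_inner \<Rightarrow>\<^sub>L 'a) => bool" where
 "selfadj A \<longleftrightarrow> (\<forall>x y. A $ x \<bullet> y = x \<bullet> A $ y)"

definition posop :: "('a::real_inner \<Rightarrow>\<^sub>L 'a) => bool" where
 "posop A \<longleftrightarrow> selfadj A \<and> (\<forall>x. 0 <= A $ x \<bullet> x)"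

lemma selfadjD: "selfadj A ==> A $ x \<bullet> y = x \<bullet> A $ y"
 by (simp add: selfadj_def)

text \<open>By the parallelogram identity a minimizing sequence for the distance to S is Cauchy,
  since midpoints stay in S; minimality along y + t z makes the error of the limit orthogonal to
  S.\<close>

lemma ex_orthogonal_projection:
 fixes S :: "'a::{real_inner,complete_space} set"
 assumes S: "subspace S" "closed S"
 shows "\<exists>y\<in>S. \<forall>z\<in>S. (x - y) \<bullet> z = 0"
proof -
 define D where "D = (\<lambda>s. (norm (x - s))^2) ` S"
 have ne: "D \<noteq> {}" and bdd: "bdd_below D"
  using subspace_0[OF S(1)] by (auto simp: D_def intro!: bdd_belowI[of _ 0])
 define d where "d = Inf D"
 have d_le: "d <= (norm (x - s))^2" if "s \<in> S" for s
  unfolding d_def using that bdd by (intro cInf_lower) (auto simp: D_def)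
 have "\<exists>s\<in>S. (norm (x - s))^2 < d + 1 / (real n + 1)" for n
 proof -
  have "d < d + 1 / (real n + 1)" by simp
  hence "\<exists>v\<in>D. v < d + 1 / (real n + 1)"
   unfolding d_def using cInf_lessD[OF ne] by metis
  thus ?thesis by (auto simp: D_def)
 qed
 then obtain f where f: "\<And>n. f n \<in> S" "\<And>n. (norm (x - f n))^2 < d + 1 / (real n + 1)"
  by metis
 have par: "(norm (f n - f m))^2 <= 2 / (real n + 1) + 2 / (real m + 1)" for n m
 proof -
  have mid: "(1/2) *\<^sub>R (f n + f m) \<in> S"
   using S f(1) by (simp add: subspace_add subspace_scale)
  have "(norm (f n - f m))^2 + 4 * (norm (x - (1/2) *\<^sub>R (f n + f m)))^2
    = 2 * (norm (x - f n))^2 + 2 * (norm (x - f m))^2"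
   unfolding power2_norm_eq_inner
   by (simp add: inner_diff_left inner_diff_right inner_add_left inner_add_right
     inner_commute algebra_simps)
  thus ?thesis using f(2)[of n] f(2)[of m] d_le[OF mid] by simp
 qed
 have "Cauchy f"
 proof (rule CauchyI)
  fix e :: real assume e: "0 < e"
  obtain N :: nat where N: "4 / e^2 < real N" using reals_Archimedean2 by blast
  have "norm (f m - f n) < e" if "m \<ge> N" "n \<ge> N" for m n
  proof -
   have Np: "0 < real N" using N e by (smt (verit) divide_pos_pos zero_less_power)
   have "2 / (real m + 1) <= 2 / (real N + 1)" "2 / (real n + 1) <= 2 / (real N + 1)"
    using that by (auto intro!: divide_left_mono)
   hence "(norm (f m - f n))^2 <= 4 / (real N + 1)" using par[of m n] by simp
   also have "... < 4 / real N" using Np by (intro divide_strict_left_mono) auto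
   also have "... < e^2" using N e Np by (simp add: field_simps)
   finally show ?thesis using e by (simp add: power2_less_imp_less)
  qed
  thus "\<exists>M. \<forall>m\<ge>M. \<forall>n\<ge>M. norm (f m - f n) < e" by blast
 qed
 then obtain y where y: "f ----> y" using Cauchy_convergent convergent_def by blast
 have yS: "y \<in> S" using S(2) f(1) y closed_sequentially by blast
 have "(\<lambda>n. (norm (x - f n))^2) ----> (norm (x - y))^2"
  by (intro tendsto_intros y)
 moreover have "(\<lambda>n. d + 1 / (real n + 1)) ----> d + 0"
  by (intro tendsto_intros LIMSEQ_inverse_real_of_nat[simplified inverse_eq_divide, THEN filterlim_compose[rotated]])
   (use LIMSEQ_inverse_real_of_nat in \<open>simp add: inverse_eq_divide add.commute\<close>)
 ultimately have yd: "(norm (x - y))^2 <= d"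
  using f(2) by (intro LIMSEQ_le) (auto intro: less_imp_le)
 have "(x - y) \<bullet> z = 0" if z: "z \<in> S" for z
 proof (cases "z = 0")
  case False
  \<comment> \<open>The minimizer of the quadratic function t \<mapsto> |x - y - t z|^2; it would
    undercut the distance by ((x - y) \<bullet> z)^2 / (z \<bullet> z).\<close>
  define t where "t = ((x - y) \<bullet> z) / (z \<bullet> z)"
  have "y + t *\<^sub>R z \<in> S" using S yS z by (simp add: subspace_add subspace_scale)
  hence "(norm (x - y))^2 <= (norm (x - (y + t *\<^sub>R z)))^2" using d_le[of "y + t *\<^sub>R z"] yd by linarith
  also have "... = (norm (x - y))^2 - 2 * t * ((x - y) \<bullet> z) + t^2 * (z \<bullet> z)"
   unfolding power2_norm_eq_inner
   by (simp add: inner_diff_left inner_diff_right inner_add_left inner_add_right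
     inner_commute algebra_simps power2_eq_square)
  also have "... = (norm (x - y))^2 - ((x - y) \<bullet> z)^2 / (z \<bullet> z)"
   using False by (simp add: t_def field_simps power2_eq_square)
  finally have "((x - y) \<bullet> z)^2 / (z \<bullet> z) <= 0" by simp
  moreover have "0 < z \<bullet> z" using False by simp
  ultimately show ?thesis
   by (smt (verit) divide_pos_pos zero_less_power2)
 qed simp
 thus ?thesis using yS by blast
qed

definition oproj :: "'a::{real_inner,complete_space} set => 'a \<Rightarrow>\<^sub>L 'a" where
 "oproj S = Blinfun (\<lambda>x. SOME y. y \<in> S \<and> (\<forall>z\<in>S. (x - y) \<bullet> z = 0))"

lemma orthogonal_projection_unique:
 assumes "subspace S" "y \<in> S" "y' \<in> S" "\<And>z. z \<in> S ==> (x - y) \<bullet> z = 0"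
  "\<And>z. z \<in> S ==> (x - y') \<bullet> z = 0"
 shows "y = (y'::'a::real_inner)"
proof -
 have "y - y' \<in> S" using assms(1-3) by (rule subspace_diff)
 hence "(x - y') \<bullet> (y - y') - (x - y) \<bullet> (y - y') = 0" using assms(4,5) by simp
 hence "(y - y') \<bullet> (y - y') = 0" by (simp add: inner_diff_left)
 thus ?thesis by simp
qed

context
 fixes S :: "'a::{real_inner,complete_space} set"
 assumes S: "subspace S" "closed S"
begin

private definition "pr = (\<lambda>x. SOME y. y \<in> S \<and> (\<forall>z\<in>S. (x - y) \<bullet> z = 0))"

private lemma pr: "pr x \<in> S" "\<And>z. z \<in> S ==> (x - pr x) \<bullet> z = 0"
proof -
 have "\<exists>y. y \<in> S \<and> (\<forall>z\<in>S. (x - y) \<bullet> z = 0)" using ex_orthogonal_projection[OF S] by blast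
 from someI_ex[OF this] show "pr x \<in> S" "\<And>z. z \<in> S ==> (x - pr x) \<bullet> z = 0"
  unfolding pr_def by auto
qed

private lemma pr_eq: "y \<in> S ==> (\<And>z. z \<in> S ==> (x - y) \<bullet> z = 0) ==> pr x = y"
 by (rule orthogonal_projection_unique[OF S(1) pr(1) _ pr(2)])

private lemma bl_pr: "bounded_linear pr"
proof (rule bounded_linear_intro[where K = 1])
 fix x y
 show "pr (x + y) = pr x + pr y"
 proof (rule pr_eq)
  show "pr x + pr y \<in> S" using pr S by (simp add: subspace_add)
  fix z assume "z \<in> S"
  thus "(x + y - (pr x + pr y)) \<bullet> z = 0"
   using pr(2)[of z x] pr(2)[of z y] by (simp add: inner_diff_left inner_add_left)
 qed
next
 fix r x
 show "pr (r *\<^sub>R x) = r *\<^sub>R pr x"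
 proof (rule pr_eq)
  show "r *\<^sub>R pr x \<in> S" using pr S by (simp add: subspace_scale)
  fix z assume "z \<in> S"
  thus "(r *\<^sub>R x - r *\<^sub>R pr x) \<bullet> z = 0"
   using pr(2)[of z x] by (simp add: inner_diff_left)
 qed
next
 fix x
 have "(x - pr x) \<bullet> pr x = 0" using pr by blast
 hence "(norm x)^2 = (norm (pr x))^2 + (norm (x - pr x))^2"
  unfolding power2_norm_eq_inner by (simp add: inner_diff_left inner_diff_right inner_commute)
 hence "(norm (pr x))^2 <= (norm x)^2" by simp
 thus "norm (pr x) <= norm x * 1" by (simp add: power2_le_iff_abs_le)
qed

lemma oproj_in: "oproj S x \<in> S"
 and oproj_orth: "z \<in> S ==> (x - oproj S x) \<bullet> z = 0"
 and oproj_eqI: "y \<in> S ==> (\<And>z. z \<in> S ==> (x - y) \<bullet> z = 0) ==> oproj S x = y"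
proof -
 have [simp]: "oproj S x = pr x" for x
  using bl_pr unfolding oproj_def pr_def[symmetric] by (simp add: bounded_linear_Blinfun_apply)
 show "oproj S x \<in> S" "z \<in> S ==> (x - oproj S x) \<bullet> z = 0"
  "y \<in> S ==> (\<And>z. z \<in> S ==> (x - y) \<bullet> z = 0) ==> oproj S x = y"
  using pr pr_eq by auto
qed

lemma oproj_fix: "x \<in> S ==> oproj S x = x"
 by (rule oproj_eqI) auto

lemma oproj_fix_iff: "oproj S x = x \<longleftrightarrow> x \<in> S"
 using oproj_fix oproj_in by metis

lemma oproj_inner: "z \<in> S ==> oproj S x \<bullet> z = x \<bullet> z"
 using oproj_orth[of z x] by (simp add: inner_diff_left)

lemma oproj_selfadj: "selfadj (oproj S)"
 unfolding selfadj_def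
proof safe
 fix x y
 have "oproj S x \<bullet> y = oproj S x \<bullet> oproj S y"
  using oproj_inner[OF oproj_in[of x], of y] by (simp add: inner_commute)
 also have "... = x \<bullet> oproj S y" using oproj_inner[OF oproj_in] .
 finally show "oproj S x \<bullet> y = x \<bullet> oproj S y" .
qed

lemma oproj_idem: "oproj S (oproj S x) = oproj S x"
 using oproj_fix oproj_in by blast

lemma oproj_inner_self: "oproj S x \<bullet> x = (norm (oproj S x))^2"
 using oproj_inner[OF oproj_in, of x x] by (simp add: power2_norm_eq_inner inner_commute)

lemma oproj_pythagoras: "(norm x)^2 = (norm (oproj S x))^2 + (norm (x - oproj S x))^2"
 using oproj_orth[OF oproj_in, of x x]
 unfolding power2_norm_eq_inner by (simp add: inner_diff_left inner_diff_right inner_commute)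

lemma norm_oproj_le: "norm (oproj S x) <= norm x"
proof -
 have "(norm (oproj S x))^2 <= (norm x)^2" using oproj_pythagoras[of x] by simp
 thus ?thesis by (simp add: power2_le_iff_abs_le)
qed

lemma oproj_zero_iff: "oproj S x = 0 \<longleftrightarrow> (\<forall>z\<in>S. x \<bullet> z = 0)"
proof
 assume "oproj S x = 0"
 thus "\<forall>z\<in>S. x \<bullet> z = 0" using oproj_orth[of _ x] by simp
next
 assume "\<forall>z\<in>S. x \<bullet> z = 0"
 thus "oproj S x = 0" using S by (intro oproj_eqI) (auto simp: subspace_0)
qed

lemma oproj_commute:
 fixes A :: "'a \<Rightarrow>\<^sub>L 'a"
 assumes "\<And>x. x \<in> S ==> A $ x \<in> S" and "\<And>x y. A $ x \<bullet> y = x \<bullet> B $ y" and "\<And>x. x \<in> S ==> B $ x \<in> S"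
 shows "oproj S (A $ x) = A $ (oproj S x)"
proof (rule oproj_eqI)
 show "A $ (oproj S x) \<in> S" using assms oproj_in by blast
 fix z assume z: "z \<in> S"
 have "(A $ x - A $ (oproj S x)) \<bullet> z = (x - oproj S x) \<bullet> B $ z"
  using assms(2) by (metis blinfun.diff_right)
 thus "(A $ x - A $ (oproj S x)) \<bullet> z = 0" using oproj_orth assms(3) z by simp
qed

end

section \<open>Riesz representation and adjoints\<close>

lemma riesz_representation:
 fixes f :: "'a::{real_inner,complete_space} => real"
 assumes f: "bounded_linear f"
 shows "\<exists>v. \<forall>x. f x = v \<bullet> x"
proof (cases "\<forall>x. f x = 0")
 case True
 thus ?thesis by (intro exI[of _ 0]) simp
next
 case False
 then obtain u where u: "f u \<noteq> 0" by blast
 interpret f: bounded_linear f by fact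
 define K where "K = {x. f x = 0}"
 have "subspace K" by (auto simp: K_def subspace_def f.add f.scaleR f.zero)
 moreover have "closed K"
  unfolding K_def using f.continuous_on[OF continuous_on_id] by (intro closed_Collect_eq) auto
 ultimately obtain y where y: "y \<in> K" "\<And>z. z \<in> K ==> (u - y) \<bullet> z = 0"
  using ex_orthogonal_projection by blast
 define w where "w = u - y"
 have fw: "f w \<noteq> 0" using u y by (simp add: w_def f.diff K_def)
 hence w0: "w \<bullet> w \<noteq> 0" using f.zero by auto
 have "f x = ((f w / (w \<bullet> w)) *\<^sub>R w) \<bullet> x" for x
 proof -
  have "x - (f x / f w) *\<^sub>R w \<in> K" using fw by (simp add: K_def f.diff f.scaleR)
  hence "w \<bullet> (x - (f x / f w) *\<^sub>R w) = 0" using y(2) w_def by blast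
  hence "w \<bullet> x = (f x / f w) * (w \<bullet> w)" by (simp add: inner_diff_right)
  thus ?thesis using fw w0 by (simp add: field_simps)
 qed
 thus ?thesis by blast
qed

lemma ex_operator_of_form:
 fixes b :: "'a::{real_inner,complete_space} => 'b::{real_inner,complete_space} => real"
 assumes "bounded_bilinear b"
 shows "\<exists>A :: 'b \<Rightarrow>\<^sub>L 'a. \<forall>x y. x \<bullet> A $ y = b x y"
proof -
 interpret b: bounded_bilinear b by fact
 have "\<exists>v. \<forall>x. b x y = v \<bullet> x" for y
  by (rule riesz_representation[OF b.bounded_linear_left])
 then obtain F where F: "\<And>x y. b x y = F y \<bullet> x" by metis
 obtain K where K: "K \<ge> 0" "\<And>x y. norm (b x y) <= norm x * norm y * K" using b.nonneg_bounded by blast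
 have eqI: "u = v" if "\<And>x. u \<bullet> x = v \<bullet> x" for u v :: 'a
  using that by (metis vector_eq_rdot)
 have "bounded_linear F"
 proof (rule bounded_linear_intro[where K = K])
  show "F (x + y) = F x + F y" for x y
   by (rule eqI) (simp add: F[symmetric] b.add_right inner_add_left)
  show "F (r *\<^sub>R x) = r *\<^sub>R F x" for r x
   by (rule eqI) (simp add: F[symmetric] b.scaleR_right)
  show "norm (F x) <= norm x * K" for x
  proof (cases "F x = 0")
   case False
   have "(norm (F x))^2 = b (F x) x" by (simp add: F power2_norm_eq_inner)
   also have "... <= norm (F x) * norm x * K" using K(2)[of "F x" x] by simp
   finally show ?thesis using False by (simp add: power2_eq_square algebra_simps)
  qed (use K in auto)
 qed
 thus ?thesis
  by (intro exI[of _ "Blinfun F"]) (simp add: bounded_linear_Blinfun_apply F inner_commute)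
qed

definition adj :: "('a::{real_inner,complete_space} \<Rightarrow>\<^sub>L 'b::{real_inner,complete_space}) => 'b \<Rightarrow>\<^sub>L 'a" where
 "adj A = (SOME B. \<forall>x y. x \<bullet> B $ y = A $ x \<bullet> y)"

lemma adj: "A $ x \<bullet> y = x \<bullet> adj A $ y"
proof -
 have "bounded_bilinear (\<lambda>x y. A $ x \<bullet> y)"
  by (rule bounded_bilinear.comp[OF bounded_bilinear_inner blinfun.bounded_linear_right
    bounded_linear_ident])
 from someI_ex[OF ex_operator_of_form[OF this]] show ?thesis unfolding adj_def by metis
qed

lemma adj_eqI:
 assumes "\<And>x y. A $ x \<bullet> y = x \<bullet> B $ y" shows "adj A = B"
proof (rule blinfun_eqI)
 fix y
 have "x \<bullet> adj A $ y = x \<bullet> B $ y" for x using adj[of A x y] assms by simp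
 thus "adj A $ y = B $ y" by (metis vector_eq_ldot)
qed

lemma adj_adj [simp]: "adj (adj A) = A"
 by (rule adj_eqI) (metis adj inner_commute)

lemma adj_compose [simp]: "adj (A oL B) = adj B oL adj A"
 by (rule adj_eqI) (simp add: adj)

lemma adj_add [simp]: "adj (A + B) = adj A + adj B"
 by (rule adj_eqI) (simp add: adj blinfun.add_left inner_add_left inner_add_right)

lemma adj_diff [simp]: "adj (A - B) = adj A - adj B"
 by (rule adj_eqI) (simp add: adj blinfun.diff_left inner_diff_left inner_diff_right)

lemma adj_scaleR [simp]: "adj (r *\<^sub>R A) = r *\<^sub>R adj A"
 by (rule adj_eqI) (simp add: adj blinfun.scaleR_left)

lemma adj_id [simp]: "adj id_blinfun = id_blinfun"
 by (rule adj_eqI) simp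

lemma selfadj_iff: "selfadj A \<longleftrightarrow> adj A = A"
 by (metis adj adj_eqI selfadj_def)

lemma adj': "adj A $ x \<bullet> y = x \<bullet> A $ y"
 by (metis adj inner_commute)

lemma posop_adj_self: "posop (adj A oL A)"
 unfolding posop_def selfadj_def by (auto simp: adj' adj[symmetric])

lemma posop_selfadj: "posop A ==> selfadj A"
 by (simp add: posop_def)

lemma adj_self_inner: "(adj A oL A) $ x \<bullet> x = (norm (A $ x))^2"
 by (simp add: power2_norm_eq_inner) (metis adj inner_commute)

section \<open>The Hausdorff moment problem\<close>

context
 fixes c :: "nat => nat => real"
 assumes c_nonneg: "0 <= c j l" and c_rec: "c j l = c (Suc j) l + c j (Suc l)"
begin

private lemma binomial_step:
 "(\<Sum>i\<le>Suc N. real (Suc N choose i) * F i) = (\<Sum>i\<le>N. real (N choose i) * (F (Suc i) + F i))" for F :: "nat => real"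
proof -
 have "(\<Sum>i\<le>Suc N. real (Suc N choose i) * F i) = F 0 + (\<Sum>i\<le>N. (real (N choose i) + real (N choose Suc i)) * F (Suc i))"
  by (subst sum.atMost_Suc_shift) simp
 also have "... = F 0 + (\<Sum>i\<le>N. real (N choose Suc i) * F (Suc i)) + (\<Sum>i\<le>N. real (N choose i) * F (Suc i))"
  by (simp add: algebra_simps sum.distrib)
 also have "F 0 + (\<Sum>i\<le>N. real (N choose Suc i) * F (Suc i)) = (\<Sum>i\<le>Suc N. real (N choose i) * F i)"
  by (subst sum.atMost_Suc_shift) simp
 also have "... = (\<Sum>i\<le>N. real (N choose i) * F i)" by (simp add: binomial_eq_0)
 finally show ?thesis by (simp add: algebra_simps sum.distrib)
qed

text \<open>Expansion of 1 = (t + (1 - t))^N, when \<open>c j l\<close> is thought of as the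
  integral of t^j (1 - t)^l; the hypothesis \<open>c_rec\<close> is the case N = 1.\<close>

private lemma expand: "c k l = (\<Sum>i\<le>N. real (N choose i) * c (k + i) (l + (N - i)))"
proof (induction N arbitrary: k l)
 case (Suc N)
 have "c k l = (\<Sum>i\<le>N. real (N choose i) * c (k + i) (l + (N - i)))" by (rule Suc)
 also have "... = (\<Sum>i\<le>N. real (N choose i) * (c (k + Suc i) (l + (Suc N - Suc i)) + c (k + i) (l + (Suc N - i))))"
  by (rule sum.cong[OF refl]) (subst c_rec, simp add: Suc_diff_le)
 finally show ?case
  using binomial_step[of N "\<lambda>i. c (k + i) (l + (Suc N - i))"] by simp
qed simp

text \<open>Mass that the n-th approximating measure gives to j / n: the integral of the Bernstein
  polynomial of degree n and index j.\<close>

private definition "wt n j = real (n choose j) * c j (n - j)"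

private lemma wt_nonneg: "0 <= wt n j"
 by (simp add: wt_def c_nonneg)

private lemma sum_wt: "(\<Sum>j\<le>n. wt n j) = c 0 0"
 using expand[of 0 0 n] by (simp add: wt_def)

text \<open>Moments formed with binomials are exact for every n, because choosing j elements and k
  among them is the same as choosing the k and then the other j - k; what remains is
  \<open>expand\<close> for \<open>c k 0\<close>.\<close>

private lemma sum_wt_binomial:
 assumes "k <= n"
 shows "(\<Sum>j\<le>n. wt n j * (real (j choose k) / real (n choose k))) = c k 0"
proof -
 have "(\<Sum>j\<le>n. wt n j * (real (j choose k) / real (n choose k)))
   = (\<Sum>j\<in>{k..n}. wt n j * (real (j choose k) / real (n choose k)))"
  by (rule sum.mono_neutral_right) (auto simp: binomial_eq_0)
 also have "... = (\<Sum>j\<in>{k..n}. real ((n - k) choose (j - k)) * c j (n - j))"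
 proof (rule sum.cong[OF refl])
  fix j assume j: "j \<in> {k..n}"
  have "real (n choose j) * real (j choose k) = real (n choose k) * real ((n - k) choose (j - k))"
   using choose_mult[of k j n] j by (simp flip: of_nat_mult)
  moreover have "real (n choose k) \<noteq> 0" using assms by simp
  ultimately show "wt n j * (real (j choose k) / real (n choose k)) = real ((n - k) choose (j - k)) * c j (n - j)"
   by (simp add: wt_def field_simps)
 qed
 also have "... = (\<Sum>i\<le>n - k. real ((n - k) choose i) * c (k + i) (0 + ((n - k) - i)))"
  using assms by (intro sum.reindex_bij_witness[of _ "\<lambda>i. k + i" "\<lambda>j. j - k"]) auto
 also have "... = c k 0" by (rule expand[symmetric])
 finally show ?thesis .
qed

text \<open>Replaces binomial moments by powers: two products with factors in [-1, 1] differ by at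
  most the sum of the differences of their factors, here at most k / (n - k) each.\<close>

private lemma ratio_close:
 assumes "2 * k < n" "j <= n"
 shows "\<bar>real (j choose k) / real (n choose k) - (real j / real n) ^ k\<bar> <= real k * (real k / real (n - k))"
proof -
 have bin: "real (m choose k) = (\<Prod>i = 0..<k. real m - real i) / fact k" for m
  by (simp add: binomial_gbinomial gbinomial_prod_rev)
 have nz: "(\<Prod>i = 0..<k. real n - real i) \<noteq> 0" using assms by auto
 have r: "real (j choose k) / real (n choose k) = (\<Prod>i\<in>{0..<k}. (real j - real i) / (real n - real i))"
  unfolding bin by (simp add: prod_dividef)
 have p: "(real j / real n) ^ k = (\<Prod>i\<in>{0..<k}. real j / real n)" by simp
 have "norm ((\<Prod>i\<in>{0..<k}. (real j - real i) / (real n - real i)) - (\<Prod>i\<in>{0..<k}. real j / real n))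
   <= (\<Sum>i\<in>{0..<k}. norm ((real j - real i) / (real n - real i) - real j / real n))"
 proof (rule norm_prod_diff)
  fix i assume i: "i \<in> {0..<k}"
  have "\<bar>real j - real i\<bar> <= real n - real i" using i assms by auto
  thus "norm ((real j - real i) / (real n - real i)) <= 1" using i assms by simp
  show "norm (real j / real n) <= 1" using assms by simp
 qed
 also have "... <= (\<Sum>i\<in>{0..<k}. real k / real (n - k))"
 proof (rule sum_mono)
  fix i assume i: "i \<in> {0..<k}"
  have pos: "0 < real n - real i" "0 < real n" "0 < real n - real k" using i assms by auto
  have "(real j - real i) / (real n - real i) - real j / real n = - (real i * (real n - real j) / (real n * (real n - real i)))"
   using pos by (simp add: field_simps)
  hence "norm ((real j - real i) / (real n - real i) - real j / real n) = (real i / (real n - real i)) * ((real n - real j) / real n)"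
   using pos assms by (simp add: abs_mult)
  also have "... <= (real k / (real n - real k)) * 1"
   using pos assms i by (intro mult_mono frac_le) auto
  finally show "norm ((real j - real i) / (real n - real i) - real j / real n) <= real k / real (n - k)"
   using assms by (simp add: of_nat_diff)
 qed
 finally show ?thesis unfolding r p by simp
qed

private lemma moment_limit: "(\<lambda>n. \<Sum>j\<le>n. wt n j * (real j / real n) ^ k) ----> c k 0"
proof -
 have "(\<lambda>n. (\<Sum>j\<le>n. wt n j * (real j / real n) ^ k) - c k 0) ----> 0"
 proof (rule Lim_null_comparison)
  show "\<forall>\<^sub>F n in sequentially. norm ((\<Sum>j\<le>n. wt n j * (real j / real n) ^ k) - c k 0) <= c 0 0 * (real k * (real k / (real n - real k)))"
  proof (rule eventually_sequentiallyI[of "2 * k + 1"])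
   fix n assume n: "2 * k + 1 <= n"
   have eq: "(\<Sum>j\<le>n. wt n j * (real j / real n) ^ k) - c k 0
     = (\<Sum>j\<le>n. wt n j * ((real j / real n) ^ k - real (j choose k) / real (n choose k)))"
    using sum_wt_binomial[of k n] n by (simp add: right_diff_distrib sum_subtractf)
   have "norm (\<Sum>j\<le>n. wt n j * ((real j / real n) ^ k - real (j choose k) / real (n choose k)))
     <= (\<Sum>j\<le>n. wt n j * (real k * (real k / real (n - k))))"
   proof (rule sum_norm_le)
    fix j assume "j \<in> {..n}"
    hence "\<bar>(real j / real n) ^ k - real (j choose k) / real (n choose k)\<bar> <= real k * (real k / real (n - k))"
     using ratio_close[of k n j] n by (simp only: abs_minus_commute) auto
    thus "norm (wt n j * ((real j / real n) ^ k - real (j choose k) / real (n choose k))) <= wt n j * (real k * (real k / real (n - k)))"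
     unfolding real_norm_def abs_mult abs_of_nonneg[OF wt_nonneg] by (rule mult_left_mono) (rule wt_nonneg)
   qed
   moreover have "(\<Sum>j\<le>n. wt n j * (real k * (real k / real (n - k)))) = c 0 0 * (real k * (real k / (real n - real k)))"
    using n sum_wt[of n] sum_distrib_right[of "wt n" "{..n}" "real k * (real k / (real n - real k))"]
    by (simp add: of_nat_diff)
   ultimately show "norm ((\<Sum>j\<le>n. wt n j * (real j / real n) ^ k) - c k 0) <= c 0 0 * (real k * (real k / (real n - real k)))"
    unfolding eq by simp
  qed
  show "(\<lambda>n. c 0 0 * (real k * (real k / (real n - real k)))) ----> 0"
   by real_asymp
 qed
 thus ?thesis using LIM_zero_iff by blast
qed

text \<open>Helly selection applied to the laws \<open>\<nu> n\<close>, which live on [0, 1]; the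
  weak limit inherits the moments by \<open>moment_limit\<close>. Clipping by \<open>cl\<close>
  turns powers into bounded continuous test functions on the whole line.\<close>

lemma hausdorff_normalized:
 assumes "c 0 0 = 1"
 shows "\<exists>\<mu>::real measure. finite_measure \<mu> \<and> sets \<mu> = sets borel \<and> (AE t in \<mu>. t \<in> {0..1}) \<and> (\<forall>k. (\<integral>t. t ^ k \<partial>\<mu>) = c k 0)"
proof -
 define \<nu> where "\<nu> n = distr (point_measure {..n} (\<lambda>j. ennreal (wt n j))) borel (\<lambda>j. real j / real n)" for n
 define cl where "cl = (\<lambda>t::real. min 1 (max 0 t))"
 have cl_meas[measurable]: "cl \<in> borel_measurable borel" unfolding cl_def by measurable
 have cl_range: "cl t \<in> {0..1}" for t by (auto simp: cl_def)
 have rd: "real_distribution (\<nu> n)" for n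
 proof -
  have "prob_space (point_measure {..n} (\<lambda>j. ennreal (wt n j)))"
   by (rule prob_spaceI)
    (simp add: emeasure_point_measure_finite space_point_measure sum_ennreal wt_nonneg sum_wt assms)
  then interpret p: prob_space "point_measure {..n} (\<lambda>j. ennreal (wt n j))" .
  show ?thesis unfolding \<nu>_def by (rule p.real_distribution_distr) simp
 qed
 have int: "(\<integral>t. cl t ^ k \<partial>\<nu> n) = (\<Sum>j\<le>n. wt n j * (real j / real n) ^ k)" for n k
 proof -
  have "(\<integral>t. cl t ^ k \<partial>\<nu> n) = (\<integral>j. cl (real j / real n) ^ k \<partial>point_measure {..n} (\<lambda>j. ennreal (wt n j)))"
   unfolding \<nu>_def by (rule integral_distr) auto
  also have "... = (\<Sum>j\<le>n. wt n j * cl (real j / real n) ^ k)"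
   by (subst lebesgue_integral_point_measure_finite) (auto simp: wt_nonneg)
  also have "... = (\<Sum>j\<le>n. wt n j * (real j / real n) ^ k)"
  proof (rule sum.cong[OF refl])
   fix j assume "j \<in> {..n}"
   hence "real j / real n \<in> {0..1}" by (auto simp: divide_le_eq_1)
   hence "cl (real j / real n) = real j / real n" by (auto simp: cl_def)
   thus "wt n j * cl (real j / real n) ^ k = wt n j * (real j / real n) ^ k" by simp
  qed
  finally show ?thesis .
 qed
 have "tight \<nu>"
  unfolding tight_def
 proof (intro conjI allI impI rd)
  fix e :: real assume e: "0 < e"
  \<comment> \<open>The interval is half-open, so it has to start below 0 to contain an atom at
    0.\<close>
  have "measure (\<nu> n) {-1<..1} > 1 - e" for n
  proof -
   interpret real_distribution "\<nu> n" by (rule rd)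
   have "AE t in \<nu> n. t \<in> {-1<..1}"
    unfolding \<nu>_def by (subst AE_distr_iff) (auto simp: AE_point_measure divide_le_eq_1 intro: less_le_trans[of _ 0])
   hence "prob {-1<..1} = 1" by (subst prob_eq_1) auto
   thus ?thesis using e by simp
  qed
  thus "\<exists>a b. a < b \<and> (\<forall>n. measure (\<nu> n) {a<..b} > 1 - e)"
   by (intro exI[of _ "-1"] exI[of _ 1]) auto
 qed
 from tight_imp_convergent_subsubsequence[OF this strict_mono_id]
 obtain r M where r: "strict_mono r" "real_distribution M" "weak_conv_m (\<nu> \<circ> id \<circ> r) M" by blast
 interpret M: real_distribution M by fact
 define \<mu> where "\<mu> = distr M borel cl"
 have "real_distribution \<mu>" unfolding \<mu>_def by (rule M.real_distribution_distr) simp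
 then interpret \<mu>: real_distribution \<mu> .
 have "(\<integral>t. t ^ k \<partial>\<mu>) = c k 0" for k
 proof -
  have "(\<lambda>n. \<integral>t. cl t ^ k \<partial>(\<nu> \<circ> id \<circ> r) n) ----> (\<integral>t. cl t ^ k \<partial>M)"
  proof (rule weak_conv_imp_integral_bdd_continuous_conv[where B = 1])
   show "real_distribution M" by fact
   show "real_distribution ((\<nu> \<circ> id \<circ> r) n)" for n using rd by simp
   show "weak_conv_m (\<nu> \<circ> id \<circ> r) M" by fact
   show "isCont (\<lambda>t. cl t ^ k) x" for x unfolding cl_def by (intro continuous_intros)
   show "norm (cl x ^ k) <= 1" for x using cl_range[of x] by (simp add: power_le_one)
  qed
  moreover have "(\<lambda>n. \<integral>t. cl t ^ k \<partial>(\<nu> \<circ> id \<circ> r) n) ----> c k 0"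
   using LIMSEQ_subseq_LIMSEQ[OF moment_limit r(1), of k] by (simp add: int o_def)
  ultimately have "(\<integral>t. cl t ^ k \<partial>M) = c k 0" by (rule LIMSEQ_unique)
  thus ?thesis unfolding \<mu>_def by (subst integral_distr) auto
 qed
 moreover have "AE t in \<mu>. t \<in> {0..1}"
  unfolding \<mu>_def using cl_range by (subst AE_distr_iff) auto
 ultimately show ?thesis using \<mu>.finite_measure_axioms by (intro exI[of _ \<mu>] conjI allI) auto
qed

end

lemma hausdorff_moment:
 fixes c :: "nat => nat => real"
 assumes c: "\<And>j l. 0 <= c j l" "\<And>j l. c j l = c (Suc j) l + c j (Suc l)"
 shows "\<exists>\<mu>::real measure. finite_measure \<mu> \<and> sets \<mu> = sets borel \<and> (AE t in \<mu>. t \<in> {0..1}) \<and> (\<forall>k. (\<integral>t. t ^ k \<partial>\<mu>) = c k 0)"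
proof (cases "c 0 0 = 0")
 case True
 have "c k 0 <= 0" for k
 proof (induction k)
  case (Suc k)
  thus ?case using c(1)[of k 1] c(2)[of k 0] by simp
 qed (use True in simp)
 hence "c k 0 = 0" for k using c(1)[of k 0] by (simp add: antisym)
 thus ?thesis
  by (intro exI[of _ "null_measure borel"])
   (simp add: finite_measureI AE_I[where N = UNIV])
next
 case False
 hence pos: "0 < c 0 0" using c(1)[of 0 0] by simp
 obtain \<mu> :: "real measure" where \<mu>: "finite_measure \<mu>" "sets \<mu> = sets borel" "AE t in \<mu>. t \<in> {0..1}"
  "\<And>k. (\<integral>t. t ^ k \<partial>\<mu>) = c k 0 / c 0 0"
 proof -
  have 1: "c j l / c 0 0 = c (Suc j) l / c 0 0 + c j (Suc l) / c 0 0" for j l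
   using c(2)[of j l] by (simp add: add_divide_distrib[symmetric])
  have 2: "0 <= c j l / c 0 0" for j l using c(1) pos by simp
  have 3: "c 0 0 / c 0 0 = 1" using pos by simp
  have "\<exists>\<mu>::real measure. finite_measure \<mu> \<and> sets \<mu> = sets borel \<and> (AE t in \<mu>. t \<in> {0..1}) \<and>
    (\<forall>k. (\<integral>t. t ^ k \<partial>\<mu>) = c k 0 / c 0 0)"
   by (rule hausdorff_normalized[OF 2 1 3])
  thus ?thesis using that by blast
 qed
 interpret finite_measure \<mu> by fact
 let ?N = "density \<mu> (\<lambda>_. ennreal (c 0 0))"
 have [measurable_cong]: "sets \<mu> = sets borel" by fact
 have "(\<integral>t. t ^ k \<partial>?N) = c k 0" for k
  using pos \<mu>(4)[of k] by (subst integral_density) auto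
 moreover have "finite_measure ?N"
  by (rule finite_measureI) (auto simp: emeasure_density ennreal_mult_eq_top_iff)
 ultimately show ?thesis using \<mu>(2,3) pos by (intro exI[of _ ?N]) (auto simp: AE_density)
qed

subsection \<open>Determinacy\<close>

text \<open>Boundedness on every \<open>{0..L}\<close> makes the class independent of the operator:
  it contains the identity and is closed under products, while each spectral measure sees only a
  compact interval.\<close>

definition okf :: "(real => real) => bool" where
 "okf f \<longleftrightarrow> f \<in> borel_measurable borel \<and> (\<forall>L. \<exists>K. \<forall>t\<in>{0..L}. \<bar>f t\<bar> <= K)"

lemma okf_measurable: "okf f ==> f \<in> borel_measurable borel"
 by (simp add: okf_def)

lemma okf_bound: assumes "okf f" obtains K where "0 <= K" "\<And>t. 0 <= t ==> t <= L ==> \<bar>f t\<bar> <= K"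
proof -
 obtain K where "\<forall>t\<in>{0..L}. \<bar>f t\<bar> <= K" using assms by (auto simp: okf_def)
 thus ?thesis using that[of "max K 0"] by (auto simp: le_max_iff_disj)
qed

lemma okf_boundedI: "f \<in> borel_measurable borel ==> (\<And>t. 0 <= t ==> \<bar>f t\<bar> <= K) ==> okf f"
 unfolding okf_def by (metis atLeastAtMost_iff)

lemma okf_const [simp]: "okf (\<lambda>_. r)"
 by (auto simp: okf_def)

lemma okf_ident [simp]: "okf (\<lambda>t. t)"
 by (auto simp: okf_def)

lemma okf_add [simp]: assumes "okf f" "okf g" shows "okf (\<lambda>t. f t + g t)"
 unfolding okf_def
proof (intro conjI allI)
 show "(\<lambda>t. f t + g t) \<in> borel_measurable borel" using assms by (auto simp: okf_def intro: borel_measurable_add)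
 fix L
 obtain K where "0 <= K" "\<And>t. 0 <= t ==> t <= L ==> \<bar>f t\<bar> <= K" using okf_bound[OF assms(1)] by blast
 moreover obtain K' where "0 <= K'" "\<And>t. 0 <= t ==> t <= L ==> \<bar>g t\<bar> <= K'" using okf_bound[OF assms(2)] by blast
 ultimately show "\<exists>K. \<forall>t\<in>{0..L}. \<bar>f t + g t\<bar> <= K"
  by (intro exI[of _ "K + K'"]) (auto intro!: order_trans[OF abs_triangle_ineq] add_mono)
qed

lemma okf_mult [simp]: assumes "okf f" "okf g" shows "okf (\<lambda>t. f t * g t)"
 unfolding okf_def
proof (intro conjI allI)
 show "(\<lambda>t. f t * g t) \<in> borel_measurable borel" using assms by (auto simp: okf_def intro: borel_measurable_times)
 fix L
 obtain K where K: "0 <= K" "\<And>t. 0 <= t ==> t <= L ==> \<bar>f t\<bar> <= K" using okf_bound[OF assms(1)] by blast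
 obtain K' where "0 <= K'" "\<And>t. 0 <= t ==> t <= L ==> \<bar>g t\<bar> <= K'" using okf_bound[OF assms(2)] by blast
 with K show "\<exists>K. \<forall>t\<in>{0..L}. \<bar>f t * g t\<bar> <= K"
  by (intro exI[of _ "K * K'"]) (auto simp: abs_mult intro!: mult_mono)
qed

lemma okf_minus [simp]: "okf f ==> okf (\<lambda>t. - f t)"
 using okf_mult[of "\<lambda>_. -1" f] by simp

lemma okf_diff [simp]: "okf f ==> okf g ==> okf (\<lambda>t. f t - g t)"
 using okf_add[of f "\<lambda>t. - g t"] by simp

lemma okf_power [simp]: "okf f ==> okf (\<lambda>t. f t ^ k)"
 by (induction k) auto

lemma okf_indicator [simp]: "B \<in> sets borel ==> okf (indicator B)"
 by (rule okf_boundedI[where K = 1]) (auto simp: indicator_def)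

lemma okf_indicator' [simp]: "B \<in> sets borel ==> okf (\<lambda>t. indicator B t)"
 by (rule okf_boundedI[where K = 1]) (auto simp: indicator_def)

definition cmeas :: "real => real measure => bool" where
 "cmeas L \<mu> \<longleftrightarrow> finite_measure \<mu> \<and> sets \<mu> = sets borel \<and> (AE t in \<mu>. t \<in> {0..L})"

lemma cmeas_integrable:
 assumes "cmeas L \<mu>" "okf f" shows "integrable \<mu> f"
proof -
 interpret finite_measure \<mu> using assms by (simp add: cmeas_def)
 have s[measurable_cong]: "sets \<mu> = sets borel" using assms by (simp add: cmeas_def)
 obtain K where K: "0 <= K" "\<And>t. 0 <= t ==> t <= L ==> \<bar>f t\<bar> <= K" using okf_bound[OF assms(2)] by blast
 show ?thesis
 proof (rule integrable_const_bound[where B = K])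
  show "AE t in \<mu>. norm (f t) <= K" using assms(1) K by (auto simp: cmeas_def)
  show "f \<in> borel_measurable \<mu>" using okf_measurable[OF assms(2)] by measurable
 qed
qed

lemma cmeas_dominated:
 assumes "cmeas L \<mu>" "\<And>n. okf (F n)" "okf f" "\<And>n t. 0 <= t ==> t <= L ==> \<bar>F n t\<bar> <= K"
  "\<And>t. 0 <= t ==> t <= L ==> (\<lambda>n. F n t) ----> f t"
 shows "(\<lambda>n. \<integral>t. F n t \<partial>\<mu>) ----> (\<integral>t. f t \<partial>\<mu>)"
proof -
 interpret finite_measure \<mu> using assms by (simp add: cmeas_def)
 have s[measurable_cong]: "sets \<mu> = sets borel" using assms by (simp add: cmeas_def)
 note [measurable] = okf_measurable[OF assms(2)] okf_measurable[OF assms(3)]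
 show ?thesis
 proof (rule integral_dominated_convergence[where w = "\<lambda>_. K"])
  show "AE t in \<mu>. (\<lambda>n. F n t) ----> f t" using assms(1,5) by (auto simp: cmeas_def)
  show "AE t in \<mu>. norm (F n t) <= K" for n using assms(1,4) by (auto simp: cmeas_def)
 qed auto
qed

context
 fixes L :: real and xs :: "(real \<times> real measure \<times> (real => real)) list"
 assumes xs: "\<And>c \<mu> h. (c, \<mu>, h) \<in> set xs ==> cmeas L \<mu> \<and> okf h"
  and mom: "\<And>k. (\<Sum>(c, \<mu>, h)\<leftarrow>xs. c * (\<integral>t. t ^ k * h t \<partial>\<mu>)) = 0"
begin

private definition "G f = (\<Sum>(c, \<mu>, h)\<leftarrow>xs. c * (\<integral>t. f t * h t \<partial>\<mu>))"

private lemma G_add: assumes "okf f" "okf g" shows "G (\<lambda>t. f t + g t) = G f + G g"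
proof -
 have "G (\<lambda>t. f t + g t) = (\<Sum>(c, \<mu>, h)\<leftarrow>xs. c * (\<integral>t. f t * h t \<partial>\<mu>) + c * (\<integral>t. g t * h t \<partial>\<mu>))"
  unfolding G_def
 proof (rule arg_cong[where f = sum_list], rule map_cong[OF refl])
  fix y assume "y \<in> set xs"
  moreover obtain c \<mu> h where y: "y = (c, \<mu>, h)" by (cases y)
  ultimately have "integrable \<mu> (\<lambda>t. f t * h t)" "integrable \<mu> (\<lambda>t. g t * h t)"
   using xs[of c \<mu> h] assms cmeas_integrable by auto
  thus "(case y of (c, \<mu>, h) => c * (\<integral>t. (f t + g t) * h t \<partial>\<mu>)) =
    (case y of (c, \<mu>, h) => c * (\<integral>t. f t * h t \<partial>\<mu>) + c * (\<integral>t. g t * h t \<partial>\<mu>))"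
   using y by (simp add: distrib_right distrib_left)
 qed
 also have "... = G f + G g" unfolding G_def by (simp add: sum_list_addf case_prod_unfold)
 finally show ?thesis .
qed

private lemma G_scale: "G (\<lambda>t. r * f t) = r * G f"
 unfolding G_def sum_list_const_mult[symmetric]
 by (rule arg_cong[where f = sum_list], rule map_cong[OF refl]) (auto simp: mult.assoc mult.left_commute)

private lemma G_diff: assumes "okf f" "okf g" shows "G (\<lambda>t. f t - g t) = G f - G g"
 using G_add[OF assms(1), of "\<lambda>t. - 1 * g t"] G_scale[of "-1" g] assms by simp

private lemma G_lim:
 assumes "\<And>n. okf (F n)" "okf f" "\<And>n t. 0 <= t ==> t <= L ==> \<bar>F n t\<bar> <= K"
  "\<And>t. 0 <= t ==> t <= L ==> (\<lambda>n. F n t) ----> f t"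
 shows "(\<lambda>n. G (F n)) ----> G f"
proof -
 have "(\<lambda>n. \<Sum>(c, \<mu>, h)\<leftarrow>ys. c * (\<integral>t. F n t * h t \<partial>\<mu>)) ----> (\<Sum>(c, \<mu>, h)\<leftarrow>ys. c * (\<integral>t. f t * h t \<partial>\<mu>))"
  if "set ys \<subseteq> set xs" for ys
  using that
 proof (induction ys)
  case (Cons y ys)
  obtain c \<mu> h where y: "y = (c, \<mu>, h)" by (cases y)
  hence m: "cmeas L \<mu>" "okf h" using xs Cons.prems by auto
  obtain K' where K': "0 <= K'" "\<And>t. 0 <= t ==> t <= L ==> \<bar>h t\<bar> <= K'" using okf_bound[OF m(2)] by blast
  have "(\<lambda>n. \<integral>t. F n t * h t \<partial>\<mu>) ----> (\<integral>t. f t * h t \<partial>\<mu>)"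
  proof (rule cmeas_dominated[OF m(1), where K = "K * K'"])
   fix n t assume t: "0 <= t" "t <= L"
   show "\<bar>F n t * h t\<bar> <= K * K'"
    unfolding abs_mult using t K' assms(3)[OF t, of n] by (intro mult_mono) auto
   show "(\<lambda>n. F n t * h t) ----> f t * h t" by (intro tendsto_intros assms(4) t)
  qed (use assms(1,2) m in auto)
  thus ?case using Cons y by (auto intro!: tendsto_intros)
 qed simp
 from this[OF subset_refl] show ?thesis unfolding G_def .
qed

private lemma G_poly:
 assumes "real_polynomial_function p" shows "G p = 0"
proof -
 obtain a n where p: "p = (\<lambda>t. \<Sum>i\<le>n. a i * t ^ i)"
  using assms real_polynomial_function_iff_sum by auto
 have "okf (\<lambda>t. \<Sum>i\<le>m. a i * t ^ i) \<and> G (\<lambda>t. \<Sum>i\<le>m. a i * t ^ i) = 0" for m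
 proof (induction m)
  case 0
  have "G (\<lambda>t. a 0 * t ^ 0) = a 0 * G (\<lambda>t. t ^ 0)" by (rule G_scale)
  also have "G (\<lambda>t. t ^ 0) = 0" using mom[of 0] by (simp add: G_def)
  finally show ?case by simp
 next
  case (Suc m)
  have "G (\<lambda>t. a (Suc m) * t ^ Suc m) = a (Suc m) * G (\<lambda>t. t ^ Suc m)" by (rule G_scale)
  also have "G (\<lambda>t. t ^ Suc m) = 0" using mom[of "Suc m"] unfolding G_def .
  finally have "G (\<lambda>t. a (Suc m) * t ^ Suc m) = 0" by simp
  thus ?case using Suc G_add[of "\<lambda>t. \<Sum>i\<le>m. a i * t ^ i" "\<lambda>t. a (Suc m) * t ^ Suc m"] by simp
 qed
 thus ?thesis using p by blast
qed

private lemma okf_polyf: assumes "real_polynomial_function p" shows "okf p"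
proof -
 have c: "continuous_on UNIV p"
  using assms continuous_on_polymonial_function real_polynomial_function_eq by blast
 have "\<exists>K. \<forall>t\<in>{0..L'}. \<bar>p t\<bar> <= K" for L'
 proof -
  have "compact (p ` {0..L'})" using c continuous_on_subset by (intro compact_continuous_image) auto
  hence "bounded (p ` {0..L'})" by (rule compact_imp_bounded)
  thus ?thesis by (auto simp: bounded_iff)
 qed
 thus ?thesis using borel_measurable_continuous_onI[OF c] by (simp add: okf_def)
qed

private lemma G_continuous:
 assumes "continuous_on UNIV f" "okf f" shows "G f = 0"
proof -
 have "\<exists>p. real_polynomial_function p \<and> (\<forall>t\<in>{0..L}. \<bar>f t - p t\<bar> < 1 / (real n + 1))" for n
 proof -
  obtain p where "real_polynomial_function p" "\<And>t. t \<in> {0..L} ==> \<bar>f t - p t\<bar> < 1 / (real n + 1)"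
   using Stone_Weierstrass_real_polynomial_function[of "{0..L}" f "1 / (real n + 1)"] assms
   by (metis compact_Icc continuous_on_subset of_nat_0_le_iff subset_UNIV zero_less_divide_1_iff
     add_nonneg_pos zero_less_one)
  thus ?thesis by blast
 qed
 then obtain p where p: "\<And>n. real_polynomial_function (p n)" "\<And>n t. t \<in> {0..L} ==> \<bar>f t - p n t\<bar> < 1 / (real n + 1)"
  by metis
 obtain K where K: "0 <= K" "\<And>t. 0 <= t ==> t <= L ==> \<bar>f t\<bar> <= K" using okf_bound[OF assms(2)] by blast
 have "(\<lambda>n. G (p n)) ----> G f"
 proof (rule G_lim)
  fix n t assume t: "0 <= t" "t <= L"
  have "1 / (real n + 1) <= 1" by simp
  thus "\<bar>p n t\<bar> <= K + 1" using p(2)[of t n] K(2)[OF t] t unfolding atLeastAtMost_iff by linarith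
  show "(\<lambda>n. p n t) ----> f t"
  proof (rule LIM_zero_cancel, rule Lim_null_comparison)
   show "\<forall>\<^sub>F n in sequentially. norm (p n t - f t) <= 1 / (real n + 1)"
    using p(2)[of t] t by (intro always_eventually allI) (simp add: abs_minus_commute less_imp_le)
   show "(\<lambda>n. 1 / (real n + 1)) ----> 0" by real_asymp
  qed
 qed (use p assms okf_polyf in auto)
 thus ?thesis using G_poly[OF p(1)] by (simp add: LIMSEQ_const_iff)
qed

private lemma G_atMost: "G (indicator {..b}) = 0"
proof -
 \<comment> \<open>Continuous functions equal to 1 up to b and falling to 0 within 1 / n; they
   decrease to the indicator.\<close>
 define F where "F n = (\<lambda>t::real. min 1 (max 0 (1 + real n * (b - t))))" for n
 have ok: "okf (F n)" for n unfolding F_def by (rule okf_boundedI[where K = 1]) auto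
 have "(\<lambda>n. G (F n)) ----> G (indicator {..b})"
 proof (rule G_lim[where K = 1])
  fix t :: real
  show "(\<lambda>n. F n t) ----> indicator {..b} t"
  proof (cases "t <= b")
   case True
   hence "F n t = 1" for n by (simp add: F_def)
   thus ?thesis using True by simp
  next
   case False
   obtain N :: nat where N: "1 / (t - b) < real N" using reals_Archimedean2 by blast
   have "F n t = 0" if "n \<ge> N" for n
   proof -
    have "1 / (t - b) < real n" using N that by linarith
    hence "1 < real n * (t - b)" using False by (simp add: field_simps)
    hence "1 + real n * (b - t) < 0" by (simp add: algebra_simps)
    thus ?thesis by (simp add: F_def)
   qed
   hence "(\<lambda>n. F n t) ----> 0" by (intro tendsto_eventually eventually_sequentiallyI)
   thus ?thesis using False by simp
  qed
 qed (use ok in \<open>auto simp: F_def\<close>)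
 moreover have "G (F n) = 0" for n
  by (rule G_continuous[OF _ ok]) (auto simp: F_def intro!: continuous_intros)
 ultimately show ?thesis by (simp add: LIMSEQ_const_iff)
qed

private lemma G_set:
 assumes "B \<in> sets borel" shows "G (indicator B) = 0"
proof -
 have UN: "G (indicator UNIV) = 0"
  using G_continuous[of "\<lambda>_. 1"] by (simp add: indicator_def[abs_def])
 let ?E = "range (\<lambda>a. {..a::real})"
 have "B \<in> sigma_sets UNIV ?E" using assms by (simp add: borel_eq_atMost)
 have Int: "Int_stable ?E" by (auto simp: Int_stable_def)
 have b: "\<And>B. B \<in> sigma_sets UNIV ?E ==> B \<in> sets borel" by (simp add: borel_eq_atMost)
 have "?E \<subseteq> Pow UNIV" by simp
 from Int this \<open>B \<in> sigma_sets UNIV ?E\<close> show ?thesis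
 proof (induction rule: sigma_sets_induct_disjoint)
  case (basic A)
  thus ?case using G_atMost by auto
 next
  case empty
  show ?case using G_scale[of 0 "\<lambda>_. 0"] by (simp add: indicator_def[abs_def])
 next
  case (compl A)
  hence "G (\<lambda>t. indicator UNIV t - indicator A t) = 0 - 0"
   using UN b by (subst G_diff) auto
  moreover have "(\<lambda>t. indicator UNIV t - indicator A t :: real) = indicator (UNIV - A)"
   by (auto simp: indicator_def)
  ultimately show ?case by simp
 next
  case (union A)
  have Ab: "\<And>i. A i \<in> sets borel" using union b by auto
  define F where "F n = (\<lambda>t. \<Sum>i<n. indicator (A i) t :: real)" for n
  have F: "okf (F n) \<and> G (F n) = 0" for n
  proof (induction n)
   case 0
   show ?case using G_scale[of 0 "\<lambda>_. 0"] by (simp add: F_def)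
  next
   case (Suc n)
   thus ?case using G_add[of "F n" "indicator (A n)"] union(3) Ab by (simp add: F_def)
  qed
  have "(\<lambda>n. G (F n)) ----> G (indicator (\<Union>i. A i))"
  proof (rule G_lim[where K = 1])
   fix t
   show "\<bar>F n t\<bar> <= 1" for n
   proof -
    have "F n t = indicator (\<Union>i<n. A i) t"
     unfolding F_def using union(1) by (subst indicator_UN_disjoint) (auto simp: disjoint_family_on_def)
    thus ?thesis by (auto simp: indicator_def)
   qed
   have "(\<lambda>i. indicator (A i) t) sums (indicator (\<Union>i. A i) t :: real)"
    using union(1) by (intro indicator_sums) (auto simp: disjoint_family_on_def)
   thus "(\<lambda>n. F n t) ----> indicator (\<Union>i. A i) t" by (simp add: sums_def F_def)
  qed (use F Ab in auto)
  thus ?case using F by (simp add: LIMSEQ_const_iff)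
 qed
qed

private lemma G_nonneg:
 assumes "f \<in> borel_measurable borel" "\<And>t. 0 <= f t" "okf f" shows "G f = 0"
 using assms
proof (induction rule: borel_measurable_induct_real)
 case (set A)
 thus ?case using G_set by simp
next
 case (mult u r)
 show ?case
 proof (cases "r = 0")
  case True
  thus ?thesis using G_scale[of 0 u] by simp
 next
  case False
  have "okf (\<lambda>t. (1 / r) * (r * u t))" using okf_mult[OF okf_const[of "1 / r"] mult.prems] .
  moreover have "(\<lambda>t. (1 / r) * (r * u t)) = u" using False by auto
  ultimately have "okf u" by simp
  thus ?thesis using mult by (simp add: G_scale)
 qed
next
 case (add u v)
 have "okf u \<and> okf v"
  unfolding okf_def
 proof (intro conjI allI)
  fix L
  obtain K where K: "0 <= K" "\<And>t. 0 <= t ==> t <= L ==> \<bar>v t + u t\<bar> <= K" using okf_bound[OF add.prems] by blast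
  have "\<bar>u t\<bar> <= K \<and> \<bar>v t\<bar> <= K" if "t \<in> {0..L}" for t
   using add(2)[of t] add(4)[of t] K(2)[of t] that by auto
  thus "\<exists>K. \<forall>t\<in>{0..L}. \<bar>u t\<bar> <= K" "\<exists>K. \<forall>t\<in>{0..L}. \<bar>v t\<bar> <= K"
   by blast+
 qed (use add in auto)
 thus ?case using add G_add by simp
next
 case (seq U)
 have le: "U n t <= f t" for n t
  using seq.hyps(3,4) by (intro incseq_le) (auto simp: incseq_def le_fun_def)
 have ok: "okf (U n)" for n
  unfolding okf_def
 proof (intro conjI allI)
  fix L
  obtain K where K: "0 <= K" "\<And>t. 0 <= t ==> t <= L ==> \<bar>f t\<bar> <= K" using okf_bound[OF seq.prems] by blast
  have "\<bar>U n t\<bar> <= K" if "t \<in> {0..L}" for t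
   using le[of n t] seq(2)[of n t] K(2)[of t] that by simp
  thus "\<exists>K. \<forall>t\<in>{0..L}. \<bar>U n t\<bar> <= K" by blast
 qed (use seq in auto)
 obtain K where K: "0 <= K" "\<And>t. 0 <= t ==> t <= L ==> \<bar>f t\<bar> <= K" using okf_bound[OF seq.prems] by blast
 have "(\<lambda>n. G (U n)) ----> G f"
 proof (rule G_lim[where K = K])
  show "\<bar>U n t\<bar> <= K" if "0 <= t" "t <= L" for n t
   using K(2)[OF that] le[of n t] seq(2)[of n t] by simp
 qed (use ok seq in auto)
 thus ?case using seq.IH ok by (simp add: LIMSEQ_const_iff)
qed

text \<open>Weierstrass carries the vanishing of G from polynomials to continuous functions, bounded
  limits to half-lines, the \<pi>-\<lambda> theorem to Borel sets, monotone limits to positive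
  functions. Lists of coefficients, measures and weights are allowed since additivity, homogeneity
  and multiplicativity of the calculus are relations between several measures.\<close>

lemma moment_determinacy:
 assumes "okf f" shows "(\<Sum>(c, \<mu>, h)\<leftarrow>xs. c * (\<integral>t. f t * h t \<partial>\<mu>)) = 0"
proof -
 have m: "f \<in> borel_measurable borel" using assms by (rule okf_measurable)
 have ok: "okf (\<lambda>t. max (f t) 0)" "okf (\<lambda>t. max (- f t) 0)"
  unfolding okf_def
 proof (safe)
  fix L
  obtain K where K: "0 <= K" "\<And>t. 0 <= t ==> t <= L ==> \<bar>f t\<bar> <= K" using okf_bound[OF assms] by blast
  have "\<bar>max (f t) 0\<bar> <= K \<and> \<bar>max (- f t) 0\<bar> <= K" if "t \<in> {0..L}" for t
   using that K(1) K(2)[of t] by (auto simp: abs_if max_def split: if_splits)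
  thus "\<exists>K. \<forall>t\<in>{0..L}. \<bar>max (f t) 0\<bar> <= K" "\<exists>K. \<forall>t\<in>{0..L}. \<bar>max (- f t) 0\<bar> <= K"
   by blast+
 qed (use m in auto)
 have "G (\<lambda>t. max (f t) 0 - max (- f t) 0) = 0"
  using ok m G_nonneg[OF _ _ ok(1)] G_nonneg[OF _ _ ok(2)] by (subst G_diff) auto
 moreover have "(\<lambda>t. max (f t) 0 - max (- f t) 0) = f" by (auto simp: max_def)
 ultimately show ?thesis by (simp add: G_def)
qed

end

section \<open>Borel functional calculus of a bounded positive operator\<close>

primrec bpow :: "('a::real_normed_vector \<Rightarrow>\<^sub>L 'a) => nat => 'a \<Rightarrow>\<^sub>L 'a" where
 "bpow A 0 = id_blinfun"
| "bpow A (Suc k) = A oL bpow A k"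

lemma bpow_commute:
 assumes "\<And>x. A $ B $ x = B $ A $ x" shows "bpow A k $ B $ x = B $ bpow A k $ x"
 by (induction k arbitrary: x) (auto simp: assms)

lemma bpow_commute_self: "bpow A k $ A $ x = A $ bpow A k $ x"
 by (rule bpow_commute) simp

lemma bpow_add: "bpow A (j + k) $ x = bpow A j $ bpow A k $ x"
 by (induction j) auto

lemma bpow_selfadj:
 assumes "selfadj A" shows "bpow A k $ x \<bullet> y = x \<bullet> bpow A k $ y"
 by (induction k arbitrary: x y) (simp_all add: selfadjD[OF assms] bpow_commute_self)

lemma bpow_scaleR: "bpow (r *\<^sub>R A) k $ x = r ^ k *\<^sub>R bpow A k $ x"
 by (induction k) (simp_all add: blinfun.scaleR_left blinfun.scaleR_right)

text \<open>T and S commute, so T^j S^l equals D (T^e S^f) D with D = T^m S^n and e, f at most 1.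
  The only mixed core is T S, and T + S = 1 turns it into T S T + S T S.\<close>

lemma bpow_products_nonneg:
 assumes T: "selfadj T" "\<And>x. 0 <= T $ x \<bullet> x" and S: "selfadj S" "\<And>x. 0 <= S $ x \<bullet> x"
  and sum: "\<And>x. T $ x + S $ x = x"
 shows "0 <= bpow T j $ bpow S l $ x \<bullet> x"
proof -
 have S_eq: "S $ x = x - T $ x" for x using sum[of x] by (simp add: algebra_simps)
 have comm: "T $ S $ x = S $ T $ x" for x by (simp add: S_eq blinfun.diff_right)
 have commp': "bpow S j $ T $ x = T $ bpow S j $ x" for j x by (rule bpow_commute) (simp add: comm)
 have commpp: "bpow T j $ bpow S l $ x = bpow S l $ bpow T j $ x" for j l x
  by (rule bpow_commute) (simp add: commp')
 have TS: "0 <= T $ S $ y \<bullet> y" for y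
 proof -
  have "T $ S $ y = T $ S $ T $ y + T $ S $ S $ y"
   using sum[of y] by (metis blinfun.add_right)
  hence "T $ S $ y \<bullet> y = T $ S $ T $ y \<bullet> y + T $ S $ S $ y \<bullet> y"
   by (metis inner_add_left)
  also have "T $ S $ T $ y \<bullet> y = S $ T $ y \<bullet> T $ y" by (simp add: selfadjD[OF T(1)])
  also have "T $ S $ S $ y \<bullet> y = T $ S $ y \<bullet> S $ y"
   by (simp only: comm selfadjD[OF S(1)])
  finally show ?thesis using T(2)[of "S $ y"] S(2)[of "T $ y"] by simp
 qed
 define D where "D m n = bpow T m $ bpow S n $ x" for m n
 have key: "bpow T (m + (m + e)) $ bpow S (n + (n + f)) $ x \<bullet> x = bpow T e $ bpow S f $ D m n \<bullet> D m n" for m n e f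
 proof -
  have "bpow T (m + (m + e)) $ bpow S (n + (n + f)) $ x = bpow S (n + (n + f)) $ bpow T (m + (e + m)) $ x"
   by (simp only: commpp add.commute[of m e])
  also have "... = bpow S n $ bpow S f $ bpow S n $ bpow T m $ bpow T e $ bpow T m $ x"
   by (simp only: bpow_add[symmetric] add.commute[of n f] add.assoc)
  also have "... = bpow S n $ bpow T m $ bpow T e $ bpow S f $ D m n"
   unfolding D_def by (simp only: commpp)
  finally show ?thesis
   by (simp add: D_def bpow_selfadj[OF S(1), of n] bpow_selfadj[OF T(1), of m])
 qed
 have par: "\<exists>m e. j = m + (m + e) \<and> (e = 0 \<or> e = 1)" for j :: nat by presburger
 obtain m e where m: "j = m + (m + e)" "e = 0 \<or> e = 1" using par by blast
 obtain n f where n: "l = n + (n + f)" "f = 0 \<or> f = 1" using par by blast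
 show ?thesis
  using m(2) n(2) TS T(2) S(2) unfolding m(1) n(1) key by auto
qed

text \<open>For T = a / (|a| + 1) and S = 1 - T, the forms of T^j S^l at x satisfy the conditions of
  the moment problem; the measure on [0, 1] is then stretched back. The added 1 keeps the scale
  positive for a = 0.\<close>

lemma ex_spectral_moment_measure:
 fixes a :: "'a::real_inner \<Rightarrow>\<^sub>L 'a"
 assumes a: "posop a"
 shows "\<exists>\<mu>. cmeas (norm a + 1) \<mu> \<and> (\<forall>k. (\<integral>t. t ^ k \<partial>\<mu>) = bpow a k $ x \<bullet> x)"
proof -
 define L where "L = norm a + 1"
 have L: "0 < L" by (simp add: L_def add_nonneg_pos)
 define T where "T = (1 / L) *\<^sub>R a"
 define S where "S = id_blinfun - T"
 have sa: "selfadj a" using a by (simp add: posop_def)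
 have T: "selfadj T" "\<And>x. 0 <= T $ x \<bullet> x"
  using a L by (auto simp: T_def posop_def selfadj_def blinfun.scaleR_left)
 have S: "selfadj S" using T(1) by (auto simp: S_def selfadj_def blinfun.diff_left inner_diff_left inner_diff_right)
 have S': "0 <= S $ x \<bullet> x" for x
 proof -
  have "a $ x \<bullet> x <= norm (a $ x) * norm x" by (rule norm_cauchy_schwarz)
  also have "... <= (norm a * norm x) * norm x" by (intro mult_right_mono norm_blinfun) simp
  also have "... <= L * (x \<bullet> x)" by (simp add: L_def dot_square_norm power2_eq_square algebra_simps)
  finally have "(1 / L) * (a $ x \<bullet> x) <= x \<bullet> x" using L by (simp add: field_simps)
  thus ?thesis by (simp add: S_def T_def blinfun.diff_left inner_diff_left blinfun.scaleR_left)
 qed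
 have sum: "T $ x + S $ x = x" for x by (simp add: S_def blinfun.diff_left)
 define c where "c j l = bpow T j $ bpow S l $ x \<bullet> x" for j l
 have c_rec: "c j l = c (Suc j) l + c j (Suc l)" for j l
 proof -
  have "bpow T j $ S $ bpow S l $ x = bpow T j $ bpow S l $ x - T $ bpow T j $ bpow S l $ x"
   by (simp add: S_def blinfun.diff_left blinfun.diff_right bpow_commute_self)
  thus ?thesis by (simp add: c_def inner_diff_left)
 qed
 have c_nonneg: "0 <= c j l" for j l
  unfolding c_def by (rule bpow_products_nonneg[OF T S S' sum])
 obtain \<nu> :: "real measure" where \<nu>: "finite_measure \<nu>" "sets \<nu> = sets borel" "AE t in \<nu>. t \<in> {0..1}"
  "\<And>k. (\<integral>t. t ^ k \<partial>\<nu>) = c k 0"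
  using hausdorff_moment[of c, OF c_nonneg c_rec] by blast
 interpret finite_measure \<nu> by fact
 have [measurable_cong]: "sets \<nu> = sets borel" by fact
 define \<mu> where "\<mu> = distr \<nu> borel (\<lambda>t. L * t)"
 have "(\<integral>t. t ^ k \<partial>\<mu>) = bpow a k $ x \<bullet> x" for k
 proof -
  have "(\<integral>t. t ^ k \<partial>\<mu>) = (\<integral>t. (L * t) ^ k \<partial>\<nu>)" unfolding \<mu>_def by (rule integral_distr) auto
  also have "... = L ^ k * c k 0" by (simp add: power_mult_distrib \<nu>(4))
  also have "c k 0 = (1 / L) ^ k * (bpow a k $ x \<bullet> x)" by (simp add: c_def T_def bpow_scaleR)
  finally show ?thesis using L by (simp add: power_one_over)
 qed
 moreover have "finite_measure \<mu>" unfolding \<mu>_def by (rule finite_measure_distr) simp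
 moreover have "AE t in \<mu>. t \<in> {0..L}"
  unfolding \<mu>_def using \<nu>(3) L by (subst AE_distr_iff) (auto elim!: AE_mp simp: mult_left_le)
 moreover have "sets \<mu> = sets borel" by (simp add: \<mu>_def)
 ultimately show ?thesis unfolding cmeas_def L_def by blast
qed

section \<open>Spectral measures of vectors and the operators f(a)\<close>

definition smeas :: "('a::real_inner \<Rightarrow>\<^sub>L 'a) => 'a => real measure" where
 "smeas a x = (SOME \<mu>. cmeas (norm a + 1) \<mu> \<and> (\<forall>k. (\<integral>t. t ^ k \<partial>\<mu>) = bpow a k $ x \<bullet> x))"

lemma
 assumes "posop a"
 shows smeas_cmeas: "cmeas (norm a + 1) (smeas a x)"
  and smeas_moment: "(\<integral>t. t ^ k \<partial>smeas a x) = bpow a k $ x \<bullet> x"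
 using someI_ex[OF ex_spectral_moment_measure[OF assms, of x]] by (auto simp: smeas_def)

text \<open>Polarization of the integrals of f. The measures are chosen vector by vector, so
  bilinearity of the polarized form is not built in; it comes from determinacy of moments.\<close>

definition fc :: "('a::{real_inner,complete_space} \<Rightarrow>\<^sub>L 'a) => (real => real) => 'a \<Rightarrow>\<^sub>L 'a" where
 "fc a f = (SOME A. \<forall>x y. x \<bullet> A $ y = ((\<integral>t. f t \<partial>smeas a (x + y)) - (\<integral>t. f t \<partial>smeas a (x - y))) / 4)"

context
 fixes a :: "'a::{real_inner,complete_space} \<Rightarrow>\<^sub>L 'a"
 assumes a: "posop a"
begin

private lemma sa: "selfadj a"
 using a by (simp add: posop_def)

private lemma bp: "bpow a k $ x \<bullet> y = bpow a k $ y \<bullet> x"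
 using bpow_selfadj[OF sa, where k = k and x = x and y = y] by (simp add: inner_commute)

lemma smeas_integrable: "okf f ==> integrable (smeas a x) f"
 using cmeas_integrable smeas_cmeas[OF a] by blast

text \<open>Determinacy makes relations between powers of a persist for all \<open>okf\<close>
  functions. The rules of the calculus are instances, with nonconstant weights h for
  products.\<close>

lemma smeas_identity:
 assumes "\<And>k. (\<Sum>(c, v, h)\<leftarrow>xs. c * (\<integral>t. t ^ k * h t \<partial>smeas a v)) = 0"
  "\<And>c v h. (c, v, h) \<in> set xs ==> okf h" "okf f"
 shows "(\<Sum>(c, v, h)\<leftarrow>xs. c * (\<integral>t. f t * h t \<partial>smeas a v)) = 0"
proof -
 let ?ys = "map (\<lambda>(c, v, h). (c, smeas a v, h)) xs"
 have e: "(\<Sum>(c, \<mu>, h)\<leftarrow>?ys. c * (\<integral>t. g t * h t \<partial>\<mu>)) = (\<Sum>(c, v, h)\<leftarrow>xs. c * (\<integral>t. g t * h t \<partial>smeas a v))" for g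
  by (simp add: comp_def case_prod_unfold)
 have "(\<Sum>(c, \<mu>, h)\<leftarrow>?ys. c * (\<integral>t. f t * h t \<partial>\<mu>)) = 0"
 proof (rule moment_determinacy[OF _ _ assms(3)])
  show "cmeas (norm a + 1) \<mu> \<and> okf h" if "(c, \<mu>, h) \<in> set ?ys" for c \<mu> h
   using that assms(2) smeas_cmeas[OF a] by auto
  show "(\<Sum>(c, \<mu>, h)\<leftarrow>?ys. c * (\<integral>t. t ^ k * h t \<partial>\<mu>)) = 0" for k
   using assms(1)[of k] unfolding e .
 qed
 thus ?thesis unfolding e .
qed

private definition "fb f x y = ((\<integral>t. f t \<partial>smeas a (x + y)) - (\<integral>t. f t \<partial>smeas a (x - y))) / 4"

private lemma moment_diff: "(\<integral>t. t ^ k \<partial>smeas a (x + y)) - (\<integral>t. t ^ k \<partial>smeas a (x - y)) = 4 * (bpow a k $ x \<bullet> y)"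
 by (simp add: smeas_moment[OF a] blinfun.add_right blinfun.diff_right inner_add_left inner_add_right
   inner_diff_left inner_diff_right bp[where k = k and x = y and y = x])

private lemma fb_bound:
 assumes "okf f" and K: "0 <= K" "\<And>t. 0 <= t ==> t <= norm a + 1 ==> \<bar>f t\<bar> <= K"
 shows "\<bar>\<integral>t. f t \<partial>smeas a x\<bar> <= K * (norm x)^2"
proof -
 have s: "sets (smeas a x) = sets borel" "AE t in smeas a x. t \<in> {0..norm a + 1}"
  using smeas_cmeas[OF a, of x] by (auto simp: cmeas_def)
 interpret finite_measure "smeas a x" using smeas_cmeas[OF a, of x] by (simp add: cmeas_def)
 have i: "integrable (smeas a x) f" by (rule smeas_integrable[OF assms(1)])
 have "\<bar>\<integral>t. f t \<partial>smeas a x\<bar> <= (\<integral>t. \<bar>f t\<bar> \<partial>smeas a x)" by (rule integral_abs_bound)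
 also have "... <= (\<integral>t. K \<partial>smeas a x)"
  using i s(2) K by (intro integral_mono_AE) auto
 also have "... = K * (\<integral>t. t ^ 0 \<partial>smeas a x)" by simp
 also have "... = K * (norm x)^2" by (subst smeas_moment[OF a]) (simp add: power2_norm_eq_inner)
 finally show ?thesis .
qed

private lemma fb_sym: assumes f: "okf f" shows "fb f x y = fb f y x"
proof -
 have m: "(\<Sum>(c, v, h)\<leftarrow>[(1, x - y, \<lambda>_. 1), (-1, y - x, \<lambda>_. 1)]. c * (\<integral>t. t ^ k * h t \<partial>smeas a v)) = 0" for k
  by (simp add: smeas_moment[OF a] blinfun.diff_right inner_diff_left inner_diff_right)
 have "(\<Sum>(c, v, h)\<leftarrow>[(1, x - y, \<lambda>_. 1), (-1, y - x, \<lambda>_. 1)]. c * (\<integral>t. f t * h t \<partial>smeas a v)) = 0"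
  by (rule smeas_identity[OF m _ f]) auto
 thus ?thesis by (simp add: fb_def add.commute)
qed

private lemma fb_bilinear: assumes f: "okf f" shows "bounded_bilinear (fb f)"
proof -
 have add: "fb f (x + x') y = fb f x y + fb f x' y" for x x' y
 proof -
  let ?xs = "[(1, x + x' + y, \<lambda>_. 1), (-1, x + x' - y, \<lambda>_. 1), (-1, x + y, \<lambda>_. 1), (1, x - y, \<lambda>_. 1),
    (-1, x' + y, \<lambda>_. 1), (1, x' - y, \<lambda>_. 1)]"
  have m: "(\<Sum>(c, v, h)\<leftarrow>?xs. c * (\<integral>t. t ^ k * h t \<partial>smeas a v)) = 0" for k
   using moment_diff[where k = k and x = "x + x'" and y = y] moment_diff[where k = k and x = x and y = y] moment_diff[where k = k and x = x' and y = y]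
   by (simp add: blinfun.add_right inner_add_left)
  have "(\<Sum>(c, v, h)\<leftarrow>?xs. c * (\<integral>t. f t * h t \<partial>smeas a v)) = 0"
   by (rule smeas_identity[OF m _ f]) auto
  thus ?thesis by (simp add: fb_def field_simps)
 qed
 have scale: "fb f (r *\<^sub>R x) y = r * fb f x y" for r x y
 proof -
  let ?xs = "[(1, r *\<^sub>R x + y, \<lambda>_. 1), (-1, r *\<^sub>R x - y, \<lambda>_. 1), (-r, x + y, \<lambda>_. 1), (r, x - y, \<lambda>_. 1)]"
  have m: "(\<Sum>(c, v, h)\<leftarrow>?xs. c * (\<integral>t. t ^ k * h t \<partial>smeas a v)) = 0" for k
   using moment_diff[where k = k and x = "r *\<^sub>R x" and y = y] arg_cong[OF moment_diff[where k = k and x = x and y = y], of "\<lambda>z. r * z"]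
   by (simp add: blinfun.scaleR_right algebra_simps)
  have "(\<Sum>(c, v, h)\<leftarrow>?xs. c * (\<integral>t. f t * h t \<partial>smeas a v)) = 0"
   by (rule smeas_identity[OF m _ f]) auto
  thus ?thesis by (simp add: fb_def field_simps)
 qed
 note sym = fb_sym[OF f]
 have scale': "fb f x (r *\<^sub>R y) = r * fb f x y" for r x y
  using scale[of r y x] sym by metis
 have add': "fb f x (y + y') = fb f x y + fb f x y'" for x y y'
  using add[of y y' x] sym by metis
 obtain K where K: "0 <= K" "\<And>t. 0 <= t ==> t <= norm a + 1 ==> \<bar>f t\<bar> <= K" using okf_bound[OF f] by blast
 have bd: "\<bar>fb f x y\<bar> <= K / 2 * ((norm x)^2 + (norm y)^2)" for x y
 proof -
  have "\<bar>fb f x y\<bar> <= (K * (norm (x + y))^2 + K * (norm (x - y))^2) / 4"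
   using fb_bound[OF f K, of "x + y"] fb_bound[OF f K, of "x - y"] by (simp add: fb_def)
  also have "(norm (x + y))^2 = (norm x)^2 + 2 * (x \<bullet> y) + (norm y)^2"
   by (simp add: power2_norm_eq_inner inner_add_left inner_add_right inner_commute)
  also have "(norm (x - y))^2 = (norm x)^2 - 2 * (x \<bullet> y) + (norm y)^2"
   by (simp add: power2_norm_eq_inner inner_diff_left inner_diff_right inner_commute)
  finally show ?thesis by (simp add: algebra_simps)
 qed
 have "norm (fb f x y) <= norm x * norm y * K" for x y
 proof (cases "x = 0 \<or> y = 0")
  case True
  hence "fb f x y = 0" using scale[of 0 0 y] scale'[of x 0 0] by auto
  thus ?thesis using K by simp
 next
  case False
  \<comment> \<open>Unit vectors turn the bound by the sum of the squared norms into a bound by the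
    product of the norms.\<close>
  define b where "b = fb f ((1 / norm x) *\<^sub>R x) ((1 / norm y) *\<^sub>R y)"
  have "fb f x y = norm x * norm y * b"
   using False by (simp add: b_def scale scale')
  moreover have "\<bar>b\<bar> <= K"
   using bd[of "(1 / norm x) *\<^sub>R x" "(1 / norm y) *\<^sub>R y"] False by (simp add: b_def)
  ultimately show ?thesis by (simp add: abs_mult mult_left_mono)
 qed
 thus ?thesis
  by (intro bounded_bilinear.intro) (auto simp: add add' scale scale')
qed

private lemma fc_fb: assumes "okf f" shows "x \<bullet> fc a f $ y = fb f x y"
 using someI_ex[OF ex_operator_of_form[OF fb_bilinear[OF assms]]] unfolding fc_def fb_def by blast

lemma fc_selfadj: assumes f: "okf f" shows "selfadj (fc a f)"
 unfolding selfadj_def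
proof safe
 fix x y
 show "fc a f $ x \<bullet> y = x \<bullet> fc a f $ y"
  using fc_fb[OF f, of x y] fc_fb[OF f, of y x] fb_sym[OF f, of x y] by (simp add: inner_commute)
qed

private lemma fc_form:
 assumes "okf g"
 shows "4 * (fc a g $ x \<bullet> y) = (\<integral>t. g t \<partial>smeas a (x + y)) - (\<integral>t. g t \<partial>smeas a (x - y))"
 using fc_fb[OF assms, of x y] selfadjD[OF fc_selfadj[OF assms], of x y] by (simp add: fb_def)

lemma fc_inner: assumes f: "okf f" shows "fc a f $ x \<bullet> x = (\<integral>t. f t \<partial>smeas a x)"
proof -
 let ?xs = "[(1, x + x, \<lambda>_. 1), (-1, x - x, \<lambda>_. 1), (-4, x, \<lambda>_. 1)]"
 have m: "(\<Sum>(c, v, h)\<leftarrow>?xs. c * (\<integral>t. t ^ k * h t \<partial>smeas a v)) = 0" for k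
  using moment_diff[where k = k and x = x and y = x] smeas_moment[OF a, where k = k and x = x] by simp
 have "(\<Sum>(c, v, h)\<leftarrow>?xs. c * (\<integral>t. f t * h t \<partial>smeas a v)) = 0"
  by (rule smeas_identity[OF m _ f]) auto
 thus ?thesis using fc_form[OF f, of x x] by simp
qed

text \<open>Polarized form of \<open>smeas_identity\<close>. With a weight h one factor is absorbed
  into the function, which is the mechanism of \<open>fc_mult\<close>; with h = 1 matrix elements of
  f(a) are compared.\<close>

lemma fc_transfer_weight:
 assumes h: "okf h" and f: "okf f"
  and m: "\<And>k. bpow a k $ x' \<bullet> y' = fc a (\<lambda>t. t ^ k * h t) $ x \<bullet> y"
 shows "fc a f $ x' \<bullet> y' = fc a (\<lambda>t. f t * h t) $ x \<bullet> y"
proof -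
 let ?xs = "[(1, x' + y', \<lambda>_. 1), (-1, x' - y', \<lambda>_. 1), (-1, x + y, h), (1, x - y, h)]"
 have id: "(\<Sum>(c, v, h)\<leftarrow>?xs. c * (\<integral>t. t ^ k * h t \<partial>smeas a v)) = 0" for k
  using moment_diff[where k = k and x = x' and y = y'] fc_form[of "\<lambda>t. t ^ k * h t" x y] m[of k] h by simp
 have "(\<Sum>(c, v, h)\<leftarrow>?xs. c * (\<integral>t. f t * h t \<partial>smeas a v)) = 0"
  by (rule smeas_identity[OF id _ f]) (use h in auto)
 thus ?thesis using fc_form[of "\<lambda>t. f t * h t" x y] fc_form[OF f, of x' y'] h f by simp
qed

lemma fc_power: "fc a (\<lambda>t. t ^ k) = bpow a k"
proof (rule blinfun_eqI)
 fix x
 have "fc a (\<lambda>t. t ^ k) $ x \<bullet> y = bpow a k $ x \<bullet> y" for y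
  using moment_diff[where k = k and x = x and y = y] fc_form[of "\<lambda>t. t ^ k" x y] by simp
 thus "fc a (\<lambda>t. t ^ k) $ x = bpow a k $ x" by (metis vector_eq_rdot)
qed

lemma fc_transfer:
 assumes "okf f" "\<And>k. bpow a k $ x' \<bullet> y' = bpow a k $ x \<bullet> y"
 shows "fc a f $ x' \<bullet> y' = fc a f $ x \<bullet> y"
 using fc_transfer_weight[of "\<lambda>_. 1" f x' y' x y] assms by (simp add: fc_power)

lemma fc_one [simp]: "fc a (\<lambda>_. 1) = id_blinfun"
 using fc_power[of 0] by simp

lemma fc_ident [simp]: "fc a (\<lambda>t. t) = a"
proof -
 have "fc a (\<lambda>t. t) = bpow a 1" using fc_power[of 1] by simp
 thus ?thesis by (simp add: blinfun_eqI)
qed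

private lemma fc_eqI:
 assumes "okf g" "\<And>x y. (\<integral>t. g t \<partial>smeas a (x + y)) - (\<integral>t. g t \<partial>smeas a (x - y)) = 4 * (A $ x \<bullet> y)"
 shows "fc a g = A"
proof (rule blinfun_eqI)
 fix x
 have "fc a g $ x \<bullet> y = A $ x \<bullet> y" for y
  using fc_form[OF assms(1), of x y] assms(2)[of x y] by simp
 thus "fc a g $ x = A $ x" by (metis vector_eq_rdot)
qed

lemma fc_add: assumes "okf f" "okf g" shows "fc a (\<lambda>t. f t + g t) = fc a f + fc a g"
proof (rule fc_eqI)
 fix x y
 show "(\<integral>t. f t + g t \<partial>smeas a (x + y)) - (\<integral>t. f t + g t \<partial>smeas a (x - y)) = 4 * ((fc a f + fc a g) $ x \<bullet> y)"
  using fc_form[OF assms(1), of x y] fc_form[OF assms(2), of x y] assms smeas_integrable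
  by (simp add: blinfun.add_left inner_add_left)
qed (use assms in simp)

lemma fc_scale: assumes "okf f" shows "fc a (\<lambda>t. r * f t) = r *\<^sub>R fc a f"
proof (rule fc_eqI)
 fix x y
 show "(\<integral>t. r * f t \<partial>smeas a (x + y)) - (\<integral>t. r * f t \<partial>smeas a (x - y)) = 4 * ((r *\<^sub>R fc a f) $ x \<bullet> y)"
  using arg_cong[OF fc_form[OF assms, of x y], of "\<lambda>z. r * z"]
  by (simp add: blinfun.scaleR_left right_diff_distrib)
qed (use assms in simp)

lemma fc_diff: assumes "okf f" "okf g" shows "fc a (\<lambda>t. f t - g t) = fc a f - fc a g"
proof (rule fc_eqI)
 fix x y
 show "(\<integral>t. f t - g t \<partial>smeas a (x + y)) - (\<integral>t. f t - g t \<partial>smeas a (x - y)) = 4 * ((fc a f - fc a g) $ x \<bullet> y)"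
  using fc_form[OF assms(1), of x y] fc_form[OF assms(2), of x y] assms smeas_integrable
  by (simp add: blinfun.diff_left inner_diff_left)
qed (use assms in simp)

lemma fc_const [simp]: "fc a (\<lambda>_. r) = r *\<^sub>R id_blinfun"
 using fc_scale[of "\<lambda>_. 1" r] by simp

text \<open>Transfer with weight t absorbs one factor a, induction absorbs a^k, and transfer with
  weight f then passes from a^k to g(a).\<close>

lemma fc_mult: assumes f: "okf f" and g: "okf g" shows "fc a (\<lambda>t. f t * g t) = fc a f oL fc a g"
proof -
 have one: "fc a f $ a $ x \<bullet> y = fc a (\<lambda>t. f t * t) $ x \<bullet> y" if "okf f" for f x y
 proof (rule fc_transfer_weight[OF okf_ident that])
  fix k
  have "(\<lambda>t::real. t ^ k * t) = (\<lambda>t. t ^ Suc k)" by (simp add: mult.commute)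
  thus "bpow a k $ a $ x \<bullet> y = fc a (\<lambda>t. t ^ k * t) $ x \<bullet> y"
   by (simp only: fc_power) (simp add: bpow_commute_self)
 qed
 have pow: "fc a f $ bpow a k $ x \<bullet> y = fc a (\<lambda>t. f t * t ^ k) $ x \<bullet> y" if "okf f" for f k x y
  using that
 proof (induction k arbitrary: f)
  case (Suc k)
  have "fc a f $ bpow a (Suc k) $ x \<bullet> y = fc a (\<lambda>t. f t * t) $ bpow a k $ x \<bullet> y"
   using one[OF Suc.prems] by simp
  also have "... = fc a (\<lambda>t. f t * t * t ^ k) $ x \<bullet> y" using Suc by (intro Suc.IH) auto
  finally show ?case by (simp add: mult.assoc)
 qed simp
 have "fc a g $ x \<bullet> fc a f $ y = fc a (\<lambda>t. g t * f t) $ x \<bullet> y" for x y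
 proof (rule fc_transfer_weight[OF f g])
  fix k
  have "bpow a k $ x \<bullet> fc a f $ y = fc a f $ bpow a k $ x \<bullet> y"
   using selfadjD[OF fc_selfadj[OF f]] by simp
  also have "... = fc a (\<lambda>t. f t * t ^ k) $ x \<bullet> y" by (rule pow[OF f])
  finally show "bpow a k $ x \<bullet> fc a f $ y = fc a (\<lambda>t. t ^ k * f t) $ x \<bullet> y" by (simp add: mult.commute)
 qed
 hence *: "fc a f $ fc a g $ x \<bullet> y = fc a (\<lambda>t. f t * g t) $ x \<bullet> y" for x y
  using selfadjD[OF fc_selfadj[OF f]] by (simp add: mult.commute)
 show ?thesis
 proof (rule blinfun_eqI)
  fix x
  show "fc a (\<lambda>t. f t * g t) $ x = (fc a f oL fc a g) $ x"
   using *[of x] by (metis blinfun_apply_blinfun_compose vector_eq_rdot)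
 qed
qed

lemma fc_mult_apply: "okf f ==> okf g ==> fc a f $ fc a g $ x = fc a (\<lambda>t. f t * g t) $ x"
 by (simp add: fc_mult)

text \<open>Moving B across the inner product equates matrix elements of all powers of a, and this
  equality transfers to f.\<close>

lemma fc_commute:
 assumes "okf f" "\<And>x. B $ a $ x = a $ B $ x"
 shows "fc a f $ B $ x = B $ fc a f $ x"
proof -
 have "fc a f $ B $ x \<bullet> y = fc a f $ x \<bullet> adj B $ y" for y
 proof (rule fc_transfer[OF assms(1)])
  fix k
  have "bpow a k $ B $ x = B $ bpow a k $ x" by (rule bpow_commute) (simp add: assms(2))
  thus "bpow a k $ B $ x \<bullet> y = bpow a k $ x \<bullet> adj B $ y" by (simp add: adj)
 qed
 hence "fc a f $ B $ x \<bullet> y = B $ fc a f $ x \<bullet> y" for y by (simp add: adj)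
 thus ?thesis by (metis vector_eq_rdot)
qed

lemma norm_fc_squared: assumes "okf f" shows "(norm (fc a f $ x))^2 = (\<integral>t. (f t)^2 \<partial>smeas a x)"
proof -
 have "(norm (fc a f $ x))^2 = fc a f $ fc a f $ x \<bullet> x"
  using selfadjD[OF fc_selfadj[OF assms]] by (simp add: power2_norm_eq_inner)
 thus ?thesis using assms by (simp add: fc_mult_apply fc_inner power2_eq_square)
qed

lemma fc_cong:
 assumes f: "okf f" and g: "okf g" and eq: "\<And>t. 0 <= t ==> t <= norm a + 1 ==> f t = g t"
 shows "fc a f = fc a g"
proof -
 have "fc a (\<lambda>t. f t - g t) $ x = 0" for x
 proof -
  have s: "AE t in smeas a x. t \<in> {0..norm a + 1}"
   using smeas_cmeas[OF a, of x] by (auto simp: cmeas_def)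
  have "(norm (fc a (\<lambda>t. f t - g t) $ x))^2 = (\<integral>t. (f t - g t)^2 \<partial>smeas a x)"
   using f g by (simp add: norm_fc_squared)
  also have "... = 0" by (rule integral_eq_zero_AE) (use s eq in auto)
  finally show ?thesis by simp
 qed
 hence "fc a f $ x = fc a g $ x" for x using f g by (simp add: fc_diff blinfun.diff_left)
 thus ?thesis by (rule blinfun_eqI)
qed

lemma fc_nonneg:
 assumes f: "okf f" and "\<And>t. 0 <= t ==> t <= norm a + 1 ==> 0 <= f t" shows "0 <= fc a f $ x \<bullet> x"
proof -
 have s: "AE t in smeas a x. t \<in> {0..norm a + 1}"
  using smeas_cmeas[OF a, of x] by (auto simp: cmeas_def)
 show ?thesis unfolding fc_inner[OF f] using s assms(2) by (intro integral_nonneg_AE) auto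
qed

lemma posop_fc: "okf f ==> (\<And>t. 0 <= t ==> t <= norm a + 1 ==> 0 <= f t) ==> posop (fc a f)"
 by (simp add: posop_def fc_selfadj fc_nonneg)

lemma fc_mono:
 assumes f: "okf f" "okf g" and "\<And>t. 0 <= t ==> t <= norm a + 1 ==> f t <= g t" shows "fc a f $ x \<bullet> x <= fc a g $ x \<bullet> x"
 using fc_nonneg[of "\<lambda>t. g t - f t" x] assms by (simp add: fc_diff blinfun.diff_left inner_diff_left)

lemma norm_fc_le:
 assumes f: "okf f" and K: "0 <= K" "\<And>t. 0 <= t ==> t <= norm a + 1 ==> \<bar>f t\<bar> <= K"
 shows "norm (fc a f $ x) <= K * norm x"
proof -
 have "fc a (\<lambda>t. f t * f t) $ x \<bullet> x <= fc a (\<lambda>_. K^2) $ x \<bullet> x"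
 proof (rule fc_mono)
  fix t assume "0 <= t" "t <= norm a + 1"
  hence "\<bar>f t\<bar> <= \<bar>K\<bar>" using K by auto
  thus "f t * f t <= K^2" by (metis abs_le_square_iff power2_eq_square)
 qed (use f in auto)
 moreover have "fc a (\<lambda>t. f t * f t) $ x \<bullet> x = (norm (fc a f $ x))^2"
  using f selfadjD[OF fc_selfadj[OF f]] by (simp add: fc_mult power2_norm_eq_inner)
 moreover have "fc a (\<lambda>_. K^2) $ x \<bullet> x = (K * norm x)^2"
  by (simp add: blinfun.scaleR_left power_mult_distrib power2_norm_eq_inner)
 ultimately have "(norm (fc a f $ x))^2 <= (K * norm x)^2" by simp
 thus ?thesis by (rule power2_le_imp_le) (simp add: K(1))
qed

text \<open>The squared distance at x is the integral of (F n - f)^2 against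
  \<open>smeas a x\<close>, to which dominated convergence applies.\<close>

lemma fc_tendsto:
 assumes F: "\<And>n. okf (F n)" "okf f" "\<And>n t. 0 <= t ==> t <= norm a + 1 ==> \<bar>F n t\<bar> <= K"
  "\<And>t. 0 <= t ==> t <= norm a + 1 ==> (\<lambda>n. F n t) ----> f t"
 shows "(\<lambda>n. fc a (F n) $ x) ----> fc a f $ x"
proof -
 obtain K' where K': "0 <= K'" "\<And>t. 0 <= t ==> t <= norm a + 1 ==> \<bar>f t\<bar> <= K'" using okf_bound[OF F(2)] by blast
 have "(\<lambda>n. \<integral>t. (F n t - f t)^2 \<partial>smeas a x) ----> (\<integral>t. 0 \<partial>smeas a x)"
 proof (rule cmeas_dominated[OF smeas_cmeas[OF a], where K = "(K + K')^2"])
  fix n t assume t: "0 <= t" "t <= norm a + 1"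
  have "\<bar>F n t - f t\<bar> <= \<bar>K + K'\<bar>" using F(3)[OF t, of n] K'(2)[OF t] by linarith
  thus "\<bar>(F n t - f t)^2\<bar> <= (K + K')^2" by (simp add: abs_le_square_iff)
  show "(\<lambda>n. (F n t - f t)^2) ----> 0"
   using tendsto_power[OF LIM_zero[OF F(4)[OF t]], of 2] by simp
 qed (use F in auto)
 moreover have "(norm (fc a (F n) $ x - fc a f $ x))^2 = (\<integral>t. (F n t - f t)^2 \<partial>smeas a x)" for n
  using norm_fc_squared[OF okf_diff[OF F(1)[of n] F(2)], of x] fc_diff[OF F(1)[of n] F(2)]
  by (simp add: blinfun.diff_left)
 ultimately have "(\<lambda>n. (norm (fc a (F n) $ x - fc a f $ x))^2) ----> 0" by simp
 hence "(\<lambda>n. norm (fc a (F n) $ x - fc a f $ x)) ----> 0"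
 proof -
  assume "(\<lambda>n. (norm (fc a (F n) $ x - fc a f $ x))^2) ----> 0"
  from tendsto_real_sqrt[OF this] show ?thesis
   unfolding real_sqrt_abs abs_norm_cancel real_sqrt_zero .
 qed
 hence "(\<lambda>n. fc a (F n) $ x - fc a f $ x) ----> 0" by (rule tendsto_norm_zero_cancel)
 thus ?thesis by (rule LIM_zero_cancel)
qed

end

section \<open>The modulus of a closed operator\<close>

text \<open>Bounded monotone norms converge, and by the Pythagorean identity their squares control
  the distances. Serves for truncations of |x| and for monotone sequences of projections.\<close>

lemma pythagorean_Cauchy:
 fixes f :: "nat => 'a::real_normed_vector"
 assumes d: "\<And>m n. n <= m ==> (norm (f m - f n))^2 = \<bar>(norm (f m))^2 - (norm (f n))^2\<bar>"
  and mono: "monoseq (\<lambda>n. norm (f n))" and bd: "\<And>n. norm (f n) <= K"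
 shows "Cauchy f"
proof -
 define w where "w n = (norm (f n))^2" for n
 have "Bseq (\<lambda>n. norm (f n))" using bd by (intro BseqI'[of _ K]) simp
 hence "convergent (\<lambda>n. norm (f n))" using mono by (rule Bseq_monoseq_convergent)
 hence "convergent w" unfolding w_def by (auto simp: convergent_def intro: tendsto_power)
 hence "Cauchy w" by (rule convergent_Cauchy)
 show ?thesis
 proof (rule CauchyI)
  fix e :: real assume e: "0 < e"
  then obtain N where N: "\<And>m n. m \<ge> N ==> n \<ge> N ==> norm (w m - w n) < e^2"
   using CauchyD[OF \<open>Cauchy w\<close>, of "e^2"] by auto
  have *: "norm (f m - f n) < e" if "N <= n" "n <= m" for m n
  proof -
   have "(norm (f m - f n))^2 < e^2" using d[OF that(2)] N[of m n] that by (simp add: w_def)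
   thus ?thesis using e by (simp add: power2_less_imp_less)
  qed
  show "\<exists>M. \<forall>m\<ge>M. \<forall>n\<ge>M. norm (f m - f n) < e"
   using * by (intro exI[of _ N]) (metis nat_le_linear norm_minus_commute)
 qed
qed

text \<open>The real-linear content of \<open>closed_densely_defined\<close>; complex linearity is
  kept apart as invariance under multiplication by \<i>.\<close>

definition rop :: "('a::real_normed_vector \<times> 'a) set => bool" where
 "rop x \<longleftrightarrow> subspace x \<and> closed x \<and> single_valued x \<and> closure (Domain x) = UNIV"

definition radj :: "('a::real_inner \<times> 'a) set => ('a \<times> 'a) set" where
 "radj x = {(eta, zeta). \<forall>(xi, xi')\<in>x. xi' \<bullet> eta = xi \<bullet> zeta}"

lemma radjD: "(eta, zeta) \<in> radj x ==> (xi, xi') \<in> x ==> xi' \<bullet> eta = xi \<bullet> zeta"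
 by (auto simp: radj_def)

lemma radjI: "(\<And>xi xi'. (xi, xi') \<in> x ==> xi' \<bullet> eta = xi \<bullet> zeta) ==> (eta, zeta) \<in> radj x"
 by (auto simp: radj_def)

lemma closed_radj: "closed (radj x)"
proof -
 have "radj x = (\<Inter>(xi, xi')\<in>x. {p. xi' \<bullet> fst p = xi \<bullet> snd p})"
  by (auto simp: radj_def)
 moreover have "closed {p. xi' \<bullet> fst p = xi \<bullet> snd p}" for xi xi' :: 'a
  by (intro closed_Collect_eq continuous_intros)
 ultimately show ?thesis by (auto intro!: closed_INT)
qed

lemma orthogonal_dense_zero:
 fixes y :: "'a::real_inner"
 assumes "closure D = UNIV" "\<And>z. z \<in> D ==> z \<bullet> y = 0" shows "y = 0"
proof -
 have "closed {z. z \<bullet> y = 0}" by (intro closed_Collect_eq continuous_intros)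
 hence "closure D \<subseteq> {z. z \<bullet> y = 0}" using assms(2) by (intro closure_minimal) auto
 hence "y \<bullet> y = 0" using assms(1) by blast
 thus ?thesis by simp
qed

text \<open>\<open>opT x\<close> is \<open>1 / (1 + x\<^sup>*x)\<close>, read off from the orthogonal projection onto the graph.  Since
 \<open>|x| = sg (opT x)\<close>, \<open>specF (opT x)\<close> is the spectral measure of \<open>|x|\<close> and \<open>absT (opT x)\<close> is \<open>|x|\<close>.\<close>

definition opT :: "('a::{real_inner,complete_space} \<times> 'a) set => 'a \<Rightarrow>\<^sub>L 'a" where
 "opT x = fst_blinfun oL oproj x oL Blinfun (\<lambda>xi. (xi, 0))"

lemma opT_apply: "opT x $ om = fst (oproj x $ (om, 0))"
proof -
 have "bounded_linear (\<lambda>xi::'a. (xi, 0::'a))"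
  by (intro bounded_linear_Pair bounded_linear_ident bounded_linear_zero)
 thus ?thesis by (simp add: opT_def bounded_linear_Blinfun_apply)
qed

text \<open>The error (om - xi, - eta) of the projection of (om, 0) is orthogonal to the graph
  exactly when (eta, om - xi) lies in the adjoint, that is, when xi + x*x xi = om.\<close>

lemma opT_iff:
 assumes "subspace x" "closed x"
 shows "opT x $ om = xi \<longleftrightarrow> (\<exists>eta. (xi, eta) \<in> x \<and> (eta, om - xi) \<in> radj x)"
proof
 assume T: "opT x $ om = xi"
 obtain eta where eta: "oproj x $ (om, 0) = (xi, eta)"
  using T by (metis opT_apply prod.collapse)
 have "(xi, eta) \<in> x" using oproj_in[OF assms, of "(om, 0)"] eta by simp
 moreover have "(eta, om - xi) \<in> radj x"
 proof (rule radjI)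
  fix zeta zeta' assume "(zeta, zeta') \<in> x"
  from oproj_orth[OF assms this, of "(om, 0)"] show "zeta' \<bullet> eta = zeta \<bullet> (om - xi)"
   by (simp add: eta inner_diff_left inner_diff_right inner_commute)
 qed
 ultimately show "\<exists>eta. (xi, eta) \<in> x \<and> (eta, om - xi) \<in> radj x" by blast
next
 assume "\<exists>eta. (xi, eta) \<in> x \<and> (eta, om - xi) \<in> radj x"
 then obtain eta where eta: "(xi, eta) \<in> x" "(eta, om - xi) \<in> radj x" by blast
 have "oproj x $ (om, 0) = (xi, eta)"
 proof (rule oproj_eqI[OF assms eta(1)])
  fix z assume z: "z \<in> x"
  obtain zeta zeta' where "z = (zeta, zeta')" by (cases z)
  thus "((om, 0) - (xi, eta)) \<bullet> z = 0"
   using radjD[OF eta(2), of zeta zeta'] z by (simp add: inner_diff_left inner_diff_right inner_commute[of zeta] inner_commute[of zeta'])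
 qed
 thus "opT x $ om = xi" by (simp add: opT_apply)
qed

section \<open>The modulus as a function of 1 / (1 + x*x)\<close>

definition resop :: "('a::real_inner \<Rightarrow>\<^sub>L 'a) => bool" where
 "resop T \<longleftrightarrow> posop T \<and> (\<forall>x. T $ x \<bullet> x <= x \<bullet> x) \<and> (\<forall>x. T $ x = 0 --> x = 0)"

lemma resop_opT:
 assumes x: "rop x" shows "resop (opT x)"
proof -
 have s: "subspace x" "closed x" and sv: "single_valued x" and d: "closure (Domain x) = UNIV"
  using x by (auto simp: rop_def)
 have T: "opT x $ om \<bullet> om' = oproj x $ (om, 0) \<bullet> (om', 0)" for om om'
  by (simp add: opT_apply inner_prod_def)
 have sq: "opT x $ om \<bullet> om = (norm (oproj x $ (om, 0)))^2" for om
  unfolding T by (rule oproj_inner_self[OF s])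
 have "selfadj (opT x)"
  unfolding selfadj_def using T selfadjD[OF oproj_selfadj[OF s]] by (metis inner_commute)
 moreover have "0 <= opT x $ om \<bullet> om" for om by (simp add: sq)
 moreover have "opT x $ om \<bullet> om <= om \<bullet> om" for om
 proof -
  have "(norm (oproj x $ (om, 0)))^2 <= (norm (om, 0::'a))^2"
   using norm_oproj_le[OF s, of "(om, 0)"] by (intro power_mono) simp_all
  thus ?thesis by (simp add: sq power2_norm_eq_inner)
 qed
 moreover have "om = 0" if T0: "opT x $ om = 0" for om
 proof -
  obtain eta where eta: "(0, eta) \<in> x" "(eta, om - 0) \<in> radj x" using T0 unfolding opT_iff[OF s] by blast
  have "(0, 0) \<in> x" using subspace_0[OF s(1)] by (simp add: zero_prod_def)
  hence "eta = 0" using eta(1) sv by (auto dest: single_valuedD)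
  have "z \<bullet> om = 0" if "z \<in> Domain x" for z
   using that eta(2) \<open>eta = 0\<close> by (auto dest: radjD)
  thus ?thesis by (rule orthogonal_dense_zero[OF d])
 qed
 ultimately show ?thesis by (auto simp: resop_def posop_def)
qed

text \<open>Inverse of r \<mapsto> 1 / (1 + r^2) on (0, 1]. The default 0 elsewhere is invisible to
  the calculus: by \<open>fcT_unit\<close> the spectral projection of (0, 1] is the
  identity.\<close>

definition sg :: "real => real" where
 "sg t = (if 0 < t \<and> t <= 1 then sqrt (1 / t - 1) else 0)"

lemma sg_measurable [measurable]: "sg \<in> borel_measurable borel"
 unfolding sg_def by measurable

lemma sg_nonneg: "0 <= sg t"
 by (auto simp: sg_def field_simps)

abbreviation cut :: "nat => real => real" where
 "cut n t \<equiv> indicator {..real n} (sg t)"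

definition specF :: "('a::{real_inner,complete_space} \<Rightarrow>\<^sub>L 'a) => real set => 'a \<Rightarrow>\<^sub>L 'a" where
 "specF T B = fc T (\<lambda>t. indicator B (sg t))"

definition trn :: "('a::{real_inner,complete_space} \<Rightarrow>\<^sub>L 'a) => nat => 'a \<Rightarrow>\<^sub>L 'a" where
 "trn T n = fc T (\<lambda>t. sg t * cut n t)"

definition absT :: "('a::{real_inner,complete_space} \<Rightarrow>\<^sub>L 'a) => ('a \<times> 'a) set" where
 "absT T = {(xi, eta). (\<lambda>n. trn T n $ xi) ----> eta}"

lemma okf_sg: "f \<in> borel_measurable borel ==> (\<And>r. 0 <= r ==> \<bar>f r\<bar> <= K) ==> okf (\<lambda>t. f (sg t))"
 by (rule okf_boundedI[where K = K]) (auto simp: sg_nonneg)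

lemma okf_sg_indicator [simp]: "B \<in> sets borel ==> okf (\<lambda>t. indicator B (sg t))"
 by (rule okf_sg[where K = 1]) (auto simp: indicator_def)

lemma okf_sg_cut: "B \<in> sets borel ==> B \<subseteq> {..c} ==> okf (\<lambda>t. sg t * indicator B (sg t))"
 by (rule okf_sg[of "\<lambda>r. r * indicator B r" "\<bar>c\<bar>"]) (auto simp: indicator_def)

lemma okf_trn [simp]: "okf (\<lambda>t. sg t * cut n t)"
 by (rule okf_sg_cut) auto

lemma okf_sg2_cut [simp]: "okf (\<lambda>t. (sg t)^2 * cut n t)"
proof (rule okf_sg[of "\<lambda>r. r^2 * indicator {..real n} r" "(real n)^2"])
 show "\<bar>r^2 * indicator {..real n} r\<bar> <= (real n)^2" if "0 <= r" for r
  using that by (auto simp: indicator_def power_mono)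
qed auto

lemma sg_identity: "0 < t ==> t <= 1 ==> t * (1 + (sg t)^2) = 1"
 by (simp add: sg_def field_simps)

context
 fixes T :: "'a::{real_inner,complete_space} \<Rightarrow>\<^sub>L 'a"
 assumes T: "resop T"
begin

private lemma posT: "posop T"
 using T by (simp add: resop_def)

lemmas fcT = fc_add[OF posT] fc_diff[OF posT] fc_mult[OF posT]

text \<open>Injectivity of T removes the point 0. Above 1, the form of t - 1 on that part of the
  spectrum is nonnegative, while T \<le> 1 makes it nonpositive, so the part is null.\<close>

private lemma fcT_unit: "fc T (indicator {0<..1}) = id_blinfun"
proof -
 have z: "fc T (indicator {0}) = 0"
 proof (rule blinfun_eqI)
  fix om
  have "T $ fc T (indicator {0}) $ om = fc T (\<lambda>t. t * indicator {0} t) $ om"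
   using fc_mult_apply[OF posT okf_ident, of "indicator {0}" om] fc_ident[OF posT] by simp
  also have "(\<lambda>t::real. t * indicator {0} t) = (\<lambda>_. 0)" by (auto simp: indicator_def)
  also have "fc T (\<lambda>_. 0) $ om = 0" using fc_const[OF posT, of 0] by simp
  finally show "fc T (indicator {0}) $ om = 0 $ om" using T by (simp add: resop_def)
 qed
 have o: "fc T (indicator {1<..}) = 0"
 proof (rule blinfun_eqI)
  fix om
  define P where "P = fc T (indicator {1<..})"
  let ?f = "\<lambda>t::real. (t - 1) * indicator {1<..} t"
  have ok: "okf ?f" by (intro okf_mult okf_diff) auto
  have PP: "P $ P $ om = P $ om"
  proof -
   have "(\<lambda>t::real. indicator {1<..} t * indicator {1<..} t) = (indicator {1<..} :: real => real)"
    by (auto simp: indicator_def)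
   thus ?thesis unfolding P_def by (subst fc_mult_apply[OF posT]) auto
  qed
  have "fc T ?f $ om = (T - id_blinfun) $ P $ om"
  proof -
   have "fc T ?f = fc T (\<lambda>t. t - 1) oL P" unfolding P_def by (rule fc_mult[OF posT]) auto
   also have "fc T (\<lambda>t. t - 1) = T - id_blinfun"
    using fc_diff[OF posT okf_ident okf_const[of 1]] fc_ident[OF posT] fc_one[OF posT] by simp
   finally show ?thesis by simp
  qed
  moreover have "fc T ?f $ om = fc T ?f $ P $ om"
  proof -
   have "(\<lambda>t::real. (t - 1) * indicator {1<..} t * indicator {1<..} t) = ?f"
    by (auto simp: indicator_def)
   thus ?thesis unfolding P_def by (subst fc_mult_apply[OF posT ok]) auto
  qed
  moreover have sP: "selfadj P" unfolding P_def by (rule fc_selfadj[OF posT]) simp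
  moreover have "fc T ?f $ P $ om = P $ fc T ?f $ om"
   unfolding P_def using ok by (simp add: fc_mult_apply[OF posT] mult.commute)
  ultimately have "fc T ?f $ om \<bullet> om = (T - id_blinfun) $ P $ om \<bullet> P $ om"
   by (metis selfadjD)
  also have "... <= 0" using T by (simp add: resop_def blinfun.diff_left inner_diff_left)
  finally have "(\<integral>t. ?f t \<partial>smeas T om) <= 0" using fc_inner[OF posT ok] by simp
  moreover have "0 <= (\<integral>t. ?f t \<partial>smeas T om)" by (rule integral_nonneg_AE) (auto simp: indicator_def)
  ultimately have "(\<integral>t. ?f t \<partial>smeas T om) = 0" by simp
  hence "AE t in smeas T om. ?f t = 0"
   using integral_nonneg_eq_0_iff_AE[OF smeas_integrable[OF posT ok]] by (auto simp: indicator_def)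
  hence "(\<integral>t. indicator {1<..} t \<partial>smeas T om) = (0::real)"
  proof (intro integral_eq_zero_AE)
   assume "AE t in smeas T om. ?f t = 0"
   thus "AE t in smeas T om. indicator {1<..} t = (0::real)"
    by (rule eventually_mono) (simp split: split_indicator_asm split_indicator)
  qed
  hence "P $ om \<bullet> om = 0" unfolding P_def using fc_inner[OF posT, of "indicator {1<..}"] by simp
  hence "P $ om \<bullet> P $ om = 0" using PP selfadjD[OF sP] by metis
  thus "fc T (indicator {1<..}) $ om = 0 $ om" by (simp add: P_def)
 qed
 have "fc T (\<lambda>t. indicator {0<..1} t + indicator {0} t + indicator {1<..} t) = fc T (\<lambda>_. 1)"
 proof (rule fc_cong[OF posT])
  show "okf (\<lambda>t. indicator {0<..1} t + indicator {0} t + indicator {1<..} t)" by simp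
 qed (auto simp: indicator_def)
 thus ?thesis using z o fc_one[OF posT] by (simp add: fcT)
qed

lemma fcT_cong:
 assumes f: "okf f" and g: "okf g" and eq: "\<And>t. 0 < t ==> t <= 1 ==> f t = g t"
 shows "fc T f = fc T g"
proof -
 have 1: "fc T f = fc T (\<lambda>t. f t * indicator {0<..1} t)" if "okf f" for f
  using fc_mult[OF posT that, of "indicator {0<..1}"] fcT_unit by (simp add: blinfun_eqI)
 have "(\<lambda>t. f t * indicator {0<..1} t) = (\<lambda>t. g t * indicator {0<..1} t)"
  using eq by (auto simp: indicator_def)
 thus ?thesis using 1[OF f] 1[OF g] by simp
qed

lemma fcT_apply: "okf f ==> okf g ==> fc T f $ fc T g $ x = fc T (\<lambda>t. f t * g t) $ x"
 by (rule fc_mult_apply[OF posT])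

lemma specF_UNIV: "specF T UNIV = id_blinfun"
 unfolding specF_def using fc_one[OF posT] by simp

lemma specF_selfadj: "B \<in> sets borel ==> selfadj (specF T B)"
 unfolding specF_def by (rule fc_selfadj[OF posT]) simp

lemma specF_mult: "B \<in> sets borel ==> C \<in> sets borel ==> specF T B $ specF T C $ x = specF T (B \<inter> C) $ x"
 unfolding specF_def by (simp add: fcT_apply indicator_inter_arith)

lemma specF_compl: "B \<in> sets borel ==> specF T (- B) $ x = x - specF T B $ x"
proof -
 assume B: "B \<in> sets borel"
 have "fc T (\<lambda>t. 1 - indicator B (sg t)) = id_blinfun - specF T B"
  unfolding specF_def using B fc_one[OF posT] by (subst fc_diff[OF posT]) auto
 thus ?thesis by (simp add: specF_def indicator_compl blinfun.diff_left)
qed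

lemma specF_sums:
 assumes B: "\<And>n. B n \<in> sets borel" "disjoint_family B"
 shows "(\<lambda>n. specF T (B n) $ xi) sums (specF T (\<Union>n. B n) $ xi)"
proof -
 have s: "(\<Sum>i<n. specF T (B i) $ xi) = fc T (\<lambda>t. \<Sum>i<n. indicator (B i) (sg t)) $ xi \<and> okf (\<lambda>t. \<Sum>i<n. indicator (B i) (sg t))" for n
 proof (induction n)
  case 0
  thus ?case using fc_const[OF posT, of 0] by simp
 next
  case (Suc n)
  thus ?case using B by (simp add: specF_def fcT blinfun.add_left)
 qed
 have "(\<lambda>n. fc T (\<lambda>t. \<Sum>i<n. indicator (B i) (sg t)) $ xi) ----> fc T (\<lambda>t. indicator (\<Union>n. B n) (sg t)) $ xi"
 proof (rule fc_tendsto[OF posT, where K = 1])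
  fix t :: real
  show "\<bar>\<Sum>i<n. indicator (B i) (sg t)\<bar> <= (1::real)" for n
  proof -
   have "(\<Sum>i<n. indicator (B i) (sg t)) = (indicator (\<Union>i<n. B i) (sg t) :: real)"
    using B(2) by (subst indicator_UN_disjoint) (auto simp: disjoint_family_on_def)
   thus ?thesis by (auto simp: indicator_def)
  qed
  have "(\<lambda>i. indicator (B i) (sg t)) sums (indicator (\<Union>i. B i) (sg t) :: real)"
   using B(2) by (intro indicator_sums) (auto simp: disjoint_family_on_def)
  thus "(\<lambda>n. \<Sum>i<n. indicator (B i) (sg t)) ----> (indicator (\<Union>n. B n) (sg t) :: real)"
   by (simp add: sums_def)
 qed (use s B in auto)
 thus ?thesis unfolding sums_def using s by (simp add: specF_def)
qed

lemma specF_atMost_tendsto: "(\<lambda>n. specF T {..real n} $ xi) ----> xi"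
proof -
 have "(\<lambda>n. specF T {..real n} $ xi) ----> fc T (\<lambda>_. 1) $ xi"
  unfolding specF_def
 proof (rule fc_tendsto[OF posT, where K = 1])
  fix t :: real
  obtain N :: nat where N: "sg t <= real N" using real_arch_simple by blast
  have "cut n t = (1::real)" if "N <= n" for n
   using N that by (intro indicator_simps) (simp add: order_trans[OF N])
  hence "eventually (\<lambda>n. cut n t = (1::real)) sequentially"
   by (rule eventually_sequentiallyI)
  thus "(\<lambda>n. cut n t) ----> (1::real)" by (rule tendsto_eventually)
 qed (simp_all add: indicator_abs_le_1)
 thus ?thesis using fc_one[OF posT] by simp
qed

lemma specF_right_continuous: "(\<lambda>n. specF T {s + 1 / (real n + 1)<..} $ xi) ----> specF T {s<..} $ xi"
 unfolding specF_def
proof (rule fc_tendsto[OF posT, where K = 1])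
 fix t :: real
 show "(\<lambda>n. indicator {s + 1 / (real n + 1)<..} (sg t)) ----> (indicator {s<..} (sg t) :: real)"
 proof (cases "s < sg t")
  case True
  obtain N :: nat where N: "1 / (sg t - s) < real N" using reals_Archimedean2 by blast
  have "s + 1 / (real n + 1) < sg t" if "n \<ge> N" for n
  proof -
   have "1 / (sg t - s) < real n + 1" using N that by linarith
   thus ?thesis using True by (simp add: field_simps)
  qed
  hence "eventually (\<lambda>n. indicator {s + 1 / (real n + 1)<..} (sg t) = (1::real)) sequentially"
   by (intro eventually_sequentiallyI[of N]) (simp add: indicator_def)
  thus ?thesis using True by (simp add: tendsto_eventually)
 next
  case False
  hence "indicator {s + 1 / (real n + 1)<..} (sg t) = (0::real)" for n
   by (simp add: indicator_def not_less) (smt (verit) divide_nonneg_nonneg of_nat_0_le_iff)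
  thus ?thesis using False by simp
 qed
qed (simp_all add: indicator_abs_le_1)

lemma trn_specF: "B \<in> sets borel ==> trn T n $ specF T B $ xi = specF T B $ trn T n $ xi"
 unfolding trn_def specF_def by (simp add: fcT_apply mult.commute)

lemma trn_trn: "n <= m ==> specF T {..real n} $ trn T m $ xi = trn T n $ xi"
proof -
 assume "n <= m"
 hence "(\<lambda>t. cut n t * (sg t * cut m t))
   = (\<lambda>t. sg t * cut n t)"
  by (auto simp: indicator_def)
 thus ?thesis unfolding trn_def specF_def by (simp add: fcT_apply)
qed

lemma trn_selfadj: "selfadj (trn T n)"
 unfolding trn_def by (rule fc_selfadj[OF posT]) simp

lemma trn_nonneg: "0 <= trn T n $ xi \<bullet> xi"
 unfolding trn_def by (rule fc_nonneg[OF posT]) (auto simp: sg_nonneg)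

lemma trn_diff_norm: "n <= m ==> (norm (trn T m $ xi - trn T n $ xi))^2 = (norm (trn T m $ xi))^2 - (norm (trn T n $ xi))^2"
proof -
 assume nm: "n <= m"
 have "trn T m $ xi \<bullet> trn T n $ xi = specF T {..real n} $ trn T m $ xi \<bullet> trn T m $ xi"
  using trn_trn[OF nm, of xi] selfadjD[OF specF_selfadj[of "{..real n}"]] by (simp add: inner_commute)
 also have "... = specF T {..real n} $ specF T {..real n} $ trn T m $ xi \<bullet> trn T m $ xi"
  by (simp add: specF_mult)
 also have "... = (norm (trn T n $ xi))^2"
  using trn_trn[OF nm, of xi] selfadjD[OF specF_selfadj[of "{..real n}"]] by (simp add: power2_norm_eq_inner)
 finally show ?thesis
  by (simp add: power2_norm_eq_inner inner_diff_left inner_diff_right inner_commute)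
qed

text \<open>Truncations grow by orthogonal increments, so boundedness already forces
  convergence.\<close>

lemma Domain_absT: "xi \<in> Domain (absT T) \<longleftrightarrow> (\<exists>K. \<forall>n. norm (trn T n $ xi) <= K)"
proof
 assume "xi \<in> Domain (absT T)"
 then obtain eta where "(\<lambda>n. trn T n $ xi) ----> eta" by (auto simp: absT_def)
 hence "convergent (\<lambda>n. trn T n $ xi)" by (rule convergentI)
 hence "Bseq (\<lambda>n. trn T n $ xi)" by (intro Cauchy_Bseq convergent_Cauchy)
 thus "\<exists>K. \<forall>n. norm (trn T n $ xi) <= K" by (auto simp: Bseq_def)
next
 assume "\<exists>K. \<forall>n. norm (trn T n $ xi) <= K"
 then obtain K where K: "\<And>n. norm (trn T n $ xi) <= K" by blast
 have le: "norm (trn T n $ xi) <= norm (trn T m $ xi)" if "n <= m" for m n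
  using trn_diff_norm[OF that, of xi] by (metis diff_ge_0_iff_ge norm_ge_zero power2_le_imp_le zero_le_power2)
 have "Cauchy (\<lambda>n. trn T n $ xi)"
 proof (rule pythagorean_Cauchy[OF _ _ K])
  show "(norm (trn T m $ xi - trn T n $ xi))^2 = \<bar>(norm (trn T m $ xi))^2 - (norm (trn T n $ xi))^2\<bar>" if "n <= m" for m n
   unfolding trn_diff_norm[OF that, symmetric] by simp
 qed (intro incseq_imp_monoseq incseq_SucI le, simp)
 then obtain eta where "(\<lambda>n. trn T n $ xi) ----> eta" using Cauchy_convergent convergent_def by blast
 thus "xi \<in> Domain (absT T)" by (auto simp: absT_def)
qed

lemma absT_trn: assumes "(xi, eta) \<in> absT T" shows "trn T n $ xi = specF T {..real n} $ eta"
proof -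
 have "(\<lambda>m. specF T {..real n} $ trn T m $ xi) ----> specF T {..real n} $ eta"
  using assms by (intro tendsto_intros) (simp add: absT_def)
 moreover have "eventually (\<lambda>m. specF T {..real n} $ trn T m $ xi = trn T n $ xi) sequentially"
  by (intro eventually_sequentiallyI[of n] trn_trn)
 ultimately have "(\<lambda>m. trn T n $ xi) ----> specF T {..real n} $ eta"
  by (rule Lim_transform_eventually)
 thus ?thesis by (simp add: LIMSEQ_const_iff)
qed

lemma trn_in_absT: "(specF T {..real n} $ xi, trn T n $ xi) \<in> absT T"
proof -
 have "trn T m $ specF T {..real n} $ xi = trn T n $ xi" if "n <= m" for m
  using trn_trn[OF that, of xi] trn_specF[of "{..real n}" m xi] by simp
 hence "(\<lambda>m. trn T m $ specF T {..real n} $ xi) ----> trn T n $ xi"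
  by (intro tendsto_eventually eventually_sequentiallyI[of n])
 thus ?thesis by (simp add: absT_def)
qed

lemma absT_single: "single_valued (absT T)"
 by (auto simp: single_valued_def absT_def intro: LIMSEQ_unique)

lemma absT_subspace: "subspace (absT T)"
 by (auto simp: subspace_def absT_def zero_prod_def blinfun.add_right blinfun.scaleR_right intro!: tendsto_intros)

lemma absT_dense: "closure (Domain (absT T)) = UNIV"
proof -
 have "xi \<in> closure (Domain (absT T))" for xi
  unfolding closure_sequential
  using trn_in_absT[of _ xi] specF_atMost_tendsto[of xi] by (intro exI[of _ "\<lambda>n. specF T {..real n} $ xi"]) auto
 thus ?thesis by auto
qed

lemma absT_symmetric: "(xi, eta) \<in> absT T ==> (xi', eta') \<in> absT T ==> eta \<bullet> xi' = xi \<bullet> eta'"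
proof -
 assume "(xi, eta) \<in> absT T" "(xi', eta') \<in> absT T"
 hence "(\<lambda>n. trn T n $ xi \<bullet> xi') ----> eta \<bullet> xi'" "(\<lambda>n. xi \<bullet> trn T n $ xi') ----> xi \<bullet> eta'"
  by (auto simp: absT_def intro!: tendsto_intros)
 thus ?thesis using selfadjD[OF trn_selfadj] by (simp add: LIMSEQ_unique)
qed

text \<open>An adjoint pair (eta, zeta), tested on the truncated vectors of
  \<open>trn_in_absT\<close>, has trn n eta equal to the cut-off of zeta at n, which tends to
  zeta.\<close>

lemma absT_radj: "radj (absT T) = absT T"
proof
 show "absT T \<subseteq> radj (absT T)"
  by (auto intro!: radjI absT_symmetric)
 show "radj (absT T) \<subseteq> absT T"
 proof
  fix p assume p: "p \<in> radj (absT T)"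
  obtain eta zeta where [simp]: "p = (eta, zeta)" by (cases p)
  have "trn T n $ eta = specF T {..real n} $ zeta" for n
  proof -
   have "xi \<bullet> trn T n $ eta = xi \<bullet> specF T {..real n} $ zeta" for xi
    using radjD[OF p[simplified] trn_in_absT[of n xi]] selfadjD[OF trn_selfadj] selfadjD[OF specF_selfadj[of "{..real n}"]]
    by simp
   thus ?thesis by (metis vector_eq_ldot)
  qed
  thus "p \<in> absT T" using specF_atMost_tendsto[of zeta] by (simp add: absT_def)
 qed
qed

lemma rop_absT: "rop (absT T)"
 unfolding rop_def using absT_single absT_subspace absT_dense closed_radj[of "absT T"] absT_radj by simp

lemma absT_nonneg: "(xi, eta) \<in> absT T ==> 0 <= eta \<bullet> xi"
proof -
 assume "(xi, eta) \<in> absT T"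
 hence "(\<lambda>n. trn T n $ xi \<bullet> xi) ----> eta \<bullet> xi" by (auto simp: absT_def intro!: tendsto_intros)
 thus ?thesis by (rule LIMSEQ_le_const) (auto simp: trn_nonneg)
qed

text \<open>On each truncation this is the scalar identity t (1 + sg(t)^2) = 1; in operator terms, T
  = 1 / (1 + a^2) for the operator a with graph \<open>absT T\<close>.\<close>

lemma absT_square_iff: "(xi, zeta) \<in> absT T O absT T \<longleftrightarrow> T $ (xi + zeta) = xi"
proof
 assume "(xi, zeta) \<in> absT T O absT T"
 then obtain eta where eta: "(xi, eta) \<in> absT T" "(eta, zeta) \<in> absT T" by auto
 have "specF T {..real n} $ T $ (xi + zeta) = specF T {..real n} $ xi" for n
 proof -
  have z: "specF T {..real n} $ zeta = fc T (\<lambda>t. (sg t)^2 * cut n t) $ xi"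
  proof -
   have "specF T {..real n} $ zeta = trn T n $ eta" using absT_trn[OF eta(2)] by simp
   also have "... = trn T n $ specF T {..real n} $ eta"
    using trn_trn[of n n eta] trn_specF[of "{..real n}" n eta] by simp
   also have "... = trn T n $ trn T n $ xi" using absT_trn[OF eta(1)] by simp
   also have "... = fc T (\<lambda>t. (sg t)^2 * cut n t) $ xi"
    unfolding trn_def
    unfolding fcT_apply[OF okf_trn okf_trn]
    by (auto intro!: arg_cong[where f = "\<lambda>f. fc T f $ xi"] simp: indicator_def power2_eq_square)
   finally show ?thesis .
  qed
  have "specF T {..real n} $ T $ (xi + zeta) = T $ specF T {..real n} $ (xi + zeta)"
   unfolding specF_def by (rule fc_commute[OF posT]) auto
  also have "... = T $ (specF T {..real n} $ xi + fc T (\<lambda>t. (sg t)^2 * cut n t) $ xi)"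
   by (simp add: blinfun.add_right z)
  also have "... = fc T (\<lambda>t. t) $ fc T (\<lambda>t. cut n t + (sg t)^2 * cut n t) $ xi"
   using fc_ident[OF posT] by (simp add: specF_def fcT blinfun.add_left)
  also have "... = fc T (\<lambda>t. t * (cut n t + (sg t)^2 * cut n t)) $ xi"
   by (rule fcT_apply) auto
  also have "fc T (\<lambda>t. t * (cut n t + (sg t)^2 * cut n t)) = specF T {..real n}"
   unfolding specF_def
  proof (rule fcT_cong)
   fix t :: real assume t: "0 < t" "t <= 1"
   have "t * (cut n t + (sg t)^2 * cut n t) = (t * (1 + (sg t)^2)) * cut n t"
    by (simp add: algebra_simps)
   thus "t * (cut n t + (sg t)^2 * cut n t) = cut n t"
    using sg_identity[OF t] by simp
  qed simp_all
  finally show ?thesis .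
 qed
 thus "T $ (xi + zeta) = xi"
  using specF_atMost_tendsto[of "T $ (xi + zeta)"] specF_atMost_tendsto[of xi] LIMSEQ_unique by fastforce
next
 assume eq: "T $ (xi + zeta) = xi"
 \<comment> \<open>The vector xi, its image and zeta are the functions t, sg(t) t and sg(t)^2 t = 1
   - t of T, applied to om.\<close>
 define om where "om = xi + zeta"
 let ?g = "\<lambda>t. sg t * t"
 have ok: "okf ?g" "okf (\<lambda>t. sg t * sg t * t)"
 proof -
  have t: "okf (\<lambda>t. f t * indicator {0<..1} t)" if "f \<in> borel_measurable borel" "\<And>t. 0 < t ==> t <= 1 ==> \<bar>f t\<bar> <= 1" for f :: "real => real"
   by (rule okf_boundedI[where K = 1]) (use that in \<open>auto simp: indicator_def\<close>)
  have s2: "sg t * sg t * t <= 1" if "0 < t" "t <= 1" for t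
   using sg_identity[OF that] that by (simp add: algebra_simps power2_eq_square)
  have s1: "sg t * t <= 1" if "0 < t" "t <= 1" for t
  proof -
   have "(sg t * t)^2 = (sg t * sg t * t) * t" by (simp add: power2_eq_square)
   also have "... <= 1 * 1" using s2[OF that] that by (intro mult_mono) auto
   finally have "\<bar>sg t * t\<bar> <= 1" using abs_square_le_1[of "sg t * t"] by simp
   thus ?thesis by (rule order_trans[OF abs_ge_self])
  qed
  have "(\<lambda>t. ?g t * indicator {0<..1} t) = ?g" "(\<lambda>t. sg t * sg t * t * indicator {0<..1} t) = (\<lambda>t. sg t * sg t * t)"
   by (auto simp: indicator_def sg_def)
  moreover have "okf (\<lambda>t. ?g t * indicator {0<..1} t)" using s1 by (intro t) (auto simp: sg_nonneg abs_mult)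
  moreover have "okf (\<lambda>t. sg t * sg t * t * indicator {0<..1} t)" using s2 by (intro t) (auto simp: sg_nonneg abs_mult)
  ultimately show "okf ?g" "okf (\<lambda>t. sg t * sg t * t)" by auto
 qed
 have E: "trn T n $ fc T f $ om = specF T {..real n} $ fc T (\<lambda>t. sg t * f t) $ om" if "okf f" "okf (\<lambda>t. sg t * f t)" for f n
  unfolding trn_def specF_def using that by (simp add: fcT_apply mult.assoc mult.left_commute)
 have lim: "(fc T f $ om, fc T (\<lambda>t. sg t * f t) $ om) \<in> absT T" if "okf f" "okf (\<lambda>t. sg t * f t)" for f
  unfolding absT_def using E[OF that] specF_atMost_tendsto[of "fc T (\<lambda>t. sg t * f t) $ om"] by simp
 have "(fc T (\<lambda>t. t) $ om, fc T ?g $ om) \<in> absT T" by (rule lim) (use ok in auto)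
 hence 1: "(xi, fc T ?g $ om) \<in> absT T" using eq fc_ident[OF posT] by (simp add: om_def)
 have "(fc T ?g $ om, fc T (\<lambda>t. sg t * ?g t) $ om) \<in> absT T" by (rule lim) (use ok in \<open>auto simp: mult.assoc\<close>)
 moreover have "fc T (\<lambda>t. sg t * ?g t) = fc T (\<lambda>t. 1 - t)"
 proof (rule fcT_cong)
  show "okf (\<lambda>t. sg t * ?g t)" using ok(2) by (simp add: mult.assoc)
  fix t :: real assume t: "0 < t" "t <= 1"
  show "sg t * (sg t * t) = 1 - t" using sg_identity[OF t] by (simp add: algebra_simps power2_eq_square)
 qed simp
 moreover have "fc T (\<lambda>t. 1 - t) $ om = zeta"
  using fc_diff[OF posT okf_const[of 1] okf_ident] fc_ident[OF posT] fc_one[OF posT] eq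
  by (simp add: blinfun.diff_left om_def)
 ultimately show "(xi, zeta) \<in> absT T O absT T" using 1 by auto
qed

end

text \<open>b commutes with all f(T). On a vector cut off at n, the difference \<delta> of the
  values of b and of trn n satisfies b \<delta> = - trn n \<delta>, because the squares of both
  agree there; positivity of both makes trn n \<delta> = 0, and symmetry of b then gives \<delta> =
  0.\<close>

lemma absT_unique:
 fixes b :: "('a::{real_inner,complete_space} \<times> 'a) set"
 assumes b: "rop b" "radj b = b" and pos: "\<And>xi eta. (xi, eta) \<in> b ==> 0 <= eta \<bullet> xi"
 shows "b = absT (opT b)"
proof -
 define T where "T = opT b"
 have T: "resop T" unfolding T_def by (rule resop_opT[OF b(1)])
 hence posT: "posop T" by (simp add: resop_def)
 have sb: "subspace b" "closed b" "single_valued b" using b(1) by (auto simp: rop_def)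
 have b2: "T $ om = xi \<longleftrightarrow> (\<exists>eta. (xi, eta) \<in> b \<and> (eta, om - xi) \<in> b)" for om xi
  unfolding T_def opT_iff[OF sb(1,2)] b(2) by simp
 have lin: "(xi + xi', eta + eta') \<in> b" "(xi - xi', eta - eta') \<in> b" if "(xi, eta) \<in> b" "(xi', eta') \<in> b" for xi xi' eta eta'
  using subspace_add[OF sb(1) that] subspace_diff[OF sb(1) that] by auto
 have sym: "eta \<bullet> xi' = xi \<bullet> eta'" if "(xi, eta) \<in> b" "(xi', eta') \<in> b" for xi xi' eta eta'
  using radjD[of xi' eta' b xi eta] that b(2) by auto
 have comT: "(T $ xi, T $ eta) \<in> b" if bb: "(xi, eta) \<in> b" for xi eta
 proof -
  obtain \<sigma> where \<sigma>: "(T $ xi, \<sigma>) \<in> b" "(\<sigma>, xi - T $ xi) \<in> b" using b2[of xi "T $ xi"] by auto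
  have "(xi - T $ xi, eta - \<sigma>) \<in> b" using lin(2)[OF bb \<sigma>(1)] .
  hence "T $ eta = \<sigma>" unfolding b2 using \<sigma>(2) by blast
  thus ?thesis using \<sigma>(1) by simp
 qed
 have comp: "(bpow T k $ xi, bpow T k $ eta) \<in> b" if "(xi, eta) \<in> b" for k xi eta
  by (induction k) (auto simp: that comT)
 have com: "(fc T f $ xi, fc T f $ eta) \<in> b" if bb: "(xi, eta) \<in> b" and f: "okf f" for f xi eta
 proof -
  have "(fc T f $ xi, fc T f $ eta) \<in> radj b"
  proof (rule radjI)
   fix xi' eta' assume b': "(xi', eta') \<in> b"
   have "fc T f $ xi \<bullet> eta' = fc T f $ eta \<bullet> xi'"
    by (rule fc_transfer[OF posT f]) (use sym[OF comp[OF bb] b'] in simp)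
   thus "eta' \<bullet> fc T f $ xi = xi' \<bullet> fc T f $ eta" by (simp add: inner_commute)
  qed
  thus ?thesis using b(2) by simp
 qed
 have agree: "(specF T {..real n} $ om, trn T n $ om) \<in> b" for n om
 proof -
  define xi where "xi = specF T {..real n} $ om"
  define \<alpha> where "\<alpha> = trn T n $ xi"
  let ?\<chi> = "\<lambda>t::real. (1 + (sg t)^2) * cut n t"
  have ok\<chi>: "okf ?\<chi>"
   using okf_add[OF okf_sg_indicator[of "{..real n}"] okf_sg2_cut[of n]] by (simp add: algebra_simps)
  have "fc T (\<lambda>t. t * ?\<chi> t) = specF T {..real n}"
   unfolding specF_def
  proof (rule fcT_cong[OF T])
   show "okf (\<lambda>t. t * ?\<chi> t)" using ok\<chi> by simp
   fix t :: real assume t: "0 < t" "t <= 1"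
   show "t * ?\<chi> t = cut n t" using sg_identity[OF t] by (metis mult.assoc mult_1)
  qed simp
  hence "T $ fc T ?\<chi> $ om = xi"
   using fc_mult_apply[OF posT okf_ident ok\<chi>, of om] fc_ident[OF posT] by (simp add: xi_def)
  then obtain \<beta> where \<beta>: "(xi, \<beta>) \<in> b" "(\<beta>, fc T ?\<chi> $ om - xi) \<in> b" using b2 by blast
  have \<alpha>\<alpha>: "trn T n $ \<alpha> = fc T ?\<chi> $ om - xi"
  proof -
   have "trn T n $ \<alpha> = fc T (\<lambda>t. (sg t)^2 * cut n t) $ om"
    unfolding \<alpha>_def xi_def trn_def specF_def
    by (simp add: fcT_apply[OF T]) (auto intro!: arg_cong[where f = "\<lambda>f. fc T f $ om"] simp: indicator_def power2_eq_square)
   moreover have "fc T ?\<chi> = specF T {..real n} + fc T (\<lambda>t. (sg t)^2 * cut n t)"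
    unfolding specF_def by (subst fc_add[OF posT, symmetric]) (simp_all add: distrib_right)
   ultimately show ?thesis by (simp add: xi_def blinfun.add_left)
  qed
  have \<alpha>: "(\<alpha>, trn T n $ \<beta>) \<in> b" unfolding \<alpha>_def trn_def by (rule com[OF \<beta>(1)]) simp
  define \<delta> where "\<delta> = \<beta> - \<alpha>"
  have \<delta>: "(\<delta>, - trn T n $ \<delta>) \<in> b"
  proof -
   have "- trn T n $ \<delta> = trn T n $ \<alpha> - trn T n $ \<beta>" by (simp add: \<delta>_def blinfun.diff_right blinfun.minus_left)
   thus ?thesis using lin(2)[OF \<beta>(2) \<alpha>] by (simp only: \<alpha>\<alpha> \<delta>_def)
  qed
  have "trn T n $ \<delta> \<bullet> \<delta> = 0"
   using pos[OF \<delta>] trn_nonneg[OF T, of n \<delta>] by (simp add: blinfun.minus_left)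
  define R where "R = fc T (\<lambda>t. sqrt (sg t * cut n t))"
  have okR: "okf (\<lambda>t. sqrt (sg t * cut n t))"
   by (rule okf_sg[of "\<lambda>r. sqrt (r * indicator {..real n} r)" "sqrt (real n)"]) (auto simp: indicator_def)
  have RR: "R $ R $ \<delta> = trn T n $ \<delta>"
   unfolding R_def trn_def using okR by (simp add: fcT_apply[OF T] sg_nonneg)
  have "R $ \<delta> \<bullet> R $ \<delta> = 0"
   using RR selfadjD[OF fc_selfadj[OF posT okR]] \<open>trn T n $ \<delta> \<bullet> \<delta> = 0\<close> unfolding R_def by (simp add: inner_commute)
  hence t0: "trn T n $ \<delta> = 0" using RR by simp
  have "\<delta> \<bullet> \<delta> = \<beta> \<bullet> \<delta> - \<alpha> \<bullet> \<delta>" by (simp add: \<delta>_def inner_diff_left)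
  also have "\<beta> \<bullet> \<delta> = xi \<bullet> 0" using sym[OF \<beta>(1) \<delta>] t0 by (simp add: blinfun.minus_left)
  also have "\<alpha> \<bullet> \<delta> = xi \<bullet> trn T n $ \<delta>" unfolding \<alpha>_def using selfadjD[OF trn_selfadj[OF T]] by simp
  finally have "\<delta> = 0" using t0 by simp
  hence "(xi, \<alpha>) \<in> b" using \<beta>(1) by (simp add: \<delta>_def)
  moreover have "\<alpha> = trn T n $ om"
   unfolding \<alpha>_def xi_def using trn_specF[OF T, of "{..real n}"] trn_trn[OF T order_refl, of n om] by simp
  ultimately show ?thesis by (simp add: xi_def)
 qed
 have sub: "absT T \<subseteq> b"
 proof
  fix p assume p: "p \<in> absT T"
  obtain xi eta where [simp]: "p = (xi, eta)" by (cases p)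
  have lim: "(\<lambda>n. (specF T {..real n} $ xi, trn T n $ xi)) ----> (xi, eta)"
   using p specF_atMost_tendsto[OF T, of xi] by (intro tendsto_Pair) (auto simp: absT_def)
  show "p \<in> b" using closed_sequentially[OF sb(2) agree lim] by simp
 qed
 have "b \<subseteq> radj (absT T)"
  using sub b(2) by (auto intro!: radjI dest: sym)
 thus ?thesis using sub absT_radj[OF T] by (auto simp: T_def)
qed

text \<open>\<open>opT x\<close> is determined by the graph of x*x, and by
  \<open>absT_unique\<close> it determines every positive self-adjoint square root of that
  graph.\<close>

lemma abs_of_closed:
 assumes x: "rop x"
 shows "absT (opT x) O absT (opT x) = x O radj x"
  and "rop b ==> radj b = b ==> (\<And>xi eta. (xi, eta) \<in> b ==> 0 <= eta \<bullet> xi) ==> b O b = x O radj x ==> b = absT (opT x)"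
proof -
 have T: "resop (opT x)" by (rule resop_opT[OF x])
 have s: "subspace x" "closed x" using x by (auto simp: rop_def)
 have iff: "(xi, zeta) \<in> y O radj y \<longleftrightarrow> opT y $ (xi + zeta) = xi" if "rop y" for y xi zeta
  using that opT_iff[of y "xi + zeta" xi] by (auto simp: rop_def)
 show "absT (opT x) O absT (opT x) = x O radj x"
 proof (rule set_eqI)
  fix p :: "'a \<times> 'a"
  obtain xi zeta where p: "p = (xi, zeta)" by (cases p)
  show "p \<in> absT (opT x) O absT (opT x) \<longleftrightarrow> p \<in> x O radj x"
   unfolding p absT_square_iff[OF T] iff[OF x] ..
 qed
 assume b: "rop b" "radj b = b" "\<And>xi eta. (xi, eta) \<in> b ==> 0 <= eta \<bullet> xi" "b O b = x O radj x"
 have "opT b $ om = opT x $ om" for om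
 proof -
  have "opT b $ om = xi \<longleftrightarrow> opT x $ om = xi" for xi
   using iff[OF b(1), of xi "om - xi"] iff[OF x, of xi "om - xi"] b(2,4) by simp
  thus ?thesis by blast
 qed
 hence "opT b = opT x" by (rule blinfun_eqI)
 thus "b = absT (opT x)" using absT_unique[OF b(1,2,3)] by simp
qed

section \<open>Comparison of a closed operator with its modulus\<close>

lemma okf_sg_sq_cut: "B \<in> sets borel ==> B \<subseteq> {..c} ==> okf (\<lambda>t. (sg t)^2 * indicator B (sg t))"
proof -
 assume B: "B \<in> sets borel" "B \<subseteq> {..c}"
 have "okf (\<lambda>t. (sg t * indicator B (sg t)) * (sg t * indicator B (sg t)))"
  using B by (intro okf_mult okf_sg_cut)
 moreover have "(\<lambda>t. (sg t * indicator B (sg t)) * (sg t * indicator B (sg t))) = (\<lambda>t. (sg t)^2 * indicator B (sg t))"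
  by (auto simp: indicator_def power2_eq_square)
 ultimately show ?thesis by simp
qed

context
 fixes x :: "('a::{real_inner,complete_space} \<times> 'a) set"
 assumes x: "rop x"
begin

private lemma sx: "subspace x" "closed x" "single_valued x"
 using x by (auto simp: rop_def)

private lemma RT5: "resop (opT x)"
 by (rule resop_opT[OF x])

private lemma pT5: "posop (opT x)"
 using RT5 by (simp add: resop_def)

text \<open>On the part of the spectrum selected by B the function 1 + sg^2 is bounded and is the
  reciprocal of t, so the spectral range of B lies in the range of T, hence in the domain of x*x,
  where the norm of x xi is computed from the form of x*x.\<close>

lemma specF_in_Domain:
 assumes B: "B \<in> sets borel" "B \<subseteq> {..c}"
 shows "\<exists>eta. (specF (opT x) B $ om, eta) \<in> x \<and> (eta, fc (opT x) (\<lambda>t. (sg t)^2 * indicator B (sg t)) $ om) \<in> radj x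
  \<and> norm eta = norm (fc (opT x) (\<lambda>t. sg t * indicator B (sg t)) $ om)"
proof -
 let ?\<chi> = "\<lambda>t::real. indicator B (sg t) + (sg t)^2 * indicator B (sg t)"
 have ok\<chi>: "okf ?\<chi>" using B okf_sg_sq_cut[OF B] by simp
 have "fc (opT x) (\<lambda>t. t * ?\<chi> t) = specF (opT x) B"
  unfolding specF_def
 proof (rule fcT_cong[OF RT5])
  show "okf (\<lambda>t. t * ?\<chi> t)" using okf_mult[OF okf_ident ok\<chi>] .
  fix t :: real assume t: "0 < t" "t <= 1"
  have "t * ?\<chi> t = (t * (1 + (sg t)^2)) * indicator B (sg t)" by (simp add: algebra_simps)
  thus "t * ?\<chi> t = indicator B (sg t)" using sg_identity[OF t] by simp
 qed (use B in simp)
 hence "opT x $ fc (opT x) ?\<chi> $ om = specF (opT x) B $ om"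
  using fc_mult_apply[OF pT5 okf_ident ok\<chi>, of om] fc_ident[OF pT5] by simp
 then obtain eta where eta: "(specF (opT x) B $ om, eta) \<in> x" "(eta, fc (opT x) ?\<chi> $ om - specF (opT x) B $ om) \<in> radj x"
  using opT_iff[OF sx(1,2)] by blast
 have e: "fc (opT x) ?\<chi> $ om - specF (opT x) B $ om = fc (opT x) (\<lambda>t. (sg t)^2 * indicator B (sg t)) $ om"
  unfolding specF_def using B okf_sg_sq_cut[OF B] by (simp add: fc_add[OF pT5] blinfun.add_left)
 have "(norm eta)^2 = specF (opT x) B $ om \<bullet> fc (opT x) (\<lambda>t. (sg t)^2 * indicator B (sg t)) $ om"
  using radjD[OF eta(2) eta(1)] unfolding e by (simp add: power2_norm_eq_inner)
 also have "... = om \<bullet> specF (opT x) B $ fc (opT x) (\<lambda>t. (sg t)^2 * indicator B (sg t)) $ om"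
  by (rule selfadjD[OF specF_selfadj[OF RT5 B(1)]])
 also have "... = om \<bullet> fc (opT x) (\<lambda>t. indicator B (sg t) * ((sg t)^2 * indicator B (sg t))) $ om"
  unfolding specF_def using B okf_sg_sq_cut[OF B] by (simp add: fc_mult_apply[OF pT5])
 also have "(\<lambda>t. indicator B (sg t) * ((sg t)^2 * indicator B (sg t))) = (\<lambda>t. (sg t * indicator B (sg t)) * (sg t * indicator B (sg t)))"
  by (auto simp: indicator_def power2_eq_square)
 also have "om \<bullet> fc (opT x) (\<lambda>t. (sg t * indicator B (sg t)) * (sg t * indicator B (sg t))) $ om
   = (norm (fc (opT x) (\<lambda>t. sg t * indicator B (sg t)) $ om))^2"
  unfolding fc_mult_apply[OF pT5 okf_sg_cut[OF B] okf_sg_cut[OF B], symmetric]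
  using selfadjD[OF fc_selfadj[OF pT5 okf_sg_cut[OF B]]] by (simp add: power2_norm_eq_inner)
 finally have "norm eta = norm (fc (opT x) (\<lambda>t. sg t * indicator B (sg t)) $ om)"
  by (simp add: power2_eq_iff_nonneg)
 thus ?thesis using eta unfolding e by blast
qed

text \<open>The squared norm of the truncation is the inner product of eta with a value of x that
  has this same norm; Cauchy-Schwarz removes one factor.\<close>

lemma norm_trn_le: assumes "(xi, eta) \<in> x" shows "norm (trn (opT x) n $ xi) <= norm eta"
proof -
 obtain eta' where eta': "(specF (opT x) {..real n} $ xi, eta') \<in> x"
  "(eta', fc (opT x) (\<lambda>t. (sg t)^2 * cut n t) $ xi) \<in> radj x"
  "norm eta' = norm (trn (opT x) n $ xi)"
  using specF_in_Domain[of "{..real n}" "real n" xi] unfolding trn_def by auto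
 have "(norm eta')^2 = specF (opT x) {..real n} $ xi \<bullet> fc (opT x) (\<lambda>t. (sg t)^2 * cut n t) $ xi"
  using radjD[OF eta'(2) eta'(1)] by (simp add: power2_norm_eq_inner)
 also have "... = xi \<bullet> specF (opT x) {..real n} $ fc (opT x) (\<lambda>t. (sg t)^2 * cut n t) $ xi"
  by (rule selfadjD[OF specF_selfadj[OF RT5]]) simp
 also have "specF (opT x) {..real n} $ fc (opT x) (\<lambda>t. (sg t)^2 * cut n t) $ xi
   = fc (opT x) (\<lambda>t. (sg t)^2 * cut n t) $ xi"
  unfolding specF_def
  by (subst fc_mult_apply[OF pT5]) (auto intro!: arg_cong[where f = "\<lambda>f. fc (opT x) f $ xi"] simp: fun_eq_iff split: split_indicator)
 also have "xi \<bullet> ... = eta \<bullet> eta'" using radjD[OF eta'(2) assms] by simp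
 also have "... <= norm eta * norm eta'" by (rule norm_cauchy_schwarz)
 finally have "norm eta' * norm eta' <= norm eta * norm eta'" by (simp add: power2_eq_square)
 hence "norm eta' <= norm eta" by (cases "norm eta' = 0") auto
 thus ?thesis using eta'(3) by simp
qed

text \<open>x and |x| have equal norms on differences of cut-offs, so convergence of the truncations
  of |x| makes the values of x Cauchy; closedness of x identifies the limit.\<close>

lemma closed_op_core:
 assumes \<alpha>: "(xi, \<alpha>) \<in> absT (opT x)" and eta: "\<And>n. (specF (opT x) {..real n} $ xi, eta n) \<in> x"
 shows "\<exists>zeta. eta ----> zeta \<and> (xi, zeta) \<in> x"
proof -
 have nm: "norm (eta m - eta n) = norm (trn (opT x) m $ xi - trn (opT x) n $ xi)" if "n <= m" for m n
 proof -
  let ?B = "{real n<..real m}"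
  obtain zeta where zeta: "(specF (opT x) ?B $ xi, zeta) \<in> x" "norm zeta = norm (fc (opT x) (\<lambda>t. sg t * indicator ?B (sg t)) $ xi)"
  proof -
   have "?B \<subseteq> {..real m}" by auto
   thus ?thesis using specF_in_Domain[of ?B "real m" xi] that by auto
  qed
  have i: "indicator ?B (sg t) = (cut m t - cut n t :: real)" for t
   using that by (auto simp: indicator_def)
  have "specF (opT x) ?B $ xi = specF (opT x) {..real m} $ xi - specF (opT x) {..real n} $ xi"
   unfolding specF_def i by (simp add: fc_diff[OF pT5] blinfun.diff_left)
  hence "zeta = eta m - eta n"
   using subspace_diff[OF sx(1) eta[of m] eta[of n]] zeta(1) sx(3) by (auto dest: single_valuedD)
  moreover have "fc (opT x) (\<lambda>t. sg t * indicator ?B (sg t)) $ xi = trn (opT x) m $ xi - trn (opT x) n $ xi"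
   unfolding trn_def i right_diff_distrib by (simp add: fc_diff[OF pT5] blinfun.diff_left)
  ultimately show ?thesis using zeta(2) by simp
 qed
 have "Cauchy (\<lambda>n. trn (opT x) n $ xi)"
  using \<alpha> by (intro LIMSEQ_imp_Cauchy) (auto simp: absT_def)
 hence "Cauchy eta"
  unfolding Cauchy_iff using nm by (metis nat_le_linear norm_minus_commute)
 then obtain zeta where zeta: "eta ----> zeta" using Cauchy_convergent convergent_def by blast
 have lim: "(\<lambda>n. (specF (opT x) {..real n} $ xi, eta n)) ----> (xi, zeta)"
  by (intro tendsto_Pair zeta specF_atMost_tendsto[OF RT5])
 have in_x: "(xi, zeta) \<in> x" using closed_sequentially[OF sx(2) eta lim] .
 thus ?thesis using zeta by blast
qed

lemma closed_op_norm_abs: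
 "(xi, \<alpha>) \<in> absT (opT x) ==> \<exists>eta. (xi, eta) \<in> x \<and> norm eta = norm \<alpha>"
proof -
 assume \<alpha>: "(xi, \<alpha>) \<in> absT (opT x)"
 have "\<exists>eta. (specF (opT x) {..real n} $ xi, eta) \<in> x" for n
  using specF_in_Domain[of "{..real n}" "real n" xi] by auto
 then obtain eta where eta: "\<And>n. (specF (opT x) {..real n} $ xi, eta n) \<in> x" by metis
 obtain zeta where zeta: "eta ----> zeta" and in_x: "(xi, zeta) \<in> x" using closed_op_core[OF \<alpha> eta] by blast
 have "norm (eta n) = norm (trn (opT x) n $ xi)" for n
  using specF_in_Domain[of "{..real n}" "real n" xi] eta[of n] sx(3) unfolding trn_def
  by (auto dest: single_valuedD)
 hence "(\<lambda>n. norm (trn (opT x) n $ xi)) ----> norm zeta" using tendsto_norm[OF zeta] by simp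
 moreover have "(\<lambda>n. norm (trn (opT x) n $ xi)) ----> norm \<alpha>" using \<alpha> by (auto simp: absT_def intro: tendsto_norm)
 ultimately have "norm zeta = norm \<alpha>" by (rule LIMSEQ_unique)
 thus ?thesis using in_x by blast
qed

lemma closed_op_abs_ex: "(xi, eta) \<in> x ==> \<exists>\<alpha>. (xi, \<alpha>) \<in> absT (opT x) \<and> norm \<alpha> = norm eta"
proof -
 assume eta: "(xi, eta) \<in> x"
 hence "xi \<in> Domain (absT (opT x))" unfolding Domain_absT[OF RT5] using norm_trn_le by blast
 then obtain \<alpha> where \<alpha>: "(xi, \<alpha>) \<in> absT (opT x)" by auto
 then obtain eta' where "(xi, eta') \<in> x" "norm eta' = norm \<alpha>" using closed_op_norm_abs by blast
 thus ?thesis using \<alpha> eta sx(3) by (metis single_valuedD)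
qed

end

section \<open>Projection valued measures\<close>

definition rpvm :: "(real set => 'a::real_inner \<Rightarrow>\<^sub>L 'a) => bool" where
 "rpvm E \<longleftrightarrow> (\<forall>B\<in>sets borel. selfadj (E B) \<and> (\<forall>xi. E B $ E B $ xi = E B $ xi)) \<and> E UNIV = id_blinfun \<and>
  (\<forall>B :: nat => real set. range B \<subseteq> sets borel \<and> disjoint_family B -->
    (\<forall>xi. (\<lambda>n. E (B n) $ xi) sums (E (\<Union>n. B n) $ xi)))"

abbreviation "ssm \<equiv> spectral_scalar_measure"

context
 fixes E :: "real set => 'h::complex_hilbert_space \<Rightarrow>\<^sub>L 'h"
 assumes E: "rpvm E"
begin

lemma rpvm_selfadj: "B \<in> sets borel ==> selfadj (E B)"
 using E by (simp add: rpvm_def)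

private lemma idE: "B \<in> sets borel ==> E B $ E B $ xi = E B $ xi"
 using E by (simp add: rpvm_def)

lemma rpvm_sums: "(\<And>n. B n \<in> sets borel) ==> disjoint_family B ==> (\<lambda>n. E (B n) $ xi) sums (E (\<Union>n. B n) $ xi)" for B :: "nat => real set"
 using E unfolding rpvm_def by blast

lemma rpvm_empty: "E {} $ xi = 0"
proof -
 have "(\<lambda>n::nat. E {} $ xi) sums (E (\<Union>n::nat. {}) $ xi)"
  by (rule rpvm_sums) (auto simp: disjoint_family_on_def)
 hence "summable (\<lambda>n::nat. E {} $ xi)" by (rule sums_summable)
 thus ?thesis by (simp add: summable_const_iff)
qed

lemma rpvm_union:
 assumes "B \<in> sets borel" "C \<in> sets borel" "B \<inter> C = {}"
 shows "E (B \<union> C) $ xi = E B $ xi + E C $ xi"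
proof -
 define A where "A n = (if n = 0 then B else if n = 1 then C else {})" for n :: nat
 have "(\<lambda>n. E (A n) $ xi) sums (E (\<Union>n. A n) $ xi)"
  by (rule rpvm_sums) (use assms in \<open>auto simp: A_def disjoint_family_on_def\<close>)
 moreover have "(\<Union>n. A n) = B \<union> C"
  by (auto simp: A_def split: if_splits)
 moreover have "(\<lambda>n. E (A n) $ xi) sums (\<Sum>n\<in>{0,1}. E (A n) $ xi)"
  by (rule sums_finite) (auto simp: A_def rpvm_empty)
 ultimately have "E (B \<union> C) $ xi = (\<Sum>n\<in>{0,1}. E (A n) $ xi)" using sums_unique2 by metis
 thus ?thesis by (simp add: A_def)
qed

text \<open>With P, Q the two projections, idempotence of P + Q gives PQ + QP = 0; multiplying by P
  from either side yields PQ = QP, so both vanish.\<close>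

lemma rpvm_disjoint:
 assumes B: "B \<in> sets borel" "C \<in> sets borel" "B \<inter> C = {}"
 shows "E B $ E C $ xi = 0"
proof -
 have u: "E (B \<union> C) $ xi = E B $ xi + E C $ xi" for xi by (rule rpvm_union[OF B])
 have s: "E B $ E C $ xi + E C $ E B $ xi = 0" for xi
 proof -
  have "E (B \<union> C) $ E (B \<union> C) $ xi = E (B \<union> C) $ xi" using B by (intro idE) auto
  thus ?thesis using B by (simp add: u blinfun.add_right idE algebra_simps)
 qed
 have "E B $ E C $ xi + E B $ E C $ E B $ xi = 0"
  using arg_cong[OF s[of xi], of "\<lambda>v. E B $ v"] B by (simp add: blinfun.add_right idE)
 moreover have "E B $ E C $ E B $ xi + E C $ E B $ xi = 0"
  using s[of "E B $ xi"] B by (simp add: idE)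
 ultimately have "E B $ E C $ xi = E C $ E B $ xi" by (metis add.commute add_left_cancel)
 hence "2 *\<^sub>R (E B $ E C $ xi) = 0" using s[of xi] by (simp add: scaleR_2)
 thus ?thesis by simp
qed

lemma rpvm_mult:
 assumes B: "B \<in> sets borel" "C \<in> sets borel"
 shows "E B $ E C $ xi = E (B \<inter> C) $ xi"
proof -
 have c: "E C $ xi = E (B \<inter> C) $ xi + E (C - B) $ xi"
 proof -
  have "B \<inter> C \<union> (C - B) = C" "B \<inter> C \<inter> (C - B) = {}" by auto
  thus ?thesis using rpvm_union[of "B \<inter> C" "C - B" xi] B by simp
 qed
 have b: "E B $ v = E (B \<inter> C) $ v + E (B - C) $ v" for v
 proof -
  have "B \<inter> C \<union> (B - C) = B" "B \<inter> C \<inter> (B - C) = {}" by auto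
  thus ?thesis using rpvm_union[of "B \<inter> C" "B - C" v] B by simp
 qed
 have "E B $ E (C - B) $ xi = 0" using B by (intro rpvm_disjoint) auto
 moreover have "E (B - C) $ E (B \<inter> C) $ xi = 0" using B by (intro rpvm_disjoint) auto
 ultimately show ?thesis using B by (simp add: c blinfun.add_right) (simp add: b idE)
qed

lemma rpvm_compl: "B \<in> sets borel ==> E (- B) $ xi = xi - E B $ xi"
 using rpvm_union[of B "- B" xi] E by (simp add: rpvm_def algebra_simps)

lemma rpvm_inner: "B \<in> sets borel ==> E B $ xi \<bullet> xi = (norm (E B $ xi))^2"
 using selfadjD[OF rpvm_selfadj, of B xi "E B $ xi"] idE[of B xi] by (simp add: power2_norm_eq_inner inner_commute)

lemma spectral_scalar_measure_props:
 shows sets_ssm: "sets (ssm E xi) = sets borel"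
  and emeasure_ssm: "B \<in> sets borel ==> emeasure (ssm E xi) B = ennreal ((norm (E B $ xi))^2)"
proof -
 have sa: "sigma_algebra UNIV (sets (borel :: real measure))"
  using sets.sigma_algebra_axioms[of "borel :: real measure"] by simp
 show "sets (ssm E xi) = sets borel"
  unfolding spectral_scalar_measure_def using sigma_algebra.sets_measure_of_eq[OF sa] by simp
 have ca: "countably_additive (sets borel) (\<lambda>B. ennreal ((norm (E B $ xi))^2))"
  unfolding countably_additive_def
 proof (intro allI impI)
  fix A :: "nat => real set"
  assume A: "range A \<subseteq> sets borel" "disjoint_family A" "\<Union> (range A) \<in> sets borel"
  have "(\<lambda>n. E (A n) $ xi \<bullet> xi) sums (E (\<Union>n. A n) $ xi \<bullet> xi)"
   using A by (intro bounded_linear.sums[OF bounded_linear_inner_left] rpvm_sums) auto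
  moreover have "A n \<in> sets borel" for n using A by auto
  ultimately have "(\<lambda>n. (norm (E (A n) $ xi))^2) sums ((norm (E (\<Union>n. A n) $ xi))^2)"
   using A(3) by (simp add: rpvm_inner)
  thus "(\<Sum>n. ennreal ((norm (E (A n) $ xi))^2)) = ennreal ((norm (E (\<Union> (range A)) $ xi))^2)"
   by (subst suminf_ennreal2) (auto simp: sums_iff)
 qed
 assume "B \<in> sets borel"
 thus "emeasure (ssm E xi) B = ennreal ((norm (E B $ xi))^2)"
  unfolding spectral_scalar_measure_def
  by (intro emeasure_measure_of_sigma sa ca) (auto simp: positive_def rpvm_empty)
qed

lemma finite_ssm: "finite_measure (ssm E xi)"
proof -
 have "space (ssm E xi) = UNIV" by (simp add: spectral_scalar_measure_def space_measure_of_conv)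
 thus ?thesis by (intro finite_measureI) (simp add: emeasure_ssm)
qed

lemma ssm_restrict:
 assumes B: "B \<in> sets borel"
 shows "ssm E (E B $ xi) = density (ssm E xi) (indicator B)"
proof (rule measure_eqI)
 show "sets (ssm E (E B $ xi)) = sets (density (ssm E xi) (indicator B))"
  by (simp add: sets_ssm)
 fix A assume "A \<in> sets (ssm E (E B $ xi))"
 hence A: "A \<in> sets borel" by (simp add: sets_ssm)
 have "emeasure (density (ssm E xi) (indicator B)) A = emeasure (ssm E xi) (A \<inter> B)"
  using A B by (subst emeasure_density)
   (auto simp: sets_ssm indicator_inter_arith[symmetric] Int_commute measurable_cong_sets[OF sets_ssm refl] intro!: borel_measurable_indicator)
 thus "emeasure (ssm E (E B $ xi)) A = emeasure (density (ssm E xi) (indicator B)) A"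
  using A B by (simp add: emeasure_ssm rpvm_mult)
qed

end

section \<open>Uniqueness of the spectral measure of a self-adjoint graph\<close>

definition rspec :: "(real set => 'h::complex_hilbert_space \<Rightarrow>\<^sub>L 'h) => ('h \<times> 'h) set => bool" where
 "rspec E a \<longleftrightarrow> rpvm E \<and>
  Domain a = {xi. (\<integral>\<^sup>+ r. ennreal (r^2) \<partial>ssm E xi) < \<infinity>} \<and>
  (\<forall>(xi, eta) \<in> a. eta \<bullet> xi = (\<integral> r. r \<partial>ssm E xi))"

context
 fixes E :: "real set => 'h::complex_hilbert_space \<Rightarrow>\<^sub>L 'h" and a :: "('h \<times> 'h) set"
 assumes Ea: "rspec E a" and a: "rop a"
  and sym: "\<And>xi eta xi' eta'. (xi, eta) \<in> a ==> (xi', eta') \<in> a ==> eta \<bullet> xi' = xi \<bullet> eta'"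
begin

private lemma E: "rpvm E"
 using Ea by (simp add: rspec_def)

private lemma form: "(xi, eta) \<in> a ==> eta \<bullet> xi = (\<integral> r. r \<partial>ssm E xi)"
 using Ea by (auto simp: rspec_def)

private lemma dom: "xi \<in> Domain a \<longleftrightarrow> (\<integral>\<^sup>+ r. ennreal (r^2) \<partial>ssm E xi) < \<infinity>"
 using Ea by (auto simp: rspec_def)

private lemma meas [simp]: "f \<in> borel_measurable borel ==> f \<in> borel_measurable (ssm E xi)"
 using measurable_cong_sets[OF sets_ssm[OF E] refl] by blast

lemma rspec_Domain: "B \<in> sets borel ==> xi \<in> Domain a ==> E B $ xi \<in> Domain a"
proof -
 assume B: "B \<in> sets borel" and xi: "xi \<in> Domain a"
 have "(\<integral>\<^sup>+ r. ennreal (r^2) \<partial>ssm E (E B $ xi)) = (\<integral>\<^sup>+ r. indicator B r * ennreal (r^2) \<partial>ssm E xi)"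
  unfolding ssm_restrict[OF E B] using B by (subst nn_integral_density) auto
 also have "... <= (\<integral>\<^sup>+ r. ennreal (r^2) \<partial>ssm E xi)"
  by (intro nn_integral_mono) (auto simp: indicator_def)
 also have "... < \<infinity>" using xi dom by simp
 finally show ?thesis using dom by simp
qed

lemma rspec_integrable: assumes xi: "xi \<in> Domain a" shows "integrable (ssm E xi) (\<lambda>r. r)"
proof -
 interpret finite_measure "ssm E xi" by (rule finite_ssm[OF E])
 have "integrable (ssm E xi) (\<lambda>r. r^2)"
  using xi dom by (intro integrableI_bounded) auto
 hence i: "integrable (ssm E xi) (\<lambda>r. 1 + r^2)" by simp
 show ?thesis
 proof (rule Bochner_Integration.integrable_bound[OF i])
  show "AE r in ssm E xi. norm r <= norm (1 + r^2)"
  proof (rule AE_I2)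
   fix r :: real
   have "0 <= (\<bar>r\<bar> - 1)^2" by simp
   hence "2 * \<bar>r\<bar> <= 1 + r^2" by (simp add: power2_diff)
   thus "norm r <= norm (1 + r^2)" by simp
  qed
 qed simp
qed

lemma rspec_form_restrict:
 assumes B: "B \<in> sets borel" and xi: "xi \<in> Domain a" and eta: "(E B $ xi, eta) \<in> a"
 shows "eta \<bullet> E B $ xi = (\<integral> r. indicator B r * r \<partial>ssm E xi)"
 unfolding form[OF eta] ssm_restrict[OF E B]
 using B integral_density[of "\<lambda>r. r" "ssm E xi" "indicator B"] by (simp add: ennreal_indicator)

text \<open>The defining property fixes only the domain and the diagonal form. Comparing the form at
  E B xi1 + E (- B) xi2 with the sum of its two restrictions kills the cross term, so a respects the
  range of E B; density of the domain does the rest.\<close>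

lemma rspec_commute:
 assumes B: "B \<in> sets borel" and xi: "(xi, eta) \<in> a"
 shows "(E B $ xi, E B $ eta) \<in> a"
proof -
 have sa: "subspace a" and sv: "single_valued a" and cl: "closure (Domain a) = UNIV"
  using a by (auto simp: rop_def)
 have cross: "eta1 \<bullet> E (- B) $ xi2 = 0" if B: "B \<in> sets borel"
  and h: "xi1 \<in> Domain a" "xi2 \<in> Domain a" "(E B $ xi1, eta1) \<in> a" for B xi1 xi2 eta1
 proof -
  have mB: "- B \<in> sets borel" using B by auto
  obtain eta2 where eta2: "(E (- B) $ xi2, eta2) \<in> a" using rspec_Domain[OF mB h(2)] by auto
  define v where "v = E B $ xi1 + E (- B) $ xi2"
  have v: "(v, eta1 + eta2) \<in> a" using subspace_add[OF sa h(3) eta2] by (simp add: v_def)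
  hence vd: "v \<in> Domain a" by auto
  have EB: "E B $ v = E B $ xi1" "E (- B) $ v = E (- B) $ xi2"
   using B mB rpvm_mult[OF E B B] rpvm_mult[OF E mB mB] rpvm_disjoint[OF E B mB] rpvm_disjoint[OF E mB B]
   by (auto simp: v_def blinfun.add_right)
  have int: "integrable (ssm E v) (\<lambda>r. indicator C r * r)" if "C \<in> sets borel" for C
   by (rule Bochner_Integration.integrable_bound[OF rspec_integrable[OF vd]])
    (use that in \<open>auto simp: indicator_def\<close>)
  have "(eta1 + eta2) \<bullet> v = (\<integral> r. r \<partial>ssm E v)" by (rule form[OF v])
  also have "... = (\<integral> r. indicator B r * r + indicator (- B) r * r \<partial>ssm E v)"
   by (rule Bochner_Integration.integral_cong) (auto simp: indicator_def)
  also have "... = (\<integral> r. indicator B r * r \<partial>ssm E v) + (\<integral> r. indicator (- B) r * r \<partial>ssm E v)"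
   using int[OF B] int[OF mB] by simp
  also have "... = eta1 \<bullet> E B $ v + eta2 \<bullet> E (- B) $ v"
   using rspec_form_restrict[OF B vd, of eta1] rspec_form_restrict[OF mB vd, of eta2] h(3) eta2 EB by simp
  finally have "eta1 \<bullet> E (- B) $ xi2 + eta2 \<bullet> E B $ xi1 = 0"
   unfolding EB by (simp add: v_def inner_add_left inner_add_right)
  moreover have "eta2 \<bullet> E B $ xi1 = eta1 \<bullet> E (- B) $ xi2" using sym[OF eta2 h(3)] by (simp add: inner_commute)
  ultimately show ?thesis by simp
 qed
 have inv: "E B $ eta1 = eta1" if B: "B \<in> sets borel" and h: "xi1 \<in> Domain a" "(E B $ xi1, eta1) \<in> a" for B xi1 eta1
 proof -
  have mB: "- B \<in> sets borel" using B by auto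
  have "E (- B) $ eta1 = 0"
  proof (rule orthogonal_dense_zero[OF cl])
   fix z assume "z \<in> Domain a"
   thus "z \<bullet> E (- B) $ eta1 = 0"
    using cross[OF B h(1) _ h(2), of z] selfadjD[OF rpvm_selfadj[OF E mB]] by (simp add: inner_commute)
  qed
  thus ?thesis using rpvm_compl[OF E B] by simp
 qed
 have mB: "- B \<in> sets borel" using B by auto
 have xid: "xi \<in> Domain a" using xi by auto
 obtain eta1 where eta1: "(E B $ xi, eta1) \<in> a" using rspec_Domain[OF B xid] by auto
 obtain eta2 where eta2: "(E (- B) $ xi, eta2) \<in> a" using rspec_Domain[OF mB xid] by auto
 have "(xi, eta1 + eta2) \<in> a" using subspace_add[OF sa eta1 eta2] rpvm_compl[OF E B] by simp
 hence "eta = eta1 + eta2" using xi sv by (auto dest: single_valuedD)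
 moreover have "E B $ eta2 = 0"
  using inv[OF mB xid eta2] rpvm_disjoint[OF E B mB, of eta2] by simp
 ultimately have "E B $ eta = eta1" using inv[OF B xid eta1] by (simp add: blinfun.add_right)
 thus ?thesis using eta1 by simp
qed

text \<open>The integrand r - s is strictly positive on (s, \<infinity>), so its integral can fail
  to be positive only for the zero measure.\<close>

lemma rspec_lower:
 assumes y: "E {s<..} $ y = y" "(y, z) \<in> a" "z \<bullet> y <= s * (y \<bullet> y)" shows "y = 0"
proof -
 let ?M = "ssm E y"
 interpret finite_measure ?M by (rule finite_ssm[OF E])
 have sp: "space ?M = UNIV" by (simp add: spectral_scalar_measure_def space_measure_of_conv)
 have "E {..s} $ y = 0"
  using rpvm_disjoint[OF E, of "{..s}" "{s<..}" y] y(1) by (simp add: disjoint_iff)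
 hence "emeasure ?M {..s} = 0" by (simp add: emeasure_ssm[OF E])
 hence AE: "AE r in ?M. s < r"
  by (intro AE_I[of _ _ "{..s}"]) (auto simp: sets_ssm[OF E])
 have tot: "measure ?M UNIV = y \<bullet> y"
  using E by (simp add: measure_def emeasure_ssm[OF E] rpvm_def power2_norm_eq_inner)
 have i: "integrable ?M (\<lambda>r. r)" using y(2) by (intro rspec_integrable) auto
 have "(\<integral> r. r - s \<partial>?M) = z \<bullet> y - s * (y \<bullet> y)"
  using i form[OF y(2)] tot sp by simp
 moreover have "0 <= (\<integral> r. r - s \<partial>?M)" using AE by (intro integral_nonneg_AE) auto
 ultimately have "(\<integral> r. r - s \<partial>?M) = 0" using y(3) by simp
 moreover have "(\<integral> r. r - s \<partial>?M) = 0 ==> AE r in ?M. r - s = 0"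
 proof -
  have "AE r in ?M. 0 <= r - s" using AE by eventually_elim simp
  from integral_nonneg_eq_0_iff_AE[OF _ this] show "(\<integral> r. r - s \<partial>?M) = 0 ==> AE r in ?M. r - s = 0" using i by simp
 qed
 ultimately have "AE r in ?M. r - s = 0" by blast
 hence F: "AE r in ?M. False" using AE by eventually_elim simp
 hence "emeasure ?M {r \<in> space ?M. \<not> False} = 0"
  by (subst (asm) AE_iff_measurable[of "space ?M"]) auto
 hence "emeasure ?M UNIV = 0" using sp by simp
 thus ?thesis using E by (simp add: emeasure_ssm[OF E] rpvm_def)
qed

lemma rspec_upper:
 assumes y: "E {s<..} $ y = 0" "(y, z) \<in> a" shows "z \<bullet> y <= s * (y \<bullet> y)"
proof -
 let ?M = "ssm E y"
 interpret finite_measure ?M by (rule finite_ssm[OF E])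
 have sp: "space ?M = UNIV" by (simp add: spectral_scalar_measure_def space_measure_of_conv)
 have "emeasure ?M {s<..} = 0" using y(1) by (simp add: emeasure_ssm[OF E])
 hence AE: "AE r in ?M. r <= s"
  by (intro AE_I[of _ _ "{s<..}"]) (auto simp: sets_ssm[OF E])
 have tot: "measure ?M UNIV = y \<bullet> y"
  using E by (simp add: measure_def emeasure_ssm[OF E] rpvm_def power2_norm_eq_inner)
 have i: "integrable ?M (\<lambda>r. r)" using y(2) by (intro rspec_integrable) auto
 have "z \<bullet> y <= (\<integral> r. s \<partial>?M)"
  unfolding form[OF y(2)] using i AE by (intro integral_mono_AE) auto
 thus ?thesis using tot sp by (simp add: mult.commute)
qed

end

text \<open>For commuting E and F, the vector y = E (1 - F) xi lies strictly above s for E and at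
  most at s for F, which forces y = 0. Exchanging E and F gives equality on the domain.\<close>

lemma rspec_unique:
 fixes E F :: "real set => 'h::complex_hilbert_space \<Rightarrow>\<^sub>L 'h"
 assumes E: "rspec E a" and F: "rspec F a" and a: "rop a"
  and sym: "\<And>xi eta xi' eta'. (xi, eta) \<in> a ==> (xi', eta') \<in> a ==> eta \<bullet> xi' = xi \<bullet> eta'"
  and com: "\<And>xi. E {s<..} $ F {s<..} $ xi = F {s<..} $ E {s<..} $ xi"
 shows "E {s<..} = F {s<..}"
proof -
 have *: "E {s<..} $ xi = F {s<..} $ E {s<..} $ xi"
  if E: "rspec E a" and F: "rspec F a" and com: "\<And>xi. E {s<..} $ F {s<..} $ xi = F {s<..} $ E {s<..} $ xi"
   and xi: "xi \<in> Domain a" for E F xi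
 proof -
  have pE: "rpvm E" and pF: "rpvm F" using E F by (auto simp: rspec_def)
  define y where "y = E {s<..} $ xi - F {s<..} $ E {s<..} $ xi"
  obtain z where z: "(E {s<..} $ xi, z) \<in> a" using rspec_Domain[OF E a sym, of "{s<..}" xi] xi by auto
  have ya: "(y, z - F {s<..} $ z) \<in> a"
   unfolding y_def using subspace_diff[OF _ z rspec_commute[OF F a sym, of "{s<..}", OF _ _ _ z]] a by (simp add: rop_def)
  have "F {s<..} $ y = 0" by (simp add: y_def blinfun.diff_right rpvm_mult[OF pF])
  hence "(z - F {s<..} $ z) \<bullet> y <= s * (y \<bullet> y)" by (intro rspec_upper[OF F a sym]) (use ya in auto)
  moreover have "E {s<..} $ y = y" by (simp add: y_def blinfun.diff_right com rpvm_mult[OF pE])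
  ultimately have "y = 0" by (intro rspec_lower[OF E a sym _ ya]) auto
  thus ?thesis by (simp add: y_def)
 qed
 have d: "closure (Domain a) = UNIV" using a by (simp add: rop_def)
 have "E {s<..} $ xi = F {s<..} $ xi" if "xi \<in> Domain a" for xi
  using *[OF E F com that] *[OF F E com[symmetric] that] com by simp
 hence "closure (Domain a) \<subseteq> {xi. E {s<..} $ xi = F {s<..} $ xi}"
  by (intro closure_minimal closed_Collect_eq continuous_intros) auto
 thus ?thesis using d by (intro blinfun_eqI) auto
qed

lemma rpvm_specF: "resop T ==> rpvm (specF T)"
 unfolding rpvm_def
proof (intro conjI ballI allI impI)
 assume T: "resop T"
 show "specF T UNIV = id_blinfun" by (rule specF_UNIV[OF T])
 fix B :: "real set" assume "B \<in> sets borel"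
 thus "selfadj (specF T B)" "specF T B $ specF T B $ xi = specF T B $ xi" for xi
  using specF_selfadj[OF T] specF_mult[OF T, of B B] by auto
next
 fix B :: "nat => real set" and xi
 assume "resop T" "range B \<subseteq> sets borel \<and> disjoint_family B"
 thus "(\<lambda>n. specF T (B n) $ xi) sums (specF T (\<Union>n. B n) $ xi)"
  by (intro specF_sums) auto
qed

section \<open>The constructed spectral measure of the modulus\<close>

context
 fixes T :: "'h::complex_hilbert_space \<Rightarrow>\<^sub>L 'h"
 assumes T: "resop T"
begin

private lemma pT6: "posop T"
 using T by (simp add: resop_def)

private lemma sets_smeas: "sets (smeas T xi) = sets borel"
 using smeas_cmeas[OF pT6, of xi] by (simp add: cmeas_def)

private lemma meas6 [simp]: "f \<in> borel_measurable borel ==> f \<in> borel_measurable (smeas T xi)"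
 using measurable_cong_sets[OF sets_smeas refl] by blast

private lemma sg_meas [simp]: "sg \<in> measurable (smeas T xi) borel"
 by simp

lemma ssm_specF: "ssm (specF T) xi = distr (smeas T xi) borel sg"
proof (rule measure_eqI)
 show "sets (ssm (specF T) xi) = sets (distr (smeas T xi) borel sg)"
  by (simp add: sets_ssm[OF rpvm_specF[OF T]])
 fix B assume "B \<in> sets (ssm (specF T) xi)"
 hence B: "B \<in> sets borel" by (simp add: sets_ssm[OF rpvm_specF[OF T]])
 have i: "integrable (smeas T xi) (\<lambda>t. indicator B (sg t) :: real)"
  using B by (intro smeas_integrable[OF pT6]) simp
 have "(norm (specF T B $ xi))^2 = (\<integral>t. (indicator B (sg t))^2 \<partial>smeas T xi)"
  unfolding specF_def using B by (intro norm_fc_squared[OF pT6]) simp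
 also have "... = (\<integral>t. indicator B (sg t) \<partial>smeas T xi)"
  by (rule Bochner_Integration.integral_cong) (auto simp: indicator_def)
 finally have "ennreal ((norm (specF T B $ xi))^2) = (\<integral>\<^sup>+ t. ennreal (indicator B (sg t)) \<partial>smeas T xi)"
  using i by (subst nn_integral_eq_integral) auto
 also have "... = (\<integral>\<^sup>+ t. indicator B t \<partial>distr (smeas T xi) borel sg)"
  using B by (subst nn_integral_distr) (auto simp: ennreal_indicator)
 also have "... = emeasure (distr (smeas T xi) borel sg) B" using B by simp
 finally show "emeasure (ssm (specF T) xi) B = emeasure (distr (smeas T xi) borel sg) B"
  using B by (simp add: emeasure_ssm[OF rpvm_specF[OF T]])
qed

private lemma trn_nn: "ennreal ((norm (trn T n $ xi))^2) = (\<integral>\<^sup>+ t. ennreal ((sg t)^2 * cut n t) \<partial>smeas T xi)"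
proof -
 have i: "integrable (smeas T xi) (\<lambda>t. (sg t)^2 * cut n t)"
  by (intro smeas_integrable[OF pT6] okf_sg2_cut)
 have "(norm (trn T n $ xi))^2 = (\<integral>t. (sg t * cut n t)^2 \<partial>smeas T xi)"
  unfolding trn_def by (intro norm_fc_squared[OF pT6]) simp
 also have "... = (\<integral>t. (sg t)^2 * cut n t \<partial>smeas T xi)"
  by (rule Bochner_Integration.integral_cong) (auto simp: indicator_def)
 finally show ?thesis using i by (subst nn_integral_eq_integral) auto
qed

lemma Domain_absT_ssm:
 "Domain (absT T) = {xi. (\<integral>\<^sup>+ r. ennreal (r^2) \<partial>ssm (specF T) xi) < \<infinity>}"
proof -
 have "xi \<in> Domain (absT T) \<longleftrightarrow> (\<integral>\<^sup>+ r. ennreal (r^2) \<partial>ssm (specF T) xi) < \<infinity>" for xi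
 proof -
  have e: "(\<integral>\<^sup>+ r. ennreal (r^2) \<partial>ssm (specF T) xi) = (\<integral>\<^sup>+ t. ennreal ((sg t)^2) \<partial>smeas T xi)"
   unfolding ssm_specF by (subst nn_integral_distr) auto
  let ?f = "\<lambda>n t. ennreal ((sg t)^2 * cut n t)"
  have "(\<integral>\<^sup>+ t. (SUP n. ?f n t) \<partial>smeas T xi) = (SUP n. \<integral>\<^sup>+ t. ?f n t \<partial>smeas T xi)"
  proof (rule nn_integral_monotone_convergence_SUP)
   show "incseq ?f"
    by (intro incseq_SucI le_funI ennreal_leI) (auto simp: indicator_def)
  qed simp
  moreover have "(SUP n. ?f n t) = ennreal ((sg t)^2)" for t
  proof (rule antisym)
   show "(SUP n. ?f n t) <= ennreal ((sg t)^2)"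
    by (intro SUP_least ennreal_leI) (auto simp: indicator_def)
   obtain N :: nat where "sg t <= real N" using real_arch_simple by blast
   hence e: "ennreal ((sg t)^2) = ?f N t" by simp
   have "?f N t <= (SUP n. ?f n t)" by (rule SUP_upper) simp
   thus "ennreal ((sg t)^2) <= (SUP n. ?f n t)" by (rule ord_eq_le_trans[OF e])
  qed
  ultimately have s: "(\<integral>\<^sup>+ t. ennreal ((sg t)^2) \<partial>smeas T xi) = (SUP n. ennreal ((norm (trn T n $ xi))^2))"
   by (simp add: trn_nn)
  show ?thesis
   unfolding e s Domain_absT[OF T]
  proof
   assume "\<exists>K. \<forall>n. norm (trn T n $ xi) <= K"
   then obtain K where "\<And>n. norm (trn T n $ xi) <= K" by blast
   hence "(SUP n. ennreal ((norm (trn T n $ xi))^2)) <= ennreal (K^2)"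
    by (intro SUP_least ennreal_leI power_mono) auto
   thus "(SUP n. ennreal ((norm (trn T n $ xi))^2)) < \<infinity>" using order.strict_trans1 by fastforce
  next
   assume f: "(SUP n. ennreal ((norm (trn T n $ xi))^2)) < \<infinity>"
   define K where "K = enn2real (SUP n. ennreal ((norm (trn T n $ xi))^2))"
   have "norm (trn T n $ xi) <= sqrt K" for n
   proof -
    have "ennreal ((norm (trn T n $ xi))^2) <= ennreal K"
     unfolding K_def using f by (subst ennreal_enn2real) (auto intro: SUP_upper)
    hence "(norm (trn T n $ xi))^2 <= K" by (simp add: ennreal_le_iff K_def)
    thus ?thesis by (simp add: real_le_rsqrt)
   qed
   thus "\<exists>K. \<forall>n. norm (trn T n $ xi) <= K" by blast
  qed
 qed
 thus ?thesis by blast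
qed

lemma absT_form:
 assumes "(xi, eta) \<in> absT T" shows "eta \<bullet> xi = (\<integral> r. r \<partial>ssm (specF T) xi)"
proof -
 have fin: "(\<integral>\<^sup>+ t. ennreal ((sg t)^2) \<partial>smeas T xi) < \<infinity>"
 proof -
  have "xi \<in> Domain (absT T)" using assms by auto
  hence "(\<integral>\<^sup>+ r. ennreal (r^2) \<partial>ssm (specF T) xi) < \<infinity>" unfolding Domain_absT_ssm by simp
  thus ?thesis unfolding ssm_specF by (subst (asm) nn_integral_distr) auto
 qed
 interpret finite_measure "smeas T xi" using smeas_cmeas[OF pT6, of xi] by (simp add: cmeas_def)
 have i: "integrable (smeas T xi) (\<lambda>t. 1 + (sg t)^2)"
 proof (rule Bochner_Integration.integrable_add)
  show "integrable (smeas T xi) (\<lambda>t. (sg t)^2)" using fin by (intro integrableI_bounded) auto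
 qed simp
 have "(\<lambda>n. \<integral>t. sg t * cut n t \<partial>smeas T xi) ----> (\<integral>t. sg t \<partial>smeas T xi)"
 proof (rule integral_dominated_convergence[OF _ _ i])
  show "AE t in smeas T xi. (\<lambda>n. sg t * cut n t) ----> sg t"
  proof (rule AE_I2)
   fix t
   obtain N :: nat where N: "sg t <= real N" using real_arch_simple by blast
   have "sg t * cut n t = sg t" if "N <= n" for n
    using order_trans[OF N, of "real n"] that by simp
   thus "(\<lambda>n. sg t * cut n t) ----> sg t"
    by (intro tendsto_eventually eventually_sequentiallyI)
  qed
  show "AE t in smeas T xi. norm (sg t * cut n t) <= 1 + (sg t)^2" for n
  proof (rule AE_I2)
   fix t
   have "0 <= (sg t - 1)^2" by simp
   hence "2 * sg t <= 1 + (sg t)^2" by (simp add: power2_diff)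
   hence "sg t <= 1 + (sg t)^2" using sg_nonneg[of t] by linarith
   thus "norm (sg t * cut n t) <= 1 + (sg t)^2"
    using sg_nonneg[of t] by (auto simp: indicator_def)
  qed
 qed auto
 moreover have "trn T n $ xi \<bullet> xi = (\<integral>t. sg t * cut n t \<partial>smeas T xi)" for n
  unfolding trn_def by (intro fc_inner[OF pT6]) simp
 moreover have "(\<lambda>n. trn T n $ xi \<bullet> xi) ----> eta \<bullet> xi"
  using assms by (auto simp: absT_def intro!: tendsto_intros)
 ultimately have "eta \<bullet> xi = (\<integral>t. sg t \<partial>smeas T xi)" using LIMSEQ_unique by simp
 thus ?thesis unfolding ssm_specF by (subst integral_distr) auto
qed

lemma rspec_absT: "rspec (specF T) (absT T)"
 unfolding rspec_def using rpvm_specF[OF T] Domain_absT_ssm absT_form by auto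

end

section \<open>Complex structure\<close>

lemma cinner_scaleC_right: "cinner x (c *\<^sub>C y) = cnj c * cinner x y"
 by (metis cinner_commute cinner_scaleC_left complex_cnj_mult)

lemma Im_cinner: "Im (cinner x y) = - (\<i> *\<^sub>C x \<bullet> y)"
 by (simp add: inner_eq_Re_cinner cinner_scaleC_left)

lemma inner_ii: "\<i> *\<^sub>C x \<bullet> y = - (x \<bullet> \<i> *\<^sub>C y)"
 by (simp add: inner_eq_Re_cinner cinner_scaleC_left cinner_scaleC_right)

lemma inner_ii_ii: "\<i> *\<^sub>C x \<bullet> \<i> *\<^sub>C y = x \<bullet> y"
 by (simp add: inner_eq_Re_cinner cinner_scaleC_left cinner_scaleC_right)

lemma norm_ii [simp]: "norm (\<i> *\<^sub>C x) = norm (x::'h::complex_hilbert_space)"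
 by (simp add: norm_eq_sqrt_inner inner_ii_ii)

lemma scaleC_ii_ii: "\<i> *\<^sub>C \<i> *\<^sub>C x = - (x::'h::complex_hilbert_space)"
proof -
 have "\<i> *\<^sub>C \<i> *\<^sub>C x = complex_of_real (-1) *\<^sub>C x" by (simp add: scaleC_scaleC)
 thus ?thesis by (simp only: scaleC_of_real) simp
qed

lemma scaleC_decompose: "c *\<^sub>C x = Re c *\<^sub>R x + Im c *\<^sub>R (\<i> *\<^sub>C (x::'h::complex_hilbert_space))"
proof -
 have "c *\<^sub>C x = (complex_of_real (Re c) + complex_of_real (Im c) * \<i>) *\<^sub>C x"
  by (metis complex_eq mult.commute)
 thus ?thesis by (simp only: scaleC_add_left scaleC_scaleC[symmetric] scaleC_of_real)
qed

lemma scaleC_zero_right [simp]: "c *\<^sub>C (0::'h::complex_hilbert_space) = 0"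
 using scaleC_add_right[of c 0 "0::'h"] by simp

lemma scaleR_ii: "\<i> *\<^sub>C (r *\<^sub>R x) = r *\<^sub>R (\<i> *\<^sub>C (x::'h::complex_hilbert_space))"
 by (metis scaleC_of_real scaleC_scaleC mult.commute)

lemma bounded_linear_ii: "bounded_linear (\<lambda>x::'h::complex_hilbert_space. \<i> *\<^sub>C x)"
 by (rule bounded_linear_intro[where K = 1]) (auto simp: scaleC_add_right scaleR_ii)

definition Jop :: "'h::complex_hilbert_space \<Rightarrow>\<^sub>L 'h" where
 "Jop = Blinfun (\<lambda>x. \<i> *\<^sub>C x)"

lemma Jop_apply [simp]: "Jop $ x = \<i> *\<^sub>C x"
 by (simp add: Jop_def bounded_linear_Blinfun_apply bounded_linear_ii)

lemma adj_Jop: "adj Jop = - Jop"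
 by (rule adj_eqI) (simp add: inner_ii blinfun.minus_left)

lemma cinner_eqI:
 assumes "x \<bullet> y = x' \<bullet> y'" "\<i> *\<^sub>C x \<bullet> y = \<i> *\<^sub>C x' \<bullet> y'" shows "cinner x y = cinner x' y'"
 by (rule complex_eqI) (use assms in \<open>simp_all add: Im_cinner inner_eq_Re_cinner[symmetric]\<close>)

lemma cinner_eqD:
 assumes "cinner x y = cinner x' y'" shows "x \<bullet> y = x' \<bullet> y'"
 using assms by (simp add: inner_eq_Re_cinner)

lemma bounded_ops_iff: "A \<in> bounded_ops \<longleftrightarrow> (\<forall>x. A $ (\<i> *\<^sub>C x) = \<i> *\<^sub>C (A $ x))"
proof
 assume "\<forall>x. A $ (\<i> *\<^sub>C x) = \<i> *\<^sub>C (A $ x)"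
 hence "A $ (c *\<^sub>C x) = c *\<^sub>C (A $ x)" for c x
  unfolding scaleC_decompose[of c] by (simp add: blinfun.add_right blinfun.scaleR_right)
 thus "A \<in> bounded_ops" by (simp add: bounded_ops_def)
qed (simp add: bounded_ops_def)

lemma bounded_ops_ii: "A \<in> bounded_ops ==> A $ (\<i> *\<^sub>C x) = \<i> *\<^sub>C (A $ x)"
 by (simp add: bounded_ops_iff)

lemma adj_bounded_ops: assumes "A \<in> bounded_ops" shows "adj A \<in> bounded_ops"
 unfolding bounded_ops_iff
proof
 fix x
 have "y \<bullet> adj A $ (\<i> *\<^sub>C x) = y \<bullet> \<i> *\<^sub>C (adj A $ x)" for y
 proof -
  have "y \<bullet> adj A $ (\<i> *\<^sub>C x) = A $ y \<bullet> \<i> *\<^sub>C x" by (simp add: adj)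
  also have "... = - (\<i> *\<^sub>C (A $ y) \<bullet> x)" by (simp add: inner_ii)
  also have "... = - (A $ (\<i> *\<^sub>C y) \<bullet> x)" using assms by (simp add: bounded_ops_ii)
  also have "... = y \<bullet> \<i> *\<^sub>C (adj A $ x)" by (simp add: adj inner_ii)
  finally show ?thesis .
 qed
 thus "adj A $ (\<i> *\<^sub>C x) = \<i> *\<^sub>C (adj A $ x)" by (metis vector_eq_ldot)
qed

lemma badj_eq: assumes "A \<in> bounded_ops" shows "badj A = adj A"
 unfolding badj_def
proof (rule the_equality)
 show "\<forall>xi eta. cinner (A $ xi) eta = cinner xi (adj A $ eta)"
 proof (intro allI cinner_eqI)
  show "A $ xi \<bullet> eta = xi \<bullet> adj A $ eta" for xi eta by (rule adj)
  show "\<i> *\<^sub>C (A $ xi) \<bullet> eta = \<i> *\<^sub>C xi \<bullet> adj A $ eta" for xi eta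
   using assms by (simp add: adj[symmetric] bounded_ops_ii)
 qed
 fix B assume "\<forall>xi eta. cinner (A $ xi) eta = cinner xi (B $ eta)"
 hence "A $ xi \<bullet> eta = xi \<bullet> B $ eta" for xi eta by (metis cinner_eqD)
 thus "B = adj A" by (metis adj_eqI)
qed

lemma projection_op_iff: "projection_op P \<longleftrightarrow> P \<in> bounded_ops \<and> selfadj P \<and> (\<forall>x. P $ P $ x = P $ x)"
proof -
 have "P oL P = P \<longleftrightarrow> (\<forall>x. P $ P $ x = P $ x)"
  by (metis blinfun_apply_blinfun_compose blinfun_eqI)
 thus ?thesis unfolding projection_op_def using badj_eq[of P] selfadj_iff[of P] by auto
qed

lemma selfadj_cinner_real:
 assumes "\<i> *\<^sub>C eta \<bullet> xi = \<i> *\<^sub>C xi \<bullet> eta" shows "cinner eta xi = complex_of_real (eta \<bullet> xi)"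
proof -
 have "\<i> *\<^sub>C eta \<bullet> xi = 0" using assms inner_ii[of xi eta] by (simp add: inner_commute)
 thus ?thesis by (intro complex_eqI) (simp_all add: Im_cinner inner_eq_Re_cinner[symmetric])
qed

lemma positive_opI:
 assumes "A \<in> bounded_ops" "posop A" shows "positive_op A"
proof -
 have "cinner (A $ xi) xi \<in> \<real>\<^sub>\<ge>\<^sub>0" for xi
 proof -
  have "\<i> *\<^sub>C (A $ xi) \<bullet> xi = \<i> *\<^sub>C xi \<bullet> A $ xi"
   using assms selfadjD[of A "\<i> *\<^sub>C xi" xi] by (simp add: posop_def bounded_ops_ii)
  hence "cinner (A $ xi) xi = complex_of_real (A $ xi \<bullet> xi)" by (rule selfadj_cinner_real)
  thus ?thesis using assms(2) by (simp add: posop_def nonneg_Reals_of_real_iff)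
 qed
 thus ?thesis using assms by (simp add: positive_op_def)
qed

section \<open>The spectral projections of the modulus\<close>

definition iinv :: "('h::complex_hilbert_space \<times> 'h) set => bool" where
 "iinv x \<longleftrightarrow> (\<forall>(xi, eta)\<in>x. (\<i> *\<^sub>C xi, \<i> *\<^sub>C eta) \<in> x)"

lemma cdd_iff: "closed_densely_defined x \<longleftrightarrow> rop x \<and> iinv x"
proof
 assume x: "closed_densely_defined x"
 have add: "(xi + eta, xi' + eta') \<in> x" if "(xi, xi') \<in> x" "(eta, eta') \<in> x" for xi eta xi' eta'
  using x that unfolding closed_densely_defined_def by blast
 have sc: "(c *\<^sub>C xi, c *\<^sub>C xi') \<in> x" if "(xi, xi') \<in> x" for c xi xi'
  using x that unfolding closed_densely_defined_def by blast
 have "subspace x"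
  unfolding subspace_def
 proof (intro conjI ballI allI)
  show "0 \<in> x" using x by (simp add: closed_densely_defined_def zero_prod_def)
  show "p + q \<in> x" if "p \<in> x" "q \<in> x" for p q
   using add[of "fst p" "snd p" "fst q" "snd q"] that by (simp add: plus_prod_def)
  show "r *\<^sub>R p \<in> x" if "p \<in> x" for r p
   using sc[of "fst p" "snd p" "complex_of_real r"] that by (simp add: scaleC_of_real scaleR_prod_def)
 qed
 thus "rop x \<and> iinv x" using x sc by (auto simp: rop_def iinv_def closed_densely_defined_def)
next
 assume x: "rop x \<and> iinv x"
 hence s: "subspace x" by (simp add: rop_def)
 have "(c *\<^sub>C xi, c *\<^sub>C xi') \<in> x" if "(xi, xi') \<in> x" for c xi xi'
 proof -
  have "(\<i> *\<^sub>C xi, \<i> *\<^sub>C xi') \<in> x" using x that by (auto simp: iinv_def)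
  hence "Re c *\<^sub>R (xi, xi') + Im c *\<^sub>R (\<i> *\<^sub>C xi, \<i> *\<^sub>C xi') \<in> x"
   using s that by (intro subspace_add subspace_scale)
  thus ?thesis unfolding scaleC_decompose[of c] by simp
 qed
 moreover have "(xi + eta, xi' + eta') \<in> x" if "(xi, xi') \<in> x" "(eta, eta') \<in> x" for xi eta xi' eta'
  using subspace_add[OF s that] by simp
 ultimately show "closed_densely_defined x"
  using x subspace_0[OF s] unfolding closed_densely_defined_def rop_def zero_prod_def by blast
qed

text \<open>Replacing a pair of the graph by its multiple by \<i> recovers the imaginary part of the
  pairing from the real one.\<close>

lemma op_adj_eq: assumes "iinv x" shows "op_adj x = radj x"
proof -
 have "(\<forall>(xi, xi')\<in>x. cinner xi' eta = cinner xi zeta) \<longleftrightarrow> (\<forall>(xi, xi')\<in>x. xi' \<bullet> eta = xi \<bullet> zeta)" for eta zeta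
 proof
  assume h: "\<forall>(xi, xi')\<in>x. xi' \<bullet> eta = xi \<bullet> zeta"
  show "\<forall>(xi, xi')\<in>x. cinner xi' eta = cinner xi zeta"
   using h assms by (auto intro!: cinner_eqI simp: iinv_def)
 qed (auto dest: cinner_eqD)
 thus ?thesis by (auto simp: op_adj_def radj_def)
qed

lemma opT_commute:
 assumes x: "rop x" and B: "\<And>xi eta. (xi, eta) \<in> x ==> (B $ xi, B $ eta) \<in> x"
  and B': "\<And>xi eta. (xi, eta) \<in> x ==> (adj B $ xi, adj B $ eta) \<in> x"
 shows "B $ opT x $ om = opT x $ B $ om"
proof -
 have s: "subspace x" "closed x" using x by (auto simp: rop_def)
 obtain eta where eta: "(opT x $ om, eta) \<in> x" "(eta, om - opT x $ om) \<in> radj x"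
  using opT_iff[OF s, of om "opT x $ om"] by blast
 have "(B $ eta, B $ om - B $ opT x $ om) \<in> radj x"
 proof (rule radjI)
  fix zeta zeta' assume "(zeta, zeta') \<in> x"
  from radjD[OF eta(2) B'[OF this]] show "zeta' \<bullet> B $ eta = zeta \<bullet> (B $ om - B $ opT x $ om)"
   by (simp add: adj' blinfun.diff_right[symmetric])
 qed
 hence "opT x $ B $ om = B $ opT x $ om" unfolding opT_iff[OF s] using B[OF eta(1)] by blast
 thus ?thesis by simp
qed

lemma specF_commute:
 assumes "resop T" "S \<in> sets borel" "\<And>om. B $ T $ om = T $ B $ om"
 shows "specF T S $ B $ om = B $ specF T S $ om"
 unfolding specF_def using assms by (intro fc_commute) (auto simp: resop_def)

context
 fixes x :: "('h::complex_hilbert_space \<times> 'h) set"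
 assumes x: "closed_densely_defined x"
begin

private lemma x': "rop x" "iinv x"
 using x by (auto simp: cdd_iff)

private lemma RTx: "resop (opT x)"
 by (rule resop_opT[OF x'(1)])

private lemma pTx: "posop (opT x)"
 using RTx by (simp add: resop_def)

private lemma commJ: "\<i> *\<^sub>C (opT x $ om) = opT x $ (\<i> *\<^sub>C om)"
proof -
 have inv: "(\<i> *\<^sub>C xi, \<i> *\<^sub>C eta) \<in> x" if "(xi, eta) \<in> x" for xi eta using x'(2) that by (auto simp: iinv_def)
 have "(- (\<i> *\<^sub>C xi), - (\<i> *\<^sub>C eta)) \<in> x" if "(xi, eta) \<in> x" for xi eta
  using subspace_neg[OF _ inv[OF that]] x'(1) by (simp add: rop_def)
 hence "Jop $ opT x $ om = opT x $ Jop $ om"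
  using inv by (intro opT_commute[OF x'(1)]) (auto simp: adj_Jop blinfun.minus_left)
 thus ?thesis by simp
qed

lemma fc_opT_bounded_ops: "okf f ==> fc (opT x) f \<in> bounded_ops"
 unfolding bounded_ops_iff using fc_commute[OF pTx, of f Jop] commJ by simp

lemma positive_selfadjoint_absT: "positive_selfadjoint (absT (opT x))"
proof -
 have i: "iinv (absT (opT x))"
  unfolding iinv_def
 proof safe
  fix xi eta assume "(xi, eta) \<in> absT (opT x)"
  hence "(\<lambda>n. Jop $ trn (opT x) n $ xi) ----> Jop $ eta" by (intro tendsto_intros) (simp add: absT_def)
  moreover have "trn (opT x) n $ (\<i> *\<^sub>C xi) = \<i> *\<^sub>C (trn (opT x) n $ xi)" for n
   unfolding trn_def using fc_opT_bounded_ops[OF okf_trn] by (simp add: bounded_ops_ii)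
  ultimately show "(\<i> *\<^sub>C xi, \<i> *\<^sub>C eta) \<in> absT (opT x)" by (simp add: absT_def)
 qed
 have "cinner eta xi \<in> \<real>\<^sub>\<ge>\<^sub>0" if h: "(xi, eta) \<in> absT (opT x)" for xi eta
 proof -
  have "(\<i> *\<^sub>C xi, \<i> *\<^sub>C eta) \<in> absT (opT x)" using i h by (auto simp: iinv_def)
  hence "cinner eta xi = complex_of_real (eta \<bullet> xi)"
   using absT_symmetric[OF RTx _ h] by (intro selfadj_cinner_real) auto
  thus ?thesis using absT_nonneg[OF RTx h] by (simp add: nonneg_Reals_of_real_iff)
 qed
 thus ?thesis
  unfolding positive_selfadjoint_def cdd_iff op_adj_eq[OF i] using i rop_absT[OF RTx] absT_radj[OF RTx] by auto
qed

lemma op_abs_eq: "op_abs x = absT (opT x)"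
 unfolding op_abs_def
proof (rule the_equality)
 show "positive_selfadjoint (absT (opT x)) \<and> absT (opT x) O absT (opT x) = x O op_adj x"
  using positive_selfadjoint_absT abs_of_closed(1)[OF x'(1)] by (simp add: op_adj_eq[OF x'(2)])
 fix b assume b: "positive_selfadjoint b \<and> b O b = x O op_adj x"
 hence b': "rop b" "iinv b" "radj b = b" "b O b = x O radj x"
  using op_adj_eq[of b] op_adj_eq[OF x'(2)] by (auto simp: positive_selfadjoint_def cdd_iff)
 have "0 <= eta \<bullet> xi" if "(xi, eta) \<in> b" for xi eta
  using b that by (auto simp: positive_selfadjoint_def inner_eq_Re_cinner complex_nonneg_Reals_iff)
 thus "b = absT (opT x)" using abs_of_closed(2)[OF x'(1) b'(1,3) _ b'(4)] by blast
qed

lemma spectral_measure_of_rspec: "spectral_measure_of E a ==> rspec E a"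
 unfolding spectral_measure_of_def rspec_def rpvm_def projection_valued_measure_def
 by (auto simp: projection_op_iff inner_eq_Re_cinner)

lemma spectral_measure_of_specF: "spectral_measure_of (specF (opT x)) (absT (opT x))"
proof -
 have p: "positive_selfadjoint (absT (opT x))" by (rule positive_selfadjoint_absT)
 have r: "rspec (specF (opT x)) (absT (opT x))" by (rule rspec_absT[OF RTx])
 have "projection_valued_measure (specF (opT x))"
  using r fc_opT_bounded_ops unfolding projection_valued_measure_def rspec_def rpvm_def
  by (auto simp: projection_op_iff specF_def)
 moreover have "cinner eta xi = complex_of_real (\<integral> r. r \<partial>ssm (specF (opT x)) xi)"
  if h: "(xi, eta) \<in> absT (opT x)" for xi eta
 proof -
  have "cinner eta xi \<in> \<real>\<^sub>\<ge>\<^sub>0" using p h by (auto simp: positive_selfadjoint_def)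
  hence "cinner eta xi = complex_of_real (eta \<bullet> xi)"
   by (intro complex_eqI) (auto simp: inner_eq_Re_cinner complex_nonneg_Reals_iff)
  thus ?thesis using r h by (auto simp: rspec_def)
 qed
 ultimately show ?thesis using r unfolding spectral_measure_of_def rspec_def by auto
qed

text \<open>Another spectral measure E of |x| preserves the graph of |x|, so E {s<..} commutes with
  T = 1 / (1 + |x|^2) and with functions of T. \<open>rspec_unique\<close> then settles the definite
  description.\<close>

lemma spectral_projection_eq: "spectral_projection {s<..} (op_abs x) = specF (opT x) {s<..}"
 unfolding spectral_projection_def op_abs_eq
proof (rule the_equality)
 show "\<exists>E. spectral_measure_of E (absT (opT x)) \<and> specF (opT x) {s<..} = E {s<..}"
  using spectral_measure_of_specF by blast
 fix P assume "\<exists>E. spectral_measure_of E (absT (opT x)) \<and> P = E {s<..}"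
 then obtain E where E: "spectral_measure_of E (absT (opT x))" "P = E {s<..}" by blast
 note sym = absT_symmetric[OF RTx]
 have rE: "rspec E (absT (opT x))" using spectral_measure_of_rspec[OF E(1)] .
 have "E {s<..} $ opT x $ om = opT x $ E {s<..} $ om" for om
 proof -
  define xi where "xi = opT x $ om"
  have "(xi, om - xi) \<in> absT (opT x) O absT (opT x)" unfolding absT_square_iff[OF RTx] by (simp add: xi_def)
  then obtain eta where eta: "(xi, eta) \<in> absT (opT x)" "(eta, om - xi) \<in> absT (opT x)" by auto
  have "(E {s<..} $ xi, E {s<..} $ eta) \<in> absT (opT x)" "(E {s<..} $ eta, E {s<..} $ (om - xi)) \<in> absT (opT x)"
   by (rule rspec_commute[OF rE rop_absT[OF RTx] sym]; use eta in simp)+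
  hence "(E {s<..} $ xi, E {s<..} $ (om - xi)) \<in> absT (opT x) O absT (opT x)" by auto
  thus ?thesis unfolding absT_square_iff[OF RTx] by (simp add: xi_def blinfun.diff_right)
 qed
 hence com: "E {s<..} $ specF (opT x) {s<..} $ om = specF (opT x) {s<..} $ E {s<..} $ om" for om
  using specF_commute[OF RTx, of "{s<..}" "E {s<..}"] by simp
 show "P = specF (opT x) {s<..}"
  unfolding E(2) by (rule rspec_unique[OF rE rspec_absT[OF RTx] rop_absT[OF RTx] sym com])
qed

text \<open>One half of a min-max principle, \<open>spectral_high\<close> being the other: x is
  bounded by s on the kernel of \<chi>(|x| > s), and no nonzero vector of its range satisfies that
  bound.\<close>

lemma spectral_low:
 assumes "0 <= s" "specF (opT x) {s<..} $ xi = 0" shows "\<exists>eta. (xi, eta) \<in> x \<and> norm eta <= s * norm xi"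
proof -
 have "- {s<..} = {..s}" by auto
 hence "specF (opT x) {..s} $ xi = xi" using specF_compl[OF RTx, of "{s<..}" xi] assms(2) by simp
 then obtain eta where eta: "(xi, eta) \<in> x" "norm eta = norm (fc (opT x) (\<lambda>t. sg t * indicator {..s} (sg t)) $ xi)"
  using specF_in_Domain[OF x'(1), of "{..s}" s xi] by auto
 have "norm (fc (opT x) (\<lambda>t. sg t * indicator {..s} (sg t)) $ xi) <= s * norm xi"
  using assms(1) by (intro norm_fc_le[OF pTx] okf_sg_cut) (auto simp: indicator_def sg_nonneg)
 thus ?thesis using eta by auto
qed

lemma spectral_high:
 assumes "specF (opT x) {s<..} $ xi = xi" "(xi, eta) \<in> x" "norm eta <= s * norm xi" shows "xi = 0"
proof -
 obtain \<alpha> where \<alpha>: "(xi, \<alpha>) \<in> absT (opT x)" "norm \<alpha> = norm eta"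
  using closed_op_abs_ex[OF x'(1) assms(2)] by blast
 have "\<alpha> \<bullet> xi <= norm \<alpha> * norm xi" by (rule norm_cauchy_schwarz)
 also have "... <= (s * norm xi) * norm xi" using assms(3) \<alpha>(2) by (intro mult_right_mono) auto
 finally have "\<alpha> \<bullet> xi <= s * (xi \<bullet> xi)" by (simp add: dot_square_norm power2_eq_square)
 with \<alpha>(1) assms(1) show ?thesis
  using rspec_lower[OF rspec_absT[OF RTx] rop_absT[OF RTx] absT_symmetric[OF RTx]] by blast
qed

end

section \<open>Von Neumann algebras with a trace\<close>

locale traced_algebra =
 fixes M :: "('h::complex_hilbert_space \<Rightarrow>\<^sub>L 'h) set" and \<tau> :: "('h \<Rightarrow>\<^sub>L 'h) => ennreal"
 assumes svn: "semifinite_von_neumann_algebra M \<tau>"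
begin

abbreviation "mops \<equiv> measurable_ops M \<tau>"

lemma vn: "von_neumann_algebra M"
 using svn by (simp add: semifinite_von_neumann_algebra_def)

lemma M_bounded: "A \<in> M ==> A \<in> bounded_ops"
 using vn by (auto simp: von_neumann_algebra_def)

lemma M_adj: "A \<in> M ==> adj A \<in> M"
 using vn M_bounded[of A] by (auto simp: von_neumann_algebra_def badj_eq)

lemma compose_eq_iff: "A oL B = B oL A \<longleftrightarrow> (\<forall>xi. A $ B $ xi = B $ A $ xi)" for A B :: "'h \<Rightarrow>\<^sub>L 'h"
 by (metis blinfun_apply_blinfun_compose blinfun_eqI)

lemma M_iff: "A \<in> M \<longleftrightarrow> A \<in> bounded_ops \<and> (\<forall>B\<in>commutant M. \<forall>xi. A $ B $ xi = B $ A $ xi)"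
proof -
 have "A \<in> M \<longleftrightarrow> A \<in> commutant (commutant M)" using vn by (simp add: von_neumann_algebra_def)
 thus ?thesis by (simp add: commutant_def[of "commutant M"] compose_eq_iff)
qed

lemma comm_iff: "B \<in> commutant M \<longleftrightarrow> B \<in> bounded_ops \<and> (\<forall>A\<in>M. \<forall>xi. B $ A $ xi = A $ B $ xi)"
 by (simp add: commutant_def compose_eq_iff)

lemma comm_bounded: "B \<in> commutant M ==> B \<in> bounded_ops"
 by (simp add: comm_iff)

lemma commD: "B \<in> commutant M ==> A \<in> M ==> B $ A $ xi = A $ B $ xi"
 by (simp add: comm_iff)

lemma comm_adj: assumes "B \<in> commutant M" shows "adj B \<in> commutant M"
 unfolding comm_iff
proof (intro conjI ballI allI)
 show "adj B \<in> bounded_ops" using assms adj_bounded_ops comm_bounded by blast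
 fix A xi assume A: "A \<in> M"
 have "adj B $ A $ xi \<bullet> eta = A $ adj B $ xi \<bullet> eta" for eta
  using commD[OF assms M_adj[OF A], of eta] by (simp add: adj') (metis adj adj_adj)
 thus "adj B $ A $ xi = A $ adj B $ xi" by (metis vector_eq_rdot)
qed

lemma M_zero: "0 \<in> M"
 by (simp add: M_iff bounded_ops_iff)

lemma M_add: "A \<in> M ==> B \<in> M ==> A + B \<in> M"
 by (simp add: M_iff bounded_ops_iff blinfun.add_left blinfun.add_right scaleC_add_right)

lemma ii_diff: "\<i> *\<^sub>C (x - y) = \<i> *\<^sub>C x - \<i> *\<^sub>C (y::'h)"
 using bounded_linear.linear[OF bounded_linear_ii, THEN linear_diff, of x y] by simp

lemma M_diff: "A \<in> M ==> B \<in> M ==> A - B \<in> M"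
 by (simp add: M_iff bounded_ops_iff blinfun.diff_left blinfun.diff_right ii_diff)

lemma M_scaleR: "A \<in> M ==> r *\<^sub>R A \<in> M"
 by (simp add: M_iff bounded_ops_iff blinfun.scaleR_left blinfun.scaleR_right scaleR_ii)

lemma M_compose: "A \<in> M ==> B \<in> M ==> A oL B \<in> M"
 by (simp add: M_iff bounded_ops_iff)

lemma Jop_bounded_commute: "A \<in> bounded_ops ==> A $ Jop $ xi = Jop $ A $ xi"
 by (simp add: bounded_ops_ii)

lemma M_fc: assumes "a \<in> M" "posop a" "okf f" shows "fc a f \<in> M"
 unfolding M_iff
proof (intro conjI ballI allI)
 show "fc a f \<in> bounded_ops"
  unfolding bounded_ops_iff
  using fc_commute[OF assms(2,3), of Jop] bounded_ops_ii[OF M_bounded[OF assms(1)]] by simp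
 fix B xi assume "B \<in> commutant M"
 thus "fc a f $ B $ xi = B $ fc a f $ xi"
  using commD assms(1) by (intro fc_commute[OF assms(2,3)]) auto
qed

text \<open>A self-adjoint contraction \<open>C\<close> is the imaginary part of the unitary \<open>\<surd>(1 - C^2) + iC\<close>.\<close>

lemma unitaries_commute_selfadj:
 assumes A: "A \<in> bounded_ops" "\<And>U xi. U \<in> commutant M ==> unitary_op U ==> A $ U $ xi = U $ A $ xi"
  and C: "C \<in> commutant M" "selfadj C"
 shows "A $ C $ xi = C $ A $ xi"
proof -
 \<comment> \<open>Scales C to a contraction D, so that K = 1 - D^2 is positive and has a square
   root in the calculus.\<close>
 define r where "r = 1 / (norm C + 1)"
 have r: "0 < r" by (simp add: r_def add_nonneg_pos)
 define D where "D = r *\<^sub>R C"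
 have D: "selfadj D" using C(2) by (simp add: D_def selfadj_def blinfun.scaleR_left)
 have Db: "D \<in> bounded_ops" using comm_bounded[OF C(1)]
  by (simp add: D_def bounded_ops_iff blinfun.scaleR_left scaleR_ii)
 have Dc: "norm (D $ x) <= norm x" for x
 proof -
  have "norm (C $ x) <= norm C * norm x" by (rule norm_blinfun)
  also have "... <= (norm C + 1) * norm x" by (simp add: distrib_right)
  finally have "r * norm (C $ x) <= r * ((norm C + 1) * norm x)" using r by (intro mult_left_mono) auto
  also have "... = norm x"
  proof -
   have "norm C + 1 \<noteq> 0" using norm_ge_zero[of C] by linarith
   thus ?thesis by (simp add: r_def)
  qed
  finally show ?thesis using r by (simp add: D_def blinfun.scaleR_left)
 qed
 define K where "K = id_blinfun - (D oL D)"
 have pK: "posop K"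
  unfolding posop_def selfadj_def
 proof (intro conjI allI)
  show "K $ x \<bullet> y = x \<bullet> K $ y" for x y
   by (simp add: K_def blinfun.diff_left inner_diff_left inner_diff_right selfadjD[OF D])
  show "0 <= K $ x \<bullet> x" for x
   using power_mono[OF Dc[of x], of 2] by (simp add: K_def blinfun.diff_left inner_diff_left selfadjD[OF D] power2_norm_eq_inner)
 qed
 have ok: "okf (\<lambda>t. sqrt \<bar>t\<bar>)"
  unfolding okf_def
 proof (intro conjI allI)
  show "\<exists>K. \<forall>t\<in>{0..L}. \<bar>sqrt \<bar>t\<bar>\<bar> <= K" for L :: real
   by (intro exI[of _ "sqrt L"]) simp
 qed simp
 define W where "W = fc K (\<lambda>t. sqrt \<bar>t\<bar>)"
 have WW: "W $ W $ x = K $ x" for x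
 proof -
  have "fc K (\<lambda>t. sqrt \<bar>t\<bar> * sqrt \<bar>t\<bar>) = fc K (\<lambda>t. t)"
   by (rule fc_cong[OF pK okf_mult[OF ok ok]]) auto
  thus ?thesis unfolding W_def using ok by (simp add: fc_mult_apply[OF pK] fc_ident[OF pK])
 qed
 have Wcom: "W $ B $ x = B $ W $ x" if "\<And>x. B $ D $ x = D $ B $ x" for B x
  unfolding W_def by (rule fc_commute[OF pK ok]) (simp add: K_def blinfun.diff_left blinfun.diff_right that)
 have sW: "selfadj W" unfolding W_def by (rule fc_selfadj[OF pK ok])
 have DJ: "D $ Jop $ x = Jop $ D $ x" for x by (rule Jop_bounded_commute[OF Db])
 have WJ: "W $ Jop $ x = Jop $ W $ x" for x by (rule Wcom) (simp only: DJ)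
 have WD: "W $ D $ x = D $ W $ x" for x by (rule Wcom) simp
 have JJ: "Jop $ Jop $ x = - x" for x :: 'h by (simp add: scaleC_ii_ii)
 define U where "U = W + (Jop oL D)"
 have aU: "adj U = W - (Jop oL D)"
 proof -
  have "adj D oL adj Jop = - (Jop oL D)"
   using D selfadj_iff[of D] DJ by (intro blinfun_eqI) (simp add: adj_Jop blinfun.minus_left blinfun.minus_right del: Jop_apply)
  thus ?thesis using sW selfadj_iff[of W] by (simp add: U_def)
 qed
 have UU: "adj U $ U $ x = x" "U $ adj U $ x = x" for x
  unfolding aU unfolding U_def
  by (simp_all add: blinfun.add_left blinfun.diff_left blinfun.add_right blinfun.diff_right WW WJ WD DJ JJ
    blinfun.minus_right K_def del: Jop_apply)
 have cB: "D $ B $ x = B $ D $ x" if "B \<in> M" for B x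
  using commD[OF C(1) that] by (simp add: D_def blinfun.scaleR_left blinfun.scaleR_right)
 have Ucom: "U \<in> commutant M"
  unfolding comm_iff
 proof (intro conjI ballI allI)
  show "U \<in> bounded_ops"
   unfolding bounded_ops_iff using WJ DJ by (simp add: U_def blinfun.add_left scaleC_add_right)
  fix B x assume B: "B \<in> M"
  have "W $ B $ x = B $ W $ x" using cB[OF B] by (intro Wcom) simp
  thus "U $ B $ x = B $ U $ x"
   using cB[OF B] bounded_ops_ii[OF M_bounded[OF B]] by (simp add: U_def blinfun.add_left blinfun.add_right)
 qed
 have uU: "unitary_op U" "unitary_op (adj U)"
  using UU comm_bounded[OF Ucom] adj_bounded_ops[OF comm_bounded[OF Ucom]]
  by (auto simp: unitary_op_def badj_eq intro!: blinfun_eqI)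
 have e: "(2::real) *\<^sub>R (\<i> *\<^sub>C (D $ x)) = U $ x - adj U $ x" for x
  unfolding aU unfolding U_def by (simp add: blinfun.add_left blinfun.diff_left scaleR_2)
 have "A $ ((2::real) *\<^sub>R (\<i> *\<^sub>C (D $ xi))) = (2::real) *\<^sub>R (\<i> *\<^sub>C (D $ A $ xi))"
  unfolding e using A(2)[OF Ucom uU(1)] A(2)[OF comm_adj[OF Ucom] uU(2)] by (simp add: blinfun.diff_right)
 hence "\<i> *\<^sub>C (A $ D $ xi) = \<i> *\<^sub>C (D $ A $ xi)"
  using bounded_ops_ii[OF A(1)] by (simp add: blinfun.scaleR_right)
 hence "A $ D $ xi = D $ A $ xi" by (metis scaleC_ii_ii neg_equal_iff_equal)
 thus ?thesis using r by (simp add: D_def blinfun.scaleR_left blinfun.scaleR_right)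
qed

text \<open>Affiliation speaks of unitaries only. An arbitrary B in the commutant is a combination
  of B + adj B and \<i> (B - adj B), to which the self-adjoint case applies.\<close>

lemma M_unitaryI:
 assumes A: "A \<in> bounded_ops" "\<And>U xi. U \<in> commutant M ==> unitary_op U ==> A $ U $ xi = U $ A $ xi"
 shows "A \<in> M"
 unfolding M_iff
proof (intro conjI ballI allI A(1))
 fix B xi assume B: "B \<in> commutant M"
 note B' = comm_adj[OF B]
 have Bb: "B \<in> bounded_ops" "adj B \<in> bounded_ops" using B B' comm_bounded by auto
 define C1 where "C1 = B + adj B"
 define C2 where "C2 = Jop oL (B - adj B)"
 have "C1 \<in> commutant M"
  using B B' Bb by (auto simp: comm_iff C1_def blinfun.add_left blinfun.add_right bounded_ops_iff scaleC_add_right)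
 moreover have "selfadj C1" by (simp add: C1_def selfadj_iff)
 ultimately have 1: "A $ C1 $ xi = C1 $ A $ xi" using unitaries_commute_selfadj[of A C1 xi] A by blast
 have "C2 \<in> commutant M"
  using B B' Bb M_bounded
  by (auto simp: comm_iff C2_def blinfun.diff_left blinfun.diff_right bounded_ops_ii ii_diff) (simp add: bounded_ops_iff blinfun.diff_left ii_diff)
 moreover have "selfadj C2"
 proof -
  have "adj C2 = (adj B - B) oL (- Jop)" by (simp add: C2_def adj_Jop)
  also have "... = C2"
   using Bb by (intro blinfun_eqI) (simp add: C2_def blinfun.diff_left blinfun.minus_left blinfun.minus_right blinfun.diff_right bounded_ops_ii ii_diff)
  finally show ?thesis by (simp add: selfadj_iff)
 qed
 ultimately have "A $ C2 $ xi = C2 $ A $ xi" using unitaries_commute_selfadj[of A C2 xi] A by blast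
 hence "\<i> *\<^sub>C (A $ (B - adj B) $ xi) = \<i> *\<^sub>C ((B - adj B) $ A $ xi)"
  using bounded_ops_ii[OF A(1)] by (simp add: C2_def)
 hence 2: "A $ (B - adj B) $ xi = (B - adj B) $ A $ xi" by (metis scaleC_ii_ii neg_equal_iff_equal)
 have "(2::real) *\<^sub>R (A $ B $ xi) = (2::real) *\<^sub>R (B $ A $ xi)"
  using arg_cong2[OF 1 2, of "(+)"] by (simp add: C1_def blinfun.add_left blinfun.diff_left blinfun.add_right blinfun.diff_right scaleR_2 algebra_simps)
 thus "A $ B $ xi = B $ A $ xi" by simp
qed

subsection \<open>The trace on positive elements\<close>

lemma pos_partI: "A \<in> M ==> posop A ==> A \<in> positive_part M"
 by (simp add: positive_part_def positive_opI M_bounded)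

lemma tr: "is_trace M \<tau>" and tr_faithful: "faithful_trace M \<tau>" and tr_normal: "normal_trace M \<tau>"
 using svn by (auto simp: semifinite_von_neumann_algebra_def)

lemma trace_add: "A \<in> M ==> posop A ==> B \<in> M ==> posop B ==> \<tau> (A + B) = \<tau> A + \<tau> B"
 using tr pos_partI by (simp add: is_trace_def)

lemma trace_scale: "A \<in> M ==> posop A ==> 0 <= r ==> \<tau> (r *\<^sub>R A) = ennreal r * \<tau> A"
 using tr pos_partI by (simp add: is_trace_def)

lemma posop_zero: "posop 0"
 by (simp add: posop_def selfadj_def)

lemma posop_add: assumes "posop A" "posop B" shows "posop (A + B)"
 unfolding posop_def selfadj_def
proof (intro conjI allI)
 fix x y
 show "(A + B) $ x \<bullet> y = x \<bullet> (A + B) $ y"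
  using assms by (simp add: posop_def selfadj_def blinfun.add_left inner_add_left inner_add_right)
 have "0 <= A $ x \<bullet> x" "0 <= B $ x \<bullet> x" using assms by (auto simp only: posop_def)
 thus "0 <= (A + B) $ x \<bullet> x" by (simp only: blinfun.add_left inner_add_left add_nonneg_nonneg)
qed

lemma posop_scale: assumes "posop A" "0 <= r" shows "posop (r *\<^sub>R A)"
 unfolding posop_def selfadj_def
proof (intro conjI allI)
 fix x y
 show "(r *\<^sub>R A) $ x \<bullet> y = x \<bullet> (r *\<^sub>R A) $ y"
  using assms by (simp add: posop_def selfadj_def blinfun.scaleR_left)
 have "0 <= A $ x \<bullet> x" using assms by (auto simp only: posop_def)
 thus "0 <= (r *\<^sub>R A) $ x \<bullet> x" using assms(2) by (simp only: blinfun.scaleR_left inner_scaleR_left mult_nonneg_nonneg)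
qed

lemma posop_conj: assumes "posop A" shows "posop (adj B oL A oL B)"
 unfolding posop_def selfadj_def
proof (intro conjI allI)
 fix x y
 show "(adj B oL A oL B) $ x \<bullet> y = x \<bullet> (adj B oL A oL B) $ y"
  using assms by (simp add: posop_def selfadj_def adj' adj[symmetric])
 have "0 <= A $ B $ x \<bullet> B $ x" using assms by (auto simp only: posop_def)
 thus "0 <= (adj B oL A oL B) $ x \<bullet> x" by (simp only: blinfun_apply_blinfun_compose adj')
qed

lemma trace_zero [simp]: "\<tau> 0 = 0"
 using trace_scale[OF M_zero posop_zero, of 0] by simp

lemma trace_mono: "A \<in> M ==> posop A ==> B \<in> M ==> posop (B - A) ==> \<tau> A <= \<tau> B"
 using trace_add[of A "B - A"] M_diff[of B A] by simp

lemma trace_adj: "A \<in> M ==> \<tau> (adj A oL A) = \<tau> (A oL adj A)"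
 using tr badj_eq[OF M_bounded, of A] unfolding is_trace_def by metis

lemma trace_faithful: "A \<in> M ==> posop A ==> \<tau> A = 0 ==> A = 0"
 using tr_faithful pos_partI by (simp add: faithful_trace_def)

text \<open>The strong limit of an increasing sequence is its least upper bound because forms
  converge pointwise; \<open>normal_trace\<close>, stated for directed sets, then applies to the
  range of the sequence.\<close>

lemma trace_normal_seq:
 assumes P: "\<And>n. P n \<in> M" "\<And>n. posop (P n)" "\<And>n. posop (P (Suc n) - P n)"
  and S: "S \<in> M" "posop S" and lim: "\<And>xi. (\<lambda>n. P n $ xi) ----> S $ xi"
 shows "\<tau> S = (SUP n. \<tau> (P n))"
proof -
 have mono: "posop (P m - P n)" if "n <= m" for m n
  using that
 proof (induction m rule: dec_induct)
  case base
  thus ?case using posop_zero by simp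
 next
  case (step k)
  thus ?case using posop_add[OF P(3)[of k] step.IH] by simp
 qed
 have ub: "posop (S - P n)" for n
  unfolding posop_def
 proof (intro conjI allI)
  show "selfadj (S - P n)"
   using S(2) P(2)[of n] by (simp add: posop_def selfadj_def blinfun.diff_left inner_diff_left inner_diff_right)
  fix xi
  have "(\<lambda>m. (P m - P n) $ xi \<bullet> xi) ----> (S - P n) $ xi \<bullet> xi"
   unfolding blinfun.diff_left by (intro tendsto_intros lim)
  thus "0 <= (S - P n) $ xi \<bullet> xi"
   by (rule LIMSEQ_le_const) (use mono in \<open>auto simp: posop_def\<close>)
 qed
 have le: "op_le (P n) B" if "posop (B - P n)" "B \<in> M" for n B
  unfolding op_le_def using that M_diff[OF that(2) P(1)[of n]] M_bounded by (intro positive_opI) auto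
 have lub: "op_le S R" if R: "R \<in> positive_part M" "\<forall>A\<in>range P. op_le A R" for R
 proof -
  have RM: "R \<in> M" using R(1) by (simp add: positive_part_def)
  have "cinner ((R - S) $ xi) xi \<in> \<real>\<^sub>\<ge>\<^sub>0" for xi
  proof -
   have p: "cinner ((R - P n) $ xi) xi \<in> \<real>\<^sub>\<ge>\<^sub>0" for n
    using R(2) by (auto simp: op_le_def positive_op_def)
   have "(\<lambda>n. (R - P n) $ xi \<bullet> xi) ----> (R - S) $ xi \<bullet> xi"
    unfolding blinfun.diff_left by (intro tendsto_intros lim)
   hence "0 <= (R - S) $ xi \<bullet> xi"
    by (rule LIMSEQ_le_const) (use p in \<open>auto simp: complex_nonneg_Reals_iff inner_eq_Re_cinner\<close>)
   \<comment> \<open>\<open>positive_op\<close> refers to the complex form, so the imaginary part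
     has to be shown to vanish in the limit as well.\<close>
   moreover have "(\<lambda>n. Jop $ ((R - P n) $ xi) \<bullet> xi) ----> Jop $ ((R - S) $ xi) \<bullet> xi"
    unfolding blinfun.diff_left by (intro tendsto_intros lim)
   moreover have "Jop $ ((R - P n) $ xi) \<bullet> xi = 0" for n
    using p[of n] by (simp add: complex_nonneg_Reals_iff Im_cinner)
   ultimately show ?thesis
    by (simp add: LIMSEQ_const_iff complex_nonneg_Reals_iff Im_cinner inner_eq_Re_cinner)
  qed
  thus ?thesis unfolding op_le_def positive_op_def using M_bounded[OF M_diff[OF RM S(1)]] by blast
 qed
 have "\<tau> S = (SUP A\<in>range P. \<tau> A)"
 proof (rule tr_normal[unfolded normal_trace_def, rule_format], intro conjI ballI allI impI)
  show "range P \<subseteq> positive_part M" "S \<in> positive_part M" using P S pos_partI by auto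
  fix A B assume "A \<in> range P" "B \<in> range P"
  then obtain m n where mn: "A = P m" "B = P n" by blast
  show "\<exists>C\<in>range P. op_le A C \<and> op_le B C"
   unfolding mn by (intro bexI[of _ "P (max m n)"] conjI le mono P(1)) auto
 next
  fix A assume "A \<in> range P"
  thus "op_le A S" using le ub S(1) by auto
 qed (use lub in auto)
 thus ?thesis by (simp add: image_image)
qed

subsection \<open>Invariant subspaces and their dimension\<close>

text \<open>The closed subspaces invariant under the commutant are the ranges of the projections of \<open>M\<close>; their
 dimension and codimension replace comparison theory.\<close>

definition msub :: "'h set => bool" where
 "msub V \<longleftrightarrow> subspace V \<and> closed V \<and> (\<forall>B\<in>commutant M. \<forall>xi\<in>V. B $ xi \<in> V)"

definition perp :: "'h set => 'h set" where
 "perp V = {xi. \<forall>v\<in>V. xi \<bullet> v = 0}"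

definition dm :: "'h set => ennreal" where
 "dm V = \<tau> (oproj V)"

text \<open>Domains of unbounded operators contain subspaces whose dimension may be infinite; what
  becomes small is the dimension of the complement.\<close>

definition cod :: "'h set => ennreal" where
 "cod V = dm (perp V)"

definition kr :: "('h \<Rightarrow>\<^sub>L 'h) => 'h set" where
 "kr A = {xi. A $ xi = 0}"

lemma msub_sub: "msub V ==> subspace V" and msub_closed: "msub V ==> closed V"
 by (auto simp: msub_def)

lemma Jop_comm: "Jop \<in> commutant M"
 using M_bounded by (auto simp: comm_iff bounded_ops_iff)

lemma oproj_M: assumes V: "msub V" shows "oproj V \<in> M"
proof -
 note s = msub_sub[OF V] msub_closed[OF V]
 have c: "oproj V $ B $ xi = B $ oproj V $ xi" if B: "B \<in> commutant M" for B xi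
 proof (rule oproj_commute[OF s])
  show "B $ x \<bullet> y = x \<bullet> adj B $ y" for x y by (rule adj)
 qed (use V B comm_adj[OF B] in \<open>auto simp: msub_def\<close>)
 have "oproj V \<in> bounded_ops" unfolding bounded_ops_iff using c[OF Jop_comm] by simp
 thus ?thesis unfolding M_iff using c by blast
qed

lemma oproj_posop: assumes "msub V" shows "posop (oproj V)"
 unfolding posop_def using oproj_selfadj[OF msub_sub[OF assms] msub_closed[OF assms]]
 by (simp only: oproj_inner_self[OF msub_sub[OF assms] msub_closed[OF assms]]) simp

lemma msub_Int: "msub V ==> msub W ==> msub (V \<inter> W)"
 by (auto simp: msub_def subspace_inter)

lemma subspace_perp: "subspace (perp V)"
 by (auto simp: perp_def subspace_def inner_add_left)

lemma closed_perp: "closed (perp V)"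
proof -
 have "perp V = (\<Inter>v\<in>V. {xi. xi \<bullet> v = 0})" by (auto simp: perp_def)
 moreover have "closed {xi. xi \<bullet> v = 0}" for v :: 'h by (intro closed_Collect_eq continuous_intros)
 ultimately show ?thesis by auto
qed

lemma msub_perp: assumes "msub V" shows "msub (perp V)"
 unfolding msub_def
proof (intro conjI subspace_perp closed_perp ballI)
 fix B xi assume B: "B \<in> commutant M" and xi: "xi \<in> perp V"
 have "B $ xi \<bullet> v = 0" if "v \<in> V" for v
  using xi assms comm_adj[OF B] that by (simp add: adj perp_def msub_def)
 thus "B $ xi \<in> perp V" by (simp add: perp_def)
qed

lemma oproj_perp: assumes "msub V" shows "oproj (perp V) = id_blinfun - oproj V"
proof (rule blinfun_eqI)
 fix xi
 note s = msub_sub[OF assms] msub_closed[OF assms]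
 have "oproj (perp V) $ xi = xi - oproj V $ xi"
  using oproj_orth[OF s] oproj_in[OF s]
  by (intro oproj_eqI subspace_perp closed_perp) (auto simp: perp_def inner_commute)
 thus "oproj (perp V) $ xi = (id_blinfun - oproj V) $ xi" by (simp add: blinfun.diff_left)
qed

lemma perp_perp: assumes "msub V" shows "perp (perp V) = V"
proof -
 note s = msub_sub[OF assms] msub_closed[OF assms]
 have "oproj (perp (perp V)) = oproj V" using oproj_perp[OF msub_perp[OF assms]] oproj_perp[OF assms] by simp
 thus ?thesis using oproj_fix_iff[OF s] oproj_fix_iff[OF subspace_perp closed_perp] by (metis subset_antisym subsetI)
qed

lemma msub_UNIV: "msub UNIV"
 by (simp add: msub_def)

lemma msub_zero: "msub {0}"
 by (auto simp: msub_def)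

lemma msub_kr: assumes "A \<in> M" shows "msub (kr A)"
 unfolding msub_def
proof (intro conjI ballI)
 show "subspace (kr A)" by (auto simp: kr_def subspace_def blinfun.add_right blinfun.scaleR_right)
 show "closed (kr A)" unfolding kr_def by (intro closed_Collect_eq continuous_intros)
 fix B xi assume B: "B \<in> commutant M" and xi: "xi \<in> kr A"
 show "B $ xi \<in> kr A" using commD[OF B assms, of xi] xi by (simp add: kr_def)
qed

lemma okf_decreasing_tail:
 assumes "f \<in> borel_measurable borel" "0 < c" "\<And>t. c < t ==> 0 <= f t \<and> f t <= K"
 shows "okf (\<lambda>t. f t * indicator {c<..} t)"
proof (rule okf_boundedI[where K = "\<bar>K\<bar>"])
 show "\<bar>f t * indicator {c<..} t\<bar> <= \<bar>K\<bar>" for t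
  using assms(3)[of t] by (auto simp: indicator_def)
qed (use assms in simp)

text \<open>Truncations \<open>C\<close> of the polar part of \<open>B\<close> satisfy \<open>C\<^sup>*C \<up>\<close> support of \<open>B\<close> and
 \<open>CC\<^sup>* \<le>\<close> range projection.\<close>

lemma dm_support_le:
 assumes B: "B \<in> M" and V: "msub V" and BV: "\<And>xi. B $ xi \<in> V"
 shows "dm (perp (kr B)) <= dm V"
proof -
 define a where "a = adj B oL B"
 have a: "a \<in> M" "posop a" using B M_adj M_compose posop_adj_self by (auto simp: a_def)
 \<comment> \<open>Cutting at 1 / (n + 1) keeps t^(-1/2) bounded, so that the truncated polar parts
   are bounded elements of M.\<close>
 define ch where "ch n = (indicator {1 / (real n + 1)<..} :: real => real)" for n
 define P where "P n = fc a (ch n)" for n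
 define S where "S = fc a (indicator {0<..})"
 have okch [simp]: "okf (ch n)" for n by (simp add: ch_def)
 have tail: "okf (\<lambda>t. f t * ch n t)" if "f \<in> borel_measurable borel" "\<And>t. 1 / (real n + 1) < t ==> 0 <= f t \<and> f t <= K" for f K n
  unfolding ch_def using that by (intro okf_decreasing_tail) auto
 have lim: "(\<lambda>n. P n $ xi) ----> S $ xi" for xi
  unfolding P_def S_def
 proof (rule fc_tendsto[OF a(2), where K = 1])
  fix t :: real
  show "(\<lambda>n. ch n t) ----> indicator {0<..} t"
  proof (cases "0 < t")
   case True
   obtain N :: nat where N: "1 / t < real N" using reals_Archimedean2 by blast
   have "ch n t = 1" if "n \<ge> N" for n
   proof -
    have "1 / t < real n + 1" using N that by linarith
    thus ?thesis using True by (simp add: ch_def field_simps)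
   qed
   thus ?thesis using True by (intro tendsto_eventually eventually_sequentiallyI) auto
  next
   case False
   have "ch n t = 0" for n
   proof -
    have "0 < 1 / (real n + 1)" by simp
    hence "\<not> 1 / (real n + 1) < t" using False by linarith
    thus ?thesis by (simp add: ch_def)
   qed
   thus ?thesis using False by simp
  qed
 qed (auto simp: ch_def indicator_def)
 have SP: "S = oproj (perp (kr B))"
 proof -
  have kk: "xi - S $ xi \<in> kr B" for xi
  proof -
   have "a $ (xi - S $ xi) = fc a (\<lambda>t. t * (1 - indicator {0<..} t)) $ xi"
    unfolding S_def using fc_mult_apply[OF a(2) okf_ident, of "\<lambda>t. 1 - indicator {0<..} t" xi]
    by (simp add: fc_ident[OF a(2)] fc_diff[OF a(2)] fc_one[OF a(2)] blinfun.diff_left)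
   also have "fc a (\<lambda>t. t * (1 - indicator {0<..} t)) = fc a (\<lambda>_. 0)"
    by (rule fc_cong[OF a(2) okf_mult[OF okf_ident okf_diff[OF okf_const okf_indicator']]]) (auto simp: indicator_def)
   finally have "a $ (xi - S $ xi) = 0" using fc_const[OF a(2), of 0] by simp
   hence "(norm (B $ (xi - S $ xi)))^2 = 0"
    using adj_self_inner[of B "xi - S $ xi"] by (simp add: a_def)
   thus ?thesis by (simp add: kr_def)
  qed
  have k0: "S $ z = 0" if "z \<in> kr B" for z
  proof -
   have "P n $ z = 0" for n
   proof -
    have ok: "okf (\<lambda>t. (1 / t) * ch n t)"
    proof (rule tail[where K = "real n + 1"])
     fix t :: real assume t: "1 / (real n + 1) < t"
     have "0 < 1 / (real n + 1)" by simp
     hence "0 < t" using t by linarith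
     thus "0 <= 1 / t \<and> 1 / t <= real n + 1" using t by (simp add: field_simps)
    qed simp
    have "ch n = (\<lambda>t. ((1 / t) * ch n t) * t)"
     using divide_nonneg_nonneg[of 1 "real n + 1"] by (auto simp: ch_def indicator_def)
    hence "P n $ z = fc a (\<lambda>t. ((1 / t) * ch n t) * t) $ z" by (simp add: P_def)
    also have "... = fc a (\<lambda>t. (1 / t) * ch n t) $ a $ z"
     using fc_mult_apply[OF a(2) ok okf_ident, of z] by (simp add: fc_ident[OF a(2)])
    also have "a $ z = 0" using that by (simp add: a_def kr_def)
    finally show ?thesis by simp
   qed
   thus ?thesis using lim[of z] by (simp add: LIMSEQ_const_iff)
  qed
  have "oproj (kr B) $ xi = xi - S $ xi" for xi
  proof (rule oproj_eqI[OF msub_sub[OF msub_kr[OF B]] msub_closed[OF msub_kr[OF B]] kk])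
   fix z assume "z \<in> kr B"
   thus "(xi - (xi - S $ xi)) \<bullet> z = 0"
    using k0 selfadjD[OF fc_selfadj[OF a(2)], of "indicator {0<..}" xi z] by (simp add: S_def)
  qed
  hence "S $ xi = oproj (perp (kr B)) $ xi" for xi
   using oproj_perp[OF msub_kr[OF B]] by (simp add: blinfun.diff_left)
  thus ?thesis by (rule blinfun_eqI)
 qed
 have "\<tau> S = (SUP n. \<tau> (P n))"
 proof (rule trace_normal_seq)
  show "P n \<in> M" for n unfolding P_def by (rule M_fc[OF a]) simp
  show "posop (P n)" for n unfolding P_def by (rule posop_fc[OF a(2)]) (auto simp: ch_def)
  show "posop (P (Suc n) - P n)" for n
  proof -
   have "1 / (real (Suc n) + 1) <= 1 / (real n + 1)" by (rule divide_left_mono) auto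
   hence "posop (fc a (\<lambda>t. ch (Suc n) t - ch n t))"
    by (intro posop_fc[OF a(2) okf_diff[OF okch okch]]) (auto simp: ch_def indicator_def)
   thus ?thesis unfolding P_def by (simp add: fc_diff[OF a(2)])
  qed
  show "S \<in> M" unfolding S_def by (rule M_fc[OF a]) simp
  show "posop S" unfolding S_def by (rule posop_fc[OF a(2)]) auto
 qed (rule lim)
 moreover have "\<tau> (P n) <= dm V" for n
 proof -
  define h where "h = (\<lambda>t. (1 / sqrt t) * ch n t)"
  have okh: "okf h"
   unfolding h_def
  proof (rule tail[where K = "sqrt (real n + 1)"])
   fix t :: real assume t: "1 / (real n + 1) < t"
   hence "0 < t" by (meson divide_pos_pos less_trans of_nat_0_le_iff add_nonneg_pos zero_less_one)
   hence "1 / t <= real n + 1" using t by (simp add: field_simps)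
   hence "sqrt (1 / t) <= sqrt (real n + 1)" by (rule real_sqrt_le_mono)
   thus "0 <= 1 / sqrt t \<and> 1 / sqrt t <= sqrt (real n + 1)" using \<open>0 < t\<close> by (simp add: real_sqrt_divide)
  qed simp
  define C where "C = B oL fc a h"
  have CM: "C \<in> M" unfolding C_def by (rule M_compose[OF B M_fc[OF a okh]])
  have shh: "adj (fc a h) = fc a h" using fc_selfadj[OF a(2) okh] selfadj_iff by blast
  have CC: "adj C oL C = P n"
  proof (rule blinfun_eqI)
   fix xi
   have "(adj C oL C) $ xi = fc a h $ a $ fc a h $ xi" unfolding C_def by (simp add: shh) (simp add: a_def)
   also have "... = fc a (\<lambda>t. h t * (t * h t)) $ xi"
    using fc_mult_apply[OF a(2) okf_ident okh] fc_mult_apply[OF a(2) okh okf_mult[OF okf_ident okh]]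
    by (simp add: fc_ident[OF a(2)])
   also have "(\<lambda>t. h t * (t * h t)) = ch n"
   proof
    fix t :: real
    have "0 < t" if "1 / (real n + 1) < t"
     using that by (meson divide_pos_pos less_trans of_nat_0_le_iff add_nonneg_pos zero_less_one)
    thus "h t * (t * h t) = ch n t"
     by (auto simp: h_def ch_def indicator_def field_simps)
   qed
   finally show "(adj C oL C) $ xi = P n $ xi" by (simp add: P_def)
  qed
  have C1: "norm (C $ xi) <= norm xi" for xi
  proof -
   have "(norm (C $ xi))^2 = P n $ xi \<bullet> xi" using adj_self_inner[of C xi] by (simp add: CC)
   also have "... <= fc a (\<lambda>_. 1) $ xi \<bullet> xi" unfolding P_def by (rule fc_mono[OF a(2)]) (auto simp: ch_def indicator_def)
   also have "... = (norm xi)^2" by (simp add: fc_one[OF a(2)] power2_norm_eq_inner)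
   finally show ?thesis by (simp add: power2_le_iff_abs_le)
  qed
  have C2: "norm (adj C $ xi) <= norm xi" for xi
  proof (cases "adj C $ xi = 0")
   case False
   have "(norm (adj C $ xi))^2 = C $ adj C $ xi \<bullet> xi" by (simp add: power2_norm_eq_inner adj)
   also have "... <= norm (C $ adj C $ xi) * norm xi" by (rule norm_cauchy_schwarz)
   also have "... <= norm (adj C $ xi) * norm xi" by (intro mult_right_mono C1) simp
   finally show ?thesis using False by (simp add: power2_eq_square)
  qed simp
  have CV: "C $ xi \<in> V" for xi by (simp add: C_def BV)
  note sV = msub_sub[OF V] msub_closed[OF V]
  have "posop (oproj V - (C oL adj C))"
   unfolding posop_def
  proof (intro conjI allI)
   show "selfadj (oproj V - (C oL adj C))"
    using oproj_selfadj[OF sV] unfolding selfadj_iff by simp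
   fix xi
   have "adj C $ xi = adj C $ oproj V $ xi"
   proof -
    have "eta \<bullet> adj C $ xi = eta \<bullet> adj C $ oproj V $ xi" for eta
     using oproj_fix[OF sV CV[of eta]] selfadjD[OF oproj_selfadj[OF sV], of "C $ eta" xi] by (simp add: adj[symmetric])
    thus ?thesis by (metis vector_eq_ldot)
   qed
   hence "(norm (adj C $ xi))^2 <= (norm (oproj V $ xi))^2" using C2[of "oproj V $ xi"] by (simp add: power_mono)
   thus "0 <= (oproj V - (C oL adj C)) $ xi \<bullet> xi"
    by (simp add: blinfun.diff_left inner_diff_left oproj_inner_self[OF sV] adj_self_inner[of "adj C" xi, simplified])
  qed
  hence "\<tau> (C oL adj C) <= \<tau> (oproj V)"
   using posop_adj_self[of "adj C"] by (intro trace_mono M_compose CM M_adj oproj_M V) auto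
  thus ?thesis using trace_adj[OF CM] by (simp add: CC dm_def)
 qed
 ultimately show ?thesis by (simp add: dm_def SP SUP_least)
qed

lemma dm_mono: assumes "msub V" "msub W" "V \<subseteq> W" shows "dm V <= dm W"
proof -
 have "kr (oproj V) = perp V"
  using oproj_zero_iff[OF msub_sub[OF assms(1)] msub_closed[OF assms(1)]] by (auto simp: kr_def perp_def)
 hence "perp (kr (oproj V)) = V" using perp_perp[OF assms(1)] by simp
 moreover have "dm (perp (kr (oproj V))) <= dm W"
  using assms oproj_in[OF msub_sub[OF assms(1)] msub_closed[OF assms(1)]] by (intro dm_support_le oproj_M) auto
 ultimately show ?thesis by simp
qed

lemma perp_anti: "V \<subseteq> W ==> perp W \<subseteq> perp V"
 by (auto simp: perp_def)

text \<open>The projection onto the complement of W is injective on V. Hence V is the support of B,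
  whose range lies in that complement.\<close>

lemma dm_le_cod: assumes V: "msub V" and W: "msub W" and VW: "V \<inter> W = {0}" shows "dm V <= cod W"
proof -
 note sV = msub_sub[OF V] msub_closed[OF V] and sW = msub_sub[OF W] msub_closed[OF W]
 define B where "B = oproj (perp W) oL oproj V"
 have B: "B \<in> M" unfolding B_def by (intro M_compose oproj_M msub_perp V W)
 have "kr B = perp V"
 proof (rule set_eqI)
  fix xi
  have "xi \<in> kr B \<longleftrightarrow> oproj V $ xi \<in> perp (perp W)"
   unfolding B_def kr_def using oproj_zero_iff[OF subspace_perp closed_perp] by (simp add: perp_def)
  also have "... \<longleftrightarrow> oproj V $ xi = 0"
   unfolding perp_perp[OF W] using oproj_in[OF sV, of xi] VW subspace_0[OF sW(1)] by auto
  also have "... \<longleftrightarrow> xi \<in> perp V" using oproj_zero_iff[OF sV] by (simp add: perp_def)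
  finally show "xi \<in> kr B \<longleftrightarrow> xi \<in> perp V" .
 qed
 hence "perp (kr B) = V" using perp_perp[OF V] by simp
 moreover have "dm (perp (kr B)) <= dm (perp W)"
  by (rule dm_support_le[OF B msub_perp[OF W]]) (simp add: B_def oproj_in[OF subspace_perp closed_perp])
 ultimately show ?thesis by (simp add: cod_def)
qed

lemma dm_split:
 assumes V: "msub V" and W: "msub W" and WV: "W \<subseteq> V"
 shows "dm V = dm W + dm (V \<inter> perp W)"
proof -
 note sV = msub_sub[OF V] msub_closed[OF V] and sW = msub_sub[OF W] msub_closed[OF W]
 have m: "msub (V \<inter> perp W)" by (intro msub_Int V msub_perp W)
 have "oproj V = oproj W + oproj (V \<inter> perp W)"
 proof (rule blinfun_eqI)
  fix xi
  have "oproj (V \<inter> perp W) $ xi = oproj V $ xi - oproj W $ xi"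
  proof (rule oproj_eqI[OF msub_sub[OF m] msub_closed[OF m]])
   have "oproj V $ xi - oproj W $ xi \<in> V"
    using oproj_in[OF sV] oproj_in[OF sW] WV sV by (intro subspace_diff) auto
   moreover have "(oproj V $ xi - oproj W $ xi) \<bullet> w = 0" if "w \<in> W" for w
    using oproj_inner[OF sV, of w xi] oproj_inner[OF sW that, of xi] that WV by (auto simp: inner_diff_left)
   ultimately show "oproj V $ xi - oproj W $ xi \<in> V \<inter> perp W" by (simp add: perp_def)
   fix z assume z: "z \<in> V \<inter> perp W"
   hence "oproj W $ xi \<bullet> z = 0" using oproj_in[OF sW, of xi] by (auto simp: perp_def inner_commute[of z])
   thus "(xi - (oproj V $ xi - oproj W $ xi)) \<bullet> z = 0"
    using oproj_inner[OF sV, of z xi] z by (simp add: inner_diff_left)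
  qed
  thus "oproj V $ xi = (oproj W + oproj (V \<inter> perp W)) $ xi" by (simp add: blinfun.add_left)
 qed
 thus ?thesis unfolding dm_def using trace_add[OF oproj_M[OF W] oproj_posop[OF W] oproj_M[OF m] oproj_posop[OF m]] by simp
qed

text \<open>The part of V orthogonal to V \<inter> W meets W only in 0. This bounds the dimension
  that V loses when it is cut down by W.\<close>

lemma dm_rel: assumes V: "msub V" and W: "msub W" shows "dm (V \<inter> perp (V \<inter> W)) <= cod W"
proof (rule dm_le_cod[OF msub_Int[OF V msub_perp[OF msub_Int[OF V W]]] W])
 have "xi = 0" if "xi \<in> V" "xi \<in> perp (V \<inter> W)" "xi \<in> W" for xi
 proof -
  have "xi \<bullet> xi = 0" using that(2) by (rule perp_def[THEN equalityD1, THEN subsetD, THEN CollectD, THEN bspec]) (use that in simp)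
  thus ?thesis by simp
 qed
 moreover have "0 \<in> V" "0 \<in> W" "0 \<in> perp (V \<inter> W)" using V W subspace_perp by (auto simp: msub_def subspace_0)
 ultimately show "V \<inter> perp (V \<inter> W) \<inter> W = {0}" by auto
qed

text \<open>What \<open>perp (V \<inter> W)\<close> has beyond \<open>perp V\<close> is exactly the
  part of V orthogonal to V \<inter> W, estimated by \<open>dm_rel\<close>.\<close>

lemma cod_Int: assumes V: "msub V" and W: "msub W" shows "cod (V \<inter> W) <= cod V + cod W"
proof -
 note VW = msub_Int[OF V W]
 have "dm (perp (V \<inter> W)) = dm (perp V) + dm (perp (V \<inter> W) \<inter> perp (perp V))"
  by (intro dm_split msub_perp VW V perp_anti) auto
 also have "perp (V \<inter> W) \<inter> perp (perp V) = V \<inter> perp (V \<inter> W)" using perp_perp[OF V] by auto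
 finally show ?thesis using dm_rel[OF V W] by (simp add: cod_def add_left_mono)
qed

text \<open>The preimage of W is the kernel of B, and the range of B lies in the complement of W;
  the support of B is no larger than that.\<close>

lemma preimage:
 assumes A: "A \<in> M" and W: "msub W"
 shows msub_preimage: "msub {xi. A $ xi \<in> W}" and cod_preimage: "cod {xi. A $ xi \<in> W} <= cod W"
proof -
 define B where "B = oproj (perp W) oL A"
 have B: "B \<in> M" unfolding B_def by (intro M_compose oproj_M msub_perp W A)
 have e: "{xi. A $ xi \<in> W} = kr B"
 proof (rule set_eqI)
  fix xi
  have "xi \<in> kr B \<longleftrightarrow> A $ xi \<in> perp (perp W)"
   unfolding B_def kr_def using oproj_zero_iff[OF subspace_perp closed_perp] by (simp add: perp_def)
  thus "xi \<in> {xi. A $ xi \<in> W} \<longleftrightarrow> xi \<in> kr B" by (simp add: perp_perp[OF W])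
 qed
 show "msub {xi. A $ xi \<in> W}" unfolding e by (rule msub_kr[OF B])
 show "cod {xi. A $ xi \<in> W} <= cod W"
  unfolding e cod_def
  by (rule dm_support_le[OF B msub_perp[OF W]]) (simp add: B_def oproj_in[OF subspace_perp closed_perp])
qed

lemma cod_UNIV [simp]: "cod UNIV = 0"
proof -
 have "perp (UNIV::'h set) = {0}" by (auto simp: perp_def)
 moreover have "oproj {0::'h} = 0"
  using oproj_in[OF msub_sub[OF msub_zero] msub_closed[OF msub_zero]] by (intro blinfun_eqI) auto
 ultimately show ?thesis by (simp add: cod_def dm_def)
qed

lemma dm_proj: assumes P: "P \<in> M" "selfadj P" "\<And>xi. P $ P $ xi = P $ xi"
 shows "oproj (kr P) = id_blinfun - P" "oproj (perp (kr P)) = P" "cod (kr P) = \<tau> P"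
proof -
 note s = msub_sub[OF msub_kr[OF P(1)]] msub_closed[OF msub_kr[OF P(1)]]
 have "oproj (kr P) $ xi = xi - P $ xi" for xi
 proof (rule oproj_eqI[OF s])
  show "xi - P $ xi \<in> kr P" by (simp add: kr_def blinfun.diff_right P(3))
  fix z assume "z \<in> kr P"
  thus "(xi - (xi - P $ xi)) \<bullet> z = 0" using selfadjD[OF P(2), of xi z] by (simp add: kr_def)
 qed
 thus e: "oproj (kr P) = id_blinfun - P" by (intro blinfun_eqI) (simp add: blinfun.diff_left)
 thus "oproj (perp (kr P)) = P" using oproj_perp[OF msub_kr[OF P(1)]] by simp
 thus "cod (kr P) = \<tau> P" by (simp add: cod_def dm_def)
qed

end

section \<open>Distribution functions of affiliated operators\<close>

lemma subspace_dense_iff: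
 fixes D :: "'a::{real_inner,complete_space} set"
 assumes D: "subspace D" and z: "\<And>y. (\<And>z. z \<in> D ==> z \<bullet> y = 0) ==> y = 0"
 shows "closure D = UNIV"
proof -
 have s: "subspace (closure D)"
  unfolding subspace_def
 proof (intro conjI ballI allI)
  show "0 \<in> closure D" using subspace_0[OF D] closure_subset by blast
 next
  fix x y assume "x \<in> closure D" "y \<in> closure D"
  then obtain f g where "\<forall>n. f n \<in> D" "f ----> x" "\<forall>n. g n \<in> D" "g ----> y" unfolding closure_sequential by blast
  thus "x + y \<in> closure D"
   unfolding closure_sequential using subspace_add[OF D] by (intro exI[of _ "\<lambda>n. f n + g n"]) (auto intro: tendsto_add)
 next
  fix c x assume "x \<in> closure D"
  then obtain f where "\<forall>n. f n \<in> D" "f ----> x" unfolding closure_sequential by blast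
  thus "c *\<^sub>R x \<in> closure D"
   unfolding closure_sequential using subspace_scale[OF D] by (intro exI[of _ "\<lambda>n. c *\<^sub>R f n"]) (auto intro: tendsto_scaleR)
 qed
 have "x \<in> closure D" for x
 proof -
  obtain y where y: "y \<in> closure D" "\<And>z. z \<in> closure D ==> (x - y) \<bullet> z = 0"
   using ex_orthogonal_projection[OF s closed_closure, of x] by blast
  have "x - y = 0" using y(2) closure_subset by (intro z) (auto simp: inner_commute)
  thus ?thesis using y(1) by simp
 qed
 thus ?thesis by blast
qed

context traced_algebra
begin

definition maff :: "('h \<times> 'h) set => bool" where
 "maff x \<longleftrightarrow> closed_densely_defined x \<and> affiliated x M"

definition good :: "('h \<times> 'h) set => real => 'h set => bool" where
 "good x s V \<longleftrightarrow> (\<forall>xi\<in>V. \<exists>eta. (xi, eta) \<in> x \<and> norm eta <= s * norm xi)"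

definition dst :: "('h \<times> 'h) set => real => ennreal" where
 "dst x s = \<tau> (specF (opT x) {s<..})"

lemma unitary_adj: "U \<in> commutant M ==> unitary_op U ==> unitary_op (adj U) \<and> adj U \<in> commutant M
 \<and> adj U $ U $ xi = xi \<and> U $ adj U $ xi = xi"
 using comm_adj[of U] comm_bounded[of U] adj_bounded_ops[of U]
 unfolding unitary_op_def by (auto simp: badj_eq) (metis blinfun_apply_blinfun_compose blinfun_apply_id_blinfun)+

lemma affiliated_iff:
 "affiliated x M \<longleftrightarrow> (\<forall>U\<in>commutant M. unitary_op U --> (\<forall>(xi, eta)\<in>x. (U $ xi, U $ eta) \<in> x))"
proof
 assume "affiliated x M"
 thus "\<forall>U\<in>commutant M. unitary_op U --> (\<forall>(xi, eta)\<in>x. (U $ xi, U $ eta) \<in> x)"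
  unfolding affiliated_def by (force simp: map_prod_def)
next
 assume h: "\<forall>U\<in>commutant M. unitary_op U --> (\<forall>(xi, eta)\<in>x. (U $ xi, U $ eta) \<in> x)"
 show "affiliated x M"
  unfolding affiliated_def
 proof (intro ballI impI equalityI subsetI)
  fix U p assume U: "U \<in> commutant M" "unitary_op U"
  { assume "p \<in> map_prod (blinfun_apply U) (blinfun_apply U) ` x" thus "p \<in> x" using h U by auto }
  assume p: "p \<in> x"
  have "(adj U $ fst p, adj U $ snd p) \<in> x"
   using h[rule_format, of "adj U" p] unitary_adj[OF U] p by (auto simp: case_prod_unfold)
  moreover have "p = map_prod (blinfun_apply U) (blinfun_apply U) (adj U $ fst p, adj U $ snd p)"
   using unitary_adj[OF U] by simp
  ultimately show "p \<in> map_prod (blinfun_apply U) (blinfun_apply U) ` x" by blast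
 qed
qed

context
 fixes x assumes x: "maff x"
begin

lemma maff_cdd: "closed_densely_defined x" and maff_rop: "rop x"
 using x by (auto simp: maff_def cdd_iff)

lemma maff_resop: "resop (opT x)"
 by (rule resop_opT[OF maff_rop])

lemma maff_posop: "posop (opT x)"
 using maff_resop by (simp add: resop_def)

lemma maff_single: "(xi, eta) \<in> x ==> (xi, eta') \<in> x ==> eta = eta'"
 using maff_rop by (auto simp: rop_def dest: single_valuedD)

lemma maff_add: "(xi, eta) \<in> x ==> (xi', eta') \<in> x ==> (xi + xi', eta + eta') \<in> x"
 using maff_rop subspace_add[of x "(xi, eta)" "(xi', eta')"] by (simp add: rop_def)

lemma maff_scale: "(xi, eta) \<in> x ==> (r *\<^sub>R xi, r *\<^sub>R eta) \<in> x"
 using maff_rop subspace_scale[of x "(xi, eta)" r] by (simp add: rop_def)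

lemma maff_fc: assumes f: "okf f" shows "fc (opT x) f \<in> M"
proof (rule M_unitaryI)
 show "fc (opT x) f \<in> bounded_ops" by (rule fc_opT_bounded_ops[OF maff_cdd f])
 fix U xi assume U: "U \<in> commutant M" "unitary_op U"
 have h: "(U $ xi, U $ eta) \<in> x" if "(xi, eta) \<in> x" "U \<in> commutant M" "unitary_op U" for U xi eta
  using x that unfolding maff_def affiliated_iff by blast
 have "U $ opT x $ om = opT x $ U $ om" for om
  using h U unitary_adj[OF U] by (intro opT_commute[OF maff_rop]) auto
 thus "fc (opT x) f $ U $ xi = U $ fc (opT x) f $ xi" by (intro fc_commute[OF maff_posop f])
qed

lemma maff_specF: "B \<in> sets borel ==> specF (opT x) B \<in> M"
 unfolding specF_def by (rule maff_fc) simp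

lemma dst_spectral: "\<tau> (spectral_projection {s<..} (op_abs x)) = dst x s"
 unfolding dst_def spectral_projection_eq[OF maff_cdd] ..

lemma specF_dim: "B \<in> sets borel ==> oproj (kr (specF (opT x) B)) = id_blinfun - specF (opT x) B"
 "B \<in> sets borel ==> oproj (perp (kr (specF (opT x) B))) = specF (opT x) B"
 "B \<in> sets borel ==> cod (kr (specF (opT x) B)) = \<tau> (specF (opT x) B)"
 using dm_proj[OF maff_specF specF_selfadj[OF maff_resop]] specF_mult[OF maff_resop, of B B] by auto

lemma dst_attained: "0 <= s ==> good x s (kr (specF (opT x) {s<..})) \<and> msub (kr (specF (opT x) {s<..})) \<and> cod (kr (specF (opT x) {s<..})) = dst x s"
 using spectral_low[OF maff_cdd, of s] specF_dim(3)[of "{s<..}"] msub_kr[OF maff_specF, of "{s<..}"]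
 by (auto simp: good_def kr_def dst_def)

text \<open>A nonzero vector common to V and to the range of \<chi>(|x| > s) would contradict
  \<open>spectral_high\<close>. With \<open>dst_attained\<close> this is the min-max principle:
  \<open>dst x s\<close> is the least codimension of an invariant subspace on which x is bounded by
  s.\<close>

lemma dst_le_cod: assumes V: "msub V" "good x s V" shows "dst x s <= cod V"
proof -
 let ?P = "specF (opT x) {s<..}"
 have m: "msub (perp (kr ?P))" by (intro msub_perp msub_kr maff_specF) simp
 have "dst x s = dm (perp (kr ?P))" by (simp add: dst_def dm_def specF_dim(2))
 also have "... <= cod V"
 proof (rule dm_le_cod[OF m V(1)])
  have "xi = 0" if xi: "xi \<in> perp (kr ?P)" "xi \<in> V" for xi
  proof -
   obtain eta where "(xi, eta) \<in> x" "norm eta <= s * norm xi" using V(2) xi(2) by (auto simp: good_def)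
   moreover have "?P $ xi = xi"
    using oproj_fix[OF msub_sub[OF m] msub_closed[OF m] xi(1)] specF_dim(2)[of "{s<..}"] by simp
   ultimately show ?thesis using spectral_high[OF maff_cdd] by blast
  qed
  thus "perp (kr ?P) \<inter> V = {0}" using m V(1) by (auto simp: msub_def subspace_0)
 qed
 finally show ?thesis .
qed

lemma dst_antimono: assumes "0 <= s" "s <= t" shows "dst x t <= dst x s"
proof -
 have "good x t (kr (specF (opT x) {s<..}))"
  using dst_attained[OF assms(1)] assms(2) unfolding good_def
  by (meson mult_right_mono norm_ge_zero order_trans)
 thus ?thesis using dst_le_cod dst_attained[OF assms(1)] by metis
qed

lemma specF_posop: "B \<in> sets borel ==> posop (specF (opT x) B)"
 unfolding specF_def by (rule posop_fc[OF maff_posop]) auto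

lemma specF_Un: assumes "B \<in> sets borel" "C \<in> sets borel" "B \<inter> C = {}"
 shows "specF (opT x) (B \<union> C) = specF (opT x) B + specF (opT x) C"
proof -
 have "(\<lambda>t. indicator (B \<union> C) (sg t)) = (\<lambda>t. indicator B (sg t) + indicator C (sg t) :: real)"
  using assms(3) by (intro ext) (auto split: split_indicator)
 thus ?thesis unfolding specF_def using assms by (simp only: fc_add[OF maff_posop okf_sg_indicator okf_sg_indicator])
qed

lemma specF_incr:
 assumes "\<And>n. B n \<in> sets borel" "C \<in> sets borel" "\<And>n. B n \<subseteq> B (Suc n)" "\<And>xi. (\<lambda>n. specF (opT x) (B n) $ xi) ----> specF (opT x) C $ xi"
 shows "\<tau> (specF (opT x) C) = (SUP n. \<tau> (specF (opT x) (B n)))"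
proof (rule trace_normal_seq)
 show "posop (specF (opT x) (B (Suc n)) - specF (opT x) (B n))" for n
 proof -
  have "B (Suc n) = B n \<union> (B (Suc n) - B n)" using assms(3) by auto
  hence "specF (opT x) (B (Suc n)) - specF (opT x) (B n) = specF (opT x) (B (Suc n) - B n)"
   using specF_Un[of "B n" "B (Suc n) - B n"] assms(1) by (simp add: Diff_Int_distrib)
  thus ?thesis using specF_posop assms(1) by simp
 qed
qed (use assms maff_specF specF_posop in auto)

lemma dst_right_continuous: "dst x s = (SUP n. dst x (s + 1 / (real n + 1)))"
 unfolding dst_def
proof (rule specF_incr)
 show "{s + 1 / (real n + 1)<..} \<subseteq> {s + 1 / (real (Suc n) + 1)<..}" for n
 proof -
  have "1 / (real (Suc n) + 1) <= 1 / (real n + 1)" by (rule divide_left_mono) auto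
  thus ?thesis by auto
 qed
qed (use specF_right_continuous[OF maff_resop] in auto)

text \<open>By normality the traces of \<chi>(s < |x| \<le> n) have supremum \<open>dst x s\<close>.
  If every \<open>dst x n\<close> exceeded kap, they would stay below that value by kap, which is
  impossible as it is finite.\<close>

lemma dst_vanish:
 assumes "0 <= s" "dst x s < \<infinity>" "0 < kap" shows "\<exists>n::nat. dst x (real n) <= ennreal kap"
proof -
 have lim: "(\<lambda>n. specF (opT x) {s<..real n} $ xi) ----> specF (opT x) {s<..} $ xi" for xi
 proof -
  have "specF (opT x) {s<..real n} $ xi = specF (opT x) {..real n} $ specF (opT x) {s<..} $ xi" for n
   by (subst specF_mult[OF maff_resop]) (auto simp: greaterThanAtMost_def Int_commute)
  thus ?thesis using specF_atMost_tendsto[OF maff_resop] by simp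
 qed
 have sup: "dst x s = (SUP n. \<tau> (specF (opT x) {s<..real n}))"
  unfolding dst_def by (rule specF_incr) (use lim in auto)
 show ?thesis
 proof (rule ccontr)
  assume "\<not> ?thesis"
  hence big: "ennreal kap < dst x (real n)" for n by (simp add: not_le)
  have "dst x s + 0 < dst x s + ennreal kap" using assms by (subst ennreal_add_left_cancel_less) auto
  moreover have "\<tau> (specF (opT x) {s<..real n}) + ennreal kap <= dst x s" for n
  proof (cases "s <= real n")
   case True
   hence "{s<..} = {s<..real n} \<union> {real n<..}" by auto
   hence "specF (opT x) {s<..} = specF (opT x) {s<..real n} + specF (opT x) {real n<..}"
    using specF_Un[of "{s<..real n}" "{real n<..}"] by (simp add: disjoint_iff)
   hence "dst x s = \<tau> (specF (opT x) {s<..real n}) + dst x (real n)"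
    unfolding dst_def using maff_specF specF_posop by (simp add: trace_add)
   thus ?thesis using big[of n] by (simp add: add_left_mono less_imp_le)
  next
   case False
   hence "{s<..real n} = {}" by auto
   moreover have "specF (opT x) {} = 0" unfolding specF_def using fc_const[OF maff_posop, of 0] by simp
   moreover obtain m :: nat where "s <= real m" using real_arch_simple by blast
   ultimately show ?thesis
    using big[of m] dst_antimono[OF assms(1) \<open>s <= real m\<close>] by simp
  qed
  hence "(SUP n. \<tau> (specF (opT x) {s<..real n}) + ennreal kap) <= dst x s" by (rule SUP_least)
  hence "dst x s + ennreal kap <= dst x s" by (subst (1) sup) (simp add: ennreal_SUP_add_left)
  ultimately show False by simp
 qed
qed

end

lemma measurable_ops_iff: "x \<in> mops \<longleftrightarrow> maff x \<and> (\<exists>s\<ge>0. dst x s < \<infinity>)"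
 unfolding measurable_ops_def maff_def
 using dst_spectral[unfolded maff_def, of x] by auto

lemma gen_singular_value_eq:
 "maff x ==> gen_singular_value \<tau> x t = Inf {ennreal s |s. 0 <= s \<and> dst x s <= ennreal t}"
 unfolding gen_singular_value_def by (simp add: dst_spectral)

lemma gen_singular_value_less:
 "maff x ==> gen_singular_value \<tau> x t < ennreal eps \<longleftrightarrow> (\<exists>s\<ge>0. s < eps \<and> dst x s <= ennreal t)"
 unfolding gen_singular_value_eq Inf_less_iff by (auto simp: ennreal_less_iff)

text \<open>Sums enter through closures of graphs, so the pointwise relation is at hand only on
  invariant subspaces of arbitrarily small codimension kap. Intersecting with the two optimal
  subspaces costs kap, which then tends to 0.\<close>

lemma dst_triangle:
 assumes z: "maff z1" "maff z2" "maff z3" and st: "0 <= s" "0 <= t"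
  and sum: "\<And>kap::real. 0 < kap ==> \<exists>V. msub V \<and> cod V <= ennreal kap \<and>
   (\<forall>xi\<in>V. \<forall>eta1 eta2. (xi, eta1) \<in> z1 --> (xi, eta2) \<in> z2 --> (xi, eta1 + eta2) \<in> z3)"
 shows "dst z3 (s + t) <= dst z1 s + dst z2 t"
proof (rule ennreal_le_epsilon)
 fix kap :: real assume "0 < kap"
 then obtain V where V: "msub V" "cod V <= ennreal kap"
  "\<And>xi eta1 eta2. xi \<in> V ==> (xi, eta1) \<in> z1 ==> (xi, eta2) \<in> z2 ==> (xi, eta1 + eta2) \<in> z3" using sum by blast
 define V1 where "V1 = kr (specF (opT z1) {s<..})"
 define V2 where "V2 = kr (specF (opT z2) {t<..})"
 have V1: "good z1 s V1" "msub V1" "cod V1 = dst z1 s" using dst_attained[OF z(1) st(1)] by (auto simp: V1_def)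
 have V2: "good z2 t V2" "msub V2" "cod V2 = dst z2 t" using dst_attained[OF z(2) st(2)] by (auto simp: V2_def)
 have "good z3 (s + t) (V1 \<inter> V2 \<inter> V)"
  unfolding good_def
 proof
  fix xi assume xi: "xi \<in> V1 \<inter> V2 \<inter> V"
  obtain eta1 eta2 where "(xi, eta1) \<in> z1" "norm eta1 <= s * norm xi" "(xi, eta2) \<in> z2" "norm eta2 <= t * norm xi"
   using V1(1) V2(1) xi unfolding good_def by blast
  thus "\<exists>eta. (xi, eta) \<in> z3 \<and> norm eta <= (s + t) * norm xi"
   using V(3)[of xi eta1 eta2] xi norm_triangle_ineq[of eta1 eta2] by (intro exI[of _ "eta1 + eta2"]) (simp add: distrib_right)
 qed
 hence "dst z3 (s + t) <= cod (V1 \<inter> V2 \<inter> V)"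
  by (intro dst_le_cod z msub_Int V1 V2 V)
 also have "... <= cod (V1 \<inter> V2) + cod V" by (intro cod_Int msub_Int V1 V2 V)
 also have "... <= (cod V1 + cod V2) + ennreal kap" by (intro add_mono cod_Int V1 V2 V)
 finally show "dst z3 (s + t) <= dst z1 s + dst z2 t + ennreal kap" by (simp add: V1(3) V2(3))
qed

subsection \<open>Bounded elements\<close>

lemma graph_of_iff [simp]: "(xi, eta) \<in> graph_of A \<longleftrightarrow> eta = A $ xi"
 by (auto simp: graph_of_def)

lemma maff_graph: assumes A: "A \<in> M" shows "maff (graph_of A)"
proof -
 have "closed {p. snd p = A $ fst p}" by (intro closed_Collect_eq continuous_intros)
 moreover have "graph_of A = {p. snd p = A $ fst p}" by auto
 ultimately have "closed (graph_of A)" by simp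
 moreover have "Domain (graph_of A) = UNIV" by (auto simp: Domain_iff)
 ultimately have "rop (graph_of A)"
  by (auto simp: rop_def subspace_def single_valued_def blinfun.add_right blinfun.scaleR_right zero_prod_def)
 moreover have "iinv (graph_of A)" using bounded_ops_ii[OF M_bounded[OF A]] by (auto simp: iinv_def)
 moreover have "affiliated (graph_of A) M" unfolding affiliated_iff using commD A by auto
 ultimately show ?thesis by (simp add: maff_def cdd_iff)
qed

definition dA :: "('h \<Rightarrow>\<^sub>L 'h) => real => ennreal" where
 "dA A s = dst (graph_of A) s"

lemma dA_le: "A \<in> M ==> msub V ==> (\<And>xi. xi \<in> V ==> norm (A $ xi) <= s * norm xi) ==> dA A s <= cod V"
 unfolding dA_def by (rule dst_le_cod[OF maff_graph]) (auto simp: good_def)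

lemma dA_attained:
 assumes "A \<in> M" "0 <= s" obtains V where "msub V" "\<And>xi. xi \<in> V ==> norm (A $ xi) <= s * norm xi" "cod V = dA A s"
 using dst_attained[OF maff_graph[OF assms(1)] assms(2)] by (auto simp: dA_def good_def)

lemma dA_antimono: "A \<in> M ==> 0 <= s ==> s <= t ==> dA A t <= dA A s"
 unfolding dA_def by (rule dst_antimono[OF maff_graph])

lemma dA_norm: "A \<in> M ==> (\<And>xi. norm (A $ xi) <= s * norm xi) ==> dA A s = 0"
 using dA_le[OF _ msub_UNIV, of A s] by simp

lemma dA_add: assumes A: "A \<in> M" "B \<in> M" "0 <= s" "0 <= t" shows "dA (A + B) (s + t) <= dA A s + dA B t"
 unfolding dA_def
 by (rule dst_triangle[OF maff_graph maff_graph maff_graph])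
  (use A M_add in \<open>auto simp: blinfun.add_left intro!: exI[of _ UNIV] msub_UNIV\<close>)

lemma dA_minus: assumes "A \<in> M" "0 <= s" shows "dA (- A) s <= dA A s"
proof -
 obtain V where V: "msub V" "\<And>xi. xi \<in> V ==> norm (A $ xi) <= s * norm xi" "cod V = dA A s" using dA_attained[OF assms] by blast
 have "- A \<in> M" using M_scaleR[OF assms(1), of "-1"] by simp
 thus ?thesis using V dA_le[of "- A" V s] by (simp add: blinfun.minus_left)
qed

lemma dA_diff: assumes A: "A \<in> M" "B \<in> M" "0 <= s" "0 <= t" shows "dA (A - B) (s + t) <= dA A s + dA B t"
proof -
 have "- B \<in> M" using M_scaleR[OF A(2), of "-1"] by simp
 hence "dA (A + - B) (s + t) <= dA A s + dA (- B) t" using A by (intro dA_add)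
 also have "... <= dA A s + dA B t" using dA_minus A by (intro add_left_mono)
 finally show ?thesis by simp
qed

text \<open>On the vectors of W that B maps into V the two bounds multiply, and the preimage of V
  has no larger codimension than V.\<close>

lemma dA_compose: assumes A: "A \<in> M" "B \<in> M" "0 <= s" "0 <= t" shows "dA (A oL B) (s * t) <= dA A s + dA B t"
proof -
 obtain V where V: "msub V" "\<And>xi. xi \<in> V ==> norm (A $ xi) <= s * norm xi" "cod V = dA A s" using dA_attained[OF A(1,3)] by blast
 obtain W where W: "msub W" "\<And>xi. xi \<in> W ==> norm (B $ xi) <= t * norm xi" "cod W = dA B t" using dA_attained[OF A(2,4)] by blast
 have "dA (A oL B) (s * t) <= cod ({xi. B $ xi \<in> V} \<inter> W)"
 proof (rule dA_le)
  fix xi assume xi: "xi \<in> {xi. B $ xi \<in> V} \<inter> W"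
  hence "norm (A $ B $ xi) <= s * norm (B $ xi)" using V(2) by auto
  also have "... <= s * (t * norm xi)" using W(2) xi A(3) by (intro mult_left_mono) auto
  finally show "norm ((A oL B) $ xi) <= s * t * norm xi" by simp
 qed (intro M_compose A msub_Int msub_preimage V W)+
 also have "... <= cod {xi. B $ xi \<in> V} + cod W" by (intro cod_Int msub_preimage A V W)
 also have "... <= cod V + cod W" by (intro add_right_mono cod_preimage A V)
 finally show ?thesis by (simp add: V W)
qed

lemma dA_left: assumes A: "A \<in> M" "C \<in> M" "\<And>xi. norm (C $ xi) <= norm xi" "0 <= s" shows "dA (C oL A) s <= dA A s"
 using dA_compose[OF A(2,1), of 1 s] dA_norm[OF A(2), of 1] A(3,4) by simp

lemma dA_right: assumes A: "A \<in> M" "C \<in> M" "\<And>xi. norm (C $ xi) <= norm xi" "0 <= s" shows "dA (A oL C) s <= dA A s"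
 using dA_compose[OF A(1,2), of s 1] dA_norm[OF A(2), of 1] A(3,4) by simp

text \<open>Where adj A maps into V, the squared norm of adj A eta is the inner product of A (adj A
  eta) with eta, which gives the bound s; the preimage of V under adj A has codimension at most that
  of V.\<close>

lemma dA_adj: assumes A: "A \<in> M" "0 <= s" shows "dA (adj A) s = dA A s"
proof -
 have le: "dA (adj A) s <= dA A s" if A: "A \<in> M" for A
 proof -
  obtain V where V: "msub V" "\<And>xi. xi \<in> V ==> norm (A $ xi) <= s * norm xi" "cod V = dA A s" using dA_attained[OF A assms(2)] by blast
  note sV = msub_sub[OF V(1)] msub_closed[OF V(1)]
  define B where "B = oproj (perp V) oL adj A"
  have B: "B \<in> M" unfolding B_def by (intro M_compose oproj_M msub_perp V M_adj A)
  have "dA (adj A) s <= cod (kr B)"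
  proof (rule dA_le[OF M_adj[OF A] msub_kr[OF B]])
   fix eta assume "eta \<in> kr B"
   hence "adj A $ eta = oproj V $ adj A $ eta"
    by (simp add: kr_def B_def oproj_perp[OF V(1)] blinfun.diff_left)
   hence e: "adj A $ eta \<in> V" using oproj_in[OF sV] by metis
   show "norm (adj A $ eta) <= s * norm eta"
   proof (cases "adj A $ eta = 0")
    case False
    have "(norm (adj A $ eta))^2 = A $ adj A $ eta \<bullet> eta" by (simp add: power2_norm_eq_inner adj)
    also have "... <= norm (A $ adj A $ eta) * norm eta" by (rule norm_cauchy_schwarz)
    also have "... <= (s * norm (adj A $ eta)) * norm eta" using V(2)[OF e] by (intro mult_right_mono) auto
    finally show ?thesis using False by (simp add: power2_eq_square mult.assoc mult.left_commute)
   qed (use assms(2) in simp)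
  qed
  also have "cod (kr B) <= dm (perp V)"
   unfolding cod_def by (rule dm_support_le[OF B msub_perp[OF V(1)]]) (simp add: B_def oproj_in[OF subspace_perp closed_perp])
  also have "... = dA A s" using V(3) by (simp add: cod_def)
  finally show ?thesis .
 qed
 show ?thesis using le[OF A(1)] le[OF M_adj[OF A(1)]] by simp
qed

lemma dA_support: assumes "A \<in> M" "msub V" "\<And>xi. xi \<in> perp V ==> A $ xi = 0" "0 <= s" shows "dA A s <= dm V"
proof -
 have "dA A s <= cod (perp V)"
  using assms by (intro dA_le msub_perp) auto
 thus ?thesis using perp_perp[OF assms(2)] by (simp add: cod_def)
qed

section \<open>Distribution functions of positive bounded elements\<close>

context
 fixes a :: "'h \<Rightarrow>\<^sub>L 'h" and s :: real
 assumes a: "a \<in> M" "posop a" and s: "0 <= s"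
begin

private definition "Pa = fc a (indicator {s<..})"

lemma fc_high: assumes xi: "fc a (indicator {s<..}) $ xi = xi" "a $ xi \<bullet> xi <= s * (xi \<bullet> xi)" shows "xi = 0"
proof -
 let ?f = "\<lambda>t::real. (t - s) * indicator {s<..} t"
 have ok: "okf ?f" by (intro okf_mult okf_diff) auto
 have "fc a ?f $ xi = fc a (\<lambda>t. t - s) $ xi"
  using fc_mult_apply[OF a(2), of "\<lambda>t. t - s" "indicator {s<..}" xi] xi(1) by simp
 also have "... = a $ xi - s *\<^sub>R xi"
  by (simp add: fc_diff[OF a(2)] fc_ident[OF a(2)] fc_const[OF a(2)] blinfun.diff_left blinfun.scaleR_left)
 finally have "(\<integral>t. ?f t \<partial>smeas a xi) <= 0"
  using fc_inner[OF a(2) ok, of xi] xi(2) by (simp add: inner_diff_left)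
 moreover have "0 <= (\<integral>t. ?f t \<partial>smeas a xi)" by (rule integral_nonneg_AE) (auto simp: indicator_def)
 ultimately have "(\<integral>t. ?f t \<partial>smeas a xi) = 0" by simp
 hence "AE t in smeas a xi. ?f t = 0"
  using integral_nonneg_eq_0_iff_AE[OF smeas_integrable[OF a(2) ok]] by (auto simp: indicator_def)
 hence "AE t in smeas a xi. indicator {s<..} t = (0::real)"
  by (rule eventually_mono) (simp split: split_indicator_asm split_indicator)
 hence "(\<integral>t. indicator {s<..} t \<partial>smeas a xi) = (0::real)" by (rule integral_eq_zero_AE)
 hence "xi \<bullet> xi = 0" using fc_inner[OF a(2), of "indicator {s<..}" xi] xi(1) by simp
 thus ?thesis by simp
qed

lemma fc_low: assumes xi: "fc a (indicator {s<..}) $ xi = 0"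
 shows "a $ xi \<bullet> xi <= s * (xi \<bullet> xi)" "norm (a $ xi) <= s * norm xi"
proof -
 let ?f = "\<lambda>t::real. t * (1 - indicator {s<..} t)"
 have ok: "okf ?f" by (intro okf_mult okf_diff) auto
 have e: "fc a ?f $ xi = a $ xi"
  using fc_mult_apply[OF a(2) okf_ident, of "\<lambda>t. 1 - indicator {s<..} t" xi] xi
  by (simp add: fc_ident[OF a(2)] fc_diff[OF a(2)] fc_one[OF a(2)] blinfun.diff_left)
 have "norm (fc a ?f $ xi) <= s * norm xi"
  by (rule norm_fc_le[OF a(2) ok s]) (use s in \<open>auto simp: indicator_def\<close>)
 thus n: "norm (a $ xi) <= s * norm xi" by (simp add: e)
 have "a $ xi \<bullet> xi <= norm (a $ xi) * norm xi" by (rule norm_cauchy_schwarz)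
 also have "... <= (s * norm xi) * norm xi" by (intro mult_right_mono n) simp
 finally show "a $ xi \<bullet> xi <= s * (xi \<bullet> xi)" by (simp add: dot_square_norm power2_eq_square)
qed

private lemma Pa: "Pa \<in> M" "selfadj Pa" "\<And>xi. Pa $ Pa $ xi = Pa $ xi"
proof -
 show "Pa \<in> M" unfolding Pa_def by (rule M_fc[OF a]) simp
 show "selfadj Pa" unfolding Pa_def by (rule fc_selfadj[OF a(2)]) simp
 have "(\<lambda>t. indicator {s<..} t * indicator {s<..} t) = (indicator {s<..} :: real => real)" by (auto simp: indicator_def)
 thus "Pa $ Pa $ xi = Pa $ xi" for xi unfolding Pa_def by (simp add: fc_mult_apply[OF a(2)])
qed

text \<open>For positive a the norm bound in the min-max principle may be weakened to a bound on the
  form, by \<open>fc_high\<close>. Forms are monotone in a; hence \<open>dA_pos_mono\<close>, and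
  likewise \<open>dA_square\<close>.\<close>

lemma trace_fc_le:
 assumes V: "msub V" "\<And>xi. xi \<in> V ==> a $ xi \<bullet> xi <= s * (xi \<bullet> xi)" shows "\<tau> (fc a (indicator {s<..})) <= cod V"
proof -
 have m: "msub (perp (kr Pa))" by (intro msub_perp msub_kr Pa)
 have "dm (perp (kr Pa)) <= cod V"
 proof (rule dm_le_cod[OF m V(1)])
  have "xi = 0" if xi: "xi \<in> perp (kr Pa)" "xi \<in> V" for xi
  proof -
   have "Pa $ xi = xi" using oproj_fix[OF msub_sub[OF m] msub_closed[OF m] xi(1)] dm_proj(2)[OF Pa] by simp
   thus ?thesis using fc_high V(2)[OF xi(2)] by (simp add: Pa_def)
  qed
  thus "perp (kr Pa) \<inter> V = {0}" using m V(1) by (auto simp: msub_def subspace_0)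
 qed
 thus ?thesis by (simp add: dm_def dm_proj(2)[OF Pa]) (simp add: Pa_def)
qed

lemma dA_pos: "dA a s = \<tau> (fc a (indicator {s<..}))"
proof (rule antisym)
 show "dA a s <= \<tau> (fc a (indicator {s<..}))"
  using dA_le[OF a(1) msub_kr[OF Pa(1)], of s] fc_low dm_proj(3)[OF Pa] by (auto simp: kr_def Pa_def)
 obtain V where V: "msub V" "\<And>xi. xi \<in> V ==> norm (a $ xi) <= s * norm xi" "cod V = dA a s"
  using dA_attained[OF a(1) s] by blast
 have "a $ xi \<bullet> xi <= s * (xi \<bullet> xi)" if "xi \<in> V" for xi
 proof -
  have "a $ xi \<bullet> xi <= norm (a $ xi) * norm xi" by (rule norm_cauchy_schwarz)
  also have "... <= (s * norm xi) * norm xi" using V(2)[OF that] by (intro mult_right_mono) auto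
  finally show ?thesis by (simp add: dot_square_norm power2_eq_square)
 qed
 thus "\<tau> (fc a (indicator {s<..})) <= dA a s" using trace_fc_le[OF V(1)] V(3) by simp
qed

lemma dA_pos_le: "msub V ==> (\<And>xi. xi \<in> V ==> a $ xi \<bullet> xi <= s * (xi \<bullet> xi)) ==> dA a s <= cod V"
 unfolding dA_pos by (rule trace_fc_le)

lemma dA_pos_attained:
 obtains V where "msub V" "\<And>xi. xi \<in> V ==> a $ xi \<bullet> xi <= s * (xi \<bullet> xi)" "cod V = dA a s"
 using msub_kr[OF Pa(1)] fc_low(1) dm_proj(3)[OF Pa] dA_pos that[of "kr Pa"] by (auto simp: kr_def Pa_def)

end

lemma dA_pos_mono:
 assumes a: "a \<in> M" "posop a" "b \<in> M" "posop b" "posop (b - a)" "0 <= s" shows "dA a s <= dA b s"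
proof -
 obtain V where V: "msub V" "\<And>xi. xi \<in> V ==> b $ xi \<bullet> xi <= s * (xi \<bullet> xi)" "cod V = dA b s"
  using dA_pos_attained[OF a(3,4,6)] by blast
 have "a $ xi \<bullet> xi <= b $ xi \<bullet> xi" for xi
  using a(5) unfolding posop_def by (simp add: blinfun.diff_left inner_diff_left)
 hence "dA a s <= cod V" using V(2) by (intro dA_pos_le[OF a(1,2,6) V(1)]) (meson order_trans)
 thus ?thesis by (simp add: V(3))
qed

lemma dA_square: assumes y: "y \<in> M" "0 <= s" shows "dA (adj y oL y) (s^2) = dA y s"
proof -
 let ?a = "adj y oL y"
 have a: "?a \<in> M" "posop ?a" by (auto intro: M_compose M_adj y posop_adj_self)
 have iff: "?a $ xi \<bullet> xi <= s^2 * (xi \<bullet> xi) \<longleftrightarrow> norm (y $ xi) <= s * norm xi" for xi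
 proof -
  have "?a $ xi \<bullet> xi <= s^2 * (xi \<bullet> xi) \<longleftrightarrow> (norm (y $ xi))^2 <= (s * norm xi)^2"
   unfolding adj_self_inner by (simp add: power_mult_distrib power2_norm_eq_inner)
  thus ?thesis using y(2) by (simp add: power_mono_iff)
 qed
 show ?thesis
 proof (rule antisym)
  obtain V where V: "msub V" "\<And>xi. xi \<in> V ==> norm (y $ xi) <= s * norm xi" "cod V = dA y s"
   using dA_attained[OF y] by blast
  show "dA ?a (s^2) <= dA y s"
   using dA_pos_le[OF a, of "s^2" V] V iff by simp
  obtain V where V: "msub V" "\<And>xi. xi \<in> V ==> ?a $ xi \<bullet> xi <= s^2 * (xi \<bullet> xi)" "cod V = dA ?a (s^2)"
   using dA_pos_attained[OF a, of "s^2"] by auto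
  show "dA y s <= dA ?a (s^2)" using dA_le[OF y(1) V(1)] V iff by simp
 qed
qed

end

section \<open>Sums and products of measurable operators\<close>

lemma oproj_oproj:
 assumes "subspace S" "closed S" "subspace T" "closed T" "S \<subseteq> T"
 shows "oproj S $ oproj T $ x = oproj S $ x"
proof (rule oproj_eqI[OF assms(1,2) oproj_in[OF assms(1,2)]])
 fix z assume z: "z \<in> S"
 have "(oproj T $ x - oproj S $ x) \<bullet> z = oproj T $ x \<bullet> z - oproj S $ x \<bullet> z" by (rule inner_diff_left)
 also have "... = 0" using oproj_inner[OF assms(3,4), of z x] oproj_inner[OF assms(1,2) z, of x] z assms(5) by auto
 finally show "(oproj T $ x - oproj S $ x) \<bullet> z = 0" .
qed

context traced_algebra
begin

lemma msub_INT: assumes "\<And>n::nat. msub (V n)" shows "msub (\<Inter>n. V n)"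
 using assms unfolding msub_def by (auto intro!: closed_INT) (auto simp: subspace_def)

text \<open>y lies in an intersection of complements whose dimension is below every positive bound;
  faithfulness of the trace makes it zero. This is how density of domains and of domains of adjoints
  is exploited.\<close>

lemma small_orthogonal_zero:
 assumes "\<And>kap::real. 0 < kap ==> \<exists>V. msub V \<and> cod V <= ennreal kap \<and> (\<forall>v\<in>V. v \<bullet> y = 0)"
 shows "y = 0"
proof -
 have "\<exists>V. msub V \<and> cod V <= ennreal (1 / (real n + 1)) \<and> (\<forall>v\<in>V. v \<bullet> y = 0)" for n by (rule assms) simp
 then obtain V where V: "\<And>n. msub (V n)" "\<And>n. cod (V n) <= ennreal (1 / (real n + 1))" "\<And>n v. v \<in> V n ==> v \<bullet> y = 0"
  by metis
 define Y where "Y = (\<Inter>n. perp (V n))"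
 have Y: "msub Y" unfolding Y_def by (intro msub_INT msub_perp V)
 have le: "dm Y <= ennreal (1 / (real n + 1))" for n
 proof -
  have "dm Y <= dm (perp (V n))" by (intro dm_mono Y msub_perp V) (auto simp: Y_def)
  thus ?thesis using V(2)[of n] by (simp add: cod_def)
 qed
 have "dm Y <= 0 + ennreal kap" if "0 < kap" for kap
 proof -
  obtain n where "1 / (real n + 1) < kap"
   using reals_Archimedean[OF \<open>0 < kap\<close>] by (auto simp: inverse_eq_divide add.commute)
  hence "ennreal (1 / (real n + 1)) <= ennreal kap" by (intro ennreal_leI) simp
  from order_trans[OF le this] show ?thesis by simp
 qed
 hence "dm Y <= 0" by (rule ennreal_le_epsilon)
 hence "oproj Y = 0" unfolding dm_def by (intro trace_faithful oproj_M oproj_posop Y) simp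
 moreover have "y \<in> Y" using V(3) by (auto simp: Y_def perp_def inner_commute)
 ultimately show ?thesis using oproj_fix[OF msub_sub[OF Y] msub_closed[OF Y], of y] by simp
qed

text \<open>The projections onto the complements increase and converge strongly by Pythagoras;
  normality applies once the limit is recognized as the projection onto the complement of the
  intersection.\<close>

lemma cod_INT:
 assumes W: "\<And>n::nat. msub (W n)" and dec: "\<And>m n. n <= m ==> W m \<subseteq> W n"
 shows "cod (\<Inter>n. W n) = (SUP n. cod (W n))"
 unfolding cod_def dm_def
proof (rule trace_normal_seq)
 let ?Q = "\<lambda>n. oproj (perp (W n))"
 note mp = msub_perp[OF W] and mI = msub_INT[OF W]
 show "?Q n \<in> M" "posop (?Q n)" for n by (intro oproj_M oproj_posop mp)+
 show "oproj (perp (\<Inter>n. W n)) \<in> M" "posop (oproj (perp (\<Inter>n. W n)))" by (intro oproj_M oproj_posop msub_perp mI)+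
 have s: "?Q n $ ?Q m $ xi = ?Q n $ xi" if "n <= m" for m n xi
  by (intro oproj_oproj subspace_perp closed_perp perp_anti dec that)
 have py: "(norm (?Q m $ xi))^2 = (norm (?Q n $ xi))^2 + (norm (?Q m $ xi - ?Q n $ xi))^2" if "n <= m" for m n xi
  using oproj_pythagoras[OF subspace_perp closed_perp, of "?Q m $ xi" "W n"] s[OF that, of xi] by simp
 show "posop (?Q (Suc n) - ?Q n)" for n
  unfolding posop_def
 proof (intro conjI allI)
  show "selfadj (?Q (Suc n) - ?Q n)"
   using oproj_selfadj[OF subspace_perp closed_perp] by (simp add: selfadj_iff)
  fix xi
  show "0 <= (?Q (Suc n) - ?Q n) $ xi \<bullet> xi"
   using py[of n "Suc n" xi] by (simp add: blinfun.diff_left inner_diff_left oproj_inner_self[OF subspace_perp closed_perp])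
 qed
 fix xi
 have "Cauchy (\<lambda>n. ?Q n $ xi)"
 proof (rule pythagorean_Cauchy)
  show "(norm (?Q m $ xi - ?Q n $ xi))^2 = \<bar>(norm (?Q m $ xi))^2 - (norm (?Q n $ xi))^2\<bar>" if "n <= m" for m n
   using py[OF that, of xi] by simp
  have "norm (?Q n $ xi) <= norm (?Q (Suc n) $ xi)" for n
  proof (rule power2_le_imp_le)
   show "(norm (?Q n $ xi))^2 <= (norm (?Q (Suc n) $ xi))^2" using py[of n "Suc n" xi] by simp
  qed simp
  thus "monoseq (\<lambda>n. norm (?Q n $ xi))" by (intro incseq_imp_monoseq incseq_SucI)
  show "norm (?Q n $ xi) <= norm xi" for n by (rule norm_oproj_le[OF subspace_perp closed_perp])
 qed
 then obtain y where y: "(\<lambda>n. ?Q n $ xi) ----> y" using Cauchy_convergent convergent_def by blast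
 have "oproj (perp (\<Inter>n. W n)) $ xi = y"
 proof (rule oproj_eqI[OF subspace_perp closed_perp])
  show "y \<in> perp (\<Inter>n. W n)"
   using oproj_in[OF subspace_perp closed_perp, of "W _" xi] perp_anti[of "\<Inter>n. W n" "W _"]
   by (intro closed_sequentially[OF closed_perp _ y]) blast
  fix z assume z: "z \<in> perp (\<Inter>n. W n)"
  have "xi - y \<in> W k" for k
  proof -
   have "xi - ?Q n $ xi \<in> W k" if "k <= n" for n
   proof -
    have "xi - ?Q n $ xi = oproj (W n) $ xi" by (simp add: oproj_perp[OF W] blinfun.diff_left)
    thus ?thesis using oproj_in[OF msub_sub[OF W] msub_closed[OF W], of n xi] dec[OF that] by auto
   qed
   hence "xi - ?Q (n + k) $ xi \<in> W k" for n by simp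
   moreover have "(\<lambda>n. xi - ?Q (n + k) $ xi) ----> xi - y"
    by (intro tendsto_intros LIMSEQ_ignore_initial_segment y)
   ultimately show ?thesis by (rule closed_sequentially[OF msub_closed[OF W]])
  qed
  thus "(xi - y) \<bullet> z = 0" using z by (auto simp: perp_def inner_commute)
 qed
 thus "(\<lambda>n. ?Q n $ xi) ----> oproj (perp (\<Inter>n. W n)) $ xi" using y by simp
qed

section \<open>Bounded truncations of affiliated operators\<close>

lemma ex_trunc:
 assumes x: "maff x" and s: "0 <= s"
 shows "\<exists>A\<in>M. \<forall>xi. (specF (opT x) {..s} $ xi, A $ xi) \<in> x \<and> norm (A $ xi) <= s * norm xi"
proof -
 let ?F = "specF (opT x) {..s}"
 have "\<exists>eta. (?F $ xi, eta) \<in> x \<and> norm eta <= s * norm xi" for xi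
 proof -
  obtain eta where "(?F $ xi, eta) \<in> x" "norm eta = norm (fc (opT x) (\<lambda>t. sg t * indicator {..s} (sg t)) $ xi)"
   using specF_in_Domain[OF maff_rop[OF x], of "{..s}" s xi] by auto
  moreover have "norm (fc (opT x) (\<lambda>t. sg t * indicator {..s} (sg t)) $ xi) <= s * norm xi"
   using s by (intro norm_fc_le[OF maff_posop[OF x]] okf_sg_cut) (auto simp: indicator_def sg_nonneg)
  ultimately show ?thesis by auto
 qed
 then obtain f where f: "\<And>xi. (?F $ xi, f xi) \<in> x" "\<And>xi. norm (f xi) <= s * norm xi" by metis
 have eq: "eta = f xi" if "(?F $ xi, eta) \<in> x" for xi eta using maff_single[OF x that f(1)] .
 have "bounded_linear f"
 proof (rule bounded_linear_intro[where K = s])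
  show "f (xi + eta) = f xi + f eta" for xi eta
   using eq[of "xi + eta" "f xi + f eta"] maff_add[OF x f(1) f(1)] by (simp add: blinfun.add_right)
  show "f (r *\<^sub>R xi) = r *\<^sub>R f xi" for r xi
   using eq[of "r *\<^sub>R xi" "r *\<^sub>R f xi"] maff_scale[OF x f(1)] by (simp add: blinfun.scaleR_right)
  show "norm (f xi) <= norm xi * s" for xi using f(2) by (simp add: mult.commute)
 qed
 hence ap: "Blinfun f $ xi = f xi" for xi by (simp add: bounded_linear_Blinfun_apply)
 have FM: "?F \<in> M" by (rule maff_specF[OF x]) simp
 have "Blinfun f \<in> M"
 proof (rule M_unitaryI)
  show "Blinfun f \<in> bounded_ops"
   unfolding bounded_ops_iff ap
  proof
   fix xi
   have "(\<i> *\<^sub>C (?F $ xi), \<i> *\<^sub>C f xi) \<in> x" using maff_cdd[OF x] f(1) by (auto simp: cdd_iff iinv_def)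
   thus "f (\<i> *\<^sub>C xi) = \<i> *\<^sub>C f xi"
    using eq[of "\<i> *\<^sub>C xi"] bounded_ops_ii[OF M_bounded[OF FM]] by simp
  qed
  fix U xi assume U: "U \<in> commutant M" "unitary_op U"
  have "(U $ ?F $ xi, U $ f xi) \<in> x" using x U f(1) unfolding maff_def affiliated_iff by blast
  thus "Blinfun f $ U $ xi = U $ Blinfun f $ xi"
   unfolding ap using eq[of "U $ xi"] commD[OF U(1) FM, of xi] by simp
 qed
 thus ?thesis using f by (intro bexI[of _ "Blinfun f"]) (auto simp: ap)
qed

text \<open>The operator x \<chi>(|x| \<le> s); unlike \<open>trn\<close> it keeps the phase of x,
  so that differences of truncations can approximate differences of operators.\<close>

definition trunc :: "('h \<times> 'h) set => real => 'h \<Rightarrow>\<^sub>L 'h" where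
 "trunc x s = (SOME A. A \<in> M \<and> (\<forall>xi. (specF (opT x) {..s} $ xi, A $ xi) \<in> x \<and> norm (A $ xi) <= s * norm xi))"

lemma
 assumes "maff x" "0 <= s"
 shows trunc_M: "trunc x s \<in> M" and trunc_in: "(specF (opT x) {..s} $ xi, trunc x s $ xi) \<in> x"
  and norm_trunc: "norm (trunc x s $ xi) <= s * norm xi"
proof -
 have "\<exists>A. A \<in> M \<and> (\<forall>xi. (specF (opT x) {..s} $ xi, A $ xi) \<in> x \<and> norm (A $ xi) <= s * norm xi)"
  using ex_trunc[OF assms] by blast
 from someI_ex[OF this] show "trunc x s \<in> M" "(specF (opT x) {..s} $ xi, trunc x s $ xi) \<in> x"
  "norm (trunc x s $ xi) <= s * norm xi" unfolding trunc_def by auto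
qed

lemma trunc_specF:
 assumes x: "maff x" "0 <= s" "s <= t" shows "trunc x t $ specF (opT x) {..s} $ xi = trunc x s $ xi"
proof -
 have "{..t} \<inter> {..s} = {..s}" using x(3) by auto
 hence "specF (opT x) {..t} $ specF (opT x) {..s} $ xi = specF (opT x) {..s} $ xi"
  by (simp add: specF_mult[OF maff_resop[OF x(1)]])
 hence "(specF (opT x) {..s} $ xi, trunc x t $ specF (opT x) {..s} $ xi) \<in> x"
  using trunc_in[of x t "specF (opT x) {..s} $ xi"] x by simp
 thus ?thesis using maff_single[OF x(1) _ trunc_in[OF x(1,2)]] by blast
qed

lemma trunc_tendsto: assumes x: "maff x" "(xi, eta) \<in> x" shows "(\<lambda>n. trunc x (real n) $ xi) ----> eta"
proof -
 obtain \<alpha> where \<alpha>: "(xi, \<alpha>) \<in> absT (opT x)" using closed_op_abs_ex[OF maff_rop[OF x(1)] x(2)] by blast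
 obtain zeta where "(\<lambda>n. trunc x (real n) $ xi) ----> zeta" "(xi, zeta) \<in> x"
  using closed_op_core[OF maff_rop[OF x(1)] \<alpha>, of "\<lambda>n. trunc x (real n) $ xi"] trunc_in[OF x(1)] by auto
 thus ?thesis using maff_single[OF x(1) x(2)] by metis
qed

text \<open>Graphs, not necessarily closed, whose closure is measurable. The fourth clause yields a
  dense domain and a finite value of the distribution function; the fifth, a large domain of the
  adjoint, keeps the closure single valued. Both survive differences and products with elements of
  M.\<close>

definition premeas :: "('h \<times> 'h) set => bool" where
 "premeas Z \<longleftrightarrow> subspace Z \<and> iinv Z \<and> (\<forall>U\<in>commutant M. unitary_op U --> (\<forall>(xi, eta)\<in>Z. (U $ xi, U $ eta) \<in> Z)) \<and>
  (\<forall>kap::real>0. \<exists>V s. msub V \<and> cod V <= ennreal kap \<and> 0 <= s \<and> good Z s V) \<and>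
  (\<forall>kap::real>0. \<exists>W. msub W \<and> cod W <= ennreal kap \<and> W \<subseteq> Domain (radj Z))"

lemma premeas_good: "premeas Z ==> 0 < kap ==> \<exists>V s. msub V \<and> cod V <= ennreal kap \<and> 0 <= s \<and> good Z s V" for kap :: real
 by (simp add: premeas_def)

lemma premeas_adj: "premeas Z ==> 0 < kap ==> \<exists>W. msub W \<and> cod W <= ennreal kap \<and> W \<subseteq> Domain (radj Z)" for kap :: real
 by (simp add: premeas_def)

lemma premeas_measurable:
 assumes "x \<in> mops" shows "premeas x"
proof -
 obtain s0 where x: "maff x" and s0: "0 <= s0" "dst x s0 < \<infinity>" using assms by (auto simp: measurable_ops_iff)
 have g: "\<exists>V s. msub V \<and> cod V <= ennreal kap \<and> 0 <= s \<and> good x s V" if "0 < kap" for kap :: real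
 proof -
  obtain n :: nat where "dst x (real n) <= ennreal kap" using dst_vanish[OF x s0 \<open>0 < kap\<close>] by blast
  thus ?thesis using dst_attained[OF x, of "real n"] by (metis of_nat_0_le_iff)
 qed
 have r: "\<exists>W. msub W \<and> cod W <= ennreal kap \<and> W \<subseteq> Domain (radj x)" if kap: "0 < kap" for kap :: real
 proof -
  obtain n :: nat where n: "dst x (real n) <= ennreal kap" using dst_vanish[OF x s0 kap] by blast
  let ?P = "specF (opT x) {real n<..}" and ?F = "\<lambda>m. specF (opT x) {..real m}"
  note tM = trunc_M[OF x of_nat_0_le_iff] and FM = maff_specF[OF x]
  have PM: "?P \<in> M" by (rule FM) simp
  define B where "B m = trunc x (real m) oL ?P" for m :: nat
  have BM: "B m \<in> M" for m unfolding B_def by (intro M_compose tM PM)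
  have FP: "?F k $ ?P $ xi = ?P $ ?F k $ xi" for k xi
   by (simp add: specF_mult[OF maff_resop[OF x]] Int_commute)
  have BF: "B k = B m oL ?F k" if "k <= m" for k m
  proof (rule blinfun_eqI)
   fix xi
   show "B k $ xi = (B m oL ?F k) $ xi"
    using trunc_specF[OF x(1), of "real k" "real m" "?P $ xi"] that FP[of k xi] by (simp add: B_def)
  qed
  have sF: "adj (specF (opT x) C) = specF (opT x) C" if "C \<in> sets borel" for C
   using specF_selfadj[OF maff_resop[OF x] that] selfadj_iff by blast
  \<comment> \<open>Complements of the ranges of x \<chi>(n < |x| \<le> m). They decrease in m and
    have codimension at most \<open>dst x n\<close>; for eta in their intersection the pairing with
    x xi reduces to that with the bounded trunc x n.\<close>
  define W where "W m = kr (adj (B m))" for m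
  have mW: "msub (W m)" for m unfolding W_def by (intro msub_kr M_adj BM)
  have dec: "W m \<subseteq> W k" if "k <= m" for k m
   unfolding W_def using BF[OF that] sF[of "{..real k}"] by (auto simp: kr_def)
  have "cod (W m) <= ennreal kap" for m
  proof -
   have "cod (W m) <= dm (perp (kr ?P))"
    unfolding W_def cod_def
   proof (rule dm_support_le)
    show "adj (B m) \<in> M" by (intro M_adj BM)
    show "msub (perp (kr ?P))" by (intro msub_perp msub_kr PM)
    fix xi
    have "adj (B m) $ xi = ?P $ adj (trunc x (real m)) $ xi" by (simp add: B_def sF)
    also have "... = oproj (perp (kr ?P)) $ adj (trunc x (real m)) $ xi" using specF_dim(2)[OF x, of "{real n<..}"] by simp
    finally show "adj (B m) $ xi \<in> perp (kr ?P)" using oproj_in[OF subspace_perp closed_perp] by simp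
   qed
   also have "... = dst x (real n)" using specF_dim(2)[OF x, of "{real n<..}"] by (simp add: dm_def dst_def)
   finally show ?thesis using n by simp
  qed
  hence "cod (\<Inter>m. W m) <= ennreal kap" using cod_INT[of W, OF mW dec] by (simp add: SUP_least)
  moreover have "(\<Inter>m. W m) \<subseteq> Domain (radj x)"
  proof
   fix eta assume eta: "eta \<in> (\<Inter>m. W m)"
   have "(eta, adj (trunc x (real n)) $ eta) \<in> radj x"
   proof (rule radjI)
    fix xi xi' assume h: "(xi, xi') \<in> x"
    have "trunc x (real m) $ xi \<bullet> eta = xi \<bullet> adj (trunc x (real n)) $ eta" if "n <= m" for m
    proof -
     have "{real n<..} = - {..real n}" by auto
     hence "xi = ?F n $ xi + ?P $ xi" using specF_compl[OF maff_resop[OF x], of "{..real n}" xi] by simp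
     hence "trunc x (real m) $ xi = trunc x (real m) $ (?F n $ xi + ?P $ xi)" by (rule arg_cong)
     also have "... = trunc x (real m) $ ?F n $ xi + B m $ xi" by (simp add: B_def blinfun.add_right)
     also have "trunc x (real m) $ ?F n $ xi = trunc x (real n) $ xi" using that by (intro trunc_specF[OF x]) auto
     finally show ?thesis
      using eta by (simp add: inner_add_left adj W_def kr_def)
    qed
    hence "eventually (\<lambda>m. trunc x (real m) $ xi \<bullet> eta = xi \<bullet> adj (trunc x (real n)) $ eta) sequentially"
     by (rule eventually_sequentiallyI)
    hence "(\<lambda>m. trunc x (real m) $ xi \<bullet> eta) ----> xi \<bullet> adj (trunc x (real n)) $ eta" by (rule tendsto_eventually)
    moreover have "(\<lambda>m. trunc x (real m) $ xi \<bullet> eta) ----> xi' \<bullet> eta" by (intro tendsto_intros trunc_tendsto[OF x h])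
    ultimately show "xi' \<bullet> eta = xi \<bullet> adj (trunc x (real n)) $ eta" using LIMSEQ_unique by blast
   qed
   thus "eta \<in> Domain (radj x)" by (rule DomainI)
  qed
  ultimately show ?thesis using msub_INT[of W, OF mW] by (intro exI[of _ "\<Inter>m. W m"] conjI)
 qed
 have si: "subspace x" "iinv x" using maff_rop[OF x] maff_cdd[OF x] by (simp_all add: rop_def cdd_iff)
 have af: "\<forall>U\<in>commutant M. unitary_op U --> (\<forall>(xi, eta)\<in>x. (U $ xi, U $ eta) \<in> x)"
  using x by (simp add: maff_def affiliated_iff)
 show ?thesis unfolding premeas_def by (intro conjI allI impI) (fact si af | erule g r)+
qed

lemma closure_graph_invariant:
 assumes "\<And>xi eta. (xi, eta) \<in> Z ==> (B $ xi, B $ eta) \<in> Z" "(xi, eta) \<in> closure Z"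
 shows "(B $ xi, B $ eta) \<in> closure (Z::('h \<times> 'h) set)"
proof -
 obtain f where f: "\<And>n. f n \<in> Z" "f ----> (xi, eta)" using assms(2) unfolding closure_sequential by blast
 have "(B $ fst (f n), B $ snd (f n)) \<in> Z" for n using assms(1) f(1)[of n] by simp
 moreover have "(\<lambda>n. (B $ fst (f n), B $ snd (f n))) ----> (B $ xi, B $ eta)"
  using tendsto_fst[OF f(2)] tendsto_snd[OF f(2)] by (intro tendsto_intros) auto
 ultimately show ?thesis unfolding closure_sequential by (intro exI[of _ "\<lambda>n. (B $ fst (f n), B $ snd (f n))"]) auto
qed

lemma subspace_closure_graph: assumes "subspace (Z::('h \<times> 'h) set)" shows "subspace (closure Z)"
 unfolding subspace_def
proof (intro conjI ballI allI)
 show "0 \<in> closure Z" using subspace_0[OF assms] closure_subset by blast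
next
 fix x y assume "x \<in> closure Z" "y \<in> closure Z"
 then obtain f g where "\<forall>n. f n \<in> Z" "f ----> x" "\<forall>n. g n \<in> Z" "g ----> y" unfolding closure_sequential by blast
 thus "x + y \<in> closure Z"
  unfolding closure_sequential using subspace_add[OF assms] by (intro exI[of _ "\<lambda>n. f n + g n"]) (auto intro: tendsto_add)
next
 fix c x assume "x \<in> closure Z"
 then obtain f where "\<forall>n. f n \<in> Z" "f ----> x" unfolding closure_sequential by blast
 thus "c *\<^sub>R x \<in> closure Z"
  unfolding closure_sequential using subspace_scale[OF assms] by (intro exI[of _ "\<lambda>n. c *\<^sub>R f n"]) (auto intro: tendsto_scaleR)
qed

text \<open>If (0, zeta) is in the closure, zeta is orthogonal to the domain of the adjoint, hence
  zero by \<open>small_orthogonal_zero\<close>; a vector orthogonal to the domain vanishes for the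
  same reason.\<close>

lemma premeas_closure:
 assumes Z: "premeas Z" shows "closure Z \<in> mops"
proof -
 have sZ: "subspace Z" and iZ: "iinv Z" using Z by (auto simp: premeas_def)
 have sv: "eta = eta'" if h: "(xi, eta) \<in> closure Z" "(xi, eta') \<in> closure Z" for xi eta eta'
 proof -
  have "(0, eta - eta') \<in> closure Z" using subspace_diff[OF subspace_closure_graph[OF sZ] h] by simp
  then obtain f where f: "\<And>n. f n \<in> Z" "f ----> (0, eta - eta')" unfolding closure_sequential by blast
  have "eta - eta' = 0"
  proof (rule small_orthogonal_zero)
   fix kap :: real assume "0 < kap"
   then obtain W where W: "msub W" "cod W <= ennreal kap" "W \<subseteq> Domain (radj Z)" using premeas_adj[OF Z] by blast
   have "v \<bullet> (eta - eta') = 0" if v: "v \<in> W" for v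
   proof -
    obtain zeta where zeta: "(v, zeta) \<in> radj Z" using W(3) v by auto
    have "snd (f n) \<bullet> v = fst (f n) \<bullet> zeta" for n using radjD[OF zeta, of "fst (f n)" "snd (f n)"] f(1)[of n] by simp
    moreover have "(\<lambda>n. snd (f n) \<bullet> v) ----> snd (0::'h, eta - eta') \<bullet> v" "(\<lambda>n. fst (f n) \<bullet> zeta) ----> fst (0::'h, eta - eta') \<bullet> zeta"
     by (intro tendsto_intros tendsto_fst tendsto_snd f(2))+
    ultimately have "(eta - eta') \<bullet> v = 0" using LIMSEQ_unique by fastforce
    thus ?thesis by (simp add: inner_commute)
   qed
   thus "\<exists>V. msub V \<and> cod V <= ennreal kap \<and> (\<forall>v\<in>V. v \<bullet> (eta - eta') = 0)" using W by blast
  qed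
  thus ?thesis by simp
 qed
 have good': "good (closure Z) s V" if "good Z s V" for s V
  using that closure_subset[of Z] unfolding good_def by blast
 have sD: "subspace (Domain (closure Z))"
  unfolding Domain_fst by (intro linear_subspace_image linear_fst subspace_closure_graph sZ)
 have "closure (Domain (closure Z)) = UNIV"
 proof (rule subspace_dense_iff[OF sD])
  fix y assume y: "\<And>z. z \<in> Domain (closure Z) ==> z \<bullet> y = 0"
  show "y = 0"
  proof (rule small_orthogonal_zero)
   fix kap :: real assume "0 < kap"
   then obtain V s where "msub V" "cod V <= ennreal kap" "good Z s V" using premeas_good[OF Z] by blast
   thus "\<exists>V. msub V \<and> cod V <= ennreal kap \<and> (\<forall>v\<in>V. v \<bullet> y = 0)"
    using y good' unfolding good_def by (metis DomainI)
  qed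
 qed
 hence "rop (closure Z)" using sv subspace_closure_graph[OF sZ] by (auto simp: rop_def single_valued_def)
 moreover have "iinv (closure Z)"
  using closure_graph_invariant[of Z Jop] iZ unfolding iinv_def by fastforce
 moreover have "affiliated (closure Z) M"
  unfolding affiliated_iff
 proof (intro ballI impI)
  fix U p assume U: "U \<in> commutant M" "unitary_op U" and p: "p \<in> closure Z"
  have "(U $ xi, U $ eta) \<in> Z" if "(xi, eta) \<in> Z" for xi eta using Z U that unfolding premeas_def by blast
  from closure_graph_invariant[OF this, of "fst p" "snd p"] show "case p of (xi, eta) => (U $ xi, U $ eta) \<in> closure Z"
   using p by (simp add: case_prod_unfold)
 qed
 ultimately have m: "maff (closure Z)" by (simp add: maff_def cdd_iff)
 obtain V s where V: "msub V" "cod V <= ennreal 1" "0 <= s" "good Z s V" using premeas_good[OF Z, of 1] by auto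
 have "dst (closure Z) s <= cod V" by (rule dst_le_cod[OF m V(1) good'[OF V(4)]])
 also have "... < \<infinity>" using V(2) by (simp add: order.strict_trans1)
 finally show ?thesis using m V(3) by (auto simp: measurable_ops_iff)
qed

lemma premeas_diff:
 assumes x: "premeas x" and y: "premeas y"
 shows "premeas {(xi, eta - zeta) |xi eta zeta. (xi, eta) \<in> x \<and> (xi, zeta) \<in> y}" (is "premeas ?D")
 unfolding premeas_def
proof (intro conjI allI impI ballI)
 have sx: "subspace x" and sy: "subspace y" using x y by (auto simp: premeas_def)
 show "subspace ?D"
  unfolding subspace_def
 proof (intro conjI ballI allI)
  show "0 \<in> ?D" using subspace_0[OF sx] subspace_0[OF sy] unfolding zero_prod_def by force
 next
  fix p q assume "p \<in> ?D" "q \<in> ?D"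
  then obtain xi eta zeta xi' eta' zeta' where "p = (xi, eta - zeta)" "q = (xi', eta' - zeta')" "(xi, eta) \<in> x" "(xi, zeta) \<in> y" "(xi', eta') \<in> x" "(xi', zeta') \<in> y"
   by blast
  hence "p + q = (xi + xi', (eta + eta') - (zeta + zeta'))" "(xi + xi', eta + eta') \<in> x" "(xi + xi', zeta + zeta') \<in> y"
   using subspace_add[OF sx, of "(xi, eta)" "(xi', eta')"] subspace_add[OF sy, of "(xi, zeta)" "(xi', zeta')"] by auto
  thus "p + q \<in> ?D" by blast
 next
  fix c p assume "p \<in> ?D"
  then obtain xi eta zeta where "p = (xi, eta - zeta)" "(xi, eta) \<in> x" "(xi, zeta) \<in> y" by blast
  hence "c *\<^sub>R p = (c *\<^sub>R xi, c *\<^sub>R eta - c *\<^sub>R zeta)" "(c *\<^sub>R xi, c *\<^sub>R eta) \<in> x" "(c *\<^sub>R xi, c *\<^sub>R zeta) \<in> y"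
   using subspace_scale[OF sx, of "(xi, eta)" c] subspace_scale[OF sy, of "(xi, zeta)" c] by (auto simp: scaleR_diff_right)
  thus "c *\<^sub>R p \<in> ?D" by blast
 qed
 show "iinv ?D"
  using x y unfolding premeas_def iinv_def by (fastforce simp: ii_diff)
 show "case p of (xi, eta) => (U $ xi, U $ eta) \<in> ?D" if "U \<in> commutant M" "unitary_op U" "p \<in> ?D" for U p
  using x y that unfolding premeas_def by (fastforce simp: blinfun.diff_right)
next
 fix kap :: real assume "0 < kap"
 hence k2: "0 < kap / 2" by simp
 have kk: "ennreal (kap / 2) + ennreal (kap / 2) = ennreal kap" using k2 by (simp flip: ennreal_plus)
 obtain V s where V: "msub V" "cod V <= ennreal (kap / 2)" "0 <= s" "good x s V" using premeas_good[OF x k2] by blast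
 obtain W t where W: "msub W" "cod W <= ennreal (kap / 2)" "0 <= t" "good y t W" using premeas_good[OF y k2] by blast
 have "good ?D (s + t) (V \<inter> W)"
  unfolding good_def
 proof
  fix xi assume "xi \<in> V \<inter> W"
  then obtain eta zeta where h: "(xi, eta) \<in> x" "norm eta <= s * norm xi" "(xi, zeta) \<in> y" "norm zeta <= t * norm xi"
   using V(4) W(4) unfolding good_def by blast
  have "norm (eta - zeta) <= (s + t) * norm xi" using norm_triangle_ineq4[of eta zeta] h by (simp add: distrib_right)
  thus "\<exists>eta. (xi, eta) \<in> ?D \<and> norm eta <= (s + t) * norm xi" using h by blast
 qed
 moreover have "cod (V \<inter> W) <= ennreal kap"
  using cod_Int[OF V(1) W(1)] add_mono[OF V(2) W(2)] kk by simp
 ultimately show "\<exists>V s. msub V \<and> cod V <= ennreal kap \<and> 0 <= s \<and> good ?D s V"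
  using msub_Int[OF V(1) W(1)] V(3) W(3) by (intro exI[of _ "V \<inter> W"] exI[of _ "s + t"]) simp
 obtain V' where V': "msub V'" "cod V' <= ennreal (kap / 2)" "V' \<subseteq> Domain (radj x)" using premeas_adj[OF x k2] by blast
 obtain W' where W': "msub W'" "cod W' <= ennreal (kap / 2)" "W' \<subseteq> Domain (radj y)" using premeas_adj[OF y k2] by blast
 have "V' \<inter> W' \<subseteq> Domain (radj ?D)"
 proof
  fix eta assume "eta \<in> V' \<inter> W'"
  then obtain zeta1 zeta2 where "(eta, zeta1) \<in> radj x" "(eta, zeta2) \<in> radj y" using V'(3) W'(3) by blast
  hence "(eta, zeta1 - zeta2) \<in> radj ?D"
   by (fastforce simp: radj_def inner_diff_left inner_diff_right)
  thus "eta \<in> Domain (radj ?D)" by blast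
 qed
 moreover have "cod (V' \<inter> W') <= ennreal kap"
  using cod_Int[OF V'(1) W'(1)] add_mono[OF V'(2) W'(2)] kk by simp
 ultimately show "\<exists>W. msub W \<and> cod W <= ennreal kap \<and> W \<subseteq> Domain (radj ?D)" using msub_Int[OF V'(1) W'(1)] by blast
qed

lemma premeas_right:
 assumes z: "premeas z" and e: "e \<in> M" shows "premeas (graph_of e O z)"
 unfolding premeas_def
proof (intro conjI allI impI ballI)
 have sz: "subspace z" using z by (simp add: premeas_def)
 have iff: "(xi, eta) \<in> graph_of e O z \<longleftrightarrow> (e $ xi, eta) \<in> z" for xi eta by (auto simp: relcomp_unfold)
 show "subspace (graph_of e O z)"
  unfolding subspace_def
 proof (intro conjI ballI allI)
  show "0 \<in> graph_of e O z" using subspace_0[OF sz] iff[of 0 0] by (simp add: zero_prod_def)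
  show "p + q \<in> graph_of e O z" if "p \<in> graph_of e O z" "q \<in> graph_of e O z" for p q
   using that subspace_add[OF sz] iff by (cases p; cases q) (force simp: blinfun.add_right)
  show "c *\<^sub>R p \<in> graph_of e O z" if "p \<in> graph_of e O z" for c p
   using that subspace_scale[OF sz] iff by (cases p) (force simp: blinfun.scaleR_right)
 qed
 show "iinv (graph_of e O z)"
  using z bounded_ops_ii[OF M_bounded[OF e]] unfolding premeas_def iinv_def by (auto simp: iff)
 show "case p of (xi, eta) => (U $ xi, U $ eta) \<in> graph_of e O z" if "U \<in> commutant M" "unitary_op U" "p \<in> graph_of e O z" for U p
 proof -
  obtain xi eta where "p = (xi, eta)" "(e $ xi, eta) \<in> z" using \<open>p \<in> _\<close> by (cases p) (auto simp: iff)
  moreover have "(U $ e $ xi, U $ eta) \<in> z" using z that(1,2) \<open>(e $ xi, eta) \<in> z\<close> unfolding premeas_def by blast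
  ultimately show ?thesis using commD[OF that(1) e, of xi] by (simp add: iff)
 qed
next
 fix kap :: real assume k: "0 < kap"
 obtain V s where V: "msub V" "cod V <= ennreal kap" "0 <= s" "good z s V" using premeas_good[OF z k] by blast
 have "good (graph_of e O z) (s * norm e) {xi. e $ xi \<in> V}"
  unfolding good_def
 proof
  fix xi assume "xi \<in> {xi. e $ xi \<in> V}"
  then obtain eta where h: "(e $ xi, eta) \<in> z" "norm eta <= s * norm (e $ xi)" using V(4) unfolding good_def by blast
  have "s * norm (e $ xi) <= s * (norm e * norm xi)" by (intro mult_left_mono norm_blinfun V)
  thus "\<exists>eta. (xi, eta) \<in> graph_of e O z \<and> norm eta <= s * norm e * norm xi" using h by (intro exI[of _ eta]) (auto simp: relcomp_unfold)
 qed
 thus "\<exists>V s. msub V \<and> cod V <= ennreal kap \<and> 0 <= s \<and> good (graph_of e O z) s V"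
  using preimage[OF e V(1)] V(2,3) by (intro exI[of _ "{xi. e $ xi \<in> V}"] exI[of _ "s * norm e"]) (auto intro: order_trans)
 obtain W where W: "msub W" "cod W <= ennreal kap" "W \<subseteq> Domain (radj z)" using premeas_adj[OF z k] by blast
 have "Domain (radj z) \<subseteq> Domain (radj (graph_of e O z))"
 proof
  fix eta assume "eta \<in> Domain (radj z)"
  then obtain zeta where "(eta, zeta) \<in> radj z" by blast
  hence "(eta, adj e $ zeta) \<in> radj (graph_of e O z)" by (auto intro!: radjI dest: radjD simp: adj)
  thus "eta \<in> Domain (radj (graph_of e O z))" by blast
 qed
 thus "\<exists>W. msub W \<and> cod W <= ennreal kap \<and> W \<subseteq> Domain (radj (graph_of e O z))" using W by blast
qed

lemma premeas_left:
 assumes z: "premeas z" and e: "e \<in> M" shows "premeas (z O graph_of e)"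
 unfolding premeas_def
proof (intro conjI allI impI ballI)
 have sz: "subspace z" using z by (simp add: premeas_def)
 have iff: "(xi, zeta) \<in> z O graph_of e \<longleftrightarrow> (\<exists>eta. (xi, eta) \<in> z \<and> zeta = e $ eta)" for xi zeta by (auto simp: relcomp_unfold)
 show "subspace (z O graph_of e)"
  unfolding subspace_def
 proof (intro conjI ballI allI)
  show "0 \<in> z O graph_of e" using subspace_0[OF sz] iff[of 0 0] by (force simp: zero_prod_def)
  show "p + q \<in> z O graph_of e" if "p \<in> z O graph_of e" "q \<in> z O graph_of e" for p q
  proof -
   obtain xi eta xi' eta' where "p = (xi, e $ eta)" "q = (xi', e $ eta')" "(xi, eta) \<in> z" "(xi', eta') \<in> z"
    using \<open>p \<in> _\<close> \<open>q \<in> _\<close> by (cases p; cases q) (auto simp: iff)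
   thus ?thesis using subspace_add[OF sz, of "(xi, eta)" "(xi', eta')"] by (auto simp: iff blinfun.add_right)
  qed
  show "c *\<^sub>R p \<in> z O graph_of e" if "p \<in> z O graph_of e" for c p
  proof -
   obtain xi eta where "p = (xi, e $ eta)" "(xi, eta) \<in> z" using \<open>p \<in> _\<close> by (cases p) (auto simp: iff)
   thus ?thesis using subspace_scale[OF sz, of "(xi, eta)" c] by (auto simp: iff blinfun.scaleR_right)
  qed
 qed
 show "iinv (z O graph_of e)"
  using z bounded_ops_ii[OF M_bounded[OF e]] unfolding premeas_def iinv_def by (force simp: iff)
 show "case p of (xi, eta) => (U $ xi, U $ eta) \<in> z O graph_of e" if "U \<in> commutant M" "unitary_op U" "p \<in> z O graph_of e" for U p
  using z that commD[OF that(1) e] unfolding premeas_def by (force simp: iff)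
next
 fix kap :: real assume k: "0 < kap"
 obtain V s where V: "msub V" "cod V <= ennreal kap" "0 <= s" "good z s V" using premeas_good[OF z k] by blast
 have "good (z O graph_of e) (norm e * s) V"
  unfolding good_def
 proof
  fix xi assume "xi \<in> V"
  then obtain eta where h: "(xi, eta) \<in> z" "norm eta <= s * norm xi" using V(4) unfolding good_def by blast
  have "norm (e $ eta) <= norm e * norm eta" by (rule norm_blinfun)
  also have "... <= norm e * (s * norm xi)" by (intro mult_left_mono h) simp
  finally show "\<exists>eta. (xi, eta) \<in> z O graph_of e \<and> norm eta <= norm e * s * norm xi" using h by (intro exI[of _ "e $ eta"]) (auto simp: relcomp_unfold)
 qed
 thus "\<exists>V s. msub V \<and> cod V <= ennreal kap \<and> 0 <= s \<and> good (z O graph_of e) s V"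
  using V by (intro exI[of _ V] exI[of _ "norm e * s"]) auto
 obtain W where W: "msub W" "cod W <= ennreal kap" "W \<subseteq> Domain (radj z)" using premeas_adj[OF z k] by blast
 have "{eta. adj e $ eta \<in> W} \<subseteq> Domain (radj (z O graph_of e))"
 proof
  fix eta assume "eta \<in> {eta. adj e $ eta \<in> W}"
  then obtain zeta where "(adj e $ eta, zeta) \<in> radj z" using W(3) by blast
  hence "(eta, zeta) \<in> radj (z O graph_of e)" by (auto intro!: radjI dest: radjD simp: adj)
  thus "eta \<in> Domain (radj (z O graph_of e))" by blast
 qed
 thus "\<exists>W. msub W \<and> cod W <= ennreal kap \<and> W \<subseteq> Domain (radj (z O graph_of e))"
  using preimage[OF M_adj[OF e] W(1)] W(2) by (meson order_trans)
qed

definition sandwich :: "('h \<Rightarrow>\<^sub>L 'h) => ('h \<times> 'h) set => ('h \<times> 'h) set" where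
 "sandwich e z = op_mult (graph_of e) (op_mult z (graph_of e))"

lemma op_diff_measurable: "x \<in> mops ==> y \<in> mops ==> op_diff x y \<in> mops"
 unfolding op_diff_def by (intro premeas_closure premeas_diff premeas_measurable)

lemma sandwich_measurable: "z \<in> mops ==> e \<in> M ==> sandwich e z \<in> mops"
 unfolding sandwich_def op_mult_def
 by (intro premeas_closure premeas_left premeas_right premeas_measurable)

lemma op_diff_rel: "(xi, eta) \<in> x ==> (xi, zeta) \<in> y ==> (xi, eta - zeta) \<in> op_diff x y"
 unfolding op_diff_def by (rule closure_subset[THEN subsetD]) blast

lemma sandwich_rel:
 assumes h: "(e $ xi, eta) \<in> z" shows "(xi, e $ eta) \<in> sandwich e z"
proof -
 have "(xi, eta) \<in> graph_of e O z" by (rule relcompI[OF _ h]) simp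
 hence "(xi, eta) \<in> op_mult z (graph_of e)"
  unfolding op_mult_def by (rule closure_subset[THEN subsetD])
 moreover have "(eta, e $ eta) \<in> graph_of e" by simp
 ultimately show ?thesis
  unfolding sandwich_def op_mult_def[of "graph_of e"] by (intro closure_subset[THEN subsetD] relcompI)
qed

lemma measurable_maff: "x \<in> mops ==> maff x"
 by (simp add: measurable_ops_iff)

lemma measurable_Domain:
 assumes "x \<in> mops" "0 < kap"
 shows "\<exists>V. msub V \<and> cod V <= ennreal kap \<and> V \<subseteq> Domain x"
proof -
 obtain V s where "msub V" "cod V <= ennreal kap" "good x s V"
  using premeas_good[OF premeas_measurable[OF assms(1)] assms(2)] by blast
 thus ?thesis unfolding good_def by blast
qed

subsection \<open>Local convergence in measure\<close>

text \<open>The closures stand in the way of a direct identity between the three graphs. Where e xi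
  lies in the domains of x, y and z, the values are forced by single-valuedness and add up; these xi
  form a preimage of small codimension.\<close>

lemma sandwich_triangle:
 assumes m: "x \<in> mops" "y \<in> mops" "z \<in> mops" and e: "e \<in> M" and st: "0 <= s" "0 <= t"
 shows "dst (sandwich e (op_diff z x)) (s + t) <= dst (sandwich e (op_diff y x)) s + dst (sandwich e (op_diff z y)) t"
proof (rule dst_triangle[OF _ _ _ st])
 show mm: "maff (sandwich e (op_diff y x))" "maff (sandwich e (op_diff z y))" "maff (sandwich e (op_diff z x))"
  by (intro measurable_maff sandwich_measurable op_diff_measurable m e)+
 fix kap :: real assume "0 < kap"
 hence k: "0 < kap / 3" by simp
 have kk: "ennreal (kap / 3) + ennreal (kap / 3) + ennreal (kap / 3) = ennreal kap" using k by (simp flip: ennreal_plus)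
 obtain V1 V2 V3 where V: "msub V1" "cod V1 <= ennreal (kap / 3)" "V1 \<subseteq> Domain x" "msub V2" "cod V2 <= ennreal (kap / 3)" "V2 \<subseteq> Domain y"
  "msub V3" "cod V3 <= ennreal (kap / 3)" "V3 \<subseteq> Domain z"
  using measurable_Domain[OF m(1) k] measurable_Domain[OF m(2) k] measurable_Domain[OF m(3) k] by blast
 have mV: "msub (V1 \<inter> V2 \<inter> V3)" by (intro msub_Int V)
 have "cod (V1 \<inter> V2 \<inter> V3) <= cod V1 + cod V2 + cod V3"
  using cod_Int[OF V(1,4)] cod_Int[OF msub_Int[OF V(1,4)] V(7)] by (meson add_right_mono order_trans)
 also have "... <= ennreal kap" unfolding kk[symmetric] by (intro add_mono V)
 finally have "cod {xi. e $ xi \<in> V1 \<inter> V2 \<inter> V3} <= ennreal kap" using cod_preimage[OF e mV] by (rule order_trans[rotated])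
 moreover have "(xi, eta1 + eta2) \<in> sandwich e (op_diff z x)"
  if h: "e $ xi \<in> V1 \<inter> V2 \<inter> V3" "(xi, eta1) \<in> sandwich e (op_diff y x)" "(xi, eta2) \<in> sandwich e (op_diff z y)" for xi eta1 eta2
 proof -
  obtain a b c where abc: "(e $ xi, a) \<in> x" "(e $ xi, b) \<in> y" "(e $ xi, c) \<in> z" using h(1) V(3,6,9) by blast
  have "eta1 = e $ (b - a)" by (rule maff_single[OF mm(1) h(2) sandwich_rel[OF op_diff_rel[OF abc(2,1)]]])
  moreover have "eta2 = e $ (c - b)" by (rule maff_single[OF mm(2) h(3) sandwich_rel[OF op_diff_rel[OF abc(3,2)]]])
  ultimately have "eta1 + eta2 = e $ (c - a)" by (simp add: blinfun.diff_right)
  thus ?thesis using sandwich_rel[OF op_diff_rel[OF abc(3,1)]] by simp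
 qed
 ultimately show "\<exists>V. msub V \<and> cod V <= ennreal kap \<and> (\<forall>xi\<in>V. \<forall>eta1 eta2. (xi, eta1) \<in> sandwich e (op_diff y x) -->
   (xi, eta2) \<in> sandwich e (op_diff z y) --> (xi, eta1 + eta2) \<in> sandwich e (op_diff z x))"
  using msub_preimage[OF e mV] by (intro exI[of _ "{xi. e $ xi \<in> V1 \<inter> V2 \<inter> V3}"]) blast
qed

text \<open>Strict inequalities in both parameters make these sets open, which the basic
  neighbourhoods need not be.\<close>

definition near :: "('h \<Rightarrow>\<^sub>L 'h) => real => real => ('h \<times> 'h) set => ('h \<times> 'h) set set" where
 "near e eps \<delta> x = {y \<in> mops. \<exists>s\<ge>0. s < eps \<and> dst (sandwich e (op_diff y x)) s < ennreal \<delta>}"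

text \<open>The gaps between \<open>dst\<close> and \<delta> and between s and eps leave room for a
  translate of a basic neighbourhood, by the triangle inequality.\<close>

lemma open_near:
 assumes x: "x \<in> mops" and e: "e \<in> M" "projection_op e" "\<tau> e < \<infinity>"
 shows "local_measure_open M \<tau> (near e eps \<delta> x)"
 unfolding local_measure_open_def
proof (intro conjI ballI)
 show "near e eps \<delta> x \<subseteq> mops" by (auto simp: near_def)
 fix y assume y: "y \<in> near e eps \<delta> x"
 then obtain s where ym: "y \<in> mops" and s: "0 <= s" "s < eps" "dst (sandwich e (op_diff y x)) s < ennreal \<delta>"
  by (auto simp: near_def)
 let ?d = "dst (sandwich e (op_diff y x)) s"
 obtain \<delta>' where \<delta>': "0 < \<delta>'" "?d + ennreal \<delta>' < ennreal \<delta>"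
 proof -
  have d: "?d = ennreal (enn2real ?d)" using order.strict_trans[OF s(3) ennreal_less_top] by simp
  hence d2: "enn2real ?d < \<delta>" using s(3) ennreal_less_iff[of "enn2real ?d" \<delta>] by simp
  show ?thesis
  proof (rule that)
   show "0 < (\<delta> - enn2real ?d) / 2" using d2 by simp
   show "?d + ennreal ((\<delta> - enn2real ?d) / 2) < ennreal \<delta>"
   proof -
    have "?d + ennreal ((\<delta> - enn2real ?d) / 2) = ennreal (enn2real ?d + (\<delta> - enn2real ?d) / 2)"
     using d2 by (subst d) (simp add: ennreal_plus)
    also have "... < ennreal \<delta>"
    proof (rule ennreal_lessI)
     show "0 < \<delta>" using d2 enn2real_nonneg[of ?d] by linarith
     show "enn2real ?d + (\<delta> - enn2real ?d) / 2 < \<delta>" using d2 by (simp add: field_simps)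
    qed
    finally show ?thesis .
   qed
  qed
 qed
 define N where "N = {w \<in> mops. gen_singular_value \<tau> (op_mult (graph_of e) (op_mult w (graph_of e))) \<delta>' < ennreal (eps - s)}"
 have N: "N \<in> local_measure_nhds M \<tau>"
  unfolding local_measure_nhds_def N_def using e \<delta>'(1) s(2)
  by (intro CollectI exI[of _ e] exI[of _ "eps - s"] exI[of _ \<delta>']) auto
 have "z \<in> near e eps \<delta> x" if z: "z \<in> mops" "op_diff z y \<in> N" for z
 proof -
  have "maff (sandwich e (op_diff z y))" using z ym e by (intro measurable_maff sandwich_measurable op_diff_measurable)
  moreover have "gen_singular_value \<tau> (sandwich e (op_diff z y)) \<delta>' < ennreal (eps - s)" using z(2) by (simp add: N_def sandwich_def)
  ultimately obtain t where t: "0 <= t" "t < eps - s" "dst (sandwich e (op_diff z y)) t <= ennreal \<delta>'"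
   using gen_singular_value_less by blast
  have "dst (sandwich e (op_diff z x)) (s + t) <= ?d + dst (sandwich e (op_diff z y)) t"
   by (rule sandwich_triangle[OF x ym z(1) e(1) s(1) t(1)])
  also have "... <= ?d + ennreal \<delta>'" using t(3) by (rule add_left_mono)
  also have "... < ennreal \<delta>" by (rule \<delta>'(2))
  finally show ?thesis using z(1) s(1) t(1,2) unfolding near_def by (intro CollectI conjI exI[of _ "s + t"]) auto
 qed
 hence "{z \<in> mops. op_diff z y \<in> \<Inter>{N}} \<subseteq> near e eps \<delta> x" by auto
 thus "\<exists>F. finite F \<and> F \<subseteq> local_measure_nhds M \<tau> \<and> {z \<in> mops. op_diff z y \<in> \<Inter> F} \<subseteq> near e eps \<delta> x"
  using N by (intro exI[of _ "{N}"]) auto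
qed

text \<open>\<open>op_diff x x\<close> is a closure and is not read off as the zero operator; it
  vanishes on the domain of x, which contains an invariant subspace of codimension at most \<delta>
  / 2.\<close>

lemma near_self:
 assumes x: "x \<in> mops" and e: "e \<in> M" and pos: "0 < eps" "0 < \<delta>"
 shows "x \<in> near e eps \<delta> x"
proof -
 obtain V where V: "msub V" "cod V <= ennreal (\<delta> / 2)" "V \<subseteq> Domain x" using measurable_Domain[OF x, of "\<delta> / 2"] pos by auto
 have "dst (sandwich e (op_diff x x)) 0 <= cod {xi. e $ xi \<in> V}"
 proof (rule dst_le_cod)
  show "maff (sandwich e (op_diff x x))" using x e by (intro measurable_maff sandwich_measurable op_diff_measurable)
  show "msub {xi. e $ xi \<in> V}" by (rule msub_preimage[OF e V(1)])
  show "good (sandwich e (op_diff x x)) 0 {xi. e $ xi \<in> V}"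
   unfolding good_def
  proof
   fix xi assume "xi \<in> {xi. e $ xi \<in> V}"
   then obtain a where "(e $ xi, a) \<in> x" using V(3) by blast
   from sandwich_rel[OF op_diff_rel[OF this this]] show "\<exists>eta. (xi, eta) \<in> sandwich e (op_diff x x) \<and> norm eta <= 0 * norm xi"
    by (intro exI[of _ 0]) simp
  qed
 qed
 also have "... <= ennreal (\<delta> / 2)" using cod_preimage[OF e V(1)] V(2) by (rule order_trans)
 also have "... < ennreal \<delta>" using pos by (simp add: ennreal_less_iff)
 finally show ?thesis using x pos(1) unfolding near_def by (intro CollectI conjI exI[of _ 0]) auto
qed

lemma limitin_near:
 assumes lim: "limitin (subtopology (local_measure_topology M \<tau>) X) u x sequentially"
  and x: "x \<in> mops" and e: "e \<in> M" "projection_op e" "\<tau> e < \<infinity>" and pos: "0 < eps" "0 < \<delta>"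
 shows "\<forall>\<^sub>F n in sequentially. u n \<in> near e eps \<delta> x"
proof -
 have o: "openin (local_measure_topology M \<tau>) (near e eps \<delta> x)"
  unfolding openin_local_measure_topology by (rule open_near[OF x e])
 have "limitin (local_measure_topology M \<tau>) u x sequentially" using lim by (simp add: limitin_subtopology)
 thus ?thesis using o near_self[OF x e(1) pos] unfolding limitin_def by blast
qed

end

section \<open>Integrals of distribution functions\<close>

text \<open>With y = x^th, the bound exp z \<ge> 1 + z is applied to x / y and to 1 / y; the weights
  th and 1 - th cancel the logarithms.\<close>

lemma powr_le_tangent:
 fixes x th :: real assumes "0 <= x" "0 < th" "th <= 1" shows "x powr th <= 1 - th + th * x"
proof (cases "x = 0")
 case False
 hence x: "0 < x" using assms by simp
 define y where "y = x powr th"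
 have y: "0 < y" using x by (simp add: y_def)
 have e1: "x / y = exp ((1 - th) * ln x)" using x by (simp add: y_def powr_def exp_diff left_diff_distrib)
 have e2: "1 / y = exp (- (th * ln x))" using x by (simp add: y_def powr_def exp_minus inverse_eq_divide)
 have "1 + (1 - th) * ln x <= x / y" "1 + - (th * ln x) <= 1 / y" unfolding e1 e2 by (rule exp_ge_add_one_self)+
 hence "th * (1 + (1 - th) * ln x) + (1 - th) * (1 + - (th * ln x)) <= th * (x / y) + (1 - th) * (1 / y)"
  using assms by (intro add_mono mult_left_mono) auto
 hence "1 <= (th * x + (1 - th)) / y" by (simp add: algebra_simps add_divide_distrib diff_divide_distrib)
 hence "y <= th * x + (1 - th)" using y by (simp add: pos_le_divide_eq)
 thus ?thesis by (simp add: y_def)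
qed (use assms in simp)

text \<open>The tangent inequality at a / b. It converts a loss in d^th, which the norm measures,
  into a loss in d, on which superadditivity of traces acts.\<close>

lemma diff_le_powr_diff:
 fixes a b th :: real assumes a: "0 <= a" "a <= b" and th: "0 < th" "th <= 1"
 shows "b - a <= 1 / th * b powr (1 - th) * (b powr th - a powr th)"
proof (cases "b = 0")
 case False
 hence b: "0 < b" using a by simp
 have "(a / b) powr th <= 1 - th + th * (a / b)" using a b th by (intro powr_le_tangent) auto
 hence "b * (a / b) powr th <= b * (1 - th + th * (a / b))" using b by (intro mult_left_mono) auto
 also have "... = b - th * (b - a)" using b by (simp add: field_simps)
 finally have "b * (a / b) powr th <= b - th * (b - a)" .
 moreover have "b * (a / b) powr th = b powr (1 - th) * a powr th" "b = b powr (1 - th) * b powr th"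
  using a b by (simp_all add: powr_divide powr_diff flip: powr_add)
 ultimately have "th * (b - a) <= b powr (1 - th) * (b powr th - a powr th)"
  by (metis (no_types, opaque_lifting) diff_le_eq le_diff_eq add.commute right_diff_distrib)
 thus ?thesis using th by (simp add: field_simps)
qed (use a in simp)

lemma powr_subadditive:
 fixes x y th :: real assumes "0 <= x" "0 <= y" "0 < th" "th <= 1" shows "(x + y) powr th <= x powr th + y powr th"
proof (cases "x + y = 0")
 case False
 hence s: "0 < x + y" using assms by simp
 have k: "z / (x + y) * (x + y) powr th <= z powr th" if z: "0 <= z" "z <= x + y" for z
 proof (cases "z = 0")
  case False
  hence "z / (x + y) = (z / (x + y)) powr 1" using z s by simp
  also have "... <= (z / (x + y)) powr th" using z s assms by (intro powr_mono') auto
  finally have "z / (x + y) * (x + y) powr th <= (z / (x + y)) powr th * (x + y) powr th" by (intro mult_right_mono) auto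
  thus ?thesis using z s by (simp add: powr_divide)
 qed simp
 have "(x + y) powr th = x / (x + y) * (x + y) powr th + y / (x + y) * (x + y) powr th"
  using s by (simp flip: distrib_right add_divide_distrib)
 thus ?thesis using k[of x] k[of y] assms by linarith
qed (use assms in simp)

lemma ennreal_powr_ennreal [simp]: "0 <= x ==> ennreal_powr (ennreal x) r = ennreal (x powr r)"
 by (simp add: ennreal_powr_def)

lemma ennreal_powr_top [simp]: "ennreal_powr top r = top"
 by (simp add: ennreal_powr_def)

lemma ennreal_powr_zero [simp]: "ennreal_powr 0 r = 0"
 by (simp add: ennreal_powr_def)

lemma ennreal_powr_mono: "x <= y ==> 0 <= r ==> ennreal_powr x r <= ennreal_powr y r"
 by (cases x; cases y) (auto simp: powr_mono2 top_unique)

lemma ennreal_powr_subadditive: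
 assumes "0 < th" "th <= 1" shows "ennreal_powr (x + y) th <= ennreal_powr x th + ennreal_powr y th"
 by (cases x; cases y) (use assms in \<open>auto simp: powr_subadditive simp flip: ennreal_plus\<close>)

lemma ennreal_powr_one [simp]: "ennreal_powr x 1 = x"
 by (cases x) auto

lemma measurable_ennreal_powr [measurable]: "(\<lambda>x. ennreal_powr x r) \<in> borel_measurable borel"
 unfolding ennreal_powr_def by measurable

text \<open>A superlevel set is a down-set, hence a countable union of rational half-lines with at
  most one further point.\<close>

lemma borel_measurable_antimono_ennreal:
 fixes f :: "real => ennreal" assumes f: "\<And>x y. x <= y ==> f y <= f x"
 shows "f \<in> borel_measurable borel"
proof (rule borel_measurableI_greater)
 fix c
 define S where "S = {x. c < f x}"
 define U where "U = (\<Union>q\<in>\<rat> \<inter> S. {..q})"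
 have dn: "x \<in> S" if "y \<in> S" "x <= y" for x y using that f[of x y] by (auto simp: S_def)
 have "x = y" if "x \<in> S - U" "y \<in> S - U" for x y
 proof -
  have "\<not> x < y" if h: "x \<in> S - U" "y \<in> S - U" for x y
  proof
   assume "x < y"
   then obtain q where q: "q \<in> \<rat>" "x < q" "q < y" using Rats_dense_in_real by blast
   hence "q \<in> S" using dn[of y q] h by auto
   hence "x \<in> U" using q by (auto simp: U_def intro!: bexI[of _ q])
   thus False using h by simp
  qed
  from this[of x y] this[of y x] show ?thesis using that by force
 qed
 hence "S - U = {} \<or> (\<exists>x. S - U = {x})" by blast
 hence "finite (S - U)" by (metis finite.emptyI finite.insertI)
 hence "S - U \<in> sets borel" by (intro borel_closed finite_imp_closed)
 moreover have "U \<in> sets borel"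
  unfolding U_def using countable_rat by (intro sets.countable_UN' countable_Int1) auto
 moreover have "S = U \<union> (S - U)" using dn by (auto simp: U_def)
 ultimately have "S \<in> sets borel" by (metis sets.Un)
 thus "{x \<in> space borel. c < f x} \<in> sets borel" by (simp add: S_def)
qed

section \<open>The integral functional on distribution functions\<close>

definition distf :: "(real => ennreal) => bool" where
 "distf d \<longleftrightarrow> (\<forall>s t. 0 < s --> s <= t --> d t <= d s)"

lemma distfD: "distf d ==> 0 < s ==> s <= t ==> d t <= d s"
 by (simp add: distf_def)

lemma distf_scale: "distf d ==> 0 < c ==> distf (\<lambda>s. d (c * s))"
 by (simp add: distf_def)

lemma distf_add: "distf d ==> distf d' ==> distf (\<lambda>s. d s + d' s)"
 by (simp add: distf_def add_mono)

lemma distf_measurable: assumes "distf d" shows "(\<lambda>s. d s * indicator {0<..} s) \<in> borel_measurable borel"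
proof -
 have "(\<lambda>s. if 0 < s then d s else top) \<in> borel_measurable borel"
  using assms by (intro borel_measurable_antimono_ennreal) (auto simp: distf_def)
 hence "(\<lambda>s. (if 0 < s then d s else top) * indicator {0<..} s) \<in> borel_measurable borel" by measurable
 moreover have "(\<lambda>s. (if 0 < s then d s else top) * indicator {0<..} s) = (\<lambda>s. d s * indicator {0<..} s)"
  by (auto simp: fun_eq_iff)
 ultimately show ?thesis by simp
qed

lemma distf_measurable_comp:
 assumes d: "distf d" and g: "g \<in> borel_measurable borel" "\<And>x. x \<in> S ==> 0 < g x" and S: "S \<in> sets borel"
 shows "(\<lambda>x. d (g x) * indicator S x) \<in> borel_measurable (borel :: 'b::topological_space measure)"
proof -
 have "(\<lambda>x. (\<lambda>s. d s * indicator {0<..} s) (g x) * indicator S x) \<in> borel_measurable borel"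
  using measurable_compose[OF g(1) distf_measurable[OF d]] S by measurable
 moreover have "(\<lambda>x. (\<lambda>s. d s * indicator {0<..} s) (g x) * indicator S x) = (\<lambda>x. d (g x) * indicator S x)"
  using g(2) by (auto simp: fun_eq_iff indicator_def)
 ultimately show ?thesis by simp
qed

text \<open>After the substitution \<open>r = s\<^sup>p\<close> this is \<open>\<integral> p s^(p-1) d(s)^th ds\<close>; for \<open>th = p/q\<close> it is the \<open>p\<close>-th power of the Lorentz norm.\<close>

definition Lam :: "real => real => (real => ennreal) => ennreal" where
 "Lam p th d = (\<integral>\<^sup>+ r. ennreal_powr (d (r powr (1 / p))) th * indicator {0<..} r \<partial>lborel)"

lemma distf_powr: "distf d ==> 0 <= th ==> distf (\<lambda>s. ennreal_powr (d s) th)"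
 by (auto simp: distf_def intro: ennreal_powr_mono)

lemma Lam_measurable: "distf d ==> 0 <= th ==> (\<lambda>r. ennreal_powr (d (r powr (1 / p))) th * indicator {0<..} r) \<in> borel_measurable borel"
 by (rule distf_measurable_comp[OF distf_powr]) auto

lemma Lam_mono:
 assumes "\<And>s. 0 < s ==> d s <= d' s" "0 <= th" shows "Lam p th d <= Lam p th d'"
 unfolding Lam_def using assms by (intro nn_integral_mono) (auto intro: ennreal_powr_mono split: split_indicator)

lemma Lam_cong: assumes "\<And>s. 0 < s ==> d s = d' s" shows "Lam p th d = Lam p th d'"
 unfolding Lam_def using assms by (intro nn_integral_cong) (auto split: split_indicator)

lemma Lam_scale:
 assumes d: "distf d" and c: "0 < c" "0 < p" "0 <= th"
 shows "Lam p th d = ennreal (c powr p) * Lam p th (\<lambda>s. d (c * s))"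
proof -
 have "Lam p th d = ennreal \<bar>c powr p\<bar> * (\<integral>\<^sup>+ r. ennreal_powr (d ((0 + c powr p * r) powr (1 / p))) th * indicator {0<..} (0 + c powr p * r) \<partial>lborel)"
  unfolding Lam_def using c by (intro nn_integral_real_affine Lam_measurable d) auto
 also have "(\<integral>\<^sup>+ r. ennreal_powr (d ((0 + c powr p * r) powr (1 / p))) th * indicator {0<..} (0 + c powr p * r) \<partial>lborel) = Lam p th (\<lambda>s. d (c * s))"
  unfolding Lam_def using c by (intro nn_integral_cong) (auto simp: powr_mult powr_powr zero_less_mult_iff split: split_indicator)
 finally show ?thesis by simp
qed

lemma Lam_add:
 assumes "distf d" "distf d'" "0 < th" "th <= 1"
 shows "Lam p th (\<lambda>s. d s + d' s) <= Lam p th d + Lam p th d'"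
proof -
 have "Lam p th (\<lambda>s. d s + d' s) <= (\<integral>\<^sup>+ r. ennreal_powr (d (r powr (1 / p))) th * indicator {0<..} r
   + ennreal_powr (d' (r powr (1 / p))) th * indicator {0<..} r \<partial>lborel)"
  unfolding Lam_def using assms by (intro nn_integral_mono) (auto intro: ennreal_powr_subadditive split: split_indicator)
 also have "... = Lam p th d + Lam p th d'"
  unfolding Lam_def using assms by (intro nn_integral_add) (auto intro: Lam_measurable)
 finally show ?thesis .
qed

text \<open>s \<mapsto> d (sqrt s) is the distribution function of the square of the modulus, so
  squaring operators halves the exponent.\<close>

lemma Lam_double: assumes "0 < p" shows "Lam (2 * p) th d = Lam p th (\<lambda>s. d (sqrt s))"
proof -
 have "r powr (1 / (2 * p)) = sqrt (r powr (1 / p))" for r using assms by (simp add: powr_half_sqrt[symmetric] powr_powr mult.commute)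
 thus ?thesis by (simp add: Lam_def)
qed

lemma Lam_finite:
 assumes d: "distf d" and fin: "Lam p th d < \<infinity>" and s: "0 < s" "0 < p" "0 <= th" shows "d s < \<infinity>"
proof (rule ccontr)
 assume "\<not> d s < \<infinity>"
 hence ds: "d s = top" by (simp add: less_top[symmetric])
 have "d u = top" if "0 < u" "u <= s" for u using distfD[OF d that] ds by (simp add: top_unique)
 moreover have "r powr (1 / p) <= s" if "0 < r" "r <= s powr p" for r
  using powr_mono2[of "1 / p" r "s powr p"] that s by (simp add: powr_powr)
 ultimately have "(\<integral>\<^sup>+ r. top * indicator {0<..s powr p} r \<partial>lborel) <= Lam p th d"
  unfolding Lam_def by (intro nn_integral_mono) (auto split: split_indicator)
 moreover have "(\<integral>\<^sup>+ r. top * indicator {0<..s powr p} r \<partial>lborel) = top"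
  using s by (subst nn_integral_cmult_indicator) (auto simp: ennreal_top_mult)
 ultimately show False using fin by (simp add: top_unique)
qed

text \<open>Equals 1 / s times the integral of d over (s, \<infinity>). For the distribution
  function of a positive a it is the trace of the positive part of a / s - 1, see
  \<open>trace_ramp\<close>.\<close>

definition tail :: "(real => ennreal) => real => ennreal" where
 "tail d s = (\<integral>\<^sup>+ v. d (s * v) * indicator {1<..} v \<partial>lborel)"

lemma tail_measurable: "distf d ==> 0 < s ==> (\<lambda>v. d (s * v) * indicator {1<..} v) \<in> borel_measurable borel"
 by (rule distf_measurable_comp) auto

text \<open>Right and left Riemann sums with step kap for the decreasing d; in
  \<open>trace_ramp\<close> they are matched with spectral staircases.\<close>

lemma tail_Riemann:
 assumes d: "distf d" and s: "0 < s" and k: "0 < kap" and z: "d (s * (1 + real N * kap)) = 0"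
 shows "(\<Sum>j<N. ennreal kap * d (s * (1 + real (Suc j) * kap))) <= tail d s"
  and "tail d s <= (\<Sum>j<N. ennreal kap * d (s * (1 + real j * kap)))"
proof -
 let ?g = "\<lambda>v. d (s * v)"
 let ?I = "\<lambda>n. {1<..1 + real n * kap}"
 let ?J = "\<lambda>n. {1 + real n * kap<..1 + real (Suc n) * kap}"
 have mono: "?g w <= ?g v" if "0 < v" "v <= w" for v w using that s by (intro distfD[OF d]) auto
 have pos: "0 < 1 + real n * kap" for n using k by (simp add: add_pos_nonneg)
 have em: "emeasure lborel (?J n) = ennreal kap" for n using k by (simp add: algebra_simps)
 have lo: "ennreal kap * ?g (1 + real (Suc n) * kap) <= (\<integral>\<^sup>+ v. ?g v * indicator (?J n) v \<partial>lborel)" for n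
 proof -
  have "(\<integral>\<^sup>+ v. ?g (1 + real (Suc n) * kap) * indicator (?J n) v \<partial>lborel) <= (\<integral>\<^sup>+ v. ?g v * indicator (?J n) v \<partial>lborel)"
   using pos[of n] by (intro nn_integral_mono) (auto split: split_indicator intro!: mono)
  thus ?thesis using em[of n] by (subst (asm) nn_integral_cmult_indicator) (simp, simp add: mult.commute)
 qed
 have hi: "(\<integral>\<^sup>+ v. ?g v * indicator (?J n) v \<partial>lborel) <= ennreal kap * ?g (1 + real n * kap)" for n
 proof -
  have "(\<integral>\<^sup>+ v. ?g v * indicator (?J n) v \<partial>lborel) <= (\<integral>\<^sup>+ v. ?g (1 + real n * kap) * indicator (?J n) v \<partial>lborel)"
   using pos[of n] by (intro nn_integral_mono) (auto split: split_indicator intro!: mono)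
  thus ?thesis using em[of n] by (subst (asm) nn_integral_cmult_indicator) (simp, simp add: mult.commute)
 qed
 have J: "(\<integral>\<^sup>+ v. ?g v * indicator (?I n) v \<partial>lborel) = (\<Sum>j<n. \<integral>\<^sup>+ v. ?g v * indicator (?J j) v \<partial>lborel)" for n
 proof (induction n)
  case (Suc n)
  have m: "(\<lambda>v. ?g v * indicator (?I n) v) \<in> borel_measurable borel" "(\<lambda>v. ?g v * indicator (?J n) v) \<in> borel_measurable borel"
   using s pos[of n] by (intro distf_measurable_comp[OF d]; auto)+
  have "indicator (?I (Suc n)) v = (indicator (?I n) v + indicator (?J n) v :: ennreal)" for v
   using k pos[of n] by (auto split: split_indicator simp: distrib_right) (smt (verit) mult_nonneg_nonneg of_nat_0_le_iff)+
  thus ?case using m by (simp only: distrib_left) (simp add: nn_integral_add Suc.IH)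
 qed simp
 have "(\<integral>\<^sup>+ v. ?g v * indicator (?I N) v \<partial>lborel) <= tail d s"
  unfolding tail_def by (intro nn_integral_mono) (auto split: split_indicator)
 moreover have "(\<Sum>j<N. ennreal kap * ?g (1 + real (Suc j) * kap)) <= (\<integral>\<^sup>+ v. ?g v * indicator (?I N) v \<partial>lborel)"
  unfolding J by (intro sum_mono lo)
 ultimately show "(\<Sum>j<N. ennreal kap * d (s * (1 + real (Suc j) * kap))) <= tail d s" by (rule order_trans[rotated])
 have "?g v = 0" if "1 + real N * kap <= v" for v
  using mono[OF pos that] z by simp
 hence "tail d s <= (\<integral>\<^sup>+ v. ?g v * indicator (?I N) v \<partial>lborel)"
  unfolding tail_def by (intro nn_integral_mono) (auto split: split_indicator)
 also have "... <= (\<Sum>j<N. ennreal kap * ?g (1 + real j * kap))" unfolding J by (intro sum_mono hi)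
 finally show "tail d s <= (\<Sum>j<N. ennreal kap * d (s * (1 + real j * kap)))" .
qed

lemma nn_integral_powr_tail:
 fixes p :: real assumes p: "1 < p"
 shows "(\<integral>\<^sup>+ v. ennreal (v powr - p) * indicator {1<..} v \<partial>lborel) = ennreal (1 / (p - 1))"
proof -
 have "(\<integral>\<^sup>+ v. ennreal (v powr - p) * indicator {1<..} v \<partial>lborel) = (\<integral>\<^sup>+ v. ennreal (v powr - p) * indicator {1..} v \<partial>lborel)"
 proof (rule nn_integral_cong_AE)
  have "AE v in lborel. v \<noteq> (1::real)" by (rule AE_lborel_singleton)
  thus "AE v in lborel. ennreal (v powr - p) * indicator {1<..} v = ennreal (v powr - p) * indicator {1..} v"
   by eventually_elim (auto split: split_indicator)
 qed
 also have "... = ennreal (0 - 1 powr (1 - p) / (1 - p))"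
 proof (rule nn_integral_FTC_atLeast[where F = "\<lambda>v. v powr (1 - p) / (1 - p)"])
  show "((\<lambda>v. v powr (1 - p) / (1 - p)) has_real_derivative v powr - p) (at v)" if "1 <= v" for v
   using that p by (auto intro!: derivative_eq_intros)
  show "((\<lambda>v. v powr (1 - p) / (1 - p)) \<longlongrightarrow> 0) at_top" using p by real_asymp
 qed auto
 also have "0 - 1 powr (1 - p) / (1 - p) = 1 / (p - 1)" using p by (simp add: field_simps)
 finally show ?thesis .
qed

text \<open>By Fubini the tail averages rescaled copies of \<open>m\<close>, each contributing a multiple of the same integral.\<close>

lemma nn_integral_tail:
 fixes m :: "real => ennreal"
 assumes m: "m \<in> borel_measurable borel" and p: "1 < p"
 shows "(\<integral>\<^sup>+ r. tail m (r powr (1 / p)) * indicator {0<..} r \<partial>lborel)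
  = ennreal (1 / (p - 1)) * (\<integral>\<^sup>+ r. m (r powr (1 / p)) * indicator {0<..} r \<partial>lborel)"
proof -
 let ?J = "\<integral>\<^sup>+ r. m (r powr (1 / p)) * indicator {0<..} r \<partial>lborel"
 have [measurable]: "m \<in> borel_measurable borel" by (rule m)
 have "(\<integral>\<^sup>+ r. tail m (r powr (1 / p)) * indicator {0<..} r \<partial>lborel)
  = (\<integral>\<^sup>+ r. (\<integral>\<^sup>+ v. m (r powr (1 / p) * v) * indicator {1<..} v * indicator {0<..} r \<partial>lborel) \<partial>lborel)"
  unfolding tail_def by (intro nn_integral_cong nn_integral_multc[symmetric]) measurable
 also have "... = (\<integral>\<^sup>+ v. (\<integral>\<^sup>+ r. m (r powr (1 / p) * v) * indicator {1<..} v * indicator {0<..} r \<partial>lborel) \<partial>lborel)"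
  by (rule lborel_pair.Fubini') measurable
 also have "... = (\<integral>\<^sup>+ v. ?J * (ennreal (v powr - p) * indicator {1<..} v) \<partial>lborel)"
 proof (rule nn_integral_cong)
  fix v :: real
  show "(\<integral>\<^sup>+ r. m (r powr (1 / p) * v) * indicator {1<..} v * indicator {0<..} r \<partial>lborel) = ?J * (ennreal (v powr - p) * indicator {1<..} v)"
  proof (cases "1 < v")
   case True
   have "?J = ennreal \<bar>v powr p\<bar> * (\<integral>\<^sup>+ r. m ((0 + v powr p * r) powr (1 / p)) * indicator {0<..} (0 + v powr p * r) \<partial>lborel)"
    using True by (intro nn_integral_real_affine) simp_all
   also have "(\<integral>\<^sup>+ r. m ((0 + v powr p * r) powr (1 / p)) * indicator {0<..} (0 + v powr p * r) \<partial>lborel)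
    = (\<integral>\<^sup>+ r. m (r powr (1 / p) * v) * indicator {1<..} v * indicator {0<..} r \<partial>lborel)"
    using True p by (intro nn_integral_cong) (auto simp: powr_mult powr_powr zero_less_mult_iff mult.commute split: split_indicator)
   finally have "?J * ennreal (v powr - p) = ennreal (v powr p) * ennreal (v powr - p) * (\<integral>\<^sup>+ r. m (r powr (1 / p) * v) * indicator {1<..} v * indicator {0<..} r \<partial>lborel)"
    by (simp add: mult_ac)
   also have "ennreal (v powr p) * ennreal (v powr - p) = 1" using True by (simp flip: ennreal_mult' powr_add)
   finally show ?thesis using True by simp
  qed simp
 qed
 also have "... = ?J * (\<integral>\<^sup>+ v. ennreal (v powr - p) * indicator {1<..} v \<partial>lborel)" by (rule nn_integral_cmult) measurable
 also have "... = ennreal (1 / (p - 1)) * ?J" unfolding nn_integral_powr_tail[OF p] by (rule mult.commute)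
 finally show ?thesis .
qed

text \<open>Young's inequality with small constant, by comparing \<open>y\<close> with \<open>l x\<close>.\<close>

lemma powr_product_split:
 fixes b x y th l :: real
 assumes nn: "0 <= b" "0 <= x" "0 <= y" and th: "0 < th" "th <= 1" and l: "0 < l" and b: "b <= 1 / th * x powr ((1 - th) / th) * y"
 shows "b powr th <= (l / th) powr th * x + (1 / th) powr th * l powr (th - 1) * y"
proof (cases "y <= l * x")
 case True
 have "b <= 1 / th * x powr ((1 - th) / th) * (l * x)" using b True th by (smt (verit) mult_left_mono divide_nonneg_pos mult_nonneg_nonneg powr_ge_zero)
 also have "... = l / th * x powr (1 / th)"
 proof (cases "x = 0")
  case False
  hence "x powr ((1 - th) / th) * x = x powr ((1 - th) / th + 1)" using nn by (simp add: powr_add)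
  moreover have "(1 - th) / th + 1 = 1 / th" using th by (simp add: field_simps)
  ultimately show ?thesis by simp
 qed simp
 finally have "b powr th <= (l / th * x powr (1 / th)) powr th" using nn th by (intro powr_mono2) auto
 also have "... = (l / th) powr th * x" using nn th l by (subst powr_mult) (auto simp: powr_powr)
 finally show ?thesis using nn l th by (simp add: add_increasing2)
next
 case False
 moreover have "0 <= l * x" using l nn by simp
 ultimately have xy: "x <= y / l" "0 < y" using l by (auto simp: pos_le_divide_eq mult.commute)
 have "b <= 1 / th * x powr ((1 - th) / th) * y" by (rule b)
 also have "... <= 1 / th * (y / l) powr ((1 - th) / th) * y"
  using nn th xy by (intro mult_right_mono mult_left_mono powr_mono2) auto
 finally have "b powr th <= (1 / th * (y / l) powr ((1 - th) / th) * y) powr th" using nn th by (intro powr_mono2) auto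
 also have "... = (1 / th) powr th * ((y / l) powr ((1 - th) / th)) powr th * y powr th"
  using nn th by (simp only: powr_mult powr_ge_zero mult_nonneg_nonneg divide_nonneg_pos zero_le_one)
 also have "((y / l) powr ((1 - th) / th)) powr th = (y / l) powr (1 - th)" using th by (simp add: powr_powr)
 also have "(y / l) powr (1 - th) * y powr th = l powr (th - 1) * y"
  using xy l by (simp add: powr_divide powr_diff divide_simps flip: powr_add)
 hence "(1 / th) powr th * (y / l) powr (1 - th) * y powr th = (1 / th) powr th * l powr (th - 1) * y" by (simp add: mult.assoc)
 finally show ?thesis using nn l th by (simp add: add_increasing)
qed

text \<open>The function m = D^th - A^th has small integral. The tangent inequality bounds D - A
  beyond s by D(s)^(1 - th) m / th, so the hypothesis on tails bounds B (2 s) by D(s)^(1 - th) tail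
  m s / th. Young's inequality splits its power th into a small multiple of D^th and a large
  multiple of tail m, whose integral is that of m divided by p - 1.\<close>

lemma Lam_difference_estimate:
 assumes p: "1 < p" and th: "0 < th" "th <= 1" and l: "0 < l" and \<delta>: "0 <= \<delta>"
  and d: "distf D" "distf A" "distf B" and le: "\<And>s. 0 < s ==> A s <= D s" and fin: "\<And>s. 0 < s ==> D s < \<infinity>"
  and tail: "\<And>s. 0 < s ==> tail A s + B (2 * s) <= tail D s" "\<And>s. 0 < s ==> tail D s < \<infinity>"
  and L: "Lam p th D <= 1" "1 <= Lam p th A + ennreal \<delta>"
 shows "Lam p th (\<lambda>s. B (2 * s)) <= ennreal ((l / th) powr th + (1 / th) powr th * l powr (th - 1) * \<delta> / (p - 1))"
proof -
 define m where "m s = (ennreal_powr (D s) th - ennreal_powr (A s) th) * indicator {0<..} s" for s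
 define c1 where "c1 = (l / th) powr th"
 define c2 where "c2 = (1 / th) powr th * l powr (th - 1)"
 have c: "0 <= c1" "0 <= c2" by (auto simp: c1_def c2_def)
 have mm: "m \<in> borel_measurable borel"
 proof -
  have "(\<lambda>s. ennreal_powr (D s) th * indicator {0<..} s - ennreal_powr (A s) th * indicator {0<..} s) \<in> borel_measurable borel"
   using th by (intro borel_measurable_minus_ennreal distf_measurable distf_powr d) auto
  moreover have "(\<lambda>s. ennreal_powr (D s) th * indicator {0<..} s - ennreal_powr (A s) th * indicator {0<..} s) = m"
   by (auto simp: fun_eq_iff m_def indicator_def)
  ultimately show ?thesis by simp
 qed
 have key: "ennreal_powr (B (2 * s)) th <= ennreal c1 * ennreal_powr (D s) th + ennreal c2 * tail m s" if s: "0 < s" for s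
 proof (cases "tail m s = top")
  case True
  have "0 < c2" using th l by (simp add: c2_def)
  thus ?thesis using True by (simp add: ennreal_mult_top)
 next
  case False
  then obtain N where N: "tail m s = ennreal N" "0 <= N" by (cases "tail m s") auto
  obtain D0 where D0: "D s = ennreal D0" "0 <= D0" using fin[OF s] by (cases "D s") auto
  have pw: "D u <= A u + ennreal (1 / th * D0 powr (1 - th)) * m u" if u: "s <= u" for u
  proof -
   obtain Du where Du: "D u = ennreal Du" "0 <= Du" using fin[of u] s u by (cases "D u") auto
   obtain Au where Au: "A u = ennreal Au" "0 <= Au" using le[of u] s u Du by (cases "A u") (auto simp: top_unique)
   have AD: "Au <= Du" using le[of u] s u Du Au by simp
   have DD: "Du <= D0" using distfD[OF d(1) s u] Du D0 by simp
   have mu: "m u = ennreal (Du powr th - Au powr th)" using s u Du Au by (simp add: m_def ennreal_minus)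
   have nn: "0 <= Du powr th - Au powr th" using AD Au th by (simp add: powr_mono2)
   have "Du - Au <= 1 / th * Du powr (1 - th) * (Du powr th - Au powr th)" by (rule diff_le_powr_diff[OF Au(2) AD th])
   also have "... <= 1 / th * D0 powr (1 - th) * (Du powr th - Au powr th)"
    using th DD Du nn by (intro mult_right_mono mult_left_mono powr_mono2) auto
   finally have "Du <= Au + 1 / th * D0 powr (1 - th) * (Du powr th - Au powr th)" by simp
   hence "ennreal Du <= ennreal (Au + 1 / th * D0 powr (1 - th) * (Du powr th - Au powr th))" by (rule ennreal_leI)
   also have "... = A u + ennreal (1 / th * D0 powr (1 - th)) * m u"
    using Au nn th by (simp only: mu Au(1)) (simp add: ennreal_mult' flip: times_divide_eq_left)
   finally show ?thesis by (simp add: Du)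
  qed
  have "tail D s <= (\<integral>\<^sup>+ v. A (s * v) * indicator {1<..} v + ennreal (1 / th * D0 powr (1 - th)) * (m (s * v) * indicator {1<..} v) \<partial>lborel)"
   unfolding tail_def
  proof (intro nn_integral_mono)
   fix v
   show "D (s * v) * indicator {1<..} v <= A (s * v) * indicator {1<..} v + ennreal (1 / th * D0 powr (1 - th)) * (m (s * v) * indicator {1<..} v)"
    using pw[of "s * v"] s by (cases "1 < v") auto
  qed
  also have "... = tail A s + ennreal (1 / th * D0 powr (1 - th)) * tail m s"
   unfolding tail_def using mm s d by (subst nn_integral_add) (auto simp: nn_integral_cmult intro: tail_measurable)
  finally have "tail A s + B (2 * s) <= tail A s + ennreal (1 / th * D0 powr (1 - th)) * tail m s" using tail(1)[OF s] by (rule order_trans[rotated])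
  moreover have "tail A s < \<infinity>" using tail[OF s] by (meson add_increasing2 le_less_trans order_refl zero_le)
  ultimately have "B (2 * s) <= ennreal (1 / th * D0 powr (1 - th)) * tail m s" by (auto simp: ennreal_add_left_cancel_le)
  hence "B (2 * s) <= ennreal (1 / th * D0 powr (1 - th) * N)" using N th by (simp add: ennreal_mult[symmetric])
  then obtain b where b: "B (2 * s) = ennreal b" "0 <= b" "b <= 1 / th * D0 powr (1 - th) * N"
   using N th by (cases "B (2 * s)") (auto simp: top_unique ennreal_le_iff)
  \<comment> \<open>Brings the bound into the form of \<open>powr_product_split\<close> with x =
    D0^th and y = N.\<close>
  have "D0 powr (1 - th) = (D0 powr th) powr ((1 - th) / th)" using th by (simp add: powr_powr)
  hence "b powr th <= c1 * D0 powr th + c2 * N"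
   unfolding c1_def c2_def using b N by (intro powr_product_split[OF _ _ _ th l]) auto
  thus ?thesis unfolding b(1) N(1) D0(1) using b(2) N(2) D0(2) c
   by (simp add: ennreal_mult[symmetric] ennreal_plus[symmetric] ennreal_leI del: ennreal_plus)
 qed
 let ?J = "\<integral>\<^sup>+ r. m (r powr (1 / p)) * indicator {0<..} r \<partial>lborel"
 have Jm: "(\<lambda>r. m (r powr (1 / p)) * indicator {0<..} r) \<in> borel_measurable borel" using mm by measurable
 have "Lam p th A + ?J = (\<integral>\<^sup>+ r. ennreal_powr (A (r powr (1 / p))) th * indicator {0<..} r + m (r powr (1 / p)) * indicator {0<..} r \<partial>lborel)"
  unfolding Lam_def using Jm th by (intro nn_integral_add[symmetric]) (auto intro!: Lam_measurable d)
 also have "... = Lam p th D"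
  unfolding Lam_def using le th
  by (intro nn_integral_cong) (auto simp: m_def add_diff_inverse_ennreal ennreal_powr_mono split: split_indicator)
 finally have JJ: "Lam p th A + ?J = Lam p th D" .
 hence "Lam p th A + ?J <= Lam p th A + ennreal \<delta>" using L by (simp add: order_trans)
 moreover have "Lam p th A < \<infinity>" using order.strict_trans1[OF order_trans[OF Lam_mono[OF le] L(1)] ennreal_one_less_top] th by simp
 ultimately have J: "?J <= ennreal \<delta>" by (auto simp: ennreal_add_left_cancel_le)
 have tm: "(\<lambda>r. tail m (r powr (1 / p)) * indicator {0<..} r) \<in> borel_measurable borel"
  unfolding tail_def using mm by measurable
 have "Lam p th (\<lambda>s. B (2 * s)) <= (\<integral>\<^sup>+ r. ennreal c1 * (ennreal_powr (D (r powr (1 / p))) th * indicator {0<..} r)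
   + ennreal c2 * (tail m (r powr (1 / p)) * indicator {0<..} r) \<partial>lborel)"
  unfolding Lam_def by (intro nn_integral_mono) (auto split: split_indicator intro!: key)
 also have "... = ennreal c1 * Lam p th D + ennreal c2 * (ennreal (1 / (p - 1)) * ?J)"
  unfolding nn_integral_tail[OF mm p, symmetric] Lam_def
 proof -
  have [measurable]: "(\<lambda>r. ennreal_powr (D (r powr (1 / p))) th * indicator {0<..} r) \<in> borel_measurable borel"
   using th by (intro Lam_measurable d) auto
  note tm [measurable]
  show "(\<integral>\<^sup>+ r. ennreal c1 * (ennreal_powr (D (r powr (1 / p))) th * indicator {0<..} r)
    + ennreal c2 * (tail m (r powr (1 / p)) * indicator {0<..} r) \<partial>lborel)
   = ennreal c1 * (\<integral>\<^sup>+ r. ennreal_powr (D (r powr (1 / p))) th * indicator {0<..} r \<partial>lborel)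
    + ennreal c2 * (\<integral>\<^sup>+ r. tail m (r powr (1 / p)) * indicator {0<..} r \<partial>lborel)"
   by (subst nn_integral_add, measurable, subst nn_integral_cmult, measurable, subst nn_integral_cmult, measurable)
 qed
 also have "... <= ennreal c1 * 1 + ennreal c2 * (ennreal (1 / (p - 1)) * ennreal \<delta>)"
  by (intro add_mono mult_left_mono J L) auto
 also have "... = ennreal (c1 + c2 * (1 / (p - 1) * \<delta>))" using c p \<delta> by (simp add: ennreal_mult[symmetric])
 finally show ?thesis by (simp add: c1_def c2_def)
qed

section \<open>Superadditivity and uniform monotonicity\<close>

lemma okf_continuous: assumes f: "continuous_on UNIV f" shows "okf f"
 unfolding okf_def
proof (intro conjI allI)
 show "f \<in> borel_measurable borel" using f by (rule borel_measurable_continuous_onI)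
 fix L
 have "bounded (f ` {0..L})"
  using f by (intro compact_imp_bounded compact_continuous_image) (auto intro: continuous_on_subset)
 thus "\<exists>K. \<forall>t\<in>{0..L}. \<bar>f t\<bar> <= K" by (auto simp: bounded_iff)
qed

lemma okf_sqrt [simp]: "okf (\<lambda>t. sqrt t)"
 by (intro okf_continuous continuous_intros)

lemma fc_sqrt_square: assumes "posop a" shows "fc a (\<lambda>t. sqrt t) $ fc a (\<lambda>t. sqrt t) $ xi = a $ xi"
proof -
 have "fc a (\<lambda>t. sqrt t * sqrt t) = fc a (\<lambda>t. t)" by (rule fc_cong[OF assms okf_mult[OF okf_sqrt okf_sqrt] okf_ident]) simp
 thus ?thesis by (simp add: fc_mult_apply[OF assms okf_sqrt okf_sqrt] fc_ident[OF assms])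
qed

lemma posop_diffI:
 assumes "selfadj A" "selfadj B" "\<And>x. A $ x \<bullet> x <= B $ x \<bullet> x" shows "posop (B - A)"
 using assms by (simp add: posop_def selfadj_def blinfun.diff_left inner_diff_left inner_diff_right)

lemma norm_posop_squared_le:
 fixes T :: "'a::{real_inner,complete_space} \<Rightarrow>\<^sub>L 'a"
 assumes T: "posop T" shows "(norm (T $ x))^2 <= (norm T + 1) * (T $ x \<bullet> x)"
proof -
 have "fc T (\<lambda>t. t * t) $ x \<bullet> x <= fc T (\<lambda>t. (norm T + 1) * t) $ x \<bullet> x"
  by (rule fc_mono[OF T]) (auto intro: mult_right_mono)
 moreover have "fc T (\<lambda>t. t * t) $ x \<bullet> x = (norm (T $ x))^2"
  using posop_selfadj[OF T] by (simp add: fc_mult[OF T okf_ident okf_ident] fc_ident[OF T] selfadj_def power2_norm_eq_inner)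
 moreover have "fc T (\<lambda>t. (norm T + 1) * t) = (norm T + 1) *\<^sub>R T" using fc_scale[OF T okf_ident] by (simp add: fc_ident[OF T])
 ultimately show ?thesis by (simp add: blinfun.scaleR_left)
qed

text \<open>An approximate eigenvector for a negative spectral value of \<open>\<surd>h - \<surd>a\<close> would be almost
 annihilated by both square roots.\<close>

lemma sqrt_operator_monotone:
 fixes a h :: "'a::{real_inner,complete_space} \<Rightarrow>\<^sub>L 'a"
 assumes a: "posop a" and h: "posop h" and le: "\<And>x. a $ x \<bullet> x <= h $ x \<bullet> x"
 shows "posop (fc h (\<lambda>t. sqrt t) - fc a (\<lambda>t. sqrt t))"
proof -
 define u where "u = fc h (\<lambda>t. sqrt t)"
 define v where "v = fc a (\<lambda>t. sqrt t)"
 define w where "w = u - v"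
 have pu: "posop u" and pv: "posop v" unfolding u_def v_def by (auto intro: posop_fc[OF h] posop_fc[OF a])
 have su: "u $ x \<bullet> y = x \<bullet> u $ y" and sv: "v $ x \<bullet> y = x \<bullet> v $ y" for x y
  using pu pv by (auto simp: posop_def selfadj_def)
 have uu: "h $ x \<bullet> x = (norm (u $ x))^2" and vv: "a $ x \<bullet> x = (norm (v $ x))^2" for x
  using fc_sqrt_square[OF h, of x] fc_sqrt_square[OF a, of x] su[of "u $ x" x] sv[of "v $ x" x]
  by (simp_all add: u_def[symmetric] v_def[symmetric] power2_norm_eq_inner)
 have sw: "selfadj w" using pu pv by (simp add: w_def posop_def selfadj_iff)
 have "0 <= w $ x \<bullet> x" for x
 proof (rule ccontr)
  assume neg: "\<not> 0 <= w $ x \<bullet> x"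
  hence x0: "x \<noteq> 0" by auto
  \<comment> \<open>The numerical range of w. Its infimum l makes w - l positive, with a small form
    at a nearly minimizing unit vector y.\<close>
  define S where "S = {w $ y \<bullet> y |y. norm y = 1}"
  define l where "l = Inf S"
  have wb: "\<bar>w $ y \<bullet> y\<bar> <= norm w" if "norm y = 1" for y
  proof -
   have "\<bar>w $ y \<bullet> y\<bar> <= norm (w $ y) * norm y" by (rule Cauchy_Schwarz_ineq2)
   thus ?thesis using norm_blinfun[of w y] that by simp
  qed
  have bdd: "bdd_below S" unfolding S_def using wb by (intro bdd_belowI[of _ "- norm w"]) fastforce
  have S0: "w $ (x /\<^sub>R norm x) \<bullet> (x /\<^sub>R norm x) \<in> S"
   unfolding S_def using x0 by (intro CollectI exI[of _ "x /\<^sub>R norm x"]) simp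
  moreover have neg': "w $ (x /\<^sub>R norm x) \<bullet> (x /\<^sub>R norm x) < 0"
   using neg x0 by (simp add: blinfun.scaleR_right mult_pos_neg)
  ultimately have l0: "l < 0" using cInf_lower[OF _ bdd] unfolding l_def by (meson le_less_trans)
  define T where "T = w - l *\<^sub>R id_blinfun"
  have T: "posop T"
   unfolding T_def
  proof (rule posop_diffI)
   show "selfadj (l *\<^sub>R id_blinfun)" by (simp add: selfadj_def blinfun.scaleR_left)
   fix y
   show "(l *\<^sub>R id_blinfun) $ y \<bullet> y <= w $ y \<bullet> y"
   proof (cases "y = 0")
    case False
    hence "w $ (y /\<^sub>R norm y) \<bullet> (y /\<^sub>R norm y) \<in> S"
     unfolding S_def by (intro CollectI exI[of _ "y /\<^sub>R norm y"]) simp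
    hence "l <= w $ (y /\<^sub>R norm y) \<bullet> (y /\<^sub>R norm y)" unfolding l_def by (rule cInf_lower[OF _ bdd])
    also have "... = w $ y \<bullet> y / (norm y)^2" by (simp add: blinfun.scaleR_right power2_eq_square field_simps)
    finally show ?thesis using False by (simp add: blinfun.scaleR_left power2_norm_eq_inner[symmetric] field_simps)
   qed simp
  qed (rule sw)
  define C where "C = norm u + norm v"
  have C: "0 <= C" by (simp add: C_def)
  \<comment> \<open>The first bound gives w y \<bullet> y < l / 2. The second makes |T y|^2 at most
    l^4 / (8 (C^2 + 1)), against l^4 \<le> 4 |T y|^2 C^2, which the factorization below
    forces.\<close>
  define \<delta> where "\<delta> = min (- l / 2) (l ^ 4 / (8 * (norm T + 1) * (C^2 + 1)))"
  have nT: "0 < norm T + 1" "0 < C^2 + 1" by (auto simp: add_nonneg_pos)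
  have \<delta>: "0 < \<delta>" using l0 nT by (simp add: \<delta>_def)
  have "Inf S < l + \<delta>" using \<delta> by (simp add: l_def)
  then obtain y where y: "norm y = 1" "w $ y \<bullet> y < l + \<delta>"
   using cInf_lessD[of S] S0 by (auto simp: S_def)
  have ny: "y \<bullet> y = 1" using y(1) by (simp flip: power2_norm_eq_inner)
  have Ty: "T $ y = w $ y - l *\<^sub>R y" by (simp add: T_def blinfun.diff_left blinfun.scaleR_left)
  have "T $ y \<bullet> y < \<delta>" using y ny by (simp add: Ty inner_diff_left)
  hence "(norm (T $ y))^2 <= (norm T + 1) * \<delta>"
   using norm_posop_squared_le[OF T, of y] nT mult_left_mono[of "T $ y \<bullet> y" \<delta> "norm T + 1"] by linarith
  also have "... <= (norm T + 1) * (l ^ 4 / (8 * (norm T + 1) * (C^2 + 1)))"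
   using nT by (intro mult_left_mono) (auto simp: \<delta>_def)
  also have "... = l ^ 4 / (8 * (C^2 + 1))" using nT(1) by (simp only: times_divide_eq_right mult.assoc mult.left_commute[of 8]) simp
  finally have T2: "(norm (T $ y))^2 * (8 * (C^2 + 1)) <= l ^ 4" using nT by (simp add: field_simps)
  define z where "z = u $ y + v $ y"
  have "norm z <= norm u * norm y + norm v * norm y"
   unfolding z_def by (intro norm_triangle_le add_mono norm_blinfun)
  hence nz: "norm z <= C" using y(1) by (simp add: C_def)
  \<comment> \<open>Here a \<le> h enters, through |u y|^2 - |v y|^2 = (u - v) y \<bullet> (u + v)
    y.\<close>
  have "0 <= (norm (u $ y))^2 - (norm (v $ y))^2" using le[of y] uu vv by simp
  also have "... = w $ y \<bullet> z"
   using inner_commute[of "u $ y" "v $ y"]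
   by (simp add: z_def w_def blinfun.diff_left power2_norm_eq_inner inner_diff_left inner_add_right)
  also have "... = l * (y \<bullet> z) + T $ y \<bullet> z" by (simp add: Ty inner_diff_left)
  finally have e1: "- l * (y \<bullet> z) <= T $ y \<bullet> z" by simp
  have "T $ y \<bullet> z <= norm (T $ y) * norm z" by (rule norm_cauchy_schwarz)
  also have "... <= norm (T $ y) * C" by (intro mult_left_mono nz) simp
  finally have e2: "- l * (y \<bullet> z) <= norm (T $ y) * C" using e1 by simp
  have "0 <= u $ y \<bullet> y" "0 <= v $ y \<bullet> y" using pu pv by (auto simp: posop_def)
  moreover have "w $ y \<bullet> y = u $ y \<bullet> y - v $ y \<bullet> y" by (simp add: w_def blinfun.diff_left inner_diff_left)
  ultimately have "- (w $ y \<bullet> y) <= y \<bullet> z" by (simp add: z_def inner_add_right inner_commute)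
  moreover have "w $ y \<bullet> y < l / 2" using y(2) by (simp add: \<delta>_def)
  ultimately have "- l / 2 <= y \<bullet> z" by linarith
  hence "- l * (- l / 2) <= - l * (y \<bullet> z)" using l0 by (intro mult_left_mono) auto
  hence "l^2 / 2 <= norm (T $ y) * C" using e2 by (simp add: power2_eq_square)
  hence "(l^2 / 2)^2 <= (norm (T $ y) * C)^2" by (intro power_mono) auto
  hence "l ^ 4 <= 4 * ((norm (T $ y))^2 * C^2)" by (simp add: power_divide power_mult_distrib flip: power_mult)
  moreover have "0 < l ^ 4" using l0 by simp
  moreover have "(norm (T $ y))^2 * (8 * (C^2 + 1)) = 8 * ((norm (T $ y))^2 * C^2) + 8 * (norm (T $ y))^2" by (simp add: algebra_simps)
  ultimately show False using T2 zero_le_power2[of "norm (T $ y)"] by linarith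
 qed
 thus ?thesis using sw by (simp add: posop_def w_def u_def v_def)
qed

definition ramp :: "real => real => real" where
 "ramp s t = max 0 (t / s - 1)"

lemma ramp_nonneg: "0 <= ramp s t"
 by (simp add: ramp_def)

lemma continuous_ramp: "continuous_on UNIV (ramp s)"
 unfolding ramp_def[abs_def] by (cases "s = 0") (auto intro!: continuous_intros)

lemma okf_ramp [simp]: "okf (ramp s)"
 by (rule okf_continuous[OF continuous_ramp])

lemma okf_sqrt_ramp: "okf (\<lambda>t. sqrt (ramp s t))"
 by (intro okf_continuous continuous_on_real_sqrt continuous_ramp)

lemma okf_sum_indicators: "okf (\<lambda>t. \<Sum>j<(N::nat). kap * indicator {c j<..} t)"
proof (induction N)
 case (Suc N)
 show ?case unfolding sum.lessThan_Suc by (rule okf_add[OF Suc.IH okf_mult[OF okf_const okf_indicator']]) simp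
qed simp

lemma ramp_staircase:
 assumes s: "0 < s" and k: "0 < kap"
 shows "(\<Sum>j<N. kap * indicator {s * (1 + real (Suc j) * kap)<..} t) <= ramp s t" (is ?lo)
  and "t <= s * (1 + real N * kap) ==> ramp s t <= (\<Sum>j<N. kap * indicator {s * (1 + real j * kap)<..} t)" (is "_ ==> ?hi")
proof -
 define z where "z = t / s - 1"
 have iff: "s * (1 + real j * kap) < t \<longleftrightarrow> real j * kap < z" for j using s by (simp add: z_def field_simps)
 have "(\<Sum>j<N. kap * indicator {s * (1 + real (Suc j) * kap)<..} t) <= max 0 (min z (real N * kap))"
 proof (induction N)
  case (Suc N)
  have "max 0 (min z (real N * kap)) + kap * indicator {s * (1 + real (Suc N) * kap)<..} t <= max 0 (min z (real (Suc N) * kap))"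
  proof (cases "real (Suc N) * kap < z")
   case True
   hence "real N * kap <= z" using k by (simp add: distrib_right)
   thus ?thesis using True k iff[of "Suc N"] by (simp add: distrib_right min_def)
  next
   case False
   hence "\<not> s * (1 + real (Suc N) * kap) < t" using iff[of "Suc N"] by simp
   moreover have "min z (real N * kap) <= min z (real (Suc N) * kap)" using k by (intro min.mono) (auto simp: distrib_right)
   ultimately show ?thesis by (auto simp: indicator_def)
  qed
  thus ?case using Suc.IH by simp
 qed simp
 also have "... <= ramp s t" by (auto simp: ramp_def z_def)
 finally show ?lo .
 have "max 0 (min z (real N * kap)) <= (\<Sum>j<N. kap * indicator {s * (1 + real j * kap)<..} t)"
 proof (induction N)
  case (Suc N)
  have "max 0 (min z (real (Suc N) * kap)) <= max 0 (min z (real N * kap)) + kap * indicator {s * (1 + real N * kap)<..} t"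
   using k iff[of N] by (cases "real N * kap < z") (auto simp: distrib_right min_def max_def)
  also have "... <= (\<Sum>j<Suc N. kap * indicator {s * (1 + real j * kap)<..} t)"
   unfolding sum.lessThan_Suc by (rule add_right_mono[OF Suc.IH])
  finally show ?case .
 qed simp
 moreover assume "t <= s * (1 + real N * kap)"
 hence "z <= real N * kap" using s by (simp add: z_def field_simps)
 ultimately show ?hi by (simp add: ramp_def z_def min_absorb1)
qed

lemma ramp_scaled: "0 < s ==> t * indicator {s<..} t = s * indicator {s<..} t + s * ramp s t" for t :: real
 by (auto simp: ramp_def indicator_def field_simps max_def)

section \<open>Traces of ramps and their superadditivity\<close>

context traced_algebra
begin

lemma distf_dA: "A \<in> M ==> distf (dA A)"
 by (simp add: distf_def dA_antimono)

lemma trace_form_mono: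
 assumes "A \<in> M" "posop A" "B \<in> M" "selfadj B" "\<And>xi. A $ xi \<bullet> xi <= B $ xi \<bullet> xi" shows "\<tau> A <= \<tau> B"
 using assms by (intro trace_mono posop_diffI) (auto intro: posop_selfadj)

lemma trace_fc_mono:
 assumes "a \<in> M" "posop a" "okf f" "okf g" "\<And>t. 0 <= t ==> t <= norm a + 1 ==> 0 <= f t"
  "\<And>t. 0 <= t ==> t <= norm a + 1 ==> f t <= g t"
 shows "\<tau> (fc a f) <= \<tau> (fc a g)"
 using assms by (intro trace_form_mono M_fc posop_fc fc_selfadj fc_mono) auto

lemma trace_fc_add:
 assumes "a \<in> M" "posop a" "okf f" "okf g" "\<And>t. 0 <= t ==> 0 <= f t" "\<And>t. 0 <= t ==> 0 <= g t"
 shows "\<tau> (fc a (\<lambda>t. f t + g t)) = \<tau> (fc a f) + \<tau> (fc a g)"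
 unfolding fc_add[OF assms(2-4)] using assms by (intro trace_add M_fc posop_fc) auto

lemma trace_fc_scale:
 assumes "a \<in> M" "posop a" "okf f" "\<And>t. 0 <= t ==> 0 <= f t" "0 <= r"
 shows "\<tau> (fc a (\<lambda>t. r * f t)) = ennreal r * \<tau> (fc a f)"
 unfolding fc_scale[OF assms(2,3)] using assms by (intro trace_scale M_fc posop_fc) auto

lemma trace_fc_staircase:
 assumes a: "a \<in> M" "posop a" and c: "\<And>j. 0 <= c j" "0 <= kap"
 shows "\<tau> (fc a (\<lambda>t. \<Sum>j<(N::nat). kap * indicator {c j<..} t)) = (\<Sum>j<N. ennreal kap * dA a (c j))"
proof (induction N)
 case 0
 thus ?case by (simp add: fc_const[OF a(2)])
next
 case (Suc N)
 have "\<tau> (fc a (\<lambda>t. (\<Sum>j<N. kap * indicator {c j<..} t) + kap * indicator {c N<..} t))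
  = \<tau> (fc a (\<lambda>t. \<Sum>j<N. kap * indicator {c j<..} t)) + \<tau> (fc a (\<lambda>t. kap * indicator {c N<..} t))"
  using c by (intro trace_fc_add[OF a okf_sum_indicators okf_mult[OF okf_const okf_indicator']]) (auto intro!: sum_nonneg)
 also have "\<tau> (fc a (\<lambda>t. kap * indicator {c N<..} t)) = ennreal kap * dA a (c N)"
  using c by (subst trace_fc_scale[OF a okf_indicator']) (auto simp: dA_pos[OF a])
 finally show ?case unfolding sum.lessThan_Suc Suc.IH .
qed

text \<open>Staircases squeeze the trace and the tail between the same two sums, which differ by at
  most kap times \<open>dA a s\<close>. Beyond the norm of a the distribution function vanishes, so
  finitely many steps suffice.\<close>

lemma trace_ramp:
 assumes a: "a \<in> M" "posop a" and s: "0 < s" and fin: "dA a s < \<infinity>"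
 shows "\<tau> (fc a (ramp s)) = tail (dA a) s"
proof -
 have both: "\<tau> (fc a (ramp s)) <= tail (dA a) s + ennreal e \<and> tail (dA a) s <= \<tau> (fc a (ramp s)) + ennreal e" if e: "0 < e" for e
 proof -
  obtain D where D: "dA a s = ennreal D" "0 <= D" using fin by (cases "dA a s") auto
  \<comment> \<open>Makes kap D at most e; the denominator is D + 1 to allow for D = 0.\<close>
  define kap where "kap = e / (D + 1)"
  have k: "0 < kap" using e D by (simp add: kap_def)
  have "kap * D <= e" using e D by (simp add: kap_def field_simps)
  hence kD: "ennreal kap * dA a s <= ennreal e" using k D by (simp add: ennreal_leI flip: ennreal_mult)
  obtain N :: nat where "((norm a + 1) / s - 1) / kap <= real N" using real_arch_simple by blast
  hence N: "norm a + 1 <= s * (1 + real N * kap)" using k s by (simp add: field_simps)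
  have cpos: "0 <= s * (1 + real j * kap)" for j using s k by simp
  have z: "dA a (s * (1 + real N * kap)) = 0"
  proof (rule dA_norm[OF a(1)])
   fix xi
   have "norm (a $ xi) <= norm a * norm xi" by (rule norm_blinfun)
   also have "... <= s * (1 + real N * kap) * norm xi" using N by (intro mult_right_mono) auto
   finally show "norm (a $ xi) <= s * (1 + real N * kap) * norm xi" .
  qed
  define L where "L = (\<Sum>j<N. ennreal kap * dA a (s * (1 + real (Suc j) * kap)))"
  define H where "H = (\<Sum>j<N. ennreal kap * dA a (s * (1 + real j * kap)))"
  have "H <= (\<Sum>j<Suc N. ennreal kap * dA a (s * (1 + real j * kap)))" unfolding H_def by (intro sum_mono2) auto
  also have "... = ennreal kap * dA a s + L" unfolding L_def by (subst sum.lessThan_Suc_shift) simp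
  also have "... <= ennreal e + L" by (rule add_right_mono[OF kD])
  finally have HL: "H <= L + ennreal e" by (simp add: add.commute)
  have "L = \<tau> (fc a (\<lambda>t. \<Sum>j<N. kap * indicator {s * (1 + real (Suc j) * kap)<..} t))"
   unfolding L_def using k by (intro trace_fc_staircase[OF a, symmetric] cpos) auto
  also have "... <= \<tau> (fc a (ramp s))"
   using k by (intro trace_fc_mono[OF a okf_sum_indicators okf_ramp] ramp_staircase s) (auto intro!: sum_nonneg)
  finally have L1: "L <= \<tau> (fc a (ramp s))" .
  have "\<tau> (fc a (ramp s)) <= \<tau> (fc a (\<lambda>t. \<Sum>j<N. kap * indicator {s * (1 + real j * kap)<..} t))"
   using N by (intro trace_fc_mono[OF a okf_ramp okf_sum_indicators] ramp_nonneg ramp_staircase s k) auto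
  also have "... = H" unfolding H_def using k by (intro trace_fc_staircase[OF a] cpos) auto
  finally have H1: "\<tau> (fc a (ramp s)) <= H" .
  have tl: "L <= tail (dA a) s" "tail (dA a) s <= H"
   unfolding L_def H_def by (rule tail_Riemann[OF distf_dA[OF a(1)] s k z])+
  show ?thesis
   by (rule conjI[OF order_trans[OF order_trans[OF H1 HL] add_right_mono[OF tl(1)]]
      order_trans[OF order_trans[OF tl(2) HL] add_right_mono[OF L1]]])
 qed
 show ?thesis
  by (rule antisym; rule ennreal_le_epsilon; drule both; erule conjunct1 conjunct2)
qed

lemma trace_conj_contraction:
 assumes Z: "Z \<in> M" "\<And>xi. norm (adj Z $ xi) <= norm xi" and Q: "Q \<in> M" "\<And>xi. Z $ xi = Y $ Q $ xi"
  and Y: "\<And>xi. norm (Y $ xi) <= norm xi"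
 shows "\<tau> (Z oL adj Z) <= \<tau> (adj Q oL Q)"
proof -
 have "\<tau> (Z oL adj Z) = \<tau> (adj Z oL Z)" by (rule trace_adj[OF Z(1), symmetric])
 also have "... <= \<tau> (adj Q oL Q)"
 proof (rule trace_form_mono)
  show "adj Z oL Z \<in> M" "adj Q oL Q \<in> M" by (intro M_compose M_adj Z Q)+
  show "posop (adj Z oL Z)" "selfadj (adj Q oL Q)" by (auto intro: posop_adj_self posop_selfadj)
  fix xi
  show "(adj Z oL Z) $ xi \<bullet> xi <= (adj Q oL Q) $ xi \<bullet> xi"
   unfolding adj_self_inner Q(2) by (intro power_mono Y) simp
 qed
 finally show ?thesis .
qed

lemma norm_le_of_adj:
 fixes Z :: "'h \<Rightarrow>\<^sub>L 'h"
 assumes "\<And>xi. norm (adj Z $ xi) <= norm xi" shows "norm (Z $ xi) <= norm xi"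
proof (cases "Z $ xi = 0")
 case False
 have "(norm (Z $ xi))^2 = xi \<bullet> adj Z $ Z $ xi" using adj[of Z xi "Z $ xi"] by (simp add: power2_norm_eq_inner)
 also have "... <= norm xi * norm (adj Z $ Z $ xi)" by (rule norm_cauchy_schwarz)
 also have "... <= norm xi * norm (Z $ xi)" by (intro mult_left_mono assms) simp
 finally show ?thesis using False by (simp add: power2_eq_square)
qed simp

text \<open>With \<open>k = a \<chi>(a > s) + b \<chi>(b > s) <= h\<close> and \<open>K = 1 / \<surd>(h + eps)\<close>, the operator \<open>X = K k K\<close> is a contraction
 of trace at most \<open>\<tau>(a > s) + \<tau>(b > s)\<close>, while \<open>\<tau>(X h)\<close> is almost \<open>\<tau>(k)\<close>.\<close>

lemma ramp_superadditive_approx: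
 assumes a: "a \<in> M" "posop a" and b: "b \<in> M" "posop b" and s: "0 < s" and e: "0 < eps"
  and fin: "dA a s < \<infinity>" "dA b s < \<infinity>"
 defines "h \<equiv> a + b"
 shows "ennreal s * (\<tau> (fc a (ramp s)) + \<tau> (fc b (ramp s))) <= ennreal eps * (dA a s + dA b s) + ennreal s * \<tau> (fc h (ramp s))"
proof -
 have h: "h \<in> M" "posop h" unfolding h_def by (intro M_add posop_add a b)+
 define g where "g t = t * indicator {s<..} t" for t :: real
 have og: "okf g" unfolding g_def by (intro okf_mult[OF okf_ident okf_indicator']) simp
 have g0: "0 <= g t" "g t <= t" if "0 <= t" for t using that by (auto simp: g_def indicator_def)
 define i where "i t = sqrt (1 / (max 0 t + eps))" for t
 have oi: "okf i" unfolding i_def[abs_def] using e by (intro okf_continuous continuous_intros) (auto simp: add_nonneg_eq_0_iff)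
 define K where "K = fc h i"
 define r where "r = fc h (ramp s)"
 have KM: "K \<in> M" and sK: "adj K = K" and rM: "r \<in> M" and pr: "posop r"
  unfolding K_def r_def using M_fc[OF h] fc_selfadj[OF h(2)] posop_fc[OF h(2)] oi ramp_nonneg by (auto simp: selfadj_iff[symmetric])
 \<comment> \<open>K is 1 / sqrt(h + eps) in the calculus of h, so K (h + eps) K = 1; the summand
   with eps is kept apart, as it becomes the error term.\<close>
 have KhK: "K $ h $ K $ xi + eps *\<^sub>R (K $ K $ xi) = xi" for xi
 proof -
  have "fc h (\<lambda>t. i t * (t * i t) + eps * (i t * i t)) = fc h (\<lambda>t. 1)"
  proof (rule fc_cong[OF h(2)])
   fix t :: real assume "0 <= t"
   show "i t * (t * i t) + eps * (i t * i t) = 1"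
   proof -
    have "i t * i t = 1 / (t + eps)" using e \<open>0 <= t\<close> by (simp add: i_def)
    moreover have "z * (t * z) + eps * (z * z) = (t + eps) * (z * z)" for z by (simp add: algebra_simps)
    hence "i t * (t * i t) + eps * (i t * i t) = (t + eps) * (i t * i t)" .
    ultimately show ?thesis using e \<open>0 <= t\<close> by (simp only:) simp
   qed
  qed (intro okf_add okf_mult okf_const okf_ident oi)+
  hence "fc h (\<lambda>t. i t * (t * i t)) + eps *\<^sub>R fc h (\<lambda>t. i t * i t) = id_blinfun"
   by (simp add: fc_add[OF h(2) okf_mult[OF oi okf_mult[OF okf_ident oi]] okf_mult[OF okf_const okf_mult[OF oi oi]]]
    fc_scale[OF h(2) okf_mult[OF oi oi]] fc_one[OF h(2)])
  hence "(fc h (\<lambda>t. i t * (t * i t)) + eps *\<^sub>R fc h (\<lambda>t. i t * i t)) $ xi = xi" by simp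
  thus ?thesis
   by (simp add: blinfun.add_left blinfun.scaleR_left fc_mult[OF h(2) oi okf_mult[OF okf_ident oi]] fc_mult[OF h(2) okf_ident oi]
    fc_mult[OF h(2) oi oi] fc_ident[OF h(2)] K_def[symmetric])
 qed
 have Kin: "K $ x \<bullet> y = x \<bullet> K $ y" for x y using adj[of K x y] sK by simp
 have hK: "h $ K $ xi \<bullet> K $ xi <= (norm xi)^2" for xi
 proof -
  have "(norm xi)^2 = (K $ h $ K $ xi + eps *\<^sub>R (K $ K $ xi)) \<bullet> xi" by (simp add: KhK power2_norm_eq_inner)
  also have "... = h $ K $ xi \<bullet> K $ xi + eps * (norm (K $ xi))^2"
   by (simp add: inner_add_left Kin power2_norm_eq_inner)
  finally show ?thesis using e by simp
 qed
 \<comment> \<open>For G = sqrt(c) \<chi>(c > s) the operator Z = K G is a contraction, since c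
   \<le> h, and Z = Z \<chi>(c > s). So the trace of Z (adj Z), equal to that of (adj Z) Z, is at
   most the trace of \<chi>(c > s).\<close>
 have half: "\<tau> (K oL fc c g oL K) <= dA c s" if c: "c \<in> M" "posop c" "\<And>xi. c $ xi \<bullet> xi <= h $ xi \<bullet> xi" for c
 proof -
  let ?f = "\<lambda>t. sqrt t * indicator {s<..} t" and ?P = "fc c (indicator {s<..})"
  have oi': "okf (indicator {s<..} :: real => real)" by simp
  have of: "okf ?f" by (intro okf_mult[OF okf_sqrt okf_indicator']) simp
  define G where "G = fc c ?f"
  have sG: "adj G = G" using fc_selfadj[OF c(2) of] by (simp add: G_def selfadj_iff)
  have GG: "G $ G $ xi = fc c g $ xi" for xi
  proof -
   have "fc c (\<lambda>t. ?f t * ?f t) = fc c g"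
    by (rule fc_cong[OF c(2) okf_mult[OF of of] og]) (auto simp: g_def indicator_def)
   thus ?thesis by (simp add: G_def fc_mult_apply[OF c(2) of of])
  qed
  have GP: "G $ ?P $ xi = G $ xi" for xi
  proof -
   have "fc c (\<lambda>t. ?f t * indicator {s<..} t) = fc c ?f"
    by (rule fc_cong[OF c(2) okf_mult[OF of oi'] of]) (auto simp: indicator_def)
   thus ?thesis by (simp add: G_def fc_mult_apply[OF c(2) of oi'])
  qed
  have PP: "?P oL ?P = ?P"
  proof -
   have "fc c (\<lambda>t. indicator {s<..} t * indicator {s<..} t) = ?P"
    by (rule fc_cong[OF c(2) okf_mult[OF oi' oi'] oi']) (auto simp: indicator_def)
   thus ?thesis by (simp add: fc_mult[OF c(2) oi' oi'])
  qed
  have sP: "adj ?P = ?P" using fc_selfadj[OF c(2) oi'] by (simp add: selfadj_iff)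
  define Z where "Z = K oL G"
  have ZM: "Z \<in> M" unfolding Z_def G_def by (intro M_compose KM M_fc c of)
  have aZ: "norm (adj Z $ xi) <= norm xi" for xi
  proof (rule power2_le_imp_le)
   have "(norm (adj Z $ xi))^2 = G $ G $ K $ xi \<bullet> K $ xi"
    using adj[of G "G $ K $ xi" "K $ xi"] by (simp add: Z_def sG sK power2_norm_eq_inner)
   also have "... <= c $ K $ xi \<bullet> K $ xi"
    unfolding GG using fc_mono[OF c(2) og okf_ident, of "K $ xi"] g0 by (simp add: fc_ident[OF c(2)])
   also have "... <= (norm xi)^2" using c(3) hK order_trans by blast
   finally show "(norm (adj Z $ xi))^2 <= (norm xi)^2" .
  qed simp
  have "K oL fc c g oL K = Z oL adj Z" by (rule blinfun_eqI) (simp add: Z_def sG sK GG)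
  hence "\<tau> (K oL fc c g oL K) = \<tau> (Z oL adj Z)" by simp
  also have "... <= \<tau> (adj ?P oL ?P)"
  proof (rule trace_conj_contraction[OF ZM aZ _ _ norm_le_of_adj[OF aZ]])
   show "?P \<in> M" by (intro M_fc c oi')
   show "Z $ xi = Z $ ?P $ xi" for xi by (simp add: Z_def GP)
  qed
  also have "... = dA c s" using s by (simp add: sP PP dA_pos[OF c(1,2)])
  finally show ?thesis .
 qed
 have la: "a $ xi \<bullet> xi <= h $ xi \<bullet> xi" "b $ xi \<bullet> xi <= h $ xi \<bullet> xi" for xi
  using a(2) b(2) by (auto simp: h_def posop_def blinfun.add_left inner_add_left)
 define k where "k = fc a g + fc b g"
 have gM: "fc a g \<in> M" "fc b g \<in> M" "posop (fc a g)" "posop (fc b g)"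
  using a b og g0 by (auto intro: M_fc posop_fc)
 have k: "k \<in> M" "posop k" unfolding k_def by (intro M_add posop_add gM)+
 have kh: "k $ xi \<bullet> xi <= h $ xi \<bullet> xi" for xi
 proof -
  have "fc a g $ xi \<bullet> xi <= a $ xi \<bullet> xi" using fc_mono[OF a(2) og okf_ident, of xi] g0 by (simp add: fc_ident[OF a(2)])
  moreover have "fc b g $ xi \<bullet> xi <= b $ xi \<bullet> xi" using fc_mono[OF b(2) og okf_ident, of xi] g0 by (simp add: fc_ident[OF b(2)])
  ultimately show ?thesis by (simp add: k_def h_def blinfun.add_left inner_add_left)
 qed
 define w where "w = fc k (\<lambda>t. sqrt t)"
 have wM: "w \<in> M" and sw: "adj w = w" unfolding w_def using M_fc[OF k okf_sqrt] fc_selfadj[OF k(2) okf_sqrt] by (auto simp: selfadj_iff)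
 have ww: "w $ w $ xi = k $ xi" for xi unfolding w_def by (rule fc_sqrt_square[OF k(2)])
 define W where "W = K oL w"
 have WM: "W \<in> M" unfolding W_def by (intro M_compose KM wM)
 have aW: "adj W = w oL K" by (simp add: W_def sw sK)
 have cW: "norm (adj W $ xi) <= norm xi" for xi
 proof (rule power2_le_imp_le)
  have "(norm (adj W $ xi))^2 = k $ K $ xi \<bullet> K $ xi"
   using adj[of w "w $ K $ xi" "K $ xi"] by (simp add: aW sw ww power2_norm_eq_inner)
  also have "... <= (norm xi)^2" using kh hK order_trans by blast
  finally show "(norm (adj W $ xi))^2 <= (norm xi)^2" .
 qed simp
 let ?T = "\<tau> (adj W oL W)" and ?F = "dA a s + dA b s"
 have conj: "adj W oL c oL W \<in> M" "posop (adj W oL c oL W)" if "c \<in> M" "posop c" for c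
  using that by (auto intro!: M_compose M_adj WM posop_conj)
 have WW: "adj W oL W \<in> M" "posop (adj W oL W)" by (auto intro: M_compose M_adj WM posop_adj_self)
 have T: "?T <= ?F"
 proof -
  have "?T = \<tau> (W oL adj W)" by (rule trace_adj[OF WM])
  also have "W oL adj W = (K oL fc a g oL K) + (K oL fc b g oL K)"
   by (rule blinfun_eqI) (simp add: W_def sw sK ww k_def blinfun.add_left blinfun.add_right)
  also have "\<tau> ... = \<tau> (K oL fc a g oL K) + \<tau> (K oL fc b g oL K)"
   using posop_conj[OF gM(3), of K] posop_conj[OF gM(4), of K] by (intro trace_add M_compose KM gM) (simp_all add: sK)
  also have "... <= ?F" by (intro add_mono half a b la)
  finally show ?thesis .
 qed
 \<comment> \<open>Inserts K h K + eps K^2 = 1 between the two factors w of k.\<close>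
 have "k = (adj W oL h oL W) + eps *\<^sub>R (adj W oL W)"
 proof (rule blinfun_eqI)
  fix xi
  have "k $ xi = w $ (K $ h $ K $ w $ xi + eps *\<^sub>R (K $ K $ w $ xi))" by (simp add: KhK ww)
  thus "k $ xi = ((adj W oL h oL W) + eps *\<^sub>R (adj W oL W)) $ xi"
   by (simp add: aW W_def blinfun.add_left blinfun.add_right blinfun.scaleR_left blinfun.scaleR_right sw sK)
 qed
 hence "\<tau> k = \<tau> (adj W oL h oL W) + ennreal eps * ?T"
  using e by (simp add: trace_add[OF conj[OF h] M_scaleR[OF WW(1)] posop_scale[OF WW(2)]] trace_scale[OF WW])
 \<comment> \<open>Uses t \<le> s + s (ramp s t), with equality from s on, on the spectrum of
   h.\<close>
 also have "\<tau> (adj W oL h oL W) <= \<tau> (s *\<^sub>R (adj W oL W) + s *\<^sub>R (adj W oL r oL W))"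
 proof (rule trace_form_mono)
  show "adj W oL h oL W \<in> M" "posop (adj W oL h oL W)" by (intro conj h)+
  show "s *\<^sub>R (adj W oL W) + s *\<^sub>R (adj W oL r oL W) \<in> M" by (intro M_add M_scaleR WW conj rM pr)
  show "selfadj (s *\<^sub>R (adj W oL W) + s *\<^sub>R (adj W oL r oL W))"
   using s by (intro posop_selfadj posop_add posop_scale WW conj rM pr) auto
  fix xi
  have "h $ W $ xi \<bullet> W $ xi <= fc h (\<lambda>t. s + s * ramp s t) $ W $ xi \<bullet> W $ xi"
   using fc_mono[OF h(2) okf_ident okf_add[OF okf_const okf_mult[OF okf_const okf_ramp]], of s s s "W $ xi"] s
   by (simp add: fc_ident[OF h(2)] ramp_def max_def field_simps)
  also have "fc h (\<lambda>t. s + s * ramp s t) = s *\<^sub>R id_blinfun + s *\<^sub>R r"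
   by (simp add: r_def fc_add[OF h(2) okf_const okf_mult[OF okf_const okf_ramp]] fc_scale[OF h(2) okf_ramp] fc_const[OF h(2)])
  finally show "(adj W oL h oL W) $ xi \<bullet> xi <= (s *\<^sub>R (adj W oL W) + s *\<^sub>R (adj W oL r oL W)) $ xi \<bullet> xi"
   by (simp add: adj' blinfun.add_left blinfun.scaleR_left inner_add_left)
 qed
 also have "... = ennreal s * ?T + ennreal s * \<tau> (adj W oL r oL W)"
  using s trace_add[OF M_scaleR[OF WW(1), of s] posop_scale[OF WW(2), of s] M_scaleR[OF conj(1)[OF rM pr], of s] posop_scale[OF conj(2)[OF rM pr], of s]] rM pr
  by (simp add: trace_scale WW conj)
 also have "\<tau> (adj W oL r oL W) <= \<tau> r"
 proof -
  define Q where "Q = fc h (\<lambda>t. sqrt (ramp s t))"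
  have QM: "Q \<in> M" and sQ: "adj Q = Q"
   unfolding Q_def using M_fc[OF h okf_sqrt_ramp] fc_selfadj[OF h(2) okf_sqrt_ramp] by (auto simp: selfadj_iff)
  have "fc h (\<lambda>t. sqrt (ramp s t) * sqrt (ramp s t)) = r" by (simp add: r_def ramp_nonneg eta_contract_eq)
  hence QQ: "Q $ Q $ xi = r $ xi" for xi by (simp add: Q_def fc_mult_apply[OF h(2) okf_sqrt_ramp okf_sqrt_ramp])
  define V where "V = adj W oL Q"
  have VM: "V \<in> M" unfolding V_def by (intro M_compose M_adj WM QM)
  have "adj W oL r oL W = V oL adj V" by (rule blinfun_eqI) (simp add: V_def sQ QQ)
  hence "\<tau> (adj W oL r oL W) = \<tau> (adj V oL V)" by (simp add: trace_adj[OF VM])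
  also have "... <= \<tau> r"
  proof (rule trace_form_mono)
   show "adj V oL V \<in> M" "posop (adj V oL V)" by (auto intro: M_compose M_adj VM posop_adj_self)
   show "r \<in> M" "selfadj r" using rM pr by (auto simp: posop_def)
   fix xi
   have "(norm (V $ xi))^2 <= (norm (Q $ xi))^2" unfolding V_def by (intro power_mono) (auto intro: cW)
   also have "... = r $ xi \<bullet> xi" using adj[of Q "Q $ xi" xi] by (simp add: sQ QQ power2_norm_eq_inner)
   finally show "(adj V oL V) $ xi \<bullet> xi <= r $ xi \<bullet> xi" by (simp only: adj_self_inner)
  qed
  finally show ?thesis .
 qed
 finally have "\<tau> k <= ennreal s * ?T + ennreal s * \<tau> r + ennreal eps * ?T" by (simp add: add_mono mult_left_mono)
 also have "... <= ennreal s * ?F + ennreal s * \<tau> r + ennreal eps * ?F"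
  by (intro add_mono mult_left_mono T order_refl zero_le)
 finally have main: "\<tau> k <= ennreal s * ?F + ennreal s * \<tau> r + ennreal eps * ?F" .
 \<comment> \<open>c \<chi>(c > s) is the sum of s \<chi>(c > s) and of s times the ramp of c. The
   first summands for a and b add up to s (dA a s + dA b s), which cancels against the bound for the
   trace of (adj W) W; the cancellation rests on \<open>fin\<close>.\<close>
 have tg: "\<tau> (fc c g) = ennreal s * dA c s + ennreal s * \<tau> (fc c (ramp s))" if c: "c \<in> M" "posop c" for c
 proof -
  have oi': "okf (indicator {s<..} :: real => real)" by simp
  have "fc c g = fc c (\<lambda>t. s * indicator {s<..} t + s * ramp s t)" using s by (simp add: g_def[abs_def] ramp_scaled)
  thus ?thesis
   using s trace_fc_add[OF c okf_mult[OF okf_const oi'] okf_mult[OF okf_const okf_ramp], of s s]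
    trace_fc_scale[OF c oi', of s] trace_fc_scale[OF c okf_ramp, of s s] by (simp add: dA_pos[OF c] ramp_nonneg)
 qed
 have "\<tau> k = ennreal s * ?F + ennreal s * (\<tau> (fc a (ramp s)) + \<tau> (fc b (ramp s)))"
  unfolding k_def trace_add[OF gM(1,3,2,4)] tg[OF a] tg[OF b] by (simp add: distrib_left ac_simps)
 hence "ennreal s * ?F + ennreal s * (\<tau> (fc a (ramp s)) + \<tau> (fc b (ramp s))) <= ennreal s * ?F + (ennreal eps * ?F + ennreal s * \<tau> r)"
  using main by (simp add: ac_simps)
 moreover have "ennreal s * ?F \<noteq> \<infinity>" using fin by (auto simp: ennreal_mult_eq_top_iff)
 ultimately show ?thesis unfolding r_def by (auto simp: ennreal_add_left_cancel_le)
qed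

end

section \<open>Uniform monotonicity\<close>

context traced_algebra
begin

lemma ramp_superadditive:
 assumes a: "a \<in> M" "posop a" and b: "b \<in> M" "posop b" and s: "0 < s" and fin: "dA a s < \<infinity>" "dA b s < \<infinity>"
 shows "\<tau> (fc a (ramp s)) + \<tau> (fc b (ramp s)) <= \<tau> (fc (a + b) (ramp s))"
proof -
 obtain F where F: "dA a s + dA b s = ennreal F" "0 <= F" using fin by (cases "dA a s + dA b s") (auto simp: top_unique)
 have "ennreal s * (\<tau> (fc a (ramp s)) + \<tau> (fc b (ramp s))) <= ennreal s * \<tau> (fc (a + b) (ramp s)) + ennreal e" if e: "0 < e" for e
 proof -
  have pos: "0 < e / (F + 1)" using e F by simp
  have "e / (F + 1) * F <= e" using e F by (simp add: field_simps)
  hence "ennreal (e / (F + 1)) * ennreal F <= ennreal e" using pos F by (simp add: ennreal_leI flip: ennreal_mult)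
  from order_trans[OF ramp_superadditive_approx[OF a b s pos fin, unfolded F] add_right_mono[OF this]]
  show ?thesis by (simp add: add.commute)
 qed
 hence "ennreal s * (\<tau> (fc a (ramp s)) + \<tau> (fc b (ramp s))) <= ennreal s * \<tau> (fc (a + b) (ramp s))" by (rule ennreal_le_epsilon)
 thus ?thesis using s by (subst (asm) ennreal_mult_le_mult_iff) auto
qed

text \<open>The ramp at s is at least 1 beyond 2 s, so \<open>dA b (2 * s)\<close> is dominated by
  the trace of the ramp of b; this is the source of the factor 2.\<close>

lemma
 assumes a: "a \<in> M" "posop a" and b: "b \<in> M" "posop b" and s: "0 < s" and fin: "dA (a + b) s < \<infinity>"
 shows tail_superadditive: "tail (dA a) s + dA b (2 * s) <= tail (dA (a + b)) s"
  and tail_finite: "tail (dA (a + b)) s < \<infinity>"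
proof -
 have h: "a + b \<in> M" "posop (a + b)" by (intro M_add posop_add a b)+
 have "dA a s <= dA (a + b) s" "dA b s <= dA (a + b) s"
  using s a(2) b(2) by (auto intro!: dA_pos_mono a b h)
 hence f: "dA a s < \<infinity>" "dA b s < \<infinity>" using fin by auto
 have "dA b (2 * s) = \<tau> (fc b (indicator {2 * s<..}))" using s by (intro dA_pos b) auto
 also have "... <= \<tau> (fc b (ramp s))"
  using s by (intro trace_fc_mono[OF b okf_indicator okf_ramp]) (auto simp: ramp_def indicator_def field_simps)
 finally have "tail (dA a) s + dA b (2 * s) <= \<tau> (fc a (ramp s)) + \<tau> (fc b (ramp s))"
  unfolding trace_ramp[OF a s f(1)] by (rule add_left_mono)
 also have "... <= \<tau> (fc (a + b) (ramp s))" by (rule ramp_superadditive[OF a b s f])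
 finally show "tail (dA a) s + dA b (2 * s) <= tail (dA (a + b)) s" by (simp only: trace_ramp[OF h s fin])
 let ?c = "(norm (a + b) + 1) / s"
 have "\<tau> (fc (a + b) (ramp s)) <= \<tau> (fc (a + b) (\<lambda>t. ?c * indicator {s<..} t))"
 proof (rule trace_fc_mono[OF h okf_ramp okf_mult[OF okf_const okf_indicator']])
  fix t assume "0 <= t" "t <= norm (a + b) + 1"
  moreover have "t / s <= ?c" if "t <= norm (a + b) + 1" using that s by (intro divide_right_mono) auto
  ultimately show "ramp s t <= ?c * indicator {s<..} t" using s by (auto simp: ramp_def indicator_def)
 qed (auto simp: ramp_nonneg)
 also have "... = ennreal ?c * dA (a + b) s"
  using s by (subst trace_fc_scale[OF h okf_indicator']) (auto simp: dA_pos[OF h])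
 also have "... < \<infinity>" using fin by (simp add: ennreal_mult_less_top)
 finally show "tail (dA (a + b)) s < \<infinity>" by (simp only: trace_ramp[OF h s fin])
qed

definition umod :: "real => real => real => real => bool" where
 "umod th p eps \<delta> \<longleftrightarrow> (\<forall>a b. a \<in> M --> b \<in> M --> posop a --> posop b --> Lam p th (dA (a + b)) <= 1 -->
  1 <= Lam p th (dA a) + ennreal \<delta> --> Lam p th (dA b) <= ennreal eps)"

lemma umodD: "umod th p eps \<delta> ==> a \<in> M ==> b \<in> M ==> posop a ==> posop b ==> Lam p th (dA (a + b)) <= 1 ==>
  1 <= Lam p th (dA a) + ennreal \<delta> ==> Lam p th (dA b) <= ennreal eps"
 unfolding umod_def by simp

definition umono :: "real => real => bool" where
 "umono th p \<longleftrightarrow> (\<forall>eps>0. \<exists>\<delta>>0. umod th p eps \<delta>)"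

lemma umono_base:
 assumes th: "0 < th" "th <= 1" and p: "1 < p" shows "umono th p"
 unfolding umono_def
proof (intro allI impI)
 fix eps :: real assume e: "0 < eps"
 \<comment> \<open>Dividing by 2^p pays for the argument 2 s. Then l makes the Young term with D^th
   equal to e' / 2, and \<delta> does the same for the term with the tail.\<close>
 define e' where "e' = eps / 2 powr p"
 have e': "0 < e'" using e by (simp add: e'_def)
 define l where "l = th * (e' / 2) powr (1 / th)"
 have l: "0 < l" using th e' by (simp add: l_def)
 have l1: "(l / th) powr th = e' / 2" using th e' by (simp add: l_def powr_powr)
 define c where "c = (1 / th) powr th * l powr (th - 1)"
 have c: "0 < c" using th l by (simp add: c_def)
 define \<delta> where "\<delta> = e' * (p - 1) / (2 * c)"
 have d: "0 < \<delta>" using e' p c by (simp add: \<delta>_def)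
 have cd: "c * \<delta> / (p - 1) = e' / 2" using c p by (simp add: \<delta>_def nonzero_divide_eq_eq)
 have sum: "(l / th) powr th + (1 / th) powr th * l powr (th - 1) * \<delta> / (p - 1) = e'" unfolding l1 c_def[symmetric] cd by simp
 have "Lam p th (dA b) <= ennreal eps"
  if a: "a \<in> M" "posop a" and b: "b \<in> M" "posop b" and L: "Lam p th (dA (a + b)) <= 1" "1 <= Lam p th (dA a) + ennreal \<delta>" for a b
 proof -
  have h: "a + b \<in> M" "posop (a + b)" by (intro M_add posop_add a b)+
  have fin: "dA (a + b) s < \<infinity>" if "0 < s" for s
   by (rule Lam_finite[OF distf_dA[OF h(1)] order.strict_trans1[OF L(1)] that]) (use p th in auto)
  have "Lam p th (\<lambda>s. dA b (2 * s)) <= ennreal e'"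
   unfolding sum[symmetric]
  proof (rule Lam_difference_estimate[OF p th l _ distf_dA[OF h(1)] distf_dA[OF a(1)] distf_dA[OF b(1)] _ _ _ _ L])
   show "0 <= \<delta>" using d by simp
   show "dA a s <= dA (a + b) s" if "0 < s" for s using that b(2) by (auto intro!: dA_pos_mono a h)
   show "dA (a + b) s < \<infinity>" if "0 < s" for s by (rule fin[OF that])
   show "tail (dA a) s + dA b (2 * s) <= tail (dA (a + b)) s" if "0 < s" for s by (rule tail_superadditive[OF a b that fin[OF that]])
   show "tail (dA (a + b)) s < \<infinity>" if "0 < s" for s by (rule tail_finite[OF a b that fin[OF that]])
  qed
  hence "ennreal (2 powr p) * Lam p th (\<lambda>s. dA b (2 * s)) <= ennreal (2 powr p) * ennreal e'" by (rule mult_left_mono) simp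
  moreover have "Lam p th (dA b) = ennreal (2 powr p) * Lam p th (\<lambda>s. dA b (2 * s))"
   using p th by (intro Lam_scale distf_dA b) auto
  moreover have "ennreal (2 powr p) * ennreal e' = ennreal eps" using e by (simp add: e'_def flip: ennreal_mult)
  ultimately show ?thesis by simp
 qed
 thus "\<exists>\<delta>>0. umod th p eps \<delta>" using d unfolding umod_def by blast
qed

lemma dA_sqrt: assumes a: "a \<in> M" "posop a" and s: "0 <= s" shows "dA (fc a (\<lambda>t. sqrt t)) (sqrt s) = dA a s"
proof -
 let ?u = "fc a (\<lambda>t. sqrt t)"
 have "adj ?u oL ?u = a"
  using fc_selfadj[OF a(2) okf_sqrt] by (intro blinfun_eqI) (simp add: selfadj_iff fc_sqrt_square[OF a(2)])
 thus ?thesis using dA_square[OF M_fc[OF a okf_sqrt], of "sqrt s"] s by simp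
qed

text \<open>The weights l and 1 / (2 l) are free to be unbalanced: a large l makes the contribution
  of A small at the expense of B, a gain when B itself is tiny.\<close>

lemma dA_compose_split:
 assumes A: "A \<in> M" "B \<in> M" and l: "0 < l" and s: "0 < s"
 shows "dA (A oL B) (s / 2) <= dA A (l * sqrt s) + dA B (1 / (2 * l) * sqrt s)"
proof -
 have "(l * sqrt s) * (1 / (2 * l) * sqrt s) = s / 2" using l s by (simp add: field_simps)
 thus ?thesis using dA_compose[OF A, of "l * sqrt s" "1 / (2 * l) * sqrt s"] l s by simp
qed

text \<open>Square roots: with \<open>u = \<surd>(a + b)\<close> and \<open>v = \<surd>a\<close>, \<open>b = u (u - v) + (u - v) v\<close>.\<close>

lemma umono_halve:
 assumes th: "0 < th" "th <= 1" and p: "0 < p" and um: "umono th (2 * p)" shows "umono th p"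
 unfolding umono_def
proof (intro allI impI)
 fix eps :: real assume e: "0 < eps"
 \<comment> \<open>l^(-2p) = eps / 4, so the terms with u and with v contribute at most eps / 4
   each. The factor c is the price of the argument s / (2 l) in the two terms with w, whence the
   modulus is requested for eps / (4 c).\<close>
 define l where "l = (4 / eps) powr (1 / (2 * p))"
 have l: "0 < l" using e by (simp add: l_def)
 have l2: "l powr (2 * p) = 4 / eps" using e p by (simp add: l_def powr_powr)
 define c where "c = (2 * l) powr (2 * p)"
 have c: "0 < c" using l by (simp add: c_def)
 have "0 < eps / (4 * c)" using e c by simp
 then obtain \<delta> where d: "0 < \<delta>" and um': "umod th (2 * p) (eps / (4 * c)) \<delta>"
  using um unfolding umono_def by blast
 have "Lam p th (dA b) <= ennreal eps"
  if a: "a \<in> M" "posop a" and b: "b \<in> M" "posop b" and L: "Lam p th (dA (a + b)) <= 1" "1 <= Lam p th (dA a) + ennreal \<delta>" for a b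
 proof -
  let ?h = "a + b"
  have h: "?h \<in> M" "posop ?h" by (intro M_add posop_add a b)+
  define u where "u = fc ?h (\<lambda>t. sqrt t)"
  define v where "v = fc a (\<lambda>t. sqrt t)"
  define w where "w = u - v"
  have uM: "u \<in> M" "v \<in> M" "w \<in> M" unfolding w_def u_def v_def by (intro M_diff M_fc[OF h] M_fc[OF a] okf_sqrt)+
  have pv: "posop v" unfolding v_def by (auto intro: posop_fc[OF a(2)])
  have pw: "posop w" unfolding w_def u_def v_def
   using b(2) by (intro sqrt_operator_monotone a h) (simp add: posop_def blinfun.add_left inner_add_left)
  have uvw: "v + w = u" by (simp add: w_def)
  have Lu: "Lam (2 * p) th (dA u) = Lam p th (dA ?h)" "Lam (2 * p) th (dA v) = Lam p th (dA a)"
   unfolding Lam_double[OF p] u_def v_def by (auto intro!: Lam_cong dA_sqrt h a)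
  have Lw: "Lam (2 * p) th (dA w) <= ennreal (eps / (4 * c))"
   using umodD[OF um' uM(2,3) pv pw] L unfolding uvw Lu by simp
  have Lv: "Lam (2 * p) th (dA v) <= Lam (2 * p) th (dA u)"
   using th pw pv by (intro Lam_mono dA_pos_mono uM) (auto simp: w_def[symmetric] uvw[symmetric] intro!: posop_add)
  have bd: "b = (u oL w) + (w oL v)"
   by (rule blinfun_eqI)
    (simp add: w_def blinfun.add_left blinfun.diff_left blinfun.diff_right u_def v_def fc_sqrt_square[OF h(2)] fc_sqrt_square[OF a(2)])
  let ?l' = "1 / (2 * l)"
  note dd = distf_scale[OF distf_dA[OF uM(1)] l] distf_scale[OF distf_dA[OF uM(2)] l]
  have dw: "distf (\<lambda>s. dA w (?l' * s))" using l by (intro distf_scale distf_dA uM) auto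
  have "dA b s <= (dA u (l * sqrt s) + dA w (?l' * sqrt s)) + (dA v (l * sqrt s) + dA w (?l' * sqrt s))" if s: "0 < s" for s
  proof -
   have "dA b (s / 2 + s / 2) <= dA (u oL w) (s / 2) + dA (w oL v) (s / 2)"
    unfolding bd using s by (intro dA_add M_compose uM) auto
   also have "dA (w oL v) (s / 2) <= dA v (l * sqrt s) + dA w (?l' * sqrt s)"
    using dA_compose_split[OF uM(3,2), of ?l' s] l s by (simp add: add.commute)
   also have "dA (u oL w) (s / 2) <= dA u (l * sqrt s) + dA w (?l' * sqrt s)" by (rule dA_compose_split[OF uM(1,3) l s])
   finally show ?thesis by (simp add: add_mono)
  qed
  hence "Lam p th (dA b) <= Lam p th (\<lambda>s. (dA u (l * sqrt s) + dA w (?l' * sqrt s)) + (dA v (l * sqrt s) + dA w (?l' * sqrt s)))"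
   using th by (intro Lam_mono) auto
  also have "... = Lam (2 * p) th (\<lambda>s. (dA u (l * s) + dA w (?l' * s)) + (dA v (l * s) + dA w (?l' * s)))"
   by (simp add: Lam_double[OF p])
  also have "... <= Lam (2 * p) th (\<lambda>s. dA u (l * s) + dA w (?l' * s)) + Lam (2 * p) th (\<lambda>s. dA v (l * s) + dA w (?l' * s))"
   by (intro Lam_add distf_add dd dw th)
  also have "... <= (Lam (2 * p) th (\<lambda>s. dA u (l * s)) + Lam (2 * p) th (\<lambda>s. dA w (?l' * s)))
    + (Lam (2 * p) th (\<lambda>s. dA v (l * s)) + Lam (2 * p) th (\<lambda>s. dA w (?l' * s)))"
   by (intro add_mono Lam_add dd dw th)
  also have "... <= (ennreal (eps / 4) + ennreal (eps / 4)) + (ennreal (eps / 4) + ennreal (eps / 4))"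
  proof -
   have sc: "Lam (2 * p) th (\<lambda>s. dA z (k * s)) <= ennreal (k powr - (2 * p)) * r" if "z \<in> M" "0 < k" "Lam (2 * p) th (dA z) <= r" for z k r
   proof -
    have "ennreal (k powr - (2 * p)) * Lam (2 * p) th (dA z) = (ennreal (k powr - (2 * p)) * ennreal (k powr (2 * p))) * Lam (2 * p) th (\<lambda>s. dA z (k * s))"
     using that p th by (subst Lam_scale[OF distf_dA, of z k]) (auto simp: mult.assoc)
    also have "ennreal (k powr - (2 * p)) * ennreal (k powr (2 * p)) = 1" using that by (simp flip: ennreal_mult' powr_add)
    finally have "Lam (2 * p) th (\<lambda>s. dA z (k * s)) = ennreal (k powr - (2 * p)) * Lam (2 * p) th (dA z)" by simp
    thus ?thesis using that by (simp add: mult_left_mono)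
   qed
   have c1: "ennreal (l powr - (2 * p)) * 1 = ennreal (eps / 4)" using l2 by (simp add: powr_minus)
   have "?l' powr - (2 * p) = c" using l by (simp add: c_def powr_minus powr_divide)
   hence c2: "ennreal (?l' powr - (2 * p)) * ennreal (eps / (4 * c)) = ennreal (eps / 4)" using c e by (simp flip: ennreal_mult')
   have "Lam (2 * p) th (dA u) <= 1" "Lam (2 * p) th (dA v) <= 1" using L(1) Lv unfolding Lu by auto
   note k = sc[OF uM(1) l this(1)] sc[OF uM(2) l this(2)]
   have "Lam (2 * p) th (\<lambda>s. dA w (?l' * s)) <= ennreal (eps / 4)" using sc[OF uM(3) _ Lw, of ?l'] l unfolding c2 by simp
   thus ?thesis using k unfolding c1 by (intro add_mono)
  qed
  also have "... = ennreal eps" using e by (simp flip: ennreal_plus)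
  finally show ?thesis .
 qed
 thus "\<exists>\<delta>>0. umod th p eps \<delta>" using d unfolding umod_def by blast
qed

lemma uniform_monotonicity:
 assumes th: "0 < th" "th <= 1" and p: "0 < p" shows "umono th p"
proof -
 have "umono th p" if "0 < p" "1 < 2 ^ k * p" for k :: nat and p
  using that
 proof (induction k arbitrary: p)
  case 0
  thus ?case using umono_base[OF th] by simp
 next
  case (Suc k)
  have "umono th (2 * p)" using Suc.prems by (intro Suc.IH) (auto simp: mult_ac)
  thus ?case by (rule umono_halve[OF th Suc.prems(1)])
 qed
 moreover obtain k :: nat where "1 / p < 2 ^ k" using real_arch_pow[of 2 "1 / p"] by auto
 ultimately show ?thesis using p by (simp add: field_simps)
qed

text \<open>The squared moduli of f y and of (1 - f) y add up to that of y, a decomposition into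
  positive operators at exponent p / 2; the case of y f follows by adjoints. \<delta> is fixed
  before f, since the projections will vary with the members of the sequence.\<close>

lemma
 assumes th: "0 < th" "th <= 1" and p: "0 < p" and e: "0 < eps"
 shows uniform_monotonicity_sides: "\<exists>\<delta>>0. \<forall>y\<in>M. \<forall>f\<in>M. selfadj f --> f oL f = f --> Lam p th (dA y) <= 1 -->
  (1 <= Lam p th (dA (f oL y)) + ennreal \<delta> --> Lam p th (dA (y - (f oL y))) <= ennreal eps) \<and>
  (1 <= Lam p th (dA (y oL f)) + ennreal \<delta> --> Lam p th (dA (y - (y oL f))) <= ennreal eps)"
proof -
 have p2: "0 < p / 2" using p by simp
 obtain \<delta> where d: "0 < \<delta>" and um: "umod th (p / 2) eps \<delta>"
  using uniform_monotonicity[OF th p2] e unfolding umono_def by blast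
 have sq: "Lam (p / 2) th (dA (adj y oL y)) = Lam p th (dA y)" if "y \<in> M" for y
 proof -
  have "Lam (p / 2) th (dA (adj y oL y)) = Lam (p / 2) th (\<lambda>s. dA y (sqrt s))"
  proof (rule Lam_cong)
   fix s :: real assume "0 < s"
   thus "dA (adj y oL y) s = dA y (sqrt s)" using dA_square[OF that, of "sqrt s"] by simp
  qed
  also have "... = Lam p th (dA y)" using Lam_double[OF p2, of th "dA y"] by simp
  finally show ?thesis .
 qed
 have left: "Lam p th (dA (y - (f oL y))) <= ennreal eps"
  if y: "y \<in> M" and f: "f \<in> M" "selfadj f" "f oL f = f" and L: "Lam p th (dA y) <= 1" "1 <= Lam p th (dA (f oL y)) + ennreal \<delta>" for y f
 proof -
  let ?e = "f oL y" and ?g = "y - (f oL y)"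
  have em: "?e \<in> M" "?g \<in> M" by (intro M_diff M_compose f y)+
  have ff: "f $ f $ xi = f $ xi" for xi using f(3) by (metis blinfun_apply_blinfun_compose)
  have "(adj ?e oL ?e) + (adj ?g oL ?g) = adj y oL y"
   using f(2) by (intro blinfun_eqI) (simp add: selfadj_iff ff blinfun.add_left blinfun.diff_left blinfun.diff_right)
  thus ?thesis
   using umodD[OF um, of "adj ?e oL ?e" "adj ?g oL ?g"] L unfolding sq[OF em(2), symmetric]
   by (simp only: sq[OF y] sq[OF em(1)] M_compose M_adj em posop_adj_self simp_thms)
 qed
 have adjL: "Lam p th (dA (adj y)) = Lam p th (dA y)" if "y \<in> M" for y by (intro Lam_cong dA_adj that) auto
 have right: "Lam p th (dA (y - (y oL f))) <= ennreal eps"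
  if y: "y \<in> M" and f: "f \<in> M" "selfadj f" "f oL f = f" and L: "Lam p th (dA y) <= 1" "1 <= Lam p th (dA (y oL f)) + ennreal \<delta>" for y f
 proof -
  have af: "f oL adj y = adj (y oL f)" "adj y - adj (y oL f) = adj (y - (y oL f))" using f(2) by (simp_all add: selfadj_iff)
  show ?thesis
   using left[OF M_adj[OF y] f] L
   unfolding af adjL[OF y] adjL[OF M_compose[OF y f(1)]] adjL[OF M_diff[OF y M_compose[OF y f(1)]]] by simp
 qed
 show ?thesis using d left right by (intro exI[of _ \<delta>]) blast
qed

end

section \<open>The Lorentz norm as an integral of the distribution function\<close>

lemma ennreal_eq_topI: assumes "\<And>n::nat. ennreal (real n) <= x" shows "x = top"
proof (rule ccontr)
 assume "x \<noteq> top"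
 then obtain r where r: "x = ennreal r" "0 <= r" by (cases x) auto
 obtain n :: nat where "r < real n" using reals_Archimedean2 by blast
 thus False using assms[of n] r by simp
qed

lemma emeasure_lborel_squeeze:
 assumes A: "A \<in> sets borel" "{u. 0 < u \<and> ennreal u < c} \<subseteq> A" "A \<subseteq> {u. 0 <= u \<and> ennreal u <= c}"
 shows "emeasure lborel A = c"
proof (cases c)
 case (real r)
 have "emeasure lborel {0<..<r} <= emeasure lborel A"
  using A real by (intro emeasure_mono) (auto simp: ennreal_less_iff)
 moreover have "emeasure lborel A <= emeasure lborel {0..r}"
  using A real by (intro emeasure_mono) (auto simp: ennreal_le_iff)
 ultimately show ?thesis using real by simp
next
 case top
 have "ennreal (real n) <= emeasure lborel A" for n
 proof -
  have "emeasure lborel {0<..<real n} <= emeasure lborel A"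
   using A top by (intro emeasure_mono) auto
  thus ?thesis by simp
 qed
 thus ?thesis using top by (simp add: ennreal_eq_topI)
qed

lemma ennreal_powr_layer_cake:
 assumes p: "0 < p"
 shows "ennreal_powr y p = (\<integral>\<^sup>+ r. indicator {r. 0 < r \<and> ennreal (r powr (1 / p)) < y} r \<partial>lborel)"
proof -
 let ?A = "{r. 0 < r \<and> ennreal (r powr (1 / p)) < y}"
 have lt: "ennreal (r powr (1 / p)) < y \<longleftrightarrow> ennreal r < ennreal_powr y p" if "0 < r" for r
 proof (cases y)
  case (real c)
  have "r powr (1 / p) < c \<longleftrightarrow> r < c powr p"
   using powr_less_cancel2[of p "r powr (1 / p)" c] powr_less_mono2[of p "r powr (1 / p)" c] p that real
   by (cases "c = 0") (auto simp: powr_powr)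
  thus ?thesis using real that by (simp add: ennreal_less_iff)
 qed (use that in simp)
 hence eq: "?A = {r. 0 < r \<and> ennreal r < ennreal_powr y p}" by auto
 have "?A \<in> sets borel" by measurable
 hence "(\<integral>\<^sup>+ r. indicator ?A r \<partial>lborel) = emeasure lborel ?A" by simp
 also have "... = ennreal_powr y p"
  using \<open>?A \<in> sets borel\<close> by (rule emeasure_lborel_squeeze) (unfold eq, auto)
 finally show ?thesis by simp
qed

lemma continuous_on_pos_part_powr: "0 < th ==> continuous_on UNIV (\<lambda>t::real. (max 0 t) powr th)"
 by (rule continuous_on_powr') (auto intro!: continuous_on_max continuous_on_id continuous_on_const)

lemma emeasure_interval_measure_powr:
 assumes th: "0 < th"
 shows "emeasure (interval_measure (\<lambda>t. (max 0 t) powr th)) {t. 0 <= t \<and> ennreal t < c} = ennreal_powr c th"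
proof -
 let ?F = "\<lambda>t::real. (max 0 t) powr th"
 let ?\<nu> = "interval_measure ?F"
 have Icc: "emeasure ?\<nu> {a..b} = ennreal (?F b - ?F a)" if "a <= b" for a b
 proof (rule emeasure_interval_measure_Icc[OF that])
  show "continuous_on UNIV ?F" by (rule continuous_on_pos_part_powr[OF th])
 qed (use th in \<open>auto intro!: powr_mono2\<close>)
 have fin: "emeasure ?\<nu> {0..<r} = ennreal (r powr th)" if r: "0 <= r" for r
 proof -
  have "emeasure ?\<nu> {0..r} = emeasure ?\<nu> ({0..<r} \<union> {r})" using r by (intro arg_cong[of _ _ "emeasure ?\<nu>"]) auto
  also have "... = emeasure ?\<nu> {0..<r} + emeasure ?\<nu> {r..r}" by (subst plus_emeasure[symmetric]) auto
  finally show ?thesis using Icc[of 0 r] Icc[of r r] r by simp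
 qed
 show ?thesis
 proof (cases c)
  case (real r)
  have "{t. 0 <= t \<and> ennreal t < c} = {0..<r}" using real by (auto simp: ennreal_less_iff)
  thus ?thesis using fin real by simp
 next
  case top
  have "ennreal (real n) <= emeasure ?\<nu> {t. 0 <= t \<and> ennreal t < c}" for n
  proof -
   have "emeasure ?\<nu> {0..<real n powr (1 / th)} <= emeasure ?\<nu> {t. 0 <= t \<and> ennreal t < c}"
    using top by (intro emeasure_mono) auto
   thus ?thesis using th by (simp add: fin powr_powr)
  qed
  thus ?thesis using top by (simp add: ennreal_eq_topI)
 qed
qed

text \<open>Layer cake for the p-th power of \<mu>, Tonelli, and the Stieltjes measure d^(p/q) of
  the interval from 0 to d. Hypothesis \<open>iff\<close> says that \<mu> and d are generalized
  inverses, so rearranging \<mu> gives \<mu> back.\<close>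

lemma lorentz_norm_eq_Lam:
 assumes d: "distf d" and p: "0 < p" "0 < q"
  and iff: "\<And>s t. 0 <= s ==> 0 <= t ==> \<mu> t <= ennreal s \<longleftrightarrow> d s <= ennreal t"
  and fin: "\<And>t. 0 < t ==> \<mu> t < \<infinity>"
  and meas: "\<And>s. 0 <= s ==> {u \<in> {0..}. s < enn2real (\<mu> u)} \<in> sets borel"
 shows "lorentz_norm q p (\<lambda>t. complex_of_real (enn2real (\<mu> t))) = ennreal_powr (Lam p (p / q) d) (1 / p)"
proof -
 let ?f = "\<lambda>t. complex_of_real (enn2real (\<mu> t))"
 let ?\<nu> = "interval_measure (\<lambda>t. (max 0 t) powr (p / q))"
 have iff': "ennreal s < \<mu> t \<longleftrightarrow> ennreal t < d s" if "0 <= s" "0 <= t" for s t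
  using iff[OF that] by (simp add: not_le[symmetric])
 have em: "emeasure (lebesgue_on {0..}) {u \<in> {0..}. s < cmod (?f u)} = d s" if s: "0 <= s" for s
 proof -
  let ?A = "{u \<in> {0..}. s < enn2real (\<mu> u)}"
  have "emeasure (lebesgue_on {0..}) ?A = emeasure lebesgue ?A"
   by (intro emeasure_restrict_space) auto
  also have "... = emeasure lborel ?A" using meas[OF s] by (simp add: emeasure_completion)
  also have "... = d s"
  proof (rule emeasure_lborel_squeeze[OF meas[OF s]])
   show "{u. 0 < u \<and> ennreal u < d s} \<subseteq> ?A"
   proof clarsimp
    fix u :: real assume u: "0 < u" "ennreal u < d s"
    obtain m where "\<mu> u = ennreal m" "0 <= m" using fin[OF u(1)] by (cases "\<mu> u") auto
    thus "s < enn2real (\<mu> u)" using iff'[of s u] u s by (simp add: ennreal_less_iff)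
   qed
   show "?A \<subseteq> {u. 0 <= u \<and> ennreal u <= d s}"
   proof clarsimp
    fix u :: real assume u: "0 <= u" "s < enn2real (\<mu> u)"
    then obtain m where "\<mu> u = ennreal m" "0 <= m" using s by (cases "\<mu> u") auto
    thus "ennreal u <= d s" using iff'[of s u] u s by (simp add: ennreal_less_iff)
   qed
  qed
  finally show ?thesis by simp
 qed
 have dr: "decreasing_rearrangement ?f t = \<mu> t" if t: "0 <= t" for t
 proof -
  have e: "emeasure (lebesgue_on {0..}) {u \<in> {0..}. s < cmod (?f u)} <= ennreal t \<longleftrightarrow> \<mu> t <= ennreal s" if "0 <= s" for s
   unfolding em[OF that] iff[OF that t] ..
  have "decreasing_rearrangement ?f t = Inf {ennreal s |s. 0 <= s \<and> \<mu> t <= ennreal s}"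
   unfolding decreasing_rearrangement_def by (intro arg_cong[of _ _ Inf] Collect_cong ex_cong1 conj_cong refl) (rule e)
  also have "... = \<mu> t"
  proof (cases "\<mu> t")
   case (real m)
   thus ?thesis by (intro antisym Inf_lower Inf_greatest) auto
  qed (auto simp: top_unique)
  finally show ?thesis .
 qed
 interpret N: sigma_finite_measure ?\<nu>
 proof (rule sigma_finite_interval_measure)
  have "isCont (\<lambda>t. (max 0 t) powr (p / q)) a" for a :: real
   using continuous_on_pos_part_powr[of "p / q"] p by (simp add: continuous_on_eq_continuous_at)
  thus "continuous (at_right a) (\<lambda>t. (max 0 t) powr (p / q))" for a :: real
   by (rule continuous_at_imp_continuous_at_within)
 qed (use p in \<open>auto intro!: powr_mono2\<close>)
 interpret pair_sigma_finite ?\<nu> lborel ..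
 let ?g = "\<lambda>r. d (r powr (1 / p)) * indicator {0<..} r"
 have gm [measurable]: "?g \<in> borel_measurable borel" by (rule distf_measurable_comp[OF d]) auto
 have "(\<integral>\<^sup>+ t \<in> {0..}. ennreal_powr (decreasing_rearrangement ?f t) p \<partial>?\<nu>)
  = (\<integral>\<^sup>+ t. \<integral>\<^sup>+ r. indicator {(t, r). 0 <= t \<and> ennreal t < ?g r} (t, r) \<partial>lborel \<partial>?\<nu>)"
 proof (rule nn_integral_cong)
  fix t
  show "ennreal_powr (decreasing_rearrangement ?f t) p * indicator {0..} t = (\<integral>\<^sup>+ r. indicator {(t, r). 0 <= t \<and> ennreal t < ?g r} (t, r) \<partial>lborel)"
  proof (cases "0 <= t")
   case True
   thus ?thesis
    unfolding dr[OF True] ennreal_powr_layer_cake[OF p(1)]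
    by (auto intro!: nn_integral_cong simp: iff' indicator_def)
  qed simp
 qed
 also have "... = (\<integral>\<^sup>+ r. \<integral>\<^sup>+ t. indicator {(t, r). 0 <= t \<and> ennreal t < ?g r} (t, r) \<partial>?\<nu> \<partial>lborel)"
  by (rule Fubini'[symmetric]) measurable
 also have "... = (\<integral>\<^sup>+ r. ennreal_powr (?g r) (p / q) \<partial>lborel)"
 proof (rule nn_integral_cong)
  fix r
  have "(\<integral>\<^sup>+ t. indicator {(t, r). 0 <= t \<and> ennreal t < ?g r} (t, r) \<partial>?\<nu>) = (\<integral>\<^sup>+ t. indicator {t. 0 <= t \<and> ennreal t < ?g r} t \<partial>?\<nu>)"
   by (intro nn_integral_cong) (auto simp: indicator_def)
  also have "... = emeasure ?\<nu> {t. 0 <= t \<and> ennreal t < ?g r}" by (rule nn_integral_indicator) measurable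
  finally show "(\<integral>\<^sup>+ t. indicator {(t, r). 0 <= t \<and> ennreal t < ?g r} (t, r) \<partial>?\<nu>) = ennreal_powr (?g r) (p / q)"
   using p by (simp add: emeasure_interval_measure_powr)
 qed
 also have "... = Lam p (p / q) d"
  unfolding Lam_def by (intro nn_integral_cong) (auto split: split_indicator)
 finally show ?thesis by (simp add: lorentz_norm_def)
qed

context traced_algebra
begin

lemma distf_dst: "maff x ==> distf (dst x)"
 by (simp add: distf_def dst_antimono)

text \<open>Right continuity of the distribution function makes the infimum attained; this is the
  inverse relation that the layer cake asks for.\<close>

lemma gen_singular_value_le:
 assumes x: "maff x" and s: "0 <= s" shows "gen_singular_value \<tau> x t <= ennreal s \<longleftrightarrow> dst x s <= ennreal t"
proof
 assume le: "gen_singular_value \<tau> x t <= ennreal s"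
 have "dst x (s + 1 / (real n + 1)) <= ennreal t" for n
 proof -
  have "ennreal s < ennreal (s + 1 / (real n + 1))" using s by (intro ennreal_lessI) (auto intro: add_nonneg_pos)
  with le have "gen_singular_value \<tau> x t < ennreal (s + 1 / (real n + 1))" by (rule order.strict_trans1)
  then obtain s' where "0 <= s'" "s' < s + 1 / (real n + 1)" "dst x s' <= ennreal t" using gen_singular_value_less[OF x] by blast
  thus ?thesis using dst_antimono[OF x, of s' "s + 1 / (real n + 1)"] by simp
 qed
 thus "dst x s <= ennreal t" by (subst dst_right_continuous[OF x]) (rule SUP_least)
next
 assume "dst x s <= ennreal t"
 thus "gen_singular_value \<tau> x t <= ennreal s" unfolding gen_singular_value_eq[OF x] using s by (intro Inf_lower) auto
qed

lemma lorentz_norm_dst: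
 assumes x: "x \<in> mops" and p: "0 < p" "0 < q"
 shows "lorentz_norm q p (singular_value_fun \<tau> x) = ennreal_powr (Lam p (p / q) (dst x)) (1 / p)"
proof -
 have mx: "maff x" by (rule measurable_maff[OF x])
 let ?m = "gen_singular_value \<tau> x"
 note le = gen_singular_value_le[OF mx]
 have fin: "?m t < \<infinity>" if t: "0 < t" for t
 proof -
  obtain s0 where "0 <= s0" "dst x s0 < \<infinity>" using x by (auto simp: measurable_ops_iff)
  then obtain n :: nat where "dst x (real n) <= ennreal t" using dst_vanish[OF mx _ _ t] by blast
  hence "?m t <= ennreal (real n)" using le[of "real n" t] by simp
  thus ?thesis by (simp add: order.strict_trans1)
 qed
 have meas: "{u \<in> {0..}. s < enn2real (?m u)} \<in> sets borel" if s: "0 <= s" for s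
 proof -
  \<comment> \<open>At u = 0 the singular value may be infinite, and \<open>enn2real\<close> then
    returns 0; this single point is split off.\<close>
  have "{u \<in> {0..}. s < enn2real (?m u)} = {u. 0 < u \<and> ennreal u < dst x s} \<union> {u \<in> {0}. s < enn2real (?m u)}"
  proof -
   have "s < enn2real (?m u) \<longleftrightarrow> ennreal u < dst x s" if u: "0 < u" for u
   proof -
    obtain m where "?m u = ennreal m" "0 <= m" using fin[OF u] by (cases "?m u") auto
    thus ?thesis using le[OF s, of u] s by (auto simp: ennreal_le_iff not_le[symmetric])
   qed
   thus ?thesis by (auto simp: order_less_le)
  qed
  moreover have "{u \<in> {0}. s < enn2real (?m u)} \<in> sets borel" by (intro borel_closed finite_imp_closed) simp
  ultimately show ?thesis by (simp add: sets.Un)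
 qed
 show ?thesis
  unfolding singular_value_fun_def[abs_def]
  by (rule lorentz_norm_eq_Lam[OF distf_dst[OF mx] p le fin meas])
qed

end

section \<open>Sequences converging locally in measure\<close>

text \<open>Comparison with a nearby operator costs a shift both in the argument and in the trace.
  By right continuity and monotone convergence a small shift costs little of the integral.\<close>

lemma Lam_shift_SUP:
 assumes d: "distf d" and rc: "\<And>s. 0 < s ==> d s = (SUP n. d (s + 1 / (real n + 1)))"
  and fin: "\<And>s. 0 < s ==> d s < \<infinity>" and th: "0 < th"
 shows "Lam p th d = (SUP n. Lam p th (\<lambda>s. d (s + 1 / (real n + 1)) - ennreal (1 / (real n + 1))))"
proof -
 let ?e = "\<lambda>n. 1 / (real n + 1)"
 let ?d = "\<lambda>n s. d (s + ?e n) - ennreal (?e n)"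
 have e: "?e (Suc n) <= ?e n" for n by (simp add: field_simps)
 have e0: "?e ----> 0" by real_asymp
 have dn: "distf (?d n)" for n
  unfolding distf_def by (intro allI impI ennreal_minus_mono distfD[OF d]) (auto intro: add_pos_nonneg)
 have inc: "?d n s <= ?d (Suc n) s" if "0 < s" for n s
  using that e[of n] by (intro ennreal_minus_mono distfD[OF d] ennreal_leI) (auto intro: add_pos_nonneg)
 have pt: "(SUP n. ennreal_powr (?d n s) th) = ennreal_powr (d s) th" if s: "0 < s" for s
 proof -
  obtain a where a: "d s = ennreal a" "0 <= a" using fin[OF s] by (cases "d s") auto
  define b where "b n = enn2real (d (s + ?e n))" for n
  have le: "d (s + ?e n) <= d s" for n using s by (intro distfD[OF d]) auto
  have b: "d (s + ?e n) = ennreal (b n)" "0 <= b n" for n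
   using le[of n] a by (cases "d (s + ?e n)"; auto simp: b_def top_unique)+
  have "incseq (\<lambda>n. d (s + ?e n))"
   using s e by (intro incseq_SucI distfD[OF d]) (auto intro: add_pos_nonneg)
  hence "(\<lambda>n. d (s + ?e n)) ----> d s" unfolding rc[OF s] by (rule LIMSEQ_SUP)
  hence "b ----> a" unfolding a(1) b(1) using a(2) b(2) by (subst (asm) tendsto_ennreal_iff) auto
  hence "(\<lambda>n. (max 0 (b n - ?e n)) powr th) ----> (max 0 (a - 0)) powr th"
   using th by (intro tendsto_powr' tendsto_max tendsto_diff tendsto_const e0) (auto simp: e0)
  hence "(\<lambda>n. ennreal ((max 0 (b n - ?e n)) powr th)) ----> ennreal ((max 0 (a - 0)) powr th)" by (rule tendsto_ennrealI)
  moreover have "ennreal_powr (?d n s) th = ennreal ((max 0 (b n - ?e n)) powr th)" for n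
  proof -
   have "?d n s = ennreal (max 0 (b n - ?e n))" unfolding b(1) ennreal_max_0 by (rule ennreal_minus) simp
   thus ?thesis by simp
  qed
  moreover have "ennreal_powr (d s) th = ennreal ((max 0 (a - 0)) powr th)" using a by (simp add: max_absorb2)
  ultimately have "(\<lambda>n. ennreal_powr (?d n s) th) ----> ennreal_powr (d s) th" by simp
  moreover have "incseq (\<lambda>n. ennreal_powr (?d n s) th)"
   using inc[OF s] th by (intro incseq_SucI ennreal_powr_mono) auto
  ultimately show ?thesis using LIMSEQ_unique[OF LIMSEQ_SUP] by blast
 qed
 have "Lam p th d = (\<integral>\<^sup>+ r. (SUP n. ennreal_powr (?d n (r powr (1 / p))) th * indicator {0<..} r) \<partial>lborel)"
  unfolding Lam_def
 proof (rule nn_integral_cong)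
  fix r :: real
  show "ennreal_powr (d (r powr (1 / p))) th * indicator {0<..} r = (SUP n. ennreal_powr (?d n (r powr (1 / p))) th * indicator {0<..} r)"
   by (cases "0 < r") (simp_all add: pt)
 qed
 also have "... = (SUP n. Lam p th (?d n))"
  unfolding Lam_def
 proof (rule nn_integral_monotone_convergence_SUP)
  show "incseq (\<lambda>n r. ennreal_powr (?d n (r powr (1 / p))) th * indicator {0<..} r)"
   using inc th by (intro incseq_SucI le_funI) (auto intro: ennreal_powr_mono split: split_indicator)
  show "(\<lambda>r. ennreal_powr (?d n (r powr (1 / p))) th * indicator {0<..} r) \<in> borel_measurable lborel" for n
   using Lam_measurable[OF dn] th by simp
 qed
 finally show ?thesis .
qed

lemma distf_cut: "distf d ==> distf (\<lambda>s. d (max s k))"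
 unfolding distf_def by (intro allI impI) (metis max.strict_coboundedI1 max.mono order_refl)

text \<open>d (max s k) bounds the part of an operator removed by truncation at k; the integrands
  decrease to 0 and are dominated by that of d.\<close>

lemma Lam_tail_vanish:
 assumes d: "distf d" and fin: "Lam p th d < \<infinity>" and van: "\<And>kap::real. 0 < kap ==> \<exists>n. d (real (Suc n)) <= ennreal kap"
  and th: "0 < th" and e: "0 < eps"
 shows "\<exists>K::nat. \<forall>k\<ge>K. Lam p th (\<lambda>s. d (max s (real k))) <= ennreal eps"
proof -
 let ?d = "\<lambda>k s. d (max s (real k))"
 have mono: "?d k s <= ?d j s" if "0 < s" "j <= k" for j k s using that by (intro distfD[OF d]) auto
 let ?g = "\<lambda>k r. ennreal_powr (?d k (r powr (1 / p))) th * indicator {0<..} r"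
 have pt: "(INF k. ?g k r) = 0" for r
 proof (cases "0 < r")
  case True
  have "(INF k. ?g k r) <= 0"
  proof (rule ennreal_le_epsilon)
   fix a :: real assume "0 < a"
   then obtain n where n: "d (real (Suc n)) <= ennreal (a powr (1 / th))" using van[of "a powr (1 / th)"] by auto
   have "?d (Suc n) (r powr (1 / p)) <= d (real (Suc n))" by (intro distfD[OF d]) auto
   hence "?d (Suc n) (r powr (1 / p)) <= ennreal (a powr (1 / th))" using n by (rule order_trans)
   hence "?g (Suc n) r <= ennreal_powr (ennreal (a powr (1 / th))) th" using True th by (simp del: ennreal_powr_ennreal add: ennreal_powr_mono)
   also have "... = ennreal a" using th \<open>0 < a\<close> by (simp add: powr_powr)
   finally have "?g (Suc n) r <= ennreal a" .
   moreover have "(INF k. ?g k r) <= ?g (Suc n) r" by (rule INF_lower) simp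
   ultimately show "(INF k. ?g k r) <= 0 + ennreal a" by (simp only: add_0 order_trans)
  qed
  thus ?thesis by simp
 qed simp
 have "(INF k. Lam p th (?d k)) = (\<integral>\<^sup>+ r. (INF k. ?g k r) \<partial>lborel)"
  unfolding Lam_def
 proof (rule nn_integral_monotone_convergence_INF_decseq[symmetric])
  show "decseq ?g"
  proof (intro decseq_SucI le_funI)
   fix n and r :: real
   show "?g (Suc n) r <= ?g n r"
    using ennreal_powr_mono[OF mono[of "r powr (1 / p)" n "Suc n"], of th] th by (cases "0 < r") auto
  qed
  show "?g k \<in> borel_measurable lborel" for k using Lam_measurable[OF distf_cut[OF d]] th by simp
  have "Lam p th (?d 0) <= Lam p th d" using th by (intro Lam_mono distfD[OF d]) auto
  thus "integral\<^sup>N lborel (?g 0) < \<infinity>" using fin unfolding Lam_def by (rule order.strict_trans1)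
 qed
 also have "... < ennreal eps" using e by (simp add: pt)
 finally obtain K where K: "Lam p th (?d K) < ennreal eps" by (auto simp: INF_less_iff)
 have "Lam p th (?d k) <= ennreal eps" if "K <= k" for k
 proof -
  have "Lam p th (?d k) <= Lam p th (?d K)" using th mono that by (intro Lam_mono) auto
  thus ?thesis using K by simp
 qed
 thus ?thesis by blast
qed

lemma Lam_bounded_support:
 assumes c: "0 < c" "0 < p" "0 <= th" and d: "\<And>s. 0 < s ==> d s <= C" "\<And>s. c <= s ==> d s = 0"
 shows "Lam p th d <= ennreal_powr C th * ennreal (c powr p)"
proof -
 have "ennreal_powr (d (r powr (1 / p))) th * indicator {0<..} r <= ennreal_powr C th * indicator {0<..c powr p} r" for r
 proof (cases "0 < r \<and> c powr p < r")
  case True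
  hence "c <= r powr (1 / p)" using powr_mono2[of "1 / p" "c powr p" r] c by (simp add: powr_powr)
  thus ?thesis using d(2) by simp
 next
  case False
  thus ?thesis using d(1)[of "r powr (1 / p)"] c by (auto intro: ennreal_powr_mono split: split_indicator)
 qed
 hence "Lam p th d <= (\<integral>\<^sup>+ r. ennreal_powr C th * indicator {0<..c powr p} r \<partial>lborel)"
  unfolding Lam_def by (intro nn_integral_mono)
 also have "... = ennreal_powr C th * ennreal (c powr p)" by (subst nn_integral_cmult_indicator) auto
 finally show ?thesis .
qed

section \<open>Truncations, carriers and compressions\<close>

context traced_algebra
begin

text \<open>All three compare x with x \<chi>(|x| \<le> k). In the last one the truncation error
  vanishes where |x| \<le> k and is bounded by s where k < |x| \<le> s, so only the part beyond max
  s k has to be excluded.\<close>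

lemma
 assumes x: "maff x" and k: "0 <= k" and s: "0 <= s"
 shows dA_trunc_le: "dA (trunc x k) s <= dst x s"
  and dst_le_trunc: "dst x s <= dA (trunc x k) s + dst x k"
  and trunc_tail: "specF (opT x) {max s k<..} $ xi = 0 ==> \<exists>eta. (xi, eta) \<in> x \<and> norm (eta - trunc x k $ xi) <= s * norm xi"
proof -
 have fixF: "specF (opT x) {..t} $ xi = xi" if "specF (opT x) {t<..} $ xi = 0" for t xi
  using specF_compl[OF maff_resop[OF x], of "{..t}" xi] that by (simp add: Compl_atMost)
 have nF: "norm (specF (opT x) {..t} $ xi) <= 1 * norm xi" "norm (xi - specF (opT x) {..t} $ xi) <= 1 * norm xi" for t xi
 proof -
  show "norm (specF (opT x) {..t} $ xi) <= 1 * norm xi"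
   unfolding specF_def by (rule norm_fc_le[OF maff_posop[OF x] okf_sg_indicator]) auto
  have "norm (specF (opT x) (- {..t}) $ xi) <= 1 * norm xi"
   unfolding specF_def by (rule norm_fc_le[OF maff_posop[OF x] okf_sg_indicator]) auto
  thus "norm (xi - specF (opT x) {..t} $ xi) <= 1 * norm xi" by (simp only: specF_compl[OF maff_resop[OF x]] sets.sets_into_space atMost_borel)
 qed
 note at = dst_attained[OF x s]
 show "dA (trunc x k) s <= dst x s"
 proof -
  let ?V = "kr (specF (opT x) {s<..})"
  have "dA (trunc x k) s <= cod ?V"
  proof (rule dA_le[OF trunc_M[OF x k]])
   show "msub ?V" using at by blast
   fix xi assume "xi \<in> ?V"
   hence "specF (opT x) {s<..} $ specF (opT x) {..k} $ xi = 0"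
    using specF_mult[OF maff_resop[OF x], of "{s<..}" "{..k}" xi] specF_mult[OF maff_resop[OF x], of "{..k}" "{s<..}" xi]
    by (simp add: kr_def Int_commute)
   then obtain eta where eta: "(specF (opT x) {..k} $ xi, eta) \<in> x" "norm eta <= s * norm (specF (opT x) {..k} $ xi)"
    using at unfolding good_def kr_def by blast
   have "eta = trunc x k $ xi" by (rule maff_single[OF x eta(1) trunc_in[OF x k]])
   moreover have "s * norm (specF (opT x) {..k} $ xi) <= s * norm xi" using nF(1) s by (intro mult_left_mono) auto
   ultimately show "norm (trunc x k $ xi) <= s * norm xi" using eta(2) by simp
  qed
  thus ?thesis using at by simp
 qed
 show "dst x s <= dA (trunc x k) s + dst x k"
 proof -
  obtain V where V: "msub V" "\<And>xi. xi \<in> V ==> norm (trunc x k $ xi) <= s * norm xi" "cod V = dA (trunc x k) s"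
   by (rule dA_attained[OF trunc_M[OF x k] s]) blast
  let ?W = "kr (specF (opT x) {k<..})"
  have W: "msub ?W" "cod ?W = dst x k" using dst_attained[OF x k] by auto
  have "good x s (V \<inter> ?W)"
   unfolding good_def
  proof
   fix xi assume xi: "xi \<in> V \<inter> ?W"
   hence "(xi, trunc x k $ xi) \<in> x" using trunc_in[OF x k, of xi] fixF[of k xi] by (simp add: kr_def)
   thus "\<exists>eta. (xi, eta) \<in> x \<and> norm eta <= s * norm xi" using V(2) xi by blast
  qed
  hence "dst x s <= cod (V \<inter> ?W)" by (rule dst_le_cod[OF x msub_Int[OF V(1) W(1)]])
  thus ?thesis using cod_Int[OF V(1) W(1)] by (simp add: V(3) W(2))
 qed
 assume xi: "specF (opT x) {max s k<..} $ xi = 0"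
 show "\<exists>eta. (xi, eta) \<in> x \<and> norm (eta - trunc x k $ xi) <= s * norm xi"
 proof (cases "s <= k")
  case True
  hence "(xi, trunc x k $ xi) \<in> x" using trunc_in[OF x k, of xi] fixF[OF xi] by (simp add: max_absorb2)
  thus ?thesis using s by (intro exI[of _ "trunc x k $ xi"]) simp
 next
  case False
  hence "(xi, trunc x s $ xi) \<in> x" using trunc_in[OF x s, of xi] fixF[OF xi] by (simp add: max_absorb1)
  moreover have "trunc x s $ xi - trunc x k $ xi = trunc x s $ (xi - specF (opT x) {..k} $ xi)"
   using trunc_specF[OF x k, of s xi] False by (simp add: blinfun.diff_right)
  moreover have "norm (trunc x s $ (xi - specF (opT x) {..k} $ xi)) <= s * norm xi"
   using norm_trunc[OF x s, of "xi - specF (opT x) {..k} $ xi"] nF(2)[of xi k] mult_left_mono[OF _ s] by fastforce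
  ultimately show ?thesis by auto
 qed
qed

text \<open>Three contributions of size s: the difference of the truncations and the two truncation
  errors, each on its own subspace.\<close>

lemma dst_op_diff_le:
 assumes u: "u \<in> mops" "u' \<in> mops" and k: "0 <= k" "0 <= k'" and s: "0 <= s"
 shows "dst (op_diff u u') (3 * s) <= dA (trunc u k - trunc u' k') s + dst u (max s k) + dst u' (max s k')"
proof -
 note m = measurable_maff[OF u(1)] measurable_maff[OF u(2)]
 let ?y = "trunc u k - trunc u' k'"
 have yM: "?y \<in> M" by (intro M_diff trunc_M m k)
 obtain V where V: "msub V" "\<And>xi. xi \<in> V ==> norm (?y $ xi) <= s * norm xi" "cod V = dA ?y s"
  by (rule dA_attained[OF yM s]) blast
 let ?A = "kr (specF (opT u) {max s k<..})" and ?B = "kr (specF (opT u') {max s k'<..})"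
 have A: "msub ?A" "cod ?A = dst u (max s k)" "msub ?B" "cod ?B = dst u' (max s k')"
  using dst_attained[OF m(1), of "max s k"] dst_attained[OF m(2), of "max s k'"] s by auto
 have "good (op_diff u u') (3 * s) (V \<inter> ?A \<inter> ?B)"
  unfolding good_def
 proof
  fix xi assume xi: "xi \<in> V \<inter> ?A \<inter> ?B"
  obtain eta where eta: "(xi, eta) \<in> u" "norm (eta - trunc u k $ xi) <= s * norm xi"
   using trunc_tail[OF m(1) k(1) s, of xi] xi by (auto simp: kr_def)
  obtain zeta where zeta: "(xi, zeta) \<in> u'" "norm (zeta - trunc u' k' $ xi) <= s * norm xi"
   using trunc_tail[OF m(2) k(2) s, of xi] xi by (auto simp: kr_def)
  have "eta - zeta = ?y $ xi + ((eta - trunc u k $ xi) - (zeta - trunc u' k' $ xi))" by (simp add: blinfun.diff_left)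
  also have "norm ... <= norm (?y $ xi) + (norm (eta - trunc u k $ xi) + norm (zeta - trunc u' k' $ xi))"
   by (intro norm_triangle_le add_left_mono norm_triangle_ineq4)
  also have "... <= s * norm xi + (s * norm xi + s * norm xi)" using V(2) xi by (intro add_mono eta zeta) auto
  finally show "\<exists>eta. (xi, eta) \<in> op_diff u u' \<and> norm eta <= 3 * s * norm xi"
   using op_diff_rel[OF eta(1) zeta(1)] by (intro exI[of _ "eta - zeta"]) simp
 qed
 hence "dst (op_diff u u') (3 * s) <= cod (V \<inter> ?A \<inter> ?B)"
  by (rule dst_le_cod[OF measurable_maff[OF op_diff_measurable[OF u]] msub_Int[OF msub_Int[OF V(1) A(1)] A(3)]])
 also have "... <= cod (V \<inter> ?A) + cod ?B" by (rule cod_Int[OF msub_Int[OF V(1) A(1)] A(3)])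
 also have "... <= cod V + cod ?A + cod ?B" by (intro add_right_mono cod_Int V A)
 finally show ?thesis by (simp add: A V)
qed

text \<open>The ranges of E and of trunc x k E each have dimension at most \<open>dst x c\<close>,
  and V is the closed span of both.\<close>

lemma ex_carrier:
 assumes x: "maff x" and c: "0 <= k" "dst x c < \<infinity>"
 defines "E \<equiv> specF (opT x) {c<..}"
 shows "\<exists>V. msub V \<and> dm V < \<infinity> \<and> (\<forall>xi. E $ xi \<in> V \<and> trunc x k $ E $ xi \<in> V)"
proof -
 let ?w = "trunc x k" and ?A = "kr E" and ?B = "kr (adj (trunc x k oL E))"
 have EM: "E \<in> M" unfolding E_def by (rule maff_specF[OF x]) simp
 have wM: "?w \<in> M" by (rule trunc_M[OF x c(1)])
 have sE: "adj E = E" using specF_selfadj[OF maff_resop[OF x], of "{c<..}"] by (simp add: E_def selfadj_iff)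
 have A: "msub ?A" and B: "msub ?B" by (intro msub_kr M_adj M_compose EM wM)+
 have cA: "cod ?A = dst x c" using specF_dim(3)[OF x, of "{c<..}"] by (simp add: E_def dst_def)
 have "cod ?B <= dm (perp ?A)"
  unfolding cod_def
 proof (rule dm_support_le)
  show "adj (?w oL E) \<in> M" "msub (perp ?A)" by (intro M_adj M_compose msub_perp EM wM A)+
  fix xi
  show "adj (?w oL E) $ xi \<in> perp ?A"
   unfolding perp_def kr_def using adj'[of E "adj ?w $ xi"] by (auto simp: sE)
 qed
 hence cB: "cod ?B <= dst x c" using cA by (simp add: cod_def)
 have "dm (perp (?A \<inter> ?B)) <= cod ?A + cod ?B" using cod_Int[OF A B] by (simp add: cod_def)
 also have "... <= dst x c + dst x c" using cA cB by (intro add_mono) auto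
 also have "... < \<infinity>" using c by simp
 finally have "dm (perp (?A \<inter> ?B)) < \<infinity>" .
 moreover have "E $ xi \<in> perp (?A \<inter> ?B)" "?w $ E $ xi \<in> perp (?A \<inter> ?B)" for xi
  using adj[of E xi] adj[of "?w oL E" xi] by (auto simp: perp_def kr_def sE)
 ultimately show ?thesis using msub_perp[OF msub_Int[OF A B]] by blast
qed

text \<open>Where |u| \<le> k and |x| \<le> k' the truncations are the operators themselves, so the
  bound for the compressed difference can be read on bounded operators.\<close>

lemma common_subspace:
 assumes u: "u \<in> mops" "x \<in> mops" and k: "0 <= k" "0 <= k'" and e: "e \<in> M" and s: "0 <= s"
 shows "\<exists>W. msub W \<and> cod W <= dst (sandwich e (op_diff u x)) s + dst u k + dst x k' \<and>
  (\<forall>xi\<in>W. e $ xi = xi --> norm (e $ (trunc u k $ xi - trunc x k' $ xi)) <= s * norm xi)"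
proof -
 note m = measurable_maff[OF u(1)] measurable_maff[OF u(2)]
 have mz: "maff (sandwich e (op_diff u x))" by (intro measurable_maff sandwich_measurable op_diff_measurable u e)
 let ?V = "kr (specF (opT (sandwich e (op_diff u x))) {s<..})" and ?A = "kr (specF (opT u) {k<..})" and ?B = "kr (specF (opT x) {k'<..})"
 have V: "msub ?V" "good (sandwich e (op_diff u x)) s ?V" "cod ?V = dst (sandwich e (op_diff u x)) s"
  "msub ?A" "cod ?A = dst u k" "msub ?B" "cod ?B = dst x k'"
  using dst_attained[OF mz s] dst_attained[OF m(1) k(1)] dst_attained[OF m(2) k(2)] by auto
 have "cod (?V \<inter> ?A \<inter> ?B) <= cod (?V \<inter> ?A) + cod ?B" by (intro cod_Int msub_Int V)
 also have "... <= cod ?V + cod ?A + cod ?B" by (intro add_right_mono cod_Int V)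
 finally have "cod (?V \<inter> ?A \<inter> ?B) <= dst (sandwich e (op_diff u x)) s + dst u k + dst x k'" by (simp add: V)
 moreover have "norm (e $ (trunc u k $ xi - trunc x k' $ xi)) <= s * norm xi" if xi: "xi \<in> ?V \<inter> ?A \<inter> ?B" "e $ xi = xi" for xi
 proof -
  have "specF (opT u) {..k} $ xi = xi" "specF (opT x) {..k'} $ xi = xi"
   using xi(1) specF_compl[OF maff_resop[OF m(1)], of "{..k}" xi] specF_compl[OF maff_resop[OF m(2)], of "{..k'}" xi]
   by (auto simp: Compl_atMost kr_def)
  hence "(e $ xi, trunc u k $ xi) \<in> u" "(e $ xi, trunc x k' $ xi) \<in> x"
   using trunc_in[OF m(1) k(1), of xi] trunc_in[OF m(2) k(2), of xi] xi(2) by simp_all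
  from sandwich_rel[OF op_diff_rel[OF this]]
  have r: "(xi, e $ (trunc u k $ xi - trunc x k' $ xi)) \<in> sandwich e (op_diff u x)" .
  obtain eta where "(xi, eta) \<in> sandwich e (op_diff u x)" "norm eta <= s * norm xi" using V(2) xi(1) unfolding good_def by blast
  thus ?thesis using maff_single[OF mz r] by blast
 qed
 ultimately show ?thesis using msub_Int[OF msub_Int[OF V(1,4)] V(6)] by blast
qed

text \<open>Lower semicontinuity in quantitative form. In the argument, c pays for the part of x
  below c, which V need not carry, and t for replacing trunc x k by v. In the trace,
  \<open>dst x k\<close> pays for truncation and \<open>cod W\<close> for shrinking V to V \<inter>
  W on the right.\<close>

lemma dA_compression_lower:
 assumes x: "maff x" and k: "0 <= c" "c <= k" and V: "msub V" "\<And>xi. specF (opT x) {c<..} $ xi \<in> V" "\<And>xi. trunc x k $ specF (opT x) {c<..} $ xi \<in> V"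
  and W: "msub W" and v: "v \<in> M" and t: "0 <= t" and s: "0 <= s"
  and close: "\<And>xi. xi \<in> V \<inter> W ==> norm (oproj V $ (v $ xi - trunc x k $ xi)) <= t * norm xi"
 shows "dst x (s + t + c) <= dA (oproj V oL v oL oproj (V \<inter> W)) s + (cod W + dst x k)"
proof -
 let ?E = "specF (opT x) {c<..}" and ?e = "oproj V" and ?f = "oproj (V \<inter> W)"
 define w where "w = trunc x k"
 have k0: "0 <= k" using k by simp
 have VW: "msub (V \<inter> W)" by (rule msub_Int[OF V(1) W])
 note sV = msub_sub[OF V(1)] msub_closed[OF V(1)] and sW = msub_sub[OF VW] msub_closed[OF VW]
 have eM: "?e \<in> M" and fM: "?f \<in> M" and wM: "w \<in> M" and EM: "?E \<in> M"
  unfolding w_def by (auto intro: oproj_M V VW trunc_M[OF x k0] maff_specF[OF x])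
 have cE: "norm (?E $ xi) <= norm xi" for xi
  using norm_fc_le[OF maff_posop[OF x] okf_sg_indicator, of "{c<..}" 1 xi] by (simp add: specF_def)
 have s0: "0 <= s + t" using s t by simp
 have "dst x (s + t + c) <= dA w (s + t + c) + dst x k" unfolding w_def using k s0 by (intro dst_le_trunc[OF x k0]) auto
 also have "dA w (s + t + c) <= dA (w oL ?E) (s + t) + dA (w - (w oL ?E)) c"
  using dA_add[OF M_compose[OF wM EM] M_diff[OF wM M_compose[OF wM EM]] s0 k(1)] by simp
 also have "dA (w - (w oL ?E)) c = 0"
 proof (rule dA_norm)
  show "w - (w oL ?E) \<in> M" by (intro M_diff M_compose wM EM)
  fix xi
  have "?E $ xi = xi - specF (opT x) {..c} $ xi" using specF_compl[OF maff_resop[OF x], of "{..c}" xi] by (simp add: Compl_atMost)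
  hence "(w - (w oL ?E)) $ xi = trunc x c $ xi"
   using trunc_specF[OF x k, of xi] by (simp add: w_def blinfun.diff_left blinfun.diff_right)
  thus "norm ((w - (w oL ?E)) $ xi) <= c * norm xi" using norm_trunc[OF x k(1)] by simp
 qed
 also have "w oL ?E = (?e oL w oL ?e) oL ?E"
  by (rule blinfun_eqI) (simp add: w_def oproj_fix[OF sV] V)
 also have "dA ... (s + t) <= dA (?e oL w oL ?e) (s + t)" by (intro dA_right M_compose eM wM EM cE s0)
 also have "... <= dA (?e oL w oL ?f) (s + t) + dA (?e oL w oL (?e - ?f)) 0"
 proof -
  have "?e oL w oL ?e = (?e oL w oL ?f) + (?e oL w oL (?e - ?f))"
   by (rule blinfun_eqI) (simp add: blinfun.add_left blinfun.diff_left blinfun.diff_right)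
  thus ?thesis using dA_add[of "?e oL w oL ?f" "?e oL w oL (?e - ?f)" "s + t" 0] s0 eM wM fM by (simp add: M_compose M_diff)
 qed
 \<comment> \<open>The difference of the projections is supported on the part of V orthogonal to V
   \<inter> W, whose dimension is bounded by \<open>dm_rel\<close>.\<close>
 also have "dA (?e oL w oL (?e - ?f)) 0 <= cod W"
 proof -
  let ?Y = "V \<inter> perp (V \<inter> W)"
  have Y: "msub ?Y" by (intro msub_Int msub_perp V VW)
  have "(?e - ?f) $ xi = 0" if xi: "xi \<in> perp ?Y" for xi
  proof -
   let ?z = "(?e - ?f) $ xi"
   have zV: "?z \<in> V" using subspace_diff[OF sV(1) oproj_in[OF sV, of xi]] oproj_in[OF sW, of xi] by (simp add: blinfun.diff_left)
   have zp: "?z \<bullet> b = 0" if "b \<in> V \<inter> W" for b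
    using that oproj_inner[OF sV, of b xi] oproj_inner[OF sW that, of xi] by (simp add: blinfun.diff_left inner_diff_left)
   hence "?z \<in> ?Y" using zV by (simp add: perp_def)
   hence "xi \<bullet> ?z = 0" using xi by (simp add: perp_def)
   moreover have "?e $ xi \<bullet> ?z = xi \<bullet> ?z" by (rule oproj_inner[OF sV zV])
   moreover have "?f $ xi \<bullet> ?z = 0" using zp[OF oproj_in[OF sW]] by (simp add: inner_commute)
   ultimately have "?z \<bullet> ?z = 0" by (simp add: blinfun.diff_left[of _ _ xi] inner_diff_left)
   thus ?thesis by simp
  qed
  hence "dA (?e oL w oL (?e - ?f)) 0 <= dm ?Y" by (intro dA_support M_compose M_diff eM wM fM Y) auto
  also have "... <= cod W" by (rule dm_rel[OF V(1) W])
  finally show ?thesis .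
 qed
 also have "dA (?e oL w oL ?f) (s + t) <= dA (?e oL v oL ?f) s + dA ((?e oL w oL ?f) - (?e oL v oL ?f)) t"
  using dA_add[of "?e oL v oL ?f" "(?e oL w oL ?f) - (?e oL v oL ?f)" s t] s t eM wM fM v by (simp add: M_compose M_diff)
 also have "dA ((?e oL w oL ?f) - (?e oL v oL ?f)) t = 0"
 proof (rule dA_norm)
  show "(?e oL w oL ?f) - (?e oL v oL ?f) \<in> M" by (intro M_compose M_diff eM wM fM v)
  fix xi
  have "norm (?e $ (v $ ?f $ xi - w $ ?f $ xi)) <= t * norm (?f $ xi)" unfolding w_def by (rule close[OF oproj_in[OF sW]])
  also have "... <= t * norm xi" by (intro mult_left_mono norm_oproj_le sW t)
  finally show "norm (((?e oL w oL ?f) - (?e oL v oL ?f)) $ xi) <= t * norm xi"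
   by (simp add: blinfun.diff_left blinfun.diff_right norm_minus_commute)
 qed
 finally have "dst x (s + t + c) <= dA (?e oL v oL ?f) s + 0 + cod W + 0 + dst x k" by - (simp only: add_mono)
 thus ?thesis by (simp add: add.assoc)
qed

lemma
 assumes p: "0 < p" "0 < th" "th <= 1" and A: "A \<in> M" "B \<in> M"
 shows Lam_dA_add: "Lam p th (dA (A + B)) <= ennreal (2 powr p) * (Lam p th (dA A) + Lam p th (dA B))"
  and Lam_dA_diff: "Lam p th (dA (A - B)) <= ennreal (2 powr p) * (Lam p th (dA A) + Lam p th (dA B))"
proof -
 have "Lam p th (dA C) <= ennreal (2 powr p) * (Lam p th (dA A) + Lam p th (dA B))"
  if C: "C \<in> M" "\<And>s. 0 < s ==> dA C (s + s) <= dA A s + dA B s" for C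
 proof -
  have "Lam p th (dA C) = ennreal (2 powr p) * Lam p th (\<lambda>s. dA C (2 * s))"
   using p by (intro Lam_scale distf_dA C) auto
  also have "Lam p th (\<lambda>s. dA C (2 * s)) <= Lam p th (\<lambda>s. dA A s + dA B s)"
   unfolding mult_2 by (rule Lam_mono[OF C(2)]) (use p in auto)
  also have "... <= Lam p th (dA A) + Lam p th (dA B)" by (intro Lam_add distf_dA A p)
  finally show ?thesis by (simp add: mult_left_mono)
 qed
 note le = this
 show "Lam p th (dA (A + B)) <= ennreal (2 powr p) * (Lam p th (dA A) + Lam p th (dA B))"
  "Lam p th (dA (A - B)) <= ennreal (2 powr p) * (Lam p th (dA A) + Lam p th (dA B))"
  by (intro le M_add M_diff dA_add dA_diff A order_less_imp_le; assumption)+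
qed

lemma Lam_op_diff_le:
 assumes p: "0 < p" "0 < th" "th <= 1" and u: "u \<in> mops" "u' \<in> mops" and k: "0 <= k" "0 <= k'"
 shows "Lam p th (dst (op_diff u u')) <= ennreal (3 powr p) *
  (Lam p th (dA (trunc u k - trunc u' k')) + Lam p th (\<lambda>s. dst u (max s k)) + Lam p th (\<lambda>s. dst u' (max s k')))"
proof -
 note m = measurable_maff[OF u(1)] measurable_maff[OF u(2)]
 let ?d = "dA (trunc u k - trunc u' k')" and ?a = "\<lambda>s. dst u (max s k)" and ?b = "\<lambda>s. dst u' (max s k')"
 have d: "distf ?d" "distf ?a" "distf ?b"
  by (intro distf_dA M_diff trunc_M m k distf_cut distf_dst)+
 have "Lam p th (dst (op_diff u u')) = ennreal (3 powr p) * Lam p th (\<lambda>s. dst (op_diff u u') (3 * s))"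
  using p by (intro Lam_scale distf_dst measurable_maff op_diff_measurable u) auto
 also have "Lam p th (\<lambda>s. dst (op_diff u u') (3 * s)) <= Lam p th (\<lambda>s. ?d s + ?a s + ?b s)"
  using p by (intro Lam_mono dst_op_diff_le u k) auto
 also have "... <= Lam p th (\<lambda>s. ?d s + ?a s) + Lam p th ?b" by (intro Lam_add distf_add d p)
 also have "... <= Lam p th ?d + Lam p th ?a + Lam p th ?b" by (intro add_right_mono Lam_add d p)
 finally show ?thesis by (simp add: mult_left_mono)
qed

end

section \<open>The uniform estimate for convergent sequences\<close>

context traced_algebra
begin

lemma ex_cut:
 assumes u: "u \<in> mops" and p: "0 < p" "0 < th" and L: "Lam p th (dst u) < \<infinity>" and e: "0 < eps" "0 < h"
 shows "\<exists>k\<ge>0. Lam p th (\<lambda>s. dst u (max s k)) <= ennreal eps \<and> dst u k <= ennreal h"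
proof -
 have m: "maff u" by (rule measurable_maff[OF u])
 obtain s0 where s0: "0 <= s0" "dst u s0 < \<infinity>" using u by (auto simp: measurable_ops_iff)
 have van: "\<exists>n. dst u (real (Suc n)) <= ennreal kap" if "0 < kap" for kap
 proof -
  obtain n :: nat where "dst u (real n) <= ennreal kap" using dst_vanish[OF m s0 \<open>0 < kap\<close>] by blast
  thus ?thesis using dst_antimono[OF m, of "real n" "real (Suc n)"] by (intro exI[of _ n]) simp
 qed
 obtain K :: nat where K: "\<And>k. K <= k ==> Lam p th (\<lambda>s. dst u (max s (real k))) <= ennreal eps"
  using Lam_tail_vanish[OF distf_dst[OF m] L van p(2) e(1)] by blast
 obtain n where n: "dst u (real (Suc n)) <= ennreal h" using van[OF e(2)] by blast
 have "dst u (real (max K (Suc n))) <= dst u (real (Suc n))" by (intro dst_antimono[OF m]) auto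
 hence "dst u (real (max K (Suc n))) <= ennreal h" using n by (rule order_trans)
 thus ?thesis using K[of "max K (Suc n)"] by (intro exI[of _ "real (max K (Suc n))"]) simp
qed

lemma UKKH_Lam:
 assumes p: "0 < p" "0 < th" "th <= 1" and eps: "0 < eps"
 shows "\<exists>\<delta>>0. \<forall>u x. (\<forall>n. u n \<in> mops \<and> Lam p th (dst (u n)) <= 1) --> x \<in> mops -->
  Lam p th (dst x) < \<infinity> --> 1 < Lam p th (dst x) + ennreal \<delta> -->
  (\<forall>e a b. e \<in> M --> projection_op e --> \<tau> e < \<infinity> --> 0 < a --> 0 < b --> (\<forall>\<^sub>F n in sequentially. u n \<in> near e a b x)) -->
  (\<exists>n0>0. \<forall>n\<ge>n0. \<forall>m\<ge>n0. Lam p th (dst (op_diff (u n) (u m))) <= ennreal eps)"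
proof -
 define C where "C = (2::real) powr p"
 \<comment> \<open>The final estimate adds up to eps0 3^p (4 C^3 + C + 2): 4 C^3 from the two
   remainders outside the corners, C from the difference of the corners, 2 from the truncation
   errors.\<close>
 define eps0 where "eps0 = eps / (3 powr p * (4 * C ^ 3 + C + 2))"
 have C: "0 < C" by (simp add: C_def)
 have C': "0 < 4 * C ^ 3 + C + 2" using C by (simp add: add_pos_pos)
 have e0: "0 < eps0" using eps C' by (simp add: eps0_def)
 obtain \<delta> where \<delta>: "0 < \<delta>" and um: "\<And>y f. y \<in> M ==> f \<in> M ==> selfadj f ==> f oL f = f ==> Lam p th (dA y) <= 1 ==>
  (1 <= Lam p th (dA (f oL y)) + ennreal \<delta> --> Lam p th (dA (y - (f oL y))) <= ennreal eps0) \<and>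
  (1 <= Lam p th (dA (y oL f)) + ennreal \<delta> --> Lam p th (dA (y - (y oL f))) <= ennreal eps0)"
  using uniform_monotonicity_sides[OF p(2,3,1) e0] by (elim exE conjE) blast
 have claim: "\<exists>n0>0. \<forall>n\<ge>n0. \<forall>m\<ge>n0. Lam p th (dst (op_diff (u n) (u m))) <= ennreal eps"
  if u: "\<And>n. u n \<in> mops" "\<And>n. Lam p th (dst (u n)) <= 1" and x: "x \<in> mops"
   and Lx: "Lam p th (dst x) < \<infinity>" "1 < Lam p th (dst x) + ennreal \<delta>"
   and lim: "\<And>e a b. e \<in> M ==> projection_op e ==> \<tau> e < \<infinity> ==> 0 < a ==> 0 < b ==> \<forall>\<^sub>F n in sequentially. u n \<in> near e a b x"
  for u x
 proof -
  note mx = measurable_maff[OF x] and mu = measurable_maff[OF u(1)]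
  note dx = distf_dst[OF mx]
  have fin: "dst x s < \<infinity>" if "0 < s" for s using Lam_finite[OF dx Lx(1) that] p by simp
  let ?L = "\<lambda>j. Lam p th (\<lambda>s. dst x (s + 1 / (real j + 1)) - ennreal (1 / (real j + 1)))"
  \<comment> \<open>A shift small enough that the shifted distribution function of x still has
    integral above 1 - \<delta>.\<close>
  have "\<exists>j. 1 < ?L j + ennreal \<delta>"
  proof (rule ccontr)
   assume "\<not> ?thesis"
   hence "(SUP j. ?L j + ennreal \<delta>) <= 1" by (intro SUP_least) (auto simp: not_less)
   hence "(SUP j. ?L j) + ennreal \<delta> <= 1" by (subst (asm) ennreal_SUP_add_left) auto
   thus False using Lx(2) Lam_shift_SUP[OF dx dst_right_continuous[OF mx] fin p(2), of p] by simp
  qed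
  then obtain j where j: "1 < ?L j + ennreal \<delta>" by blast
  define eta where "eta = 1 / (real j + 1)"
  have eta: "0 < eta" by (simp add: eta_def)
  \<comment> \<open>With t \<le> c the argument s + t + c of the compression estimate stays within
    the allowed shift eta.\<close>
  define c where "c = eta / 2"
  have c: "0 < c" using eta by (simp add: c_def)
  obtain s0 where s0: "0 <= s0" "dst x s0 < \<infinity>" using x by (auto simp: measurable_ops_iff)
  obtain i :: nat where i: "dst x (real i) <= ennreal (eta / 4)" using dst_vanish[OF mx s0, of "eta / 4"] eta by auto
  define k where "k = max (real i) c"
  have k: "0 <= k" "c <= k" using c by (auto simp: k_def)
  have "dst x k <= dst x (real i)" by (rule dst_antimono[OF mx]) (auto simp: k_def)
  hence dk: "dst x k <= ennreal (eta / 4)" using i by (rule order_trans)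
  obtain V where V: "msub V" "dm V < \<infinity>" "\<And>xi. specF (opT x) {c<..} $ xi \<in> V" "\<And>xi. trunc x k $ specF (opT x) {c<..} $ xi \<in> V"
   using ex_carrier[OF mx k(1) fin[OF c]] by blast
  note sV = msub_sub[OF V(1)] msub_closed[OF V(1)]
  define e where "e = oproj V"
  have eM: "e \<in> M" unfolding e_def by (rule oproj_M[OF V(1)])
  have se: "selfadj e" "e oL e = e"
   unfolding e_def using oproj_selfadj[OF sV] by (auto intro!: blinfun_eqI simp: oproj_idem[OF sV])
  have pe: "projection_op e" using M_bounded[OF eM] se(1) oproj_idem[OF sV] by (simp add: projection_op_iff e_def)
  have te: "\<tau> e < \<infinity>" using V(2) by (simp add: e_def dm_def)
  obtain D where D: "dm V = ennreal D" "0 <= D" using V(2) by (cases "dm V") auto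
  \<comment> \<open>The second bound makes an operator of norm at most 2 t that lives on V
    contribute at most eps0.\<close>
  define t where "t = min c ((eps0 / (D powr th + 1)) powr (1 / p) / 2)"
  have Dp: "0 < D powr th + 1" by (simp add: add_nonneg_pos)
  have t: "0 < t" "t <= c" using c e0 Dp by (auto simp: t_def)
  have tD: "ennreal_powr (dm V) th * ennreal ((2 * t) powr p) <= ennreal eps0"
  proof -
   have "(2 * t) powr p <= ((eps0 / (D powr th + 1)) powr (1 / p)) powr p" using p t by (intro powr_mono2) (auto simp: t_def)
   also have "... = eps0 / (D powr th + 1)" using p e0 Dp by (simp add: powr_powr)
   finally have "D powr th * (2 * t) powr p <= D powr th * (eps0 / (D powr th + 1))" by (rule mult_left_mono) simp
   also have "... <= eps0" using e0 Dp by (simp add: field_simps)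
   finally show ?thesis using D by (simp add: ennreal_leI flip: ennreal_mult)
  qed
  \<comment> \<open>Each of W and W' costs 2 h + eta / 4 = 3 eta / 8 in codimension; together with
    eta / 4 for the truncation of x this is exactly eta.\<close>
  define h where "h = eta / 16"
  have h: "0 < h" using eta by (simp add: h_def)
  obtain n1 where n1: "\<And>n. n1 <= n ==> u n \<in> near e t h x"
   using lim[OF eM pe te t(1) h] unfolding eventually_sequentially by blast
  have small: "dst (sandwich e (op_diff (u n) x)) t <= ennreal h" if n: "n1 <= n" for n
  proof -
   obtain s where s: "0 <= s" "s < t" "dst (sandwich e (op_diff (u n) x)) s < ennreal h" using n1[OF n] by (auto simp: near_def)
   have "maff (sandwich e (op_diff (u n) x))" by (intro measurable_maff sandwich_measurable op_diff_measurable u x eM)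
   from dst_antimono[OF this s(1), of t] s show ?thesis by simp
  qed
  have "\<exists>kn\<ge>0. Lam p th (\<lambda>s. dst (u n) (max s kn)) <= ennreal eps0 \<and> dst (u n) kn <= ennreal h" for n
   by (intro ex_cut u(1) p e0 h order.strict_trans1[OF u(2)]) simp
  then obtain K where K: "\<And>n. 0 <= K n" "\<And>n. Lam p th (\<lambda>s. dst (u n) (max s (K n))) <= ennreal eps0" "\<And>n. dst (u n) (K n) <= ennreal h"
   by metis
  define v where "v n = trunc (u n) (K n)" for n
  have vM: "v n \<in> M" for n unfolding v_def by (rule trunc_M[OF mu K(1)])
  have Lv: "Lam p th (dA (v n)) <= 1" for n
  proof -
   have "Lam p th (dA (v n)) <= Lam p th (dst (u n))"
    unfolding v_def using p by (intro Lam_mono dA_trunc_le[OF mu K(1)]) auto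
   thus ?thesis using u(2) by (rule order_trans)
  qed
  have main: "Lam p th (dst (op_diff (u n) (u m))) <= ennreal eps" if nm: "n1 <= n" "n1 <= m" for n m
  proof -
   have ex: "\<exists>W. msub W \<and> cod W <= ennreal h + ennreal h + ennreal (eta / 4) \<and>
     (\<forall>xi\<in>W. e $ xi = xi --> norm (e $ (v n $ xi - trunc x k $ xi)) <= t * norm xi)" if "n1 <= n" for n
   proof -
    have "dst (sandwich e (op_diff (u n) x)) t + dst (u n) (K n) + dst x k <= ennreal h + ennreal h + ennreal (eta / 4)"
     by (intro add_mono small that K dk)
    thus ?thesis
     using common_subspace[OF u(1)[of n] x K(1)[of n] k(1) eM, of t] t unfolding v_def by (meson order.trans order_less_imp_le)
   qed
   obtain W where W: "msub W" "cod W <= ennreal h + ennreal h + ennreal (eta / 4)"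
    "\<And>xi. xi \<in> W ==> e $ xi = xi ==> norm (e $ (v n $ xi - trunc x k $ xi)) <= t * norm xi"
    using ex[OF nm(1)] by blast
   obtain W' where W': "msub W'" "cod W' <= ennreal h + ennreal h + ennreal (eta / 4)"
    "\<And>xi. xi \<in> W' ==> e $ xi = xi ==> norm (e $ (v m $ xi - trunc x k $ xi)) <= t * norm xi"
    using ex[OF nm(2)] by blast
   \<comment> \<open>The same right projection f has to serve for both v n and v m, hence the
     intersection.\<close>
   let ?W = "W \<inter> W'"
   have WW: "msub ?W" by (rule msub_Int[OF W(1) W'(1)])
   have "cod ?W + dst x k <= (ennreal h + ennreal h + ennreal (eta / 4)) + (ennreal h + ennreal h + ennreal (eta / 4)) + ennreal (eta / 4)"
    by (intro add_mono order_trans[OF cod_Int[OF W(1) W'(1)]] W W' dk)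
   also have "... = ennreal eta" using eta by (simp add: h_def flip: ennreal_plus)
   finally have cW: "cod ?W + dst x k <= ennreal eta" .
   define f where "f = oproj (V \<inter> ?W)"
   have VW: "msub (V \<inter> ?W)" by (rule msub_Int[OF V(1) WW])
   note sW = msub_sub[OF VW] msub_closed[OF VW]
   have fM: "f \<in> M" unfolding f_def by (rule oproj_M[OF VW])
   have sf: "selfadj f" "f oL f = f"
    unfolding f_def using oproj_selfadj[OF sW] by (auto intro!: blinfun_eqI simp: oproj_idem[OF sW])
   have cf: "norm (f $ xi) <= norm xi" "norm (e $ xi) <= norm xi" for xi
    unfolding f_def e_def by (rule norm_oproj_le[OF sW] norm_oproj_le[OF sV])+
   have fin_V: "f $ xi \<in> V" "f $ xi \<in> W" "f $ xi \<in> W'" for xi using oproj_in[OF sW, of xi] by (auto simp: f_def)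
   have ef: "e $ f $ xi = f $ xi" for xi unfolding e_def by (rule oproj_fix[OF sV fin_V(1)])
   \<comment> \<open>The corner e y f keeps almost the full integral, and so does y f, which
     dominates it. Cutting y to y f and then to e y f therefore loses at most eps0 each
     time.\<close>
   have part: "Lam p th (dA (y - (e oL y oL f))) <= ennreal C * (ennreal eps0 + ennreal eps0)"
    if y: "y \<in> M" "Lam p th (dA y) <= 1"
     and cl: "\<And>xi. xi \<in> V \<inter> ?W ==> norm (e $ (y $ xi - trunc x k $ xi)) <= t * norm xi" for y
   proof -
    let ?z = "e oL y oL f"
    have zM: "?z \<in> M" "y oL f \<in> M" by (intro M_compose eM y fM)+
    have "dst x (s + eta) - ennreal eta <= dA ?z s" if s: "0 < s" for s
    proof -
     have "dst x (s + eta) <= dst x (s + t + c)" using s t c by (intro dst_antimono[OF mx]) (auto simp: c_def)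
     also have "... <= dA ?z s + (cod ?W + dst x k)"
      unfolding f_def e_def using c t s
      by (intro dA_compression_lower[OF mx _ k(2) V(1,3,4) WW y(1)] cl[unfolded e_def]) auto
     also have "... <= dA ?z s + ennreal eta" by (rule add_left_mono[OF cW])
     finally show ?thesis by (subst ennreal_minus_le_iff) (auto simp: add.commute)
    qed
    hence "?L j <= Lam p th (dA ?z)" unfolding eta_def[symmetric] using p by (intro Lam_mono) auto
    hence Lz: "1 <= Lam p th (dA ?z) + ennreal \<delta>"
     using less_imp_le[OF j] add_right_mono order_trans by blast
    have zz: "?z = e oL (y oL f)" by (rule blinfun_eqI) simp
    have "Lam p th (dA ?z) <= Lam p th (dA (y oL f))"
     unfolding zz using p by (intro Lam_mono dA_left zM eM cf) auto
    hence "1 <= Lam p th (dA (y oL f)) + ennreal \<delta>" using order_trans[OF Lz add_right_mono] by blast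
    hence 1: "Lam p th (dA (y - (y oL f))) <= ennreal eps0" using um[OF y(1) fM sf y(2)] by blast
    have "Lam p th (dA (y oL f)) <= Lam p th (dA y)" using p by (intro Lam_mono dA_right y fM cf) auto
    hence "Lam p th (dA (y oL f)) <= 1" using y(2) by (rule order_trans)
    hence 2: "Lam p th (dA ((y oL f) - ?z)) <= ennreal eps0" using um[OF zM(2) eM se] Lz unfolding zz by blast
    have eq: "(y - (y oL f)) + ((y oL f) - ?z) = y - ?z" by simp
    have "Lam p th (dA ((y - (y oL f)) + ((y oL f) - ?z))) <= ennreal C * (Lam p th (dA (y - (y oL f))) + Lam p th (dA ((y oL f) - ?z)))"
     unfolding C_def by (intro Lam_dA_add p M_diff y zM)
    also have "... <= ennreal C * (ennreal eps0 + ennreal eps0)" by (intro mult_left_mono add_mono 1 2) auto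
    finally show ?thesis unfolding eq .
   qed
   let ?r = "v n - (e oL v n oL f)" and ?r' = "v m - (e oL v m oL f)" and ?T = "(e oL v n oL f) - (e oL v m oL f)"
   have M4: "?r \<in> M" "?r' \<in> M" "?T \<in> M" by (intro M_diff M_compose vM eM fM)+
   have r: "Lam p th (dA ?r) <= ennreal C * (ennreal eps0 + ennreal eps0)" "Lam p th (dA ?r') <= ennreal C * (ennreal eps0 + ennreal eps0)"
    by (rule part[OF vM Lv]; use W(3) W'(3) in \<open>auto simp: e_def oproj_fix[OF sV]\<close>)+
   have T: "Lam p th (dA ?T) <= ennreal eps0"
   proof (rule order_trans[OF Lam_bounded_support tD])
    show "0 < 2 * t" "0 < p" "0 <= th" using t p by auto
    show "dA ?T s <= dm V" if "0 < s" for s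
    proof (rule dA_support[OF M4(3) V(1)])
     fix xi assume "xi \<in> perp V"
     hence "f $ xi = 0" unfolding f_def oproj_zero_iff[OF sW] by (auto simp: perp_def)
     thus "?T $ xi = 0" by (simp add: blinfun.diff_left)
    qed (use that in simp)
    show "dA ?T s = 0" if "2 * t <= s" for s
    proof (rule dA_norm[OF M4(3)])
     fix xi
     have "?T $ xi = e $ (v n $ f $ xi - trunc x k $ f $ xi) - e $ (v m $ f $ xi - trunc x k $ f $ xi)"
      by (simp add: blinfun.diff_left blinfun.diff_right)
     also have "norm ... <= t * norm (f $ xi) + t * norm (f $ xi)"
      by (intro order_trans[OF norm_triangle_ineq4] add_mono W W' fin_V ef)
     also have "... = 2 * t * norm (f $ xi)" by simp
     also have "... <= s * norm xi" using that t by (intro mult_mono cf) auto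
     finally show "norm (?T $ xi) <= s * norm xi" .
    qed
   qed
   \<comment> \<open>Two remainders and the difference of the corners, where v n and v m are both
     close to trunc x k.\<close>
   have eq: "(?r - ?r') + ?T = v n - v m" by simp
   have "Lam p th (dA ((?r - ?r') + ?T)) <= ennreal C * (Lam p th (dA (?r - ?r')) + Lam p th (dA ?T))"
    unfolding C_def by (intro Lam_dA_add p M_diff M4)
   also have "Lam p th (dA (?r - ?r')) <= ennreal C * (Lam p th (dA ?r) + Lam p th (dA ?r'))"
    unfolding C_def by (intro Lam_dA_diff p M4)
   finally have "Lam p th (dA (v n - v m)) <= ennreal C * (ennreal C * (Lam p th (dA ?r) + Lam p th (dA ?r')) + Lam p th (dA ?T))"
    unfolding eq by (simp add: mult_left_mono add_right_mono)
   also have "... <= ennreal C * (ennreal C * (ennreal C * (ennreal eps0 + ennreal eps0) + ennreal C * (ennreal eps0 + ennreal eps0)) + ennreal eps0)"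
    by (intro mult_left_mono add_mono r T) auto
   finally have L1: "Lam p th (dA (v n - v m)) <= ennreal C * (ennreal C * (ennreal C * (ennreal eps0 + ennreal eps0) + ennreal C * (ennreal eps0 + ennreal eps0)) + ennreal eps0)" .
   have "Lam p th (dst (op_diff (u n) (u m))) <= ennreal (3 powr p) * (Lam p th (dA (v n - v m))
     + Lam p th (\<lambda>s. dst (u n) (max s (K n))) + Lam p th (\<lambda>s. dst (u m) (max s (K m))))"
    unfolding v_def by (intro Lam_op_diff_le p u K)
   also have "... <= ennreal (3 powr p) * (ennreal C * (ennreal C * (ennreal C * (ennreal eps0 + ennreal eps0)
     + ennreal C * (ennreal eps0 + ennreal eps0)) + ennreal eps0) + ennreal eps0 + ennreal eps0)"
    by (intro mult_left_mono add_mono L1 K) auto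
   also have "... = ennreal (3 powr p * (C * (C * (C * (eps0 + eps0) + C * (eps0 + eps0)) + eps0) + eps0 + eps0))"
    using C e0 by (simp add: ennreal_mult[symmetric] ennreal_plus[symmetric] del: ennreal_plus)
   also have "3 powr p * (C * (C * (C * (eps0 + eps0) + C * (eps0 + eps0)) + eps0) + eps0 + eps0) = eps0 * (3 powr p * (4 * C ^ 3 + C + 2))"
    by (simp add: power3_eq_cube algebra_simps)
   also have "... = eps" using C' by (simp add: eps0_def)
   finally show ?thesis .
  qed
  thus ?thesis by (intro exI[of _ "max 1 n1"]) auto
 qed
 show ?thesis by (intro exI[of _ \<delta>] conjI \<delta> allI impI, rule claim; (simp; fail | blast))
qed

lemma UKKH_nc_lorentz:
 assumes p: "0 < p" "p <= q"
 shows "UKKH (nc_lorentz_space q p M \<tau>) op_diff (nc_lorentz_norm q p \<tau>)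
     (subtopology (local_measure_topology M \<tau>) (nc_lorentz_space q p M \<tau>))"
 unfolding UKKH_def
proof (intro allI impI)
 fix eps :: real assume "0 < eps"
 hence e: "0 < eps powr p" by simp
 let ?th = "p / q" and ?X = "nc_lorentz_space q p M \<tau>" and ?N = "nc_lorentz_norm q p \<tau>"
 have q: "0 < q" and th: "0 < ?th" "?th <= 1" using p by auto
 obtain \<delta>0 where \<delta>0: "0 < \<delta>0" and core: "\<And>u x. (\<And>n. u n \<in> mops \<and> Lam p ?th (dst (u n)) <= 1) ==> x \<in> mops ==>
  Lam p ?th (dst x) < \<infinity> ==> 1 < Lam p ?th (dst x) + ennreal \<delta>0 ==>
  (\<And>e a b. e \<in> M ==> projection_op e ==> \<tau> e < \<infinity> ==> 0 < a ==> 0 < b ==> \<forall>\<^sub>F n in sequentially. u n \<in> near e a b x) ==>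
  \<exists>n0>0. \<forall>n\<ge>n0. \<forall>m\<ge>n0. Lam p ?th (dst (op_diff (u n) (u m))) <= ennreal (eps powr p)"
  using UKKH_Lam[OF p(1) th e] by (elim exE conjE) blast
 \<comment> \<open>The norm bound 1 - \<delta> = c^(1/p) means that the integral exceeds c, and c +
   \<delta>0 > 1; the maximum with 1 / 2 keeps c positive when \<delta>0 is large.\<close>
 define c where "c = max (1 / 2) (1 - \<delta>0 / 2)"
 have c: "0 < c" "c < 1" "1 < c + \<delta>0" using \<delta>0 by (auto simp: c_def)
 define \<delta> where "\<delta> = 1 - c powr (1 / p)"
 have \<delta>: "0 < \<delta>" "\<delta> < 1" using c p powr_less_mono2[of "1 / p" c 1] by (auto simp: \<delta>_def)
 have norm_eq: "?N y = enn2real (ennreal_powr (Lam p ?th (dst y)) (1 / p))" if "y \<in> mops" for y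
  using lorentz_norm_dst[OF that p(1) q] by (simp add: nc_lorentz_norm_def)
 have X: "\<exists>l\<ge>0. y \<in> mops \<and> Lam p ?th (dst y) = ennreal l \<and> ?N y = l powr (1 / p)" if "y \<in> ?X" for y
 proof -
  have m: "y \<in> mops" and "lorentz_norm q p (singular_value_fun \<tau> y) < \<infinity>"
   using that by (auto simp: nc_lorentz_space_def lorentz_space_def)
  then obtain l where "Lam p ?th (dst y) = ennreal l" "0 <= l"
   using lorentz_norm_dst[OF m p(1) q] by (cases "Lam p ?th (dst y)") auto
  thus ?thesis using m norm_eq[OF m] by (intro exI[of _ l]) simp
 qed
 have "\<exists>n0>0. \<forall>n\<ge>n0. \<forall>m\<ge>n0. ?N (op_diff (u n) (u m)) <= eps"
  if u: "\<And>n. u n \<in> ?X" "\<And>n. ?N (u n) <= 1" and x: "x \<in> ?X" "1 - \<delta> < ?N x"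
   and lim: "limitin (subtopology (local_measure_topology M \<tau>) ?X) u x sequentially" for u x
 proof -
  obtain l where l: "0 <= l" "x \<in> mops" "Lam p ?th (dst x) = ennreal l" "?N x = l powr (1 / p)" using X[OF x(1)] by blast
  have "c powr (1 / p) < l powr (1 / p)" using x(2) l(4) by (simp add: \<delta>_def)
  hence "c < l" using powr_less_cancel2[of "1 / p" c l] c l p by (cases "l = 0") auto
  hence lc: "ennreal 1 < ennreal l + ennreal \<delta>0" using c l \<delta>0 by (simp add: ennreal_less_iff flip: ennreal_plus)
  have um: "u n \<in> mops \<and> Lam p ?th (dst (u n)) <= 1" for n
  proof -
   obtain r where r: "0 <= r" "u n \<in> mops" "Lam p ?th (dst (u n)) = ennreal r" "?N (u n) = r powr (1 / p)" using X[OF u(1)] by blast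
   have "(r powr (1 / p)) powr p <= 1 powr p" using u(2)[of n] r(4) p by (intro powr_mono2) auto
   thus ?thesis using r p by (simp add: powr_powr)
  qed
  have "\<exists>n0>0. \<forall>n\<ge>n0. \<forall>m\<ge>n0. Lam p ?th (dst (op_diff (u n) (u m))) <= ennreal (eps powr p)"
   using lc by (intro core[of u x] um l(2) limitin_near[OF lim l(2)]) (auto simp: l(3))
  moreover have "?N (op_diff (u n) (u m)) <= eps" if "Lam p ?th (dst (op_diff (u n) (u m))) <= ennreal (eps powr p)" for n m
  proof -
   have "ennreal_powr (Lam p ?th (dst (op_diff (u n) (u m)))) (1 / p) <= ennreal_powr (ennreal (eps powr p)) (1 / p)"
    using that p by (intro ennreal_powr_mono) auto
   also have "... = ennreal eps" using p \<open>0 < eps\<close> by (simp add: powr_powr)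
   finally have "?N (op_diff (u n) (u m)) <= enn2real (ennreal eps)"
    unfolding norm_eq[OF op_diff_measurable[OF um[THEN conjunct1] um[THEN conjunct1]]] by (intro enn2real_mono) auto
   thus ?thesis using \<open>0 < eps\<close> by simp
  qed
  ultimately show ?thesis by blast
 qed
 thus "\<exists>\<delta>. 0 < \<delta> \<and> \<delta> < 1 \<and> (\<forall>u x. (\<forall>n. u n \<in> ?X \<and> ?N (u n) <= 1) \<and> x \<in> ?X \<and>
   limitin (subtopology (local_measure_topology M \<tau>) ?X) u x sequentially \<and> 1 - \<delta> < ?N x -->
   (\<exists>n0>0. \<forall>n\<ge>n0. \<forall>m\<ge>n0. ?N (op_diff (u n) (u m)) <= eps))"
  using \<delta> by (intro exI[of _ \<delta>]) blast
qed

end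

theorem corollary2p8:
  fixes M :: "('h::complex_hilbert_space \<Rightarrow>\<^sub>L 'h) set"
    and \<tau> :: "('h \<Rightarrow>\<^sub>L 'h) \<Rightarrow> ennreal"
    and p q :: real
  assumes "semifinite_von_neumann_algebra M \<tau>"
    and "0 < p" and "p \<le> q"
  shows "UKKH (nc_lorentz_space q p M \<tau>) op_diff (nc_lorentz_norm q p \<tau>)
           (subtopology (local_measure_topology M \<tau>) (nc_lorentz_space q p M \<tau>))"
proof -
  interpret traced_algebra M \<tau> by unfold_locales (rule assms(1))
  show ?thesis using assms(2,3) by (rule UKKH_nc_lorentz)
qed

end
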